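(* Let $(M^4,J_1,\omega_2+i\omega_3)$ be (an open set of) a complex surface with holomorphic symplectic form, with complex Darboux coordinates $(z_1,z_2)$ in which $\omega_2+i\omega_3=dz_1\wedge dz_2$, and let $c\ge 0$ be a constant. Given a real analytic Kähler potential $F_0$ on $M^4$ and an additional real analytic function $F_1$ on $M^4$, there exists a unique real analytic solution $F(s)$, for $s$ in a small interval, to $$\Big(\frac{1}{s(s+c)}\Big)\ddot F=4\,\det\Big(\frac{\partial^2F}{\partial z_i\,\partial\bar z_j}\Big)_{1\le i,j\le 2}$$ with $F(0)=F_0$ and $\dot F(0)=F_1$, where dots denote derivatives with respect to $s$; and hence, by the construction recalled in the context, a torsion free $Spin(7)$-structure.
   Context: Conventions. For a complex structure $J$ and a $1$-form $\beta$, $J\beta(\cdot):=\beta(J\cdot)$; $d_M$ is the exterior differential on $M^4$, $d_M^c:=J_1\circ d_M$. $F_0$ is a Kähler potential if $d_Md_M^cF_0$ is a Kähler form, with metric $(d_Md_M^cF_0)(\cdot,J_1\cdot)$. With $z_j=x_j+iy_j$, $\partial/\partial z_j=\frac12(\partial_{x_j}-i\partial_{y_j})$. The equation with initial data at $s=0$ is understood after multiplying through by $s(s+c)$. Everything is local: the base is a small open set of $M^4$ times a small interval, with $s>0$ for the $Spin(7)$-structure, so that bundles with the prescribed curvatures exist. Construction of the $Spin(7)$-structure from $F$: one sets $\tilde\omega_1:=d_Md_M^cF$ and $u:=\ddot F$, the displayed equation being the coordinate form of the condition $\frac12u\,(\omega_2+i\omega_3)\wedge(\omega_2-i\omega_3)=s(s+c)\,\tilde\omega_1\wedge\tilde\omega_1$,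 while $d_Md_M^cu=\partial_s^2\tilde\omega_1$ holds automatically. Then $$\Phi=\eta\wedge\varphi+s^{4/3}*_\varphi\varphi,\qquad \varphi=\xi\wedge(\tilde\omega_1+ds\wedge\alpha)+(s+c)\,\omega_2\wedge\alpha+u(s+c)\,\omega_3\wedge ds,$$ on the $\mathbb{T}^3$-bundle with connection $1$-forms $\xi,\eta,\alpha$ whose curvatures are $d\xi=-\omega_2$, $d\eta=-\omega_3$, $d\alpha=-d_M^cu\wedge ds+\partial_s\tilde\omega_1$. A $Spin(7)$-structure on an 8-manifold is a $4$-form $\Phi$ pointwise linearly equivalent to $\Phi_0=dx_{0123}+dx_{0145}+dx_{0167}+dx_{0246}-dx_{0257}-dx_{0347}-dx_{0356}+dx_{2345}+dx_{2367}+dx_{4567}-dx_{1247}-dx_{1256}-dx_{1346}+dx_{1357}$ on $\mathbb{R}^8$; it is torsion free iff $d\Phi=0$. A $G_2$-structure on a 7-manifold is a $3$-form $\varphi$ pointwise linearly equivalent to $\partial_{x_0}\lrcorner\,\Phi_0$; it induces a metric, an orientation and a Hodge star $*_\varphi$.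
   Formalization: With the stated conventions the constant 4 should be 16, so the construction applied to the displayed solution F is not closed; the torsion free structure is obtained from F/4, and existence, uniqueness and the structure are also proved for the condition with the right constant. *)

theory Defs
  imports "HOL-Analysis.Analysis"
begin

section \<open>Real analytic and smooth functions\<close>

text \<open>The index set \<open>Basis \<rightarrow>\<^sub>E UNIV\<close> consists of the multi-indices; \<open>has_sum\<close> is unconditional
  (hence absolute) convergence of the multivariate power series.\<close>

definition real_analytic_on :: "('a::euclidean_space \<Rightarrow> real) \<Rightarrow> 'a set \<Rightarrow> bool" where
  "real_analytic_on f S \<longleftrightarrow>
     (\<forall>x\<in>S. \<exists>(a :: ('a \<Rightarrow> nat) \<Rightarrow> real) r. 0 < r \<and>
        (\<forall>y\<in>ball x r.
           ((\<lambda>k. a k * (\<Prod>b\<in>Basis. ((y - x) \<bullet> b) ^ k b)) has_sum f y) (Basis \<rightarrow>\<^sub>E UNIV)))"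

text \<open>Meant for open \<open>S\<close> only.\<close>

primrec ck_on :: "nat \<Rightarrow> ('a::euclidean_space \<Rightarrow> real) \<Rightarrow> 'a set \<Rightarrow> bool" where
  "ck_on 0 f S \<longleftrightarrow> continuous_on S f"
| "ck_on (Suc n) f S \<longleftrightarrow>
     (\<forall>x\<in>S. f differentiable (at x)) \<and>
     (\<forall>b\<in>Basis. ck_on n (\<lambda>x. frechet_derivative f (at x) b) S)"

definition smooth_on :: "('a::euclidean_space \<Rightarrow> real) \<Rightarrow> 'a set \<Rightarrow> bool" where
  "smooth_on f S \<longleftrightarrow> (\<forall>n. ck_on n f S)"


section \<open>Exterior forms\<close>

text \<open>A \<open>k\<close>-covector on \<open>'v\<close> is a function of a sequence of vectors that only looks at the entries
  \<open>0, \<dots>, k - 1\<close>.\<close>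

type_synonym ('v, 'b) covec = "(nat \<Rightarrow> 'v) \<Rightarrow> 'b"

definition alternating :: "nat \<Rightarrow> ('v::real_vector, real) covec \<Rightarrow> bool" where
  "alternating k \<beta> \<longleftrightarrow>
     (\<forall>v w. (\<forall>i<k. v i = w i) \<longrightarrow> \<beta> v = \<beta> w) \<and>
     (\<forall>v. \<forall>i<k. linear (\<lambda>x. \<beta> (v(i := x)))) \<and>
     (\<forall>v. \<forall>i<k. \<forall>j<k. i \<noteq> j \<and> v i = v j \<longrightarrow> \<beta> v = 0)"

definition pullback :: "('v \<Rightarrow> 'w) \<Rightarrow> ('w, 'b) covec \<Rightarrow> ('v, 'b) covec" where
  "pullback L \<beta> = (\<lambda>v. \<beta> (\<lambda>i. L (v i)))"

definition interior_prod :: "'v \<Rightarrow> ('v, 'b) covec \<Rightarrow> ('v, 'b) covec" where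
  "interior_prod x \<beta> = (\<lambda>v. \<beta> (case_nat x v))"

text \<open>Normalised such that \<open>(\<beta> \<and> \<gamma>)(x, y) = \<beta>(x) \<gamma>(y) - \<beta>(y) \<gamma>(x)\<close> for 1-forms; \<open>p\<close> and \<open>q\<close> are the
  degrees of the two factors.\<close>

definition wedge ::
  "nat \<Rightarrow> nat \<Rightarrow> ('v, 'b::field_char_0) covec \<Rightarrow> ('v, 'b) covec \<Rightarrow> ('v, 'b) covec" where
  "wedge p q \<beta> \<gamma> = (\<lambda>v.
     (\<Sum>\<sigma> | \<sigma> permutes {..<p + q}.
        of_int (sign \<sigma>) * \<beta> (\<lambda>i. v (\<sigma> i)) * \<gamma> (\<lambda>i. v (\<sigma> (p + i)))) / (fact p * fact q))"

text \<open>Differential forms on an open subset of the vector space \<open>'v\<close>.\<close>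

definition smooth_form :: "nat \<Rightarrow> 'v::euclidean_space set \<Rightarrow> ('v \<Rightarrow> ('v, real) covec) \<Rightarrow> bool" where
  "smooth_form k S \<beta> \<longleftrightarrow>
     (\<forall>x\<in>S. alternating k (\<beta> x)) \<and> (\<forall>v. smooth_on (\<lambda>x. \<beta> x v) S)"

text \<open>Exterior derivative of a \<open>k\<close>-form: the invariant formula evaluated on constant vector fields.\<close>

definition ext_d ::
  "nat \<Rightarrow> ('v::real_normed_vector \<Rightarrow> ('v, real) covec) \<Rightarrow> 'v \<Rightarrow> ('v, real) covec" where
  "ext_d k \<beta> = (\<lambda>x v. \<Sum>i\<le>k. (-1) ^ i *
     frechet_derivative (\<lambda>y. \<beta> y (\<lambda>j. if j < i then v j else v (Suc j))) (at x) (v i))"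


section \<open>\<open>G\<^sub>2\<close>- and \<open>Spin(7)\<close>-structures\<close>

text \<open>The coordinates of \<open>real ^ 8\<close> are \<open>x\<^sub>0, \<dots>, x\<^sub>7\<close>: in the index type \<open>8\<close> the
  numerals \<open>0, \<dots>, 7\<close> are its eight distinct elements.\<close>

definition dx :: "8 list \<Rightarrow> (real ^ 8, real) covec" where
  "dx is = (\<lambda>v. \<Sum>\<sigma> | \<sigma> permutes {..<length is}.
     of_int (sign \<sigma>) * (\<Prod>j<length is. v (\<sigma> j) $ (is ! j)))"

definition Phi0 :: "(real ^ 8, real) covec" where
  "Phi0 = (\<lambda>v.
     dx [0,1,2,3] v + dx [0,1,4,5] v + dx [0,1,6,7] v + dx [0,2,4,6] v - dx [0,2,5,7] v
     - dx [0,3,4,7] v - dx [0,3,5,6] v + dx [2,3,4,5] v + dx [2,3,6,7] v + dx [4,5,6,7] v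
     - dx [1,2,4,7] v - dx [1,2,5,6] v - dx [1,3,4,6] v + dx [1,3,5,7] v)"

definition spin7_structure ::
  "'v::euclidean_space set \<Rightarrow> ('v \<Rightarrow> ('v, real) covec) \<Rightarrow> bool" where
  "spin7_structure S \<Phi> \<longleftrightarrow> smooth_form 4 S \<Phi> \<and>
     (\<forall>x\<in>S. \<exists>L :: 'v \<Rightarrow> real ^ 8. linear L \<and> bij L \<and> \<Phi> x = pullback L Phi0)"

definition torsion_free_spin7_structure ::
  "'v::euclidean_space set \<Rightarrow> ('v \<Rightarrow> ('v, real) covec) \<Rightarrow> bool" where
  "torsion_free_spin7_structure S \<Phi> \<longleftrightarrow>
     spin7_structure S \<Phi> \<and> (\<forall>x\<in>S. ext_d 4 \<Phi> x = (\<lambda>v. 0))"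

text \<open>The model \<open>\<real>\<^sup>7\<close> is the hyperplane \<open>x\<^sub>0 = 0\<close> in \<open>\<real>\<^sup>8\<close>.\<close>

definition R7 :: "(real ^ 8) set" where
  "R7 = {x. x $ 0 = 0}"

definition phi0 :: "(real ^ 8, real) covec" where
  "phi0 = interior_prod (axis 0 1) Phi0"

definition g2_frame :: "('v::euclidean_space, real) covec \<Rightarrow> ('v \<Rightarrow> real ^ 8) \<Rightarrow> bool" where
  "g2_frame \<phi> L \<longleftrightarrow> linear L \<and> bij_betw L UNIV R7 \<and> \<phi> = pullback L phi0"

definition g2_structure ::
  "'v::euclidean_space set \<Rightarrow> ('v \<Rightarrow> ('v, real) covec) \<Rightarrow> bool" where
  "g2_structure S \<phi> \<longleftrightarrow> smooth_form 3 S \<phi> \<and> (\<forall>x\<in>S. \<exists>L. g2_frame (\<phi> x) L)"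

text \<open>Hodge star of the Euclidean metric and the orientation \<open>dx\<^sub>1\<^sub>2\<^sub>3\<^sub>4\<^sub>5\<^sub>6\<^sub>7\<close> on \<open>R7\<close>:
  \<open>\<star>\<beta> = (1 / k!) \<Sum> \<beta>(e\<^sub>f\<^sub>0, \<dots>, e\<^sub>f\<^sub>(\<^sub>k\<^sub>-\<^sub>1\<^sub>)) vol(e\<^sub>f\<^sub>0, \<dots>, e\<^sub>f\<^sub>(\<^sub>k\<^sub>-\<^sub>1\<^sub>), \<dots>)\<close>, which is the
  convention \<open>\<beta> \<and> \<star>\<beta> = |\<beta>|\<^sup>2 vol\<close>.\<close>

definition star7 :: "nat \<Rightarrow> (real ^ 8, real) covec \<Rightarrow> (real ^ 8, real) covec" where
  "star7 k \<beta> = (\<lambda>w.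
     (\<Sum>f \<in> {..<k} \<rightarrow>\<^sub>E (UNIV - {0}).
        \<beta> (\<lambda>j. axis (f j) 1) *
        dx [1,2,3,4,5,6,7] (\<lambda>j. if j < k then axis (f j) 1 else w (j - k))) / fact k)"

text \<open>The metric and the orientation induced by \<open>\<phi>\<close> are the pull-backs of the standard ones under a
  frame \<open>L\<close> with \<open>\<phi> = L\<^sup>* phi0\<close>.  They do not depend on \<open>L\<close>, because the stabiliser of \<open>phi0\<close>
  in \<open>GL(7)\<close> is contained in \<open>SO(7)\<close>.\<close>

definition g2_star ::
  "('v::euclidean_space, real) covec \<Rightarrow> nat \<Rightarrow> ('v, real) covec \<Rightarrow> ('v, real) covec" where
  "g2_star \<phi> k \<beta> =
     (let L = (SOME L. g2_frame \<phi> L) in pullback L (star7 k (pullback (inv_into UNIV L) \<beta>)))"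


section \<open>The complex surface in Darboux coordinates\<close>

text \<open>The surface is an open set of points \<open>(z\<^sub>1, z\<^sub>2)\<close>.\<close>

type_synonym surf = "complex \<times> complex"

definition J1 :: "surf \<Rightarrow> surf" where
  "J1 v = (\<i> * fst v, \<i> * snd v)"

definition hol_symp :: "(surf, complex) covec" where
  "hol_symp = wedge 1 1 (\<lambda>v. fst (v 0)) (\<lambda>v. snd (v 0))"

definition omega2 :: "(surf, real) covec" where
  "omega2 = (\<lambda>v. Re (hol_symp v))"

definition omega3 :: "(surf, real) covec" where
  "omega3 = (\<lambda>v. Im (hol_symp v))"

text \<open>With \<open>(J \<beta>)(v) = \<beta>(J v)\<close> one gets \<open>dd\<^sup>c = -2i \<partial>\<partial>bar\<close>; hence Kaehler potentials in the
  present sense are strictly plurisuperharmonic.\<close>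

definition d_c :: "(surf \<Rightarrow> real) \<Rightarrow> surf \<Rightarrow> (surf, real) covec" where
  "d_c f = (\<lambda>z v. frechet_derivative f (at z) (J1 (v 0)))"

definition dd_c :: "(surf \<Rightarrow> real) \<Rightarrow> surf \<Rightarrow> (surf, real) covec" where
  "dd_c f = ext_d 1 (d_c f)"

definition kaehler_form :: "surf set \<Rightarrow> (surf \<Rightarrow> (surf, real) covec) \<Rightarrow> bool" where
  "kaehler_form M \<omega> \<longleftrightarrow> smooth_form 2 M \<omega> \<and>
     (\<forall>z\<in>M. ext_d 2 \<omega> z = (\<lambda>v. 0) \<and> pullback J1 (\<omega> z) = \<omega> z \<and>
        (\<forall>x. x \<noteq> 0 \<longrightarrow> 0 < \<omega> z (case_nat x (\<lambda>_. J1 x))))"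

definition kaehler_potential :: "surf set \<Rightarrow> (surf \<Rightarrow> real) \<Rightarrow> bool" where
  "kaehler_potential M f \<longleftrightarrow> kaehler_form M (dd_c f)"

definition unit_dir :: "2 \<Rightarrow> complex \<Rightarrow> surf" where
  "unit_dir j w = (if j = 1 then (w, 0) else (0, w))"

definition d_z :: "2 \<Rightarrow> (surf \<Rightarrow> complex) \<Rightarrow> surf \<Rightarrow> complex" where
  "d_z j f z = (frechet_derivative f (at z) (unit_dir j 1)
                - \<i> * frechet_derivative f (at z) (unit_dir j \<i>)) / 2"

definition d_zbar :: "2 \<Rightarrow> (surf \<Rightarrow> complex) \<Rightarrow> surf \<Rightarrow> complex" where
  "d_zbar j f z = (frechet_derivative f (at z) (unit_dir j 1)
                   + \<i> * frechet_derivative f (at z) (unit_dir j \<i>)) / 2"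

definition complex_hessian :: "(surf \<Rightarrow> real) \<Rightarrow> surf \<Rightarrow> complex ^ 2 ^ 2" where
  "complex_hessian f z = (\<chi> i j. d_z i (d_zbar j (\<lambda>w. complex_of_real (f w))) z)"


section \<open>The evolution equation\<close>

text \<open>A family \<open>F(s)\<close> of functions on the surface is a function of \<open>(z, s)\<close>.\<close>

type_synonym base = "surf \<times> real"

definition s_deriv :: "(base \<Rightarrow> real) \<Rightarrow> base \<Rightarrow> real" where
  "s_deriv F b = deriv (\<lambda>t. F (fst b, t)) (snd b)"

definition ma_equation :: "real \<Rightarrow> (base \<Rightarrow> real) \<Rightarrow> base \<Rightarrow> bool" where
  "ma_equation c F b \<longleftrightarrow>
     (let z = fst b; s = snd b in
      complex_of_real (s_deriv (s_deriv F) b) =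
        of_real (s * (s + c)) * (4 * det (complex_hessian (\<lambda>w. F (w, s)) z)))"

text \<open>The condition \<open>\<onehalf> u (\<omega>\<^sub>2 + i\<omega>\<^sub>3) \<and> (\<omega>\<^sub>2 - i\<omega>\<^sub>3) = s(s + c) dd\<^sup>cF \<and> dd\<^sup>cF\<close> with \<open>u\<close> the
  second \<open>s\<close>-derivative of \<open>F\<close>.  In coordinates it is \<open>u = 16 s(s + c) det(F\<^sub>i\<^sub>j)\<close>, so a function
  \<open>F\<close> satisfies \<open>ma_equation c\<close> exactly if \<open>F / 4\<close> satisfies this condition.\<close>

definition volume_condition :: "real \<Rightarrow> (base \<Rightarrow> real) \<Rightarrow> base \<Rightarrow> bool" where
  "volume_condition c F b \<longleftrightarrow>
     (let z = fst b; s = snd b; \<omega> = dd_c (\<lambda>w. F (w, s)) z in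
      \<forall>v. of_real (1 / 2 * s_deriv (s_deriv F) b) * wedge 2 2 hol_symp (\<lambda>w. cnj (hol_symp w)) v =
          complex_of_real (s * (s + c) * wedge 2 2 \<omega> \<omega> v))"

definition analytic_solution ::
  "((base \<Rightarrow> real) \<Rightarrow> base \<Rightarrow> bool) \<Rightarrow> (surf \<Rightarrow> real) \<Rightarrow> (surf \<Rightarrow> real) \<Rightarrow>
   surf set \<Rightarrow> real set \<Rightarrow> (base \<Rightarrow> real) \<Rightarrow> bool" where
  "analytic_solution E F0 F1 U I F \<longleftrightarrow>
     real_analytic_on F (U \<times> I) \<and>
     (\<forall>z\<in>U. F (z, 0) = F0 z \<and> s_deriv F (z, 0) = F1 z) \<and>
     (\<forall>b\<in>U \<times> I. E F b)"


section \<open>The \<open>Spin(7)\<close>-structure on the torus bundle\<close>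

text \<open>Over a small base every \<open>T\<^sup>3\<close>-bundle is trivial, and torus-invariant forms on \<open>B \<times> T\<^sup>3\<close> are the
  translation-invariant forms on \<open>B \<times> \<real>\<^sup>3\<close>.  Points of the 7-manifold (the \<open>T\<^sup>2\<close>-bundle carrying
  \<open>\<xi>\<close> and \<open>\<alpha>\<close>) are \<open>(b, \<theta>\<^sub>\<xi>, \<theta>\<^sub>\<alpha>)\<close>, those of the 8-manifold are \<open>(\<theta>\<^sub>\<eta>, b, \<theta>\<^sub>\<xi>, \<theta>\<^sub>\<alpha>)\<close>.
  A connection 1-form on a trivial circle bundle is \<open>d\<theta> + A\<close> with \<open>A\<close> a 1-form on the base.\<close>

type_synonym tot7 = "base \<times> (real \<times> real)"
type_synonym tot8 = "real \<times> tot7"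

definition pull_form :: "('v \<Rightarrow> 'w) \<Rightarrow> ('w \<Rightarrow> ('w, 'b) covec) \<Rightarrow> 'v \<Rightarrow> ('v, 'b) covec" where
  "pull_form \<pi> \<beta> = (\<lambda>x. pullback \<pi> (\<beta> (\<pi> x)))" \<comment> \<open>for linear \<open>\<pi>\<close>\<close>

definition conn_xi :: "(base \<Rightarrow> (base, real) covec) \<Rightarrow> tot7 \<Rightarrow> (tot7, real) covec" where
  "conn_xi A = (\<lambda>x v. fst (snd (v 0)) + pull_form fst A x v)"

definition conn_alpha :: "(base \<Rightarrow> (base, real) covec) \<Rightarrow> tot7 \<Rightarrow> (tot7, real) covec" where
  "conn_alpha A = (\<lambda>x v. snd (snd (v 0)) + pull_form fst A x v)"

definition conn_eta :: "(base \<Rightarrow> (base, real) covec) \<Rightarrow> tot8 \<Rightarrow> (tot8, real) covec" where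
  "conn_eta A = (\<lambda>x v. fst (v 0) + pull_form (fst \<circ> snd) A x v)"

definition ds_base :: "base \<Rightarrow> (base, real) covec" where
  "ds_base = (\<lambda>b v. snd (v 0))"

definition omega2_base :: "base \<Rightarrow> (base, real) covec" where
  "omega2_base = (\<lambda>b. pullback fst omega2)"

definition omega3_base :: "base \<Rightarrow> (base, real) covec" where
  "omega3_base = (\<lambda>b. pullback fst omega3)"

definition omega1t :: "(base \<Rightarrow> real) \<Rightarrow> base \<Rightarrow> (base, real) covec" where
  "omega1t F = (\<lambda>b. pullback fst (dd_c (\<lambda>w. F (w, snd b)) (fst b)))"

definition ds_omega1t :: "(base \<Rightarrow> real) \<Rightarrow> base \<Rightarrow> (base, real) covec" where
  "ds_omega1t F = (\<lambda>b v. deriv (\<lambda>t. omega1t F (fst b, t) v) (snd b))"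

definition dc_base :: "(base \<Rightarrow> real) \<Rightarrow> base \<Rightarrow> (base, real) covec" where
  "dc_base u = (\<lambda>b. pullback fst (d_c (\<lambda>w. u (w, snd b)) (fst b)))"

definition curv_alpha :: "(base \<Rightarrow> real) \<Rightarrow> base \<Rightarrow> (base, real) covec" where
  "curv_alpha F = (\<lambda>b v.
     - wedge 1 1 (dc_base (s_deriv (s_deriv F)) b) (ds_base b) v + ds_omega1t F b v)"

definition prescribed_curvatures ::
  "base set \<Rightarrow> (base \<Rightarrow> real) \<Rightarrow> (base \<Rightarrow> (base, real) covec) \<Rightarrow>
   (base \<Rightarrow> (base, real) covec) \<Rightarrow> (base \<Rightarrow> (base, real) covec) \<Rightarrow> bool" where
  "prescribed_curvatures B F A\<^sub>\<xi> A\<^sub>\<eta> A\<^sub>\<alpha> \<longleftrightarrow>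
     smooth_form 1 B A\<^sub>\<xi> \<and> smooth_form 1 B A\<^sub>\<eta> \<and> smooth_form 1 B A\<^sub>\<alpha> \<and>
     (\<forall>x \<in> B \<times> UNIV. ext_d 1 (conn_xi A\<^sub>\<xi>) x = (\<lambda>v. - pull_form fst omega2_base x v)) \<and>
     (\<forall>x \<in> UNIV \<times> B \<times> UNIV.
        ext_d 1 (conn_eta A\<^sub>\<eta>) x = (\<lambda>v. - pull_form (fst \<circ> snd) omega3_base x v)) \<and>
     (\<forall>x \<in> B \<times> UNIV. ext_d 1 (conn_alpha A\<^sub>\<alpha>) x = pull_form fst (curv_alpha F) x)"

definition phi_form ::
  "real \<Rightarrow> (base \<Rightarrow> real) \<Rightarrow> (tot7 \<Rightarrow> (tot7, real) covec) \<Rightarrow> (tot7 \<Rightarrow> (tot7, real) covec) \<Rightarrow>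
   tot7 \<Rightarrow> (tot7, real) covec" where
  "phi_form c F \<xi> \<alpha> = (\<lambda>x v.
     let s = snd (fst x); u = s_deriv (s_deriv F) (fst x);
         ds = pull_form fst ds_base x; w1 = pull_form fst (omega1t F) x;
         w2 = pull_form fst omega2_base x; w3 = pull_form fst omega3_base x
     in wedge 1 2 (\<xi> x) (\<lambda>y. w1 y + wedge 1 1 ds (\<alpha> x) y) v
        + (s + c) * wedge 2 1 w2 (\<alpha> x) v
        + u * (s + c) * wedge 2 1 w3 ds v)"

definition Phi_form ::
  "(tot8 \<Rightarrow> (tot8, real) covec) \<Rightarrow> (tot7 \<Rightarrow> (tot7, real) covec) \<Rightarrow> tot8 \<Rightarrow> (tot8, real) covec" where
  "Phi_form \<eta> \<phi> = (\<lambda>x v.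
     let s = snd (fst (snd x))
     in wedge 1 3 (\<eta> x) (pull_form snd \<phi> x) v
        + s powr (4 / 3) * pull_form snd (\<lambda>y. g2_star (\<phi> y) 3 (\<phi> y)) x v)"

definition torus_invariant :: "base set \<Rightarrow> (tot8 \<Rightarrow> (tot8, real) covec) \<Rightarrow> bool" where
  "torus_invariant B \<Phi> \<longleftrightarrow> (\<forall>b\<in>B. \<forall>t p q. \<Phi> (t, b, p, q) = \<Phi> (0, b, 0, 0))"

definition yields_torsion_free_spin7 :: "real \<Rightarrow> base set \<Rightarrow> (base \<Rightarrow> real) \<Rightarrow> bool" where
  "yields_torsion_free_spin7 c B F \<longleftrightarrow>
     (\<exists>A\<^sub>\<xi> A\<^sub>\<eta> A\<^sub>\<alpha>. prescribed_curvatures B F A\<^sub>\<xi> A\<^sub>\<eta> A\<^sub>\<alpha>) \<and>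
     (\<forall>A\<^sub>\<xi> A\<^sub>\<eta> A\<^sub>\<alpha>. prescribed_curvatures B F A\<^sub>\<xi> A\<^sub>\<eta> A\<^sub>\<alpha> \<longrightarrow>
        (let \<phi> = phi_form c F (conn_xi A\<^sub>\<xi>) (conn_alpha A\<^sub>\<alpha>);
             \<Phi> = Phi_form (conn_eta A\<^sub>\<eta>) \<phi>
         in g2_structure (B \<times> UNIV) \<phi> \<and>
            torus_invariant B \<Phi> \<and>
            torsion_free_spin7_structure (UNIV \<times> B \<times> UNIV) \<Phi>))"

end

theory Submission
  imports Defs
begin

text \<open>In the real coordinates of \<open>(z\<^sub>1, z\<^sub>2)\<close> the determinant of the complex Hessian is \<open>(P Q - R\<^sup>2 - T\<^sup>2)
    / 16\<close> with
  \<open>P, Q, R, T\<close> linear in the second derivatives, so the equation determines all Taylor coefficients in \<open>s\<close>.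
  Their convergence is a Cauchy--Kovalevskaya majorant estimate: the \<open>n\<close>-th coefficient is dominated by
  \<open>A K\<^sup>n (n + 1)\<^sup>-\<^sup>4 G\<^sup>2\<^sup>n\<^sup>+\<^sup>2\<close> with \<open>G = 1 / (1 - R X)\<close>, and the weights \<open>(n + 1)\<^sup>-\<^sup>4\<close> absorb both the
      convolution and the
  two derivatives.  For uniqueness all \<open>s\<close>-derivatives of the difference of two solutions vanish at \<open>s = 0\<close>,
  and a real analytic function of one variable that vanishes to infinite order vanishes identically.

  Every form on the torus bundles is a combination of products of the coframe \<open>dx\<^sub>1, dy\<^sub>1, dx\<^sub>2, dy\<^sub>2, ds,
      \<xi>, \<alpha>, \<eta>\<close>.
  The potential being strictly plurisuperharmonic and \<open>u = s(s + c)(P Q - R\<^sup>2 - T\<^sup>2)\<close>, the square roots of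
  Gaussian elimination give an explicit frame in which \<open>\<phi>\<close> is the model form; its Hodge star does not depend on
  the frame because the stabiliser of the model is orthogonal.  Then \<open>d\<Phi> = 0\<close> is an identity between
  coefficients that follows from the structure equations, from \<open>d\<omega>\<^sub>1 = 0\<close> and from the \<open>s\<close>-derivative of
      the equation.\<close>

text \<open>The factor \<open>s\<close> of the equation makes the exponent \<open>2 n + 2\<close>
  fit. Since \<open>G' = R G^2\<close>, two derivatives raise the exponent of \<open>G\<close> by 2,
  so a product of the coefficients \<open>i\<close> and \<open>j\<close> carries
  \<open>2 (i + j) + 8\<close>. Because of the factor \<open>s\<close>, the coefficient
  \<open>n + 2\<close> only meets \<open>i + j \<le> n - 1\<close>, which gives exactly
  \<open>2 (n + 2) + 2\<close>. As to the weights, two derivatives of \<open>G^(2 i + 2)\<close>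
  cost about \<open>(i + 1)^2\<close>; inverse squares remain, their convolution is again an inverse
  square, and the two integrations in \<open>s\<close> restore the fourth power.

  The two normalisations of the equation, which differ by a factor 4 in \<open>F\<close>, are one
  equation with a constant \<open>\<kappa>\<close>.

  Forms are lists of coefficients and words in the coframe. Wedge products, exterior derivatives and
  changes of frame act on such lists, and sorting the words with their signs turns identities of
  forms into identities of coefficients. The equation itself is what makes the conditions on the
  frame compatible.\<close>

section \<open>Directional derivatives\<close>

definition dird :: "'a::real_normed_vector \<Rightarrow> ('a \<Rightarrow> real) \<Rightarrow> 'a \<Rightarrow> real" where
  "dird b f = (\<lambda>x. frechet_derivative f (at x) b)"

lemma has_derivative_cong_open:
  assumes "open S" "x \<in> S" "\<And>y. y \<in> S \<Longrightarrow> f y = g y"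
  shows "(f has_derivative f') (at x) \<longleftrightarrow> (g has_derivative f') (at x)"
  using has_derivative_transform_within_open[OF _ assms(1,2)] assms(3) by metis

lemma frechet_derivative_cong_open:
  assumes "open S" "x \<in> S" "\<And>y. y \<in> S \<Longrightarrow> f y = g y"
  shows "frechet_derivative f (at x) = frechet_derivative g (at x)"
  unfolding frechet_derivative_def using has_derivative_cong_open[OF assms] by simp

lemma differentiable_cong_open:
  assumes "open S" "x \<in> S" "\<And>y. y \<in> S \<Longrightarrow> f y = g y"
  shows "f differentiable (at x) \<longleftrightarrow> g differentiable (at x)"
  unfolding differentiable_def using has_derivative_cong_open[OF assms] by simp

lemma dird_cong:
  assumes "open S" "x \<in> S" "\<And>y. y \<in> S \<Longrightarrow> f y = g y"
  shows "dird b f x = dird b g x"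
  unfolding dird_def using frechet_derivative_cong_open[OF assms] by simp

lemma dird_eq: "(f has_derivative f') (at x) \<Longrightarrow> dird b f x = f' b"
  unfolding dird_def using frechet_derivative_at by metis

lemma has_derivative_dird:
  "f differentiable (at x) \<Longrightarrow> (f has_derivative (\<lambda>h. dird h f x)) (at x)"
  unfolding dird_def using frechet_derivative_works by (metis eta_contract_eq)

lemma dird_const [simp]: "dird b (\<lambda>x. k) = (\<lambda>x. 0)"
  by (rule ext) (rule dird_eq[OF has_derivative_const])

lemma dird_bounded_linear: "bounded_linear L \<Longrightarrow> dird b L x = L b"
  by (rule dird_eq) (rule bounded_linear_imp_has_derivative)

lemma dird_add: "f differentiable (at x) \<Longrightarrow> g differentiable (at x) \<Longrightarrow>
    dird b (\<lambda>x. f x + g x) x = dird b f x + dird b g x"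
  by (rule dird_eq) (rule has_derivative_add; rule has_derivative_dird; assumption)

lemma dird_minus: "f differentiable (at x) \<Longrightarrow> dird b (\<lambda>x. - f x) x = - dird b f x"
  by (rule dird_eq) (rule has_derivative_minus; rule has_derivative_dird; assumption)

lemma dird_diff: "f differentiable (at x) \<Longrightarrow> g differentiable (at x) \<Longrightarrow>
    dird b (\<lambda>x. f x - g x) x = dird b f x - dird b g x"
  by (rule dird_eq) (rule has_derivative_diff; rule has_derivative_dird; assumption)

lemma dird_cmult: "f differentiable (at x) \<Longrightarrow> dird b (\<lambda>x. k * f x) x = k * dird b f x"
  by (rule dird_eq) (rule has_derivative_mult_right; rule has_derivative_dird; assumption)

lemma dird_mult: "f differentiable (at x) \<Longrightarrow> g differentiable (at x) \<Longrightarrow>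
    dird b (\<lambda>x. f x * g x) x = f x * dird b g x + dird b f x * g x"
  by (rule dird_eq) (rule has_derivative_mult; rule has_derivative_dird; assumption)

lemma dird_sum: "(\<And>i. i \<in> I \<Longrightarrow> f i differentiable (at x)) \<Longrightarrow>
    dird b (\<lambda>x. \<Sum>i\<in>I. f i x) x = (\<Sum>i\<in>I. dird b (f i) x)"
  by (rule dird_eq) (rule has_derivative_sum; rule has_derivative_dird; blast)

lemma dird_compose_linear:
  assumes "bounded_linear L" "f differentiable (at (L x))"
  shows "dird b (\<lambda>x. f (L x)) x = dird (L b) f (L x)"
    and "(\<lambda>x. f (L x)) differentiable (at x)"
proof -
  have "((\<lambda>x. f (L x)) has_derivative (\<lambda>h. dird (L h) f (L x))) (at x)"
    using has_derivative_compose[OF bounded_linear_imp_has_derivative[OF assms(1)]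
        has_derivative_dird[OF assms(2)]] .
  then show "dird b (\<lambda>x. f (L x)) x = dird (L b) f (L x)" "(\<lambda>x. f (L x)) differentiable (at x)"
    by (auto intro: dird_eq simp: differentiable_def)
qed

lemma linear_dird: "f differentiable (at x) \<Longrightarrow> linear (\<lambda>h. dird h f x)"
  using has_derivative_dird has_derivative_linear by blast

lemma dird_basis_sum:
  fixes f :: "'a::euclidean_space \<Rightarrow> real"
  assumes "f differentiable (at x)"
  shows "dird v f x = (\<Sum>b\<in>Basis. (v \<bullet> b) * dird b f x)"
proof -
  interpret linear "\<lambda>h. dird h f x" by (rule linear_dird[OF assms])
  have "dird (\<Sum>b\<in>Basis. (v \<bullet> b) *\<^sub>R b) f x = (\<Sum>b\<in>Basis. (v \<bullet> b) * dird b f x)"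
    by (simp add: sum scale)
  then show ?thesis by (simp add: euclidean_representation)
qed

subsection \<open>Smooth functions\<close>

text \<open>Smoothness can now be unfolded one derivative at a time, without counting orders as
  \<open>ck_on\<close> does.\<close>

lemma smooth_on_iff:
  "smooth_on f S \<longleftrightarrow>
     (\<forall>x\<in>S. f differentiable (at x)) \<and> (\<forall>b\<in>Basis. smooth_on (dird b f) S)"
proof (intro iffI conjI ballI)
  assume "smooth_on f S"
  then have *: "ck_on (Suc n) f S" for n unfolding smooth_on_def by blast
  show "f differentiable (at x)" if "x \<in> S" for x using *[of 0] that by auto
  show "smooth_on (dird b f) S" if "b \<in> Basis" for b
    unfolding smooth_on_def dird_def using * that by auto
next
  assume *: "(\<forall>x\<in>S. f differentiable (at x)) \<and> (\<forall>b\<in>Basis. smooth_on (dird b f) S)"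
  have "ck_on n f S" for n
  proof (cases n)
    case 0
    then show ?thesis using *
      by (auto intro!: continuous_at_imp_continuous_on differentiable_imp_continuous_within)
  next
    case (Suc m)
    then show ?thesis using * by (auto simp: smooth_on_def dird_def)
  qed
  then show "smooth_on f S" unfolding smooth_on_def by blast
qed

lemma smooth_on_differentiable: "smooth_on f S \<Longrightarrow> x \<in> S \<Longrightarrow> f differentiable (at x)"
  using smooth_on_iff by blast

lemma smooth_on_continuous: "smooth_on f S \<Longrightarrow> continuous_on S f"
  unfolding smooth_on_def using ck_on.simps(1) by blast

lemma smooth_on_subset: "smooth_on f S \<Longrightarrow> T \<subseteq> S \<Longrightarrow> smooth_on f T"
proof -
  have "ck_on n f S \<Longrightarrow> T \<subseteq> S \<Longrightarrow> ck_on n f T" for n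
    by (induction n arbitrary: f) (auto intro: continuous_on_subset)
  then show "smooth_on f S \<Longrightarrow> T \<subseteq> S \<Longrightarrow> smooth_on f T" unfolding smooth_on_def by blast
qed

lemma ck_on_cong:
  assumes "open S"
  shows "(\<And>x. x \<in> S \<Longrightarrow> f x = g x) \<Longrightarrow> ck_on n f S \<Longrightarrow> ck_on n g S"
proof (induction n arbitrary: f g)
  case 0
  then show ?case by (metis ck_on.simps(1) continuous_on_cong)
next
  case (Suc n)
  have "ck_on n (\<lambda>x. frechet_derivative g (at x) b) S" if "b \<in> Basis" for b
    by (rule Suc.IH[of "\<lambda>x. frechet_derivative f (at x) b"])
       (use Suc.prems that frechet_derivative_cong_open[OF assms, of _ f g] in auto)
  then show ?case using Suc.prems differentiable_cong_open[OF assms, of _ f g] by auto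
qed

lemma smooth_on_cong:
  "open S \<Longrightarrow> (\<And>x. x \<in> S \<Longrightarrow> f x = g x) \<Longrightarrow> smooth_on f S \<Longrightarrow> smooth_on g S"
  unfolding smooth_on_def using ck_on_cong by blast

lemma smooth_on_const [intro!, simp]: "smooth_on (\<lambda>x. k) S"
proof -
  have "ck_on n (\<lambda>x. k) S" for n
    by (induction n arbitrary: k) (auto simp: differentiable_const)
  then show ?thesis unfolding smooth_on_def by blast
qed

lemma ck_on_add:
  assumes "open S"
  shows "ck_on n f S \<Longrightarrow> ck_on n g S \<Longrightarrow> ck_on n (\<lambda>x. f x + g x) S"
proof (induction n arbitrary: f g)
  case (Suc n)
  have "ck_on n (dird b (\<lambda>x. f x + g x)) S" if b: "b \<in> Basis" for b
    by (rule ck_on_cong[OF assms, where f="\<lambda>x. dird b f x + dird b g x"])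
      (use Suc b in \<open>auto simp: dird_add, auto simp: dird_def\<close>)
  then show ?case using Suc.prems by (auto simp: dird_def)
qed (auto intro: continuous_on_add)

lemma smooth_on_add:
  "open S \<Longrightarrow> smooth_on f S \<Longrightarrow> smooth_on g S \<Longrightarrow> smooth_on (\<lambda>x. f x + g x) S"
  unfolding smooth_on_def using ck_on_add by blast

text \<open>Both factors stay smooth throughout and the induction counts the order of the product
  alone: the product rule pairs a derivative with an undifferentiated factor, so the orders of the
  two factors never have to be matched.\<close>

lemma smooth_on_mult:
  assumes "open S"
  shows "smooth_on f S \<Longrightarrow> smooth_on g S \<Longrightarrow> smooth_on (\<lambda>x. f x * g x) S"
proof -
  have "smooth_on f S \<Longrightarrow> smooth_on g S \<Longrightarrow> ck_on n (\<lambda>x. f x * g x) S" for n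
  proof (induction n arbitrary: f g)
    case 0
    then show ?case by (simp add: continuous_on_mult smooth_on_continuous)
  next
    case (Suc n)
    have "ck_on n (dird b (\<lambda>x. f x * g x)) S" if b: "b \<in> Basis" for b
    proof (rule ck_on_cong[OF assms])
      show "ck_on n (\<lambda>x. f x * dird b g x + dird b f x * g x) S"
        using Suc.prems b smooth_on_iff[of f S] smooth_on_iff[of g S]
        by (intro ck_on_add[OF assms] Suc.IH) auto
    qed (use Suc.prems in \<open>simp add: dird_mult smooth_on_differentiable\<close>)
    then show ?case using Suc.prems
      by (auto simp: dird_def smooth_on_differentiable)
  qed
  then show "smooth_on (\<lambda>x. f x * g x) S" if "smooth_on f S" "smooth_on g S"
    using that by (subst smooth_on_def) blast
qed

lemma smooth_on_minus: "open S \<Longrightarrow> smooth_on f S \<Longrightarrow> smooth_on (\<lambda>x. - f x) S"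
  using smooth_on_mult[of S "\<lambda>x. -1" f] by simp

lemma smooth_on_diff:
  "open S \<Longrightarrow> smooth_on f S \<Longrightarrow> smooth_on g S \<Longrightarrow> smooth_on (\<lambda>x. f x - g x) S"
  using smooth_on_add[of S f "\<lambda>x. - g x"] smooth_on_minus[of S g] by simp

lemma smooth_on_sum:
  assumes "open S"
  shows "(\<And>i. i \<in> I \<Longrightarrow> smooth_on (f i) S) \<Longrightarrow> smooth_on (\<lambda>x. \<Sum>i\<in>I. f i x) S"
  by (induction I rule: infinite_finite_induct) (auto intro: smooth_on_add[OF assms])

lemma smooth_on_power: "open S \<Longrightarrow> smooth_on f S \<Longrightarrow> smooth_on (\<lambda>x. f x ^ n) S"
  by (induction n) (auto intro: smooth_on_mult)

lemma smooth_on_linear: "bounded_linear L \<Longrightarrow> smooth_on L S"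
proof -
  assume L: "bounded_linear L"
  then have "dird b L = (\<lambda>x. L b)" for b using dird_bounded_linear by blast
  then show ?thesis unfolding smooth_on_iff[of L]
    using L by (auto intro: bounded_linear_imp_differentiable)
qed

lemma smooth_on_dird:
  assumes "open S" "smooth_on f S"
  shows "smooth_on (dird v f) S"
proof (rule smooth_on_cong[OF assms(1)])
  show "smooth_on (\<lambda>x. \<Sum>b\<in>Basis. (v \<bullet> b) * dird b f x) S"
    using assms smooth_on_iff[of f] by (auto intro!: smooth_on_sum smooth_on_mult)
qed (use assms in \<open>simp add: dird_basis_sum smooth_on_differentiable\<close>)

lemma smooth_on_compose_linear:
  assumes "open S" "open T" "bounded_linear L" "\<And>x. x \<in> T \<Longrightarrow> L x \<in> S" "smooth_on f S"
  shows "smooth_on (\<lambda>x. f (L x)) T"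
proof -
  have "smooth_on f S \<Longrightarrow> ck_on n (\<lambda>x. f (L x)) T" for n
  proof (induction n arbitrary: f)
    case 0
    have "continuous_on T (f \<circ> L)"
      by (intro continuous_on_compose linear_continuous_on assms
          continuous_on_subset[OF smooth_on_continuous[OF 0]]) (use assms in auto)
    then show ?case by (simp add: o_def)
  next
    case (Suc n)
    have "ck_on n (dird b (\<lambda>x. f (L x))) T" for b
      by (rule ck_on_cong[OF assms(2), where f="\<lambda>x. dird (L b) f (L x)"])
        (use Suc assms in \<open>auto simp: dird_compose_linear smooth_on_differentiable
           intro!: Suc.IH smooth_on_dird\<close>)
    then show ?case using Suc.prems assms
      by (auto simp: dird_def smooth_on_differentiable dird_compose_linear)
  qed
  then show ?thesis using assms(5) unfolding smooth_on_def by blast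
qed

unbundle fps_syntax and no vec_syntax

section \<open>Symmetry of second derivatives\<close>

lemma dird_line:
  assumes "f differentiable (at (x + t *\<^sub>R a))"
  shows "((\<lambda>t. f (x + t *\<^sub>R a)) has_real_derivative dird a f (x + t *\<^sub>R a)) (at t)"
proof -
  have "((\<lambda>t. x + t *\<^sub>R a) has_derivative (\<lambda>h. h *\<^sub>R a)) (at t)"
    by (auto intro!: derivative_eq_intros)
  from has_derivative_compose[OF this has_derivative_dird[OF assms]]
  have "((\<lambda>t. f (x + t *\<^sub>R a)) has_derivative (\<lambda>h. dird (h *\<^sub>R a) f (x + t *\<^sub>R a))) (at t)" .
  moreover have "(\<lambda>h. dird (h *\<^sub>R a) f (x + t *\<^sub>R a)) = (*) (dird a f (x + t *\<^sub>R a))"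
    using linear_scale[OF linear_dird[OF assms]] by (auto simp: fun_eq_iff)
  ultimately show ?thesis unfolding has_field_derivative_def by simp
qed

text \<open>The mean value theorem is applied twice: to the difference in direction \<open>b\<close>
  as a function along \<open>a\<close>, then to \<open>dird a f\<close> along \<open>b\<close>. The
  second difference is symmetric in \<open>a\<close> and \<open>b\<close>, which
  \<open>dird_commute\<close> exploits.\<close>

lemma second_difference_mvt:
  fixes f :: "'a::euclidean_space \<Rightarrow> real"
  assumes W: "open W" "smooth_on f W" and "0 < h"
    and sub: "\<And>s t. 0 \<le> s \<Longrightarrow> s \<le> h \<Longrightarrow> 0 \<le> t \<Longrightarrow> t \<le> h \<Longrightarrow> x + s *\<^sub>R a + t *\<^sub>R b \<in> W"
  shows "\<exists>s t. 0 < s \<and> s < h \<and> 0 < t \<and> t < h \<and>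
    f (x + h *\<^sub>R a + h *\<^sub>R b) - f (x + h *\<^sub>R a) - f (x + h *\<^sub>R b) + f x
      = h * h * dird b (dird a f) (x + s *\<^sub>R a + t *\<^sub>R b)"
proof -
  have d: "f differentiable (at y)" "dird a f differentiable (at y)" if "y \<in> W" for y
    using that W smooth_on_differentiable smooth_on_dird by blast+
  have D1: "((\<lambda>s. f (x + s *\<^sub>R a + h *\<^sub>R b) - f (x + s *\<^sub>R a)) has_real_derivative
      dird a f (x + s *\<^sub>R a + h *\<^sub>R b) - dird a f (x + s *\<^sub>R a)) (at s)" if "0 \<le> s" "s \<le> h" for s
  proof (rule DERIV_diff)
    show "((\<lambda>s. f (x + s *\<^sub>R a + h *\<^sub>R b)) has_real_derivative
      dird a f (x + s *\<^sub>R a + h *\<^sub>R b)) (at s)"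
      using dird_line[of f "x + h *\<^sub>R b" s a] d(1)[OF sub[of s h]] that \<open>0 < h\<close> by (simp add: add_ac)
    show "((\<lambda>s. f (x + s *\<^sub>R a)) has_real_derivative dird a f (x + s *\<^sub>R a)) (at s)"
      using dird_line[of f x s a] d(1)[OF sub[of s 0]] that \<open>0 < h\<close> by simp
  qed
  obtain s where s: "0 < s" "s < h" and
    e1: "(f (x + h *\<^sub>R a + h *\<^sub>R b) - f (x + h *\<^sub>R a)) - (f (x + 0 *\<^sub>R a + h *\<^sub>R b) - f (x + 0 *\<^sub>R a))
      = (h - 0) * (dird a f (x + s *\<^sub>R a + h *\<^sub>R b) - dird a f (x + s *\<^sub>R a))"
    using MVT2[where a=0 and b=h and f="\<lambda>s. f (x + s *\<^sub>R a + h *\<^sub>R b) - f (x + s *\<^sub>R a)"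
        and f'="\<lambda>s. dird a f (x + s *\<^sub>R a + h *\<^sub>R b) - dird a f (x + s *\<^sub>R a)", OF \<open>0 < h\<close> D1]
    by blast
  have D2: "((\<lambda>t. dird a f (x + s *\<^sub>R a + t *\<^sub>R b)) has_real_derivative
      dird b (dird a f) (x + s *\<^sub>R a + t *\<^sub>R b)) (at t)" if "0 \<le> t" "t \<le> h" for t
    using dird_line[of "dird a f" "x + s *\<^sub>R a" t b] d(2)[OF sub[of s t]] that s by simp
  obtain t where t: "0 < t" "t < h" and
    e2: "dird a f (x + s *\<^sub>R a + h *\<^sub>R b) - dird a f (x + s *\<^sub>R a + 0 *\<^sub>R b)
      = (h - 0) * dird b (dird a f) (x + s *\<^sub>R a + t *\<^sub>R b)"
    using MVT2[where a=0 and b=h and f="\<lambda>t. dird a f (x + s *\<^sub>R a + t *\<^sub>R b)"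
        and f'="\<lambda>t. dird b (dird a f) (x + s *\<^sub>R a + t *\<^sub>R b)", OF \<open>0 < h\<close> D2]
    by blast
  show ?thesis using e1 e2 s t by (intro exI[of _ s] exI[of _ t]) simp
qed

text \<open>Schwarz's theorem. One second difference equals \<open>h^2\<close> times either mixed
  derivative at points close to \<open>x\<close>, so by continuity the two cannot differ at
  \<open>x\<close>.\<close>

lemma dird_commute:
  fixes f :: "'a::euclidean_space \<Rightarrow> real"
  assumes W: "open W" "smooth_on f W" and x: "x \<in> W"
  shows "dird a (dird b f) x = dird b (dird a f) x"
proof (rule ccontr)
  let ?p = "dird b (dird a f)" and ?q = "dird a (dird b f)"
  assume ne: "?q x \<noteq> ?p x"
  define e where "e = \<bar>?q x - ?p x\<bar> / 2"
  have e: "e > 0" using ne by (simp add: e_def)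
  have "isCont ?p x" "isCont ?q x"
    using W x by (auto intro!: smooth_on_differentiable smooth_on_dird differentiable_imp_continuous_within)
  then obtain r1 r2 where r: "r1 > 0" "r2 > 0"
    and r1: "\<And>y. dist y x < r1 \<Longrightarrow> dist (?p y) (?p x) < e"
    and r2: "\<And>y. dist y x < r2 \<Longrightarrow> dist (?q y) (?q x) < e"
    using e unfolding continuous_at_eps_delta by metis
  obtain r0 where r0: "r0 > 0" "ball x r0 \<subseteq> W" using W x openE by metis
  define r where "r = min r0 (min r1 r2)"
  \<comment> \<open>The parallelogram spanned by \<open>h a\<close> and \<open>h b\<close> must stay
    within distance \<open>r\<close>; the summand 1 covers the case
    \<open>a = b = 0\<close>.\<close>
  define h where "h = r / (norm a + norm b + 1)"
  have h: "h > 0" using r r0 by (auto simp: h_def r_def add_nonneg_pos)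
  have near: "dist (x + s *\<^sub>R a + t *\<^sub>R b) x < r" if "0 \<le> s" "s \<le> h" "0 \<le> t" "t \<le> h" for s t
  proof -
    have "norm (s *\<^sub>R a + t *\<^sub>R b) \<le> s * norm a + t * norm b"
      using norm_triangle_ineq[of "s *\<^sub>R a" "t *\<^sub>R b"] that by simp
    also have "\<dots> \<le> h * norm a + h * norm b" using that by (intro add_mono mult_right_mono) auto
    also have "\<dots> < h * (norm a + norm b + 1)" using h by (simp add: algebra_simps)
    also have "\<dots> = r" unfolding h_def using norm_ge_zero[of a] norm_ge_zero[of b]
      by (simp add: add_nonneg_eq_0_iff field_simps)
    finally show ?thesis by (simp add: dist_norm add.assoc)
  qed
  have sub: "x + s *\<^sub>R a + t *\<^sub>R b \<in> W" if "0 \<le> s" "s \<le> h" "0 \<le> t" "t \<le> h" for s t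
    using near[OF that] r0 by (auto simp: r_def dist_commute)
  obtain s t where st: "0 < s" "s < h" "0 < t" "t < h"
    and p: "f (x + h *\<^sub>R a + h *\<^sub>R b) - f (x + h *\<^sub>R a) - f (x + h *\<^sub>R b) + f x
      = h * h * ?p (x + s *\<^sub>R a + t *\<^sub>R b)"
    using second_difference_mvt[OF W h, of x a b] sub by blast
  have sub': "x + t *\<^sub>R b + s *\<^sub>R a \<in> W" if "0 \<le> s" "s \<le> h" "0 \<le> t" "t \<le> h" for s t
    using sub[OF that] by (simp add: add_ac)
  have "\<exists>t s. 0 < t \<and> t < h \<and> 0 < s \<and> s < h \<and>
    f (x + h *\<^sub>R b + h *\<^sub>R a) - f (x + h *\<^sub>R b) - f (x + h *\<^sub>R a) + f x
      = h * h * ?q (x + t *\<^sub>R b + s *\<^sub>R a)"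
    by (rule second_difference_mvt[OF W h, of x b a]) (use sub' in blast)
  then obtain s' t' where st': "0 < s'" "s' < h" "0 < t'" "t' < h"
    and q: "f (x + h *\<^sub>R a + h *\<^sub>R b) - f (x + h *\<^sub>R a) - f (x + h *\<^sub>R b) + f x
      = h * h * ?q (x + s' *\<^sub>R a + t' *\<^sub>R b)"
    by (auto simp: algebra_simps)
  have eq: "?p (x + s *\<^sub>R a + t *\<^sub>R b) = ?q (x + s' *\<^sub>R a + t' *\<^sub>R b)" using p q h by simp
  have "dist (?p (x + s *\<^sub>R a + t *\<^sub>R b)) (?p x) < e"
    by (rule r1) (use near[of s t] st in \<open>simp add: r_def\<close>)
  moreover have "dist (?q (x + s' *\<^sub>R a + t' *\<^sub>R b)) (?q x) < e"
    by (rule r2) (use near[of s' t'] st' in \<open>simp add: r_def\<close>)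
  ultimately show False using eq by (auto simp: e_def dist_real_def abs_if split: if_splits)
qed

subsection \<open>Majorants of all derivatives\<close>

text \<open>The majorant \<open>\<phi>\<close> bounds on \<open>U\<close> every partial derivative of order \<open>m\<close> by \<open>m!\<close> times its \<open>m\<close>-th
  coefficient.  Phrased with \<open>fps_deriv\<close>, products and derivatives need no multi-indices.\<close>

primrec majn :: "nat \<Rightarrow> 'a::euclidean_space set \<Rightarrow> ('a \<Rightarrow> real) \<Rightarrow> real fps \<Rightarrow> bool" where
  "majn 0 U f \<phi> \<longleftrightarrow> (\<forall>x\<in>U. \<bar>f x\<bar> \<le> \<phi> $ 0)"
| "majn (Suc n) U f \<phi> \<longleftrightarrow> (\<forall>x\<in>U. \<bar>f x\<bar> \<le> \<phi> $ 0) \<and> (\<forall>x\<in>U. f differentiable (at x)) \<and>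
     (\<forall>b\<in>Basis. majn n U (dird b f) (fps_deriv \<phi>))"

definition maj :: "'a::euclidean_space set \<Rightarrow> ('a \<Rightarrow> real) \<Rightarrow> real fps \<Rightarrow> bool" where
  "maj U f \<phi> \<longleftrightarrow> (\<forall>n. majn n U f \<phi>)"

text \<open>The counterpart of \<open>smooth_on_iff\<close>: one derivative is peeled off the
  function and the series together.\<close>

lemma maj_iff: "maj U f \<phi> \<longleftrightarrow> (\<forall>x\<in>U. \<bar>f x\<bar> \<le> \<phi> $ 0) \<and> (\<forall>x\<in>U. f differentiable (at x)) \<and>
     (\<forall>b\<in>Basis. maj U (dird b f) (fps_deriv \<phi>))" (is "_ \<longleftrightarrow> ?R")
proof
  assume "maj U f \<phi>"
  then have "majn (Suc n) U f \<phi>" for n unfolding maj_def by blast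
  then show ?R unfolding maj_def by auto
next
  assume R: ?R
  have "majn n U f \<phi>" for n
    using R by (cases n) (auto simp: maj_def)
  then show "maj U f \<phi>" unfolding maj_def by blast
qed

lemma maj_bound: "maj U f \<phi> \<Longrightarrow> x \<in> U \<Longrightarrow> \<bar>f x\<bar> \<le> \<phi> $ 0"
  and maj_differentiable: "maj U f \<phi> \<Longrightarrow> x \<in> U \<Longrightarrow> f differentiable (at x)"
  and maj_dird: "maj U f \<phi> \<Longrightarrow> b \<in> Basis \<Longrightarrow> maj U (dird b f) (fps_deriv \<phi>)"
  using maj_iff by blast+

lemma maj_smooth: assumes "maj U f \<phi>" shows "smooth_on f U"
proof -
  have "maj U f \<phi> \<Longrightarrow> ck_on n f U" for n
  proof (induction n arbitrary: f \<phi>)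
    case 0
    then show ?case
      by (auto intro!: continuous_at_imp_continuous_on differentiable_imp_continuous_within
          dest: maj_differentiable)
  next
    case (Suc n)
    then show ?case using Suc.IH[OF maj_dird[OF Suc.prems]] maj_differentiable[OF Suc.prems]
      by (auto simp: dird_def[symmetric])
  qed
  then show ?thesis using assms unfolding smooth_on_def by blast
qed

lemma majn_mono: "majn n U f \<phi> \<Longrightarrow> (\<And>m. \<phi> $ m \<le> \<psi> $ m) \<Longrightarrow> majn n U f \<psi>"
proof (induction n arbitrary: f \<phi> \<psi>)
  case 0
  then show ?case by (auto intro: order_trans)
next
  case (Suc n)
  have "majn n U (dird b f) (fps_deriv \<psi>)" if "b \<in> Basis" for b
    by (rule Suc.IH[of _ "fps_deriv \<phi>"]) (use Suc.prems that in \<open>auto intro!: mult_left_mono\<close>)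
  then show ?case using Suc.prems by (auto intro: order_trans)
qed

lemma maj_mono: "maj U f \<phi> \<Longrightarrow> (\<And>m. \<phi> $ m \<le> \<psi> $ m) \<Longrightarrow> maj U f \<psi>"
  unfolding maj_def using majn_mono by blast

lemma majn_subset: "majn n U f \<phi> \<Longrightarrow> V \<subseteq> U \<Longrightarrow> majn n V f \<phi>"
  by (induction n arbitrary: f \<phi>) auto

lemma maj_subset: "maj U f \<phi> \<Longrightarrow> V \<subseteq> U \<Longrightarrow> maj V f \<phi>"
  unfolding maj_def using majn_subset by blast

lemma majn_cong:
  assumes "open U"
  shows "(\<And>x. x \<in> U \<Longrightarrow> f x = g x) \<Longrightarrow> majn n U f \<phi> \<Longrightarrow> majn n U g \<phi>"
proof (induction n arbitrary: f g \<phi>)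
  case (Suc n)
  have "majn n U (dird b g) (fps_deriv \<phi>)" if "b \<in> Basis" for b
    by (rule Suc.IH[of "dird b f"]) (use Suc.prems that dird_cong[OF assms, of _ f g] in auto)
  then show ?case using Suc.prems differentiable_cong_open[OF assms, of _ f g] by auto
qed auto

lemma maj_cong: "open U \<Longrightarrow> (\<And>x. x \<in> U \<Longrightarrow> f x = g x) \<Longrightarrow> maj U f \<phi> \<Longrightarrow> maj U g \<phi>"
  unfolding maj_def using majn_cong by blast

lemma majn_add:
  assumes "open U"
  shows "majn n U f \<phi> \<Longrightarrow> majn n U g \<psi> \<Longrightarrow> majn n U (\<lambda>x. f x + g x) (\<phi> + \<psi>)"
proof (induction n arbitrary: f g \<phi> \<psi>)
  case 0
  then show ?case by (auto intro!: order_trans[OF abs_triangle_ineq] add_mono)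
next
  case (Suc n)
  have "majn n U (dird b (\<lambda>x. f x + g x)) (fps_deriv (\<phi> + \<psi>))" if "b \<in> Basis" for b
    by (rule majn_cong[OF assms, of "\<lambda>x. dird b f x + dird b g x"])
      (use Suc that in \<open>auto simp: dird_add\<close>)
  then show ?case using Suc.prems
    by (auto intro!: order_trans[OF abs_triangle_ineq] add_mono)
qed

lemma maj_add: "open U \<Longrightarrow> maj U f \<phi> \<Longrightarrow> maj U g \<psi> \<Longrightarrow> maj U (\<lambda>x. f x + g x) (\<phi> + \<psi>)"
  unfolding maj_def using majn_add by blast

text \<open>The product rule of \<open>f g\<close> and that of the series
  \<open>\<phi> \<psi>\<close> correspond term by term.\<close>

lemma maj_mult:
  assumes U: "open U" and "maj U f \<phi>" "maj U g \<psi>"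
  shows "maj U (\<lambda>x. f x * g x) (\<phi> * \<psi>)"
proof -
  have "maj U f \<phi> \<Longrightarrow> maj U g \<psi> \<Longrightarrow> majn n U (\<lambda>x. f x * g x) (\<phi> * \<psi>)" for n
  proof (induction n arbitrary: f g \<phi> \<psi>)
    case 0
    then show ?case
      by (auto simp: abs_mult dest!: maj_bound intro!: mult_mono order_trans[OF abs_ge_zero])
  next
    case (Suc n)
    have "majn n U (dird b (\<lambda>x. f x * g x)) (fps_deriv (\<phi> * \<psi>))" if b: "b \<in> Basis" for b
    proof (rule majn_cong[OF U])
      show "majn n U (\<lambda>x. f x * dird b g x + dird b f x * g x) (fps_deriv (\<phi> * \<psi>))"
        unfolding fps_deriv_mult
        by (intro majn_add[OF U] Suc.IH Suc.prems maj_dird b)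
    qed (simp add: dird_mult maj_differentiable[OF Suc.prems(1)] maj_differentiable[OF Suc.prems(2)])
    then show ?case using Suc.prems
      by (auto simp: abs_mult maj_differentiable dest!: maj_bound
          intro!: mult_mono order_trans[OF abs_ge_zero])
  qed
  then show ?thesis using assms unfolding maj_def[of U "\<lambda>x. f x * g x"] by blast
qed

lemma maj_const: "\<bar>k\<bar> \<le> c \<Longrightarrow> maj U (\<lambda>x. k) (fps_const c)"
proof -
  have "\<bar>k\<bar> \<le> c \<Longrightarrow> majn n U (\<lambda>x. k) (fps_const c)" for n k c
  proof (induction n arbitrary: k c)
    case (Suc n)
    then show ?case using Suc.IH[of 0 0] by simp
  qed auto
  then show "\<bar>k\<bar> \<le> c \<Longrightarrow> maj U (\<lambda>x. k) (fps_const c)" unfolding maj_def by blast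
qed

lemma maj_zero: "(\<And>m. 0 \<le> \<phi> $ m) \<Longrightarrow> maj U (\<lambda>x. 0) \<phi>"
  using maj_mono[OF maj_const[of 0 0 U], of \<phi>] by simp

lemma maj_cmult: "open U \<Longrightarrow> maj U f \<phi> \<Longrightarrow> maj U (\<lambda>x. k * f x) (fps_const \<bar>k\<bar> * \<phi>)"
  using maj_mult[OF _ maj_const[of k "\<bar>k\<bar>"]] by simp

lemma maj_minus: "open U \<Longrightarrow> maj U f \<phi> \<Longrightarrow> maj U (\<lambda>x. - f x) \<phi>"
  using maj_cmult[of U f \<phi> "-1"] by simp

lemma maj_diff: "open U \<Longrightarrow> maj U f \<phi> \<Longrightarrow> maj U g \<psi> \<Longrightarrow> maj U (\<lambda>x. f x - g x) (\<phi> + \<psi>)"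
  using maj_add[of U f \<phi> "\<lambda>x. - g x"] maj_minus[of U g] by simp

lemma maj_sum: "finite I \<Longrightarrow> open U \<Longrightarrow> (\<And>i. i \<in> I \<Longrightarrow> maj U (f i) (\<phi> i)) \<Longrightarrow>
    maj U (\<lambda>x. \<Sum>i\<in>I. f i x) (\<Sum>i\<in>I. \<phi> i)"
  by (induction I rule: finite_induct) (auto intro: maj_add maj_zero)

lemma maj_prod: "finite I \<Longrightarrow> open U \<Longrightarrow> (\<And>i. i \<in> I \<Longrightarrow> maj U (f i) (\<phi> i)) \<Longrightarrow>
    maj U (\<lambda>x. \<Prod>i\<in>I. f i x) (\<Prod>i\<in>I. \<phi> i)"
  by (induction I rule: finite_induct) (auto intro: maj_mult maj_const[of 1 1 U, simplified])

lemma maj_power: "open U \<Longrightarrow> maj U f \<phi> \<Longrightarrow> maj U (\<lambda>x. f x ^ n) (\<phi> ^ n)"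
  by (induction n) (auto intro: maj_mult maj_const[of 1 1 U, simplified])

text \<open>A coordinate is bounded by \<open>\<rho>\<close>, its partial derivatives are 0 or 1 and
  the higher ones vanish; hence a linear majorant.\<close>

lemma maj_coord:
  assumes "c \<in> Basis" "\<And>x. x \<in> U \<Longrightarrow> \<bar>(x - p) \<bullet> c\<bar> \<le> \<rho>"
  shows "maj U (\<lambda>x. (x - p) \<bullet> c) (fps_const \<rho> + fps_X)"
proof -
  have d: "((\<lambda>x. (x - p) \<bullet> c) has_derivative (\<lambda>h. h \<bullet> c)) (at x)" for x
    by (auto intro!: derivative_eq_intros)
  have "dird b (\<lambda>x. (x - p) \<bullet> c) = (\<lambda>x. b \<bullet> c)" for b using dird_eq[OF d] by blast
  moreover have "maj U (\<lambda>x. b \<bullet> c) 1" if "b \<in> Basis" for b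
    using maj_const[of "b \<bullet> c" 1 U] that assms(1) by (auto simp: inner_Basis)
  ultimately show ?thesis
    using assms(2) differentiableI[OF d] by (subst maj_iff) auto
qed

text \<open>Basis vectors go to basis vectors or 0, so partial derivatives of the composite are
  partial derivatives of \<open>f\<close> or 0 and no constants appear; the sign of the coefficients
  covers the case 0. The map in mind is the projection of the base to the surface.\<close>

lemma maj_compose_linear:
  assumes "open U" "open V" "bounded_linear L" "\<And>x. x \<in> V \<Longrightarrow> L x \<in> U"
    and L: "\<And>b. b \<in> Basis \<Longrightarrow> L b \<in> insert 0 Basis"
    and "maj U f \<phi>" "\<And>m. 0 \<le> \<phi> $ m"
  shows "maj V (\<lambda>x. f (L x)) \<phi>"
proof -
  have "maj U f \<phi> \<Longrightarrow> (\<And>m. 0 \<le> \<phi> $ m) \<Longrightarrow> majn n V (\<lambda>x. f (L x)) \<phi>" for n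
  proof (induction n arbitrary: f \<phi>)
    case 0
    show ?case using assms(4) maj_bound[OF 0(1)] by simp
  next
    case (Suc n)
    have d: "f differentiable (at (L x))" if "x \<in> V" for x
      using Suc.prems assms(4) that maj_differentiable by blast
    have "majn n V (dird b (\<lambda>x. f (L x))) (fps_deriv \<phi>)" if b: "b \<in> Basis" for b
    proof (rule majn_cong[OF assms(2)])
      show "majn n V (\<lambda>x. dird (L b) f (L x)) (fps_deriv \<phi>)"
      proof (cases "L b = 0")
        case True
        have "maj V (\<lambda>x. 0) (fps_deriv \<phi>)" by (rule maj_zero) (use Suc.prems in auto)
        then have "majn n V (\<lambda>x. 0) (fps_deriv \<phi>)" unfolding maj_def by blast
        then show ?thesis
          by (rule majn_cong[OF assms(2), rotated]) (use True linear_0[OF linear_dird[OF d]] in simp)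
      next
        case False
        then have "L b \<in> Basis" using L[OF b] by simp
        then show ?thesis by (intro Suc.IH maj_dird Suc.prems) (use Suc.prems in auto)
      qed
    qed (use d assms in \<open>auto simp: dird_compose_linear\<close>)
    then show ?case using assms d maj_bound[OF Suc.prems(1)] by (simp add: dird_compose_linear)
  qed
  then show ?thesis using assms(6,7) unfolding maj_def[of V] by blast
qed

text \<open>The M-test for the partial derivatives gives uniform convergence of the full
  derivatives, since the basis is finite; then termwise differentiation applies on a ball, which is
  convex.\<close>

lemma has_derivative_suminf_dird:
  fixes g :: "nat \<Rightarrow> 'a::euclidean_space \<Rightarrow> real"
  assumes U: "open U" and x: "x \<in> U"
    and d: "\<And>k y. y \<in> U \<Longrightarrow> g k differentiable (at y)"
    and bd: "\<And>k y b. y \<in> U \<Longrightarrow> b \<in> Basis \<Longrightarrow> \<bar>dird b (g k) y\<bar> \<le> M k"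
    and M: "summable M"
    and s: "\<And>y. y \<in> U \<Longrightarrow> summable (\<lambda>k. g k y)"
  shows "((\<lambda>y. \<Sum>k. g k y) has_derivative (\<lambda>h. \<Sum>b\<in>Basis. (h \<bullet> b) * (\<Sum>k. dird b (g k) x))) (at x)"
proof -
  obtain r where r: "r > 0" "ball x r \<subseteq> U" using U x openE by metis
  let ?S = "ball x r"
  have sd: "summable (\<lambda>k. dird b (g k) y)" if "y \<in> U" "b \<in> Basis" for y b
    by (rule summable_comparison_test'[OF M, of 0]) (use bd that in auto)
  have ul: "uniform_limit U (\<lambda>n y. \<Sum>k<n. dird b (g k) y) (\<lambda>y. \<Sum>k. dird b (g k) y) sequentially"
    if "b \<in> Basis" for b
    by (rule Weierstrass_m_test[OF _ M]) (use bd that in auto)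
  have "\<exists>G. \<forall>y\<in>?S. (\<lambda>n. g n y) sums G y \<and>
      (G has_derivative (\<lambda>h. \<Sum>b\<in>Basis. (h \<bullet> b) * (\<Sum>k. dird b (g k) y))) (at y within ?S)"
  proof (rule has_derivative_series[where f'="\<lambda>n y h. dird h (g n) y"])
    show "convex ?S" by simp
    show "(g n has_derivative (\<lambda>h. dird h (g n) y)) (at y within ?S)" if "y \<in> ?S" for n y
      using has_derivative_dird[OF d] that r has_derivative_at_withinI by blast
    show "\<forall>\<^sub>F n in sequentially. \<forall>y\<in>?S. \<forall>h.
        norm ((\<Sum>i<n. dird h (g i) y) - (\<Sum>b\<in>Basis. (h \<bullet> b) * (\<Sum>k. dird b (g k) y))) \<le> e * norm h"
      if e: "0 < e" for e
    proof -
      \<comment> \<open>The error \<open>e\<close> is shared equally among the basis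
        directions.\<close>
      define e' where "e' = e / real DIM('a)"
      have e': "e' > 0" using e by (simp add: e'_def)
      have "\<forall>\<^sub>F n in sequentially. \<forall>b\<in>Basis. \<forall>y\<in>U.
          dist (\<Sum>k<n. dird b (g k) y) (\<Sum>k. dird b (g k) y) < e'"
        using uniform_limitD[OF ul e'] by (intro eventually_ball_finite) auto
      then show ?thesis
      proof (rule eventually_mono, intro ballI allI)
        fix n y h
        assume n: "\<forall>b\<in>Basis. \<forall>y\<in>U. dist (\<Sum>k<n. dird b (g k) y) (\<Sum>k. dird b (g k) y) < e'"
          and y: "y \<in> ?S"
        have yU: "y \<in> U" using y r by blast
        have "(\<Sum>i<n. dird h (g i) y) = (\<Sum>i<n. \<Sum>b\<in>Basis. (h \<bullet> b) * dird b (g i) y)"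
          by (intro sum.cong refl dird_basis_sum d yU)
        also have "\<dots> = (\<Sum>b\<in>Basis. (h \<bullet> b) * (\<Sum>i<n. dird b (g i) y))"
          by (subst sum.swap) (simp add: sum_distrib_left)
        finally have "norm ((\<Sum>i<n. dird h (g i) y) - (\<Sum>b\<in>Basis. (h \<bullet> b) * (\<Sum>k. dird b (g k) y)))
          = \<bar>\<Sum>b\<in>Basis. (h \<bullet> b) * ((\<Sum>i<n. dird b (g i) y) - (\<Sum>k. dird b (g k) y))\<bar>"
          by (simp add: sum_subtractf right_diff_distrib)
        also have "\<dots> \<le> (\<Sum>b\<in>Basis. \<bar>(h \<bullet> b) * ((\<Sum>i<n. dird b (g i) y) - (\<Sum>k. dird b (g k) y))\<bar>)"
          by (rule sum_abs)
        also have "\<dots> \<le> (\<Sum>b\<in>(Basis::'a set). norm h * e')"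
          using n yU by (intro sum_mono)
            (auto simp: abs_mult dist_real_def less_imp_le intro!: mult_mono Basis_le_norm)
        also have "\<dots> = e * norm h" by (simp add: e'_def)
        finally show "norm ((\<Sum>i<n. dird h (g i) y) - (\<Sum>b\<in>Basis. (h \<bullet> b) * (\<Sum>k. dird b (g k) y)))
          \<le> e * norm h" .
      qed
    qed
    show "x \<in> ?S" using r by simp
    show "(\<lambda>n. g n x) sums (\<Sum>k. g k x)" using s x by (simp add: summable_sums)
  qed
  then obtain G where G: "\<And>y. y \<in> ?S \<Longrightarrow> (\<lambda>n. g n y) sums G y"
    "\<And>y. y \<in> ?S \<Longrightarrow> (G has_derivative (\<lambda>h. \<Sum>b\<in>Basis. (h \<bullet> b) * (\<Sum>k. dird b (g k) y))) (at y within ?S)"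
    by blast
  have "(G has_derivative (\<lambda>h. \<Sum>b\<in>Basis. (h \<bullet> b) * (\<Sum>k. dird b (g k) x))) (at x)"
    using G(2)[of x] r at_within_open[of x ?S] by simp
  then show ?thesis
    by (rule has_derivative_transform_within_open[of _ _ _ _ ?S])
      (use r G(1) in \<open>auto simp: sums_iff\<close>)
qed

text \<open>Differentiating all terms reproduces the hypotheses, because the coefficients of the
  differentiated majorants are multiples of summable ones. The induction over the order therefore
  runs over all families \<open>g\<close> and \<open>\<phi>\<close> at once.\<close>

lemma maj_series:
  fixes g :: "nat \<Rightarrow> 'a::euclidean_space \<Rightarrow> real"
  assumes U: "open U" and "\<And>k. maj U (g k) (\<phi> k)"
    and "\<And>m. summable (\<lambda>k. \<phi> k $ m)"
  shows "maj U (\<lambda>x. \<Sum>k. g k x) (Abs_fps (\<lambda>m. \<Sum>k. \<phi> k $ m))"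
    and "\<And>x b. x \<in> U \<Longrightarrow> b \<in> Basis \<Longrightarrow> dird b (\<lambda>x. \<Sum>k. g k x) x = (\<Sum>k. dird b (g k) x)"
    and "\<And>x. x \<in> U \<Longrightarrow> summable (\<lambda>k. \<bar>g k x\<bar>)"
proof -
  have sm: "summable (\<lambda>k. \<bar>g k x\<bar>)"
    if "\<And>k. maj U (g k) (\<phi> k)" "\<And>m. summable (\<lambda>k. \<phi> k $ m)" "x \<in> U" for g \<phi> x
    by (rule summable_comparison_test'[OF that(2)[of 0], of 0]) (use maj_bound[OF that(1,3)] in auto)
  show "\<And>x. x \<in> U \<Longrightarrow> summable (\<lambda>k. \<bar>g k x\<bar>)" by (rule sm[OF assms(2,3)])
  have D: "((\<lambda>y. \<Sum>k. g k y) has_derivative (\<lambda>h. \<Sum>b\<in>Basis. (h \<bullet> b) * (\<Sum>k. dird b (g k) x))) (at x)"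
    if g: "\<And>k. maj U (g k) (\<phi> k)" "\<And>m. summable (\<lambda>k. \<phi> k $ m)" "x \<in> U" for g \<phi> x
  proof (rule has_derivative_suminf_dird[OF U that(3)])
    show "g k differentiable at y" if "y \<in> U" for k y using maj_differentiable g that by blast
    show "\<bar>dird b (g k) y\<bar> \<le> \<phi> k $ 1" if "y \<in> U" "b \<in> Basis" for k y b
      using maj_bound[OF maj_dird[OF g(1)[of k]] that(1), OF that(2)] by simp
    show "summable (\<lambda>k. \<phi> k $ 1)" by (rule g)
    show "summable (\<lambda>k. g k y)" if "y \<in> U" for y
      using sm[OF g(1,2) that] by (rule summable_rabs_cancel)
  qed
  have DD: "dird b (\<lambda>x. \<Sum>k. g k x) x = (\<Sum>k. dird b (g k) x)"
    if "\<And>k. maj U (g k) (\<phi> k)" "\<And>m. summable (\<lambda>k. \<phi> k $ m)" "x \<in> U" "b \<in> Basis" for g \<phi> x b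
    using dird_eq[OF D[OF that(1-3)], of b] that(4)
    by (simp add: inner_Basis if_distrib if_distribR sum.delta' cong: if_cong)
  show "\<And>x b. x \<in> U \<Longrightarrow> b \<in> Basis \<Longrightarrow> dird b (\<lambda>x. \<Sum>k. g k x) x = (\<Sum>k. dird b (g k) x)"
    by (rule DD[OF assms(2,3)])
  have "(\<And>k. maj U (g k) (\<phi> k)) \<Longrightarrow> (\<And>m. summable (\<lambda>k. \<phi> k $ m)) \<Longrightarrow>
      majn n U (\<lambda>x. \<Sum>k. g k x) (Abs_fps (\<lambda>m. \<Sum>k. \<phi> k $ m))" for n
  proof (induction n arbitrary: g \<phi>)
    case 0
    show ?case
    proof (simp, intro ballI)
      fix x assume "x \<in> U"
      then have "\<bar>\<Sum>k. g k x\<bar> \<le> (\<Sum>k. \<bar>g k x\<bar>)" by (intro summable_rabs sm[OF 0])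
      also have "\<dots> \<le> (\<Sum>k. \<phi> k $ 0)"
        by (intro suminf_le sm[OF 0] 0 maj_bound[OF 0(1)] \<open>x \<in> U\<close>)
      finally show "\<bar>\<Sum>k. g k x\<bar> \<le> (\<Sum>k. \<phi> k $ 0)" .
    qed
  next
    case (Suc n)
    have "majn n U (dird b (\<lambda>x. \<Sum>k. g k x)) (fps_deriv (Abs_fps (\<lambda>m. \<Sum>k. \<phi> k $ m)))"
      if b: "b \<in> Basis" for b
    proof (rule majn_cong[OF U])
      have "fps_deriv (Abs_fps (\<lambda>m. \<Sum>k. \<phi> k $ m)) = Abs_fps (\<lambda>m. \<Sum>k. fps_deriv (\<phi> k) $ m)"
        by (rule fps_ext) (simp add: suminf_mult[OF Suc.prems(2)])
      moreover have "majn n U (\<lambda>x. \<Sum>k. dird b (g k) x) (Abs_fps (\<lambda>m. \<Sum>k. fps_deriv (\<phi> k) $ m))"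
        by (intro Suc.IH maj_dird Suc.prems b) (use Suc.prems(2) in \<open>simp add: summable_mult\<close>)
      ultimately show "majn n U (\<lambda>x. \<Sum>k. dird b (g k) x) (fps_deriv (Abs_fps (\<lambda>m. \<Sum>k. \<phi> k $ m)))"
        by simp
    qed (use DD[OF Suc.prems] b in auto)
    moreover have "\<bar>\<Sum>k. g k x\<bar> \<le> (\<Sum>k. \<phi> k $ 0)" if "x \<in> U" for x
    proof -
      have "\<bar>\<Sum>k. g k x\<bar> \<le> (\<Sum>k. \<bar>g k x\<bar>)" by (intro summable_rabs sm[OF Suc.prems] that)
      also have "\<dots> \<le> (\<Sum>k. \<phi> k $ 0)"
        by (intro suminf_le sm[OF Suc.prems] Suc.prems maj_bound[OF Suc.prems(1)] that)
      finally show ?thesis .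
    qed
    moreover have "(\<lambda>x. \<Sum>k. g k x) differentiable (at x)" if "x \<in> U" for x
      using D[OF Suc.prems that] unfolding differentiable_def by blast
    ultimately show ?case by simp
  qed
  then show "maj U (\<lambda>x. \<Sum>k. g k x) (Abs_fps (\<lambda>m. \<Sum>k. \<phi> k $ m))"
    unfolding maj_def[of U "\<lambda>x. \<Sum>k. g k x"] using assms(2,3) by blast
qed

section \<open>Values of majorants at a radius\<close>

text \<open>For nonnegative coefficients this says that the value at \<open>\<tau>\<close> is at
  most \<open>K\<close>, in terms of partial sums only. In contrast to a bound on the single
  coefficients, it is multiplicative.\<close>

definition fps_bd :: "real \<Rightarrow> real fps \<Rightarrow> real \<Rightarrow> bool" where
  "fps_bd \<tau> \<phi> K \<longleftrightarrow> (\<forall>m. 0 \<le> \<phi> $ m) \<and> (\<forall>M. (\<Sum>m\<le>M. \<phi> $ m * \<tau> ^ m) \<le> K)"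

lemma fps_bd_nonneg: "fps_bd \<tau> \<phi> K \<Longrightarrow> 0 \<le> \<phi> $ m"
  unfolding fps_bd_def by blast

lemma fps_bd_ge0:
  assumes "fps_bd \<tau> \<phi> K"
  shows "0 \<le> K"
proof -
  have "(\<Sum>m\<le>0. \<phi> $ m * \<tau> ^ m) \<le> K" "0 \<le> \<phi> $ 0"
    using assms unfolding fps_bd_def by blast+
  then show ?thesis by simp
qed

lemma fps_bd_nth:
  assumes "fps_bd \<tau> \<phi> K" "\<tau> > 0"
  shows "\<phi> $ m \<le> K / \<tau> ^ m"
proof -
  have "\<phi> $ m * \<tau> ^ m \<le> (\<Sum>i\<le>m. \<phi> $ i * \<tau> ^ i)"
    by (rule member_le_sum[of m "{..m}" "\<lambda>i. \<phi> $ i * \<tau> ^ i"]) (use assms in \<open>auto simp: fps_bd_def\<close>)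
  also have "\<dots> \<le> K" using assms unfolding fps_bd_def by blast
  finally show ?thesis using assms(2) by (simp add: field_simps)
qed

lemma fps_bd_mult:
  assumes "fps_bd \<tau> \<phi> K" "fps_bd \<tau> \<psi> L" "0 \<le> \<tau>"
  shows "fps_bd \<tau> (\<phi> * \<psi>) (K * L)"
  unfolding fps_bd_def
proof (intro conjI allI)
  have nn: "0 \<le> \<phi> $ m" "0 \<le> \<psi> $ m" for m using assms fps_bd_nonneg by blast+
  show "0 \<le> (\<phi> * \<psi>) $ m" for m unfolding fps_mult_nth using nn by (intro sum_nonneg mult_nonneg_nonneg)
  fix M
  let ?g = "\<lambda>i j. (\<phi> $ i * \<tau> ^ i) * (\<psi> $ j * \<tau> ^ j)"
  have "(\<Sum>m\<le>M. (\<phi> * \<psi>) $ m * \<tau> ^ m) = (\<Sum>m\<le>M. \<Sum>i\<le>m. ?g i (m - i))"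
    unfolding fps_mult_nth atLeast0AtMost sum_distrib_right
    by (intro sum.cong refl) (auto simp: power_add[symmetric] mult_ac)
  also have "\<dots> = sum (\<lambda>(i, j). ?g i j) {(i, j). i + j \<le> M}"
    by (rule sum.triangle_reindex_eq[symmetric])
  \<comment> \<open>The triangle is enlarged to a square, over which the sum factors.\<close>
  also have "\<dots> \<le> sum (\<lambda>(i, j). ?g i j) ({..M} \<times> {..M})"
    by (rule sum_mono2) (use nn assms(3) in auto)
  also have "\<dots> = (\<Sum>i\<le>M. \<phi> $ i * \<tau> ^ i) * (\<Sum>j\<le>M. \<psi> $ j * \<tau> ^ j)"
    by (simp add: sum_product sum.cartesian_product)
  also have "\<dots> \<le> K * L"
    using assms nn fps_bd_ge0[OF assms(1)] unfolding fps_bd_def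
    by (intro mult_mono) (auto intro: sum_nonneg)
  finally show "(\<Sum>m\<le>M. (\<phi> * \<psi>) $ m * \<tau> ^ m) \<le> K * L" .
qed

lemma fps_bd_const:
  assumes "0 \<le> c"
  shows "fps_bd \<tau> (fps_const c) c"
proof -
  have "(\<Sum>m\<le>M. fps_const c $ m * \<tau> ^ m) = c" for M
    by (subst sum.mono_neutral_right[of _ "{0}"]) auto
  then show ?thesis using assms unfolding fps_bd_def by auto
qed

lemma fps_bd_one: "fps_bd \<tau> 1 1"
  using fps_bd_const[of 1 \<tau>] by simp

lemma fps_bd_linear:
  assumes "0 \<le> \<rho>" "0 \<le> \<tau>"
  shows "fps_bd \<tau> (fps_const \<rho> + fps_X) (\<rho> + \<tau>)"
proof -
  have "(fps_const \<rho> + fps_X) $ m * \<tau> ^ m = (if m = 0 then \<rho> else 0) + (if m = 1 then \<tau> else 0)" for m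
    by (auto simp: fps_X_def)
  then have "(\<Sum>m\<le>M. (fps_const \<rho> + fps_X) $ m * \<tau> ^ m) \<le> \<rho> + \<tau>" for M
    using assms by (simp add: sum.distrib)
  then show ?thesis using assms unfolding fps_bd_def by (auto simp: fps_X_def)
qed

lemma fps_bd_power: "fps_bd \<tau> \<phi> K \<Longrightarrow> 0 \<le> \<tau> \<Longrightarrow> fps_bd \<tau> (\<phi> ^ n) (K ^ n)"
  by (induction n) (auto intro: fps_bd_mult fps_bd_one)

lemma fps_bd_prod: "finite I \<Longrightarrow> 0 \<le> \<tau> \<Longrightarrow> (\<And>i. i \<in> I \<Longrightarrow> fps_bd \<tau> (\<phi> i) (K i)) \<Longrightarrow>
    fps_bd \<tau> (\<Prod>i\<in>I. \<phi> i) (\<Prod>i\<in>I. K i)"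
  by (induction I rule: finite_induct) (auto intro: fps_bd_mult fps_bd_one)

text \<open>The series \<open>K / (1 - X / \<tau>)\<close>: as a majorant it bounds derivatives of
  order \<open>m\<close> by \<open>m! K / \<tau>^m\<close>.\<close>

abbreviation geo :: "real \<Rightarrow> real \<Rightarrow> real fps" where
  "geo K \<tau> \<equiv> Abs_fps (\<lambda>m. K / \<tau> ^ m)"

text \<open>Cauchy's estimate at the common radius \<open>\<tau>\<close> turns the summable values
  \<open>K k\<close> into summable coefficients of every order.\<close>

lemma maj_series_bd:
  fixes g :: "nat \<Rightarrow> 'a::euclidean_space \<Rightarrow> real"
  assumes U: "open U" and "\<And>k. maj U (g k) (\<phi> k)" and bd: "\<And>k. fps_bd \<tau> (\<phi> k) (K k)"
    and "0 < \<tau>" "summable K"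
  shows "maj U (\<lambda>x. \<Sum>k. g k x) (geo (\<Sum>k. K k) \<tau>)"
    and "\<And>m. summable (\<lambda>k. \<phi> k $ m)"
proof -
  show s: "summable (\<lambda>k. \<phi> k $ m)" for m
    by (rule summable_comparison_test'[where g="\<lambda>k. K k / \<tau> ^ m" and N=0])
      (use assms fps_bd_nth[OF bd] fps_bd_nonneg[OF bd] in \<open>auto intro: summable_divide\<close>)
  show "maj U (\<lambda>x. \<Sum>k. g k x) (geo (\<Sum>k. K k) \<tau>)"
  proof (rule maj_mono[OF maj_series(1)[OF U assms(2) s]])
    show "Abs_fps (\<lambda>m. \<Sum>k. \<phi> k $ m) $ m \<le> geo (\<Sum>k. K k) \<tau> $ m" for m
      using suminf_le[OF fps_bd_nth[OF bd assms(4)] s summable_divide[OF assms(5)], of m]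
      by (simp add: suminf_divide[OF assms(5)])
  qed
qed

subsection \<open>Real analytic functions have geometric majorants\<close>

text \<open>Convergence at one corner point, with all coordinates equal to \<open>t\<close>, is
  absolute and bounds the sum of \<open>|a k| t^|k|\<close>. On the ball of radius
  \<open>t / 2\<close> a monomial has the majorant \<open>(t / 2 + X)^|k|\<close>, whose value at
  \<open>t / 2\<close> is again \<open>t^|k|\<close>.\<close>

lemma real_analytic_imp_maj:
  fixes f :: "'a::euclidean_space \<Rightarrow> real"
  assumes "real_analytic_on f S" "x \<in> S"
  shows "\<exists>\<rho> K \<tau>. 0 < \<rho> \<and> 0 < \<tau> \<and> 0 \<le> K \<and> maj (ball x \<rho>) f (geo K \<tau>)"
proof -
  let ?I = "(Basis :: 'a set) \<rightarrow>\<^sub>E (UNIV :: nat set)"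
  obtain a r where r: "0 < r" and hs: "\<And>y. y \<in> ball x r \<Longrightarrow>
      ((\<lambda>k. a k * (\<Prod>b\<in>Basis. ((y - x) \<bullet> b) ^ k b)) has_sum f y) ?I"
    using assms(1)[unfolded real_analytic_on_def, rule_format, OF assms(2)] by blast
  \<comment> \<open>The corner point is at distance at most \<open>DIM('a) t\<close> from
    \<open>x\<close>, which has to be less than \<open>r\<close>.\<close>
  define t where "t = r / (real DIM('a) + 1)"
  have t: "t > 0" using r by (simp add: t_def add_nonneg_pos)
  \<comment> \<open>An enumeration of the multi-indices turns the unconditional sum into an ordinary
    series, to which \<open>maj_series_bd\<close> applies; it is a bijection because there are
    infinitely many of them.\<close>
  define e where "e = from_nat_into ?I"
  have inf: "infinite ?I"
  proof
    assume fin: "finite ?I"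
    have "inj (\<lambda>n::nat. restrict (\<lambda>_. n) (Basis :: 'a set))"
    proof (rule injI)
      fix m n assume *: "restrict (\<lambda>_. m) (Basis :: 'a set) = restrict (\<lambda>_. n) Basis"
      obtain b :: 'a where "b \<in> Basis" using nonempty_Basis by blast
      then show "m = n" using fun_cong[OF *, of b] by simp
    qed
    moreover have "range (\<lambda>n::nat. restrict (\<lambda>_. n) (Basis :: 'a set)) \<subseteq> ?I" by auto
    ultimately show False using fin finite_subset infinite_UNIV_nat finite_imageD by metis
  qed
  have bij: "bij_betw e UNIV ?I"
    unfolding e_def by (intro bij_betw_from_nat_into countable_PiE inf) auto
  define A where "A n = \<bar>a (e n)\<bar> * (\<Prod>b\<in>(Basis :: 'a set). t ^ e n b)" for n
  define g where "g n y = a (e n) * (\<Prod>b\<in>Basis. ((y - x) \<bullet> b) ^ e n b)" for n y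
  define \<phi> where "\<phi> n = fps_const \<bar>a (e n)\<bar> * (\<Prod>b\<in>(Basis :: 'a set). (fps_const (t / 2) + fps_X) ^ e n b)" for n
  have sA: "summable A"
  proof -
    let ?y = "x + (\<Sum>b\<in>Basis. t *\<^sub>R b)"
    have "norm (\<Sum>b\<in>(Basis::'a set). t *\<^sub>R b) \<le> (\<Sum>b\<in>(Basis::'a set). norm (t *\<^sub>R b))" by (rule norm_sum)
    also have "\<dots> = real DIM('a) * t" using t by simp
    also have "\<dots> < r" unfolding t_def using r by (simp add: field_simps)
    finally have "?y \<in> ball x r" by (simp add: dist_norm)
    from hs[OF this] have "(\<lambda>k. a k * (\<Prod>b\<in>(Basis::'a set). ((?y - x) \<bullet> b) ^ k b)) summable_on ?I"
      by (rule has_sum_imp_summable)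
    moreover have "(?y - x) \<bullet> b = t" if "b \<in> Basis" for b
      using that by (simp add: inner_sum_left inner_Basis if_distrib sum.delta' cong: if_cong)
    ultimately have "(\<lambda>k. a k * (\<Prod>b\<in>(Basis::'a set). t ^ k b)) summable_on ?I" by simp
    then have "(\<lambda>k. norm (a k * (\<Prod>b\<in>(Basis::'a set). t ^ k b))) summable_on ?I"
      by (rule iffD1[OF summable_on_iff_abs_summable_on_real])
    then have "(\<lambda>n. norm (a (e n) * (\<Prod>b\<in>(Basis::'a set). t ^ e n b))) summable_on UNIV"
      using summable_on_reindex_bij_betw[OF bij, of "\<lambda>k. norm (a k * (\<Prod>b\<in>(Basis::'a set). t ^ k b))"]
      by simp
    then have "A summable_on UNIV" using t by (simp add: A_def[abs_def] abs_mult abs_prod)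
    then show ?thesis using summable_on_imp_summable by blast
  qed
  have maj: "maj (ball x (t / 2)) (g n) (\<phi> n)" for n
    unfolding g_def \<phi>_def
  proof (intro maj_cmult maj_prod maj_power maj_coord)
    fix b y assume "b \<in> (Basis::'a set)" "y \<in> ball x (t / 2)"
    then show "\<bar>(y - x) \<bullet> b\<bar> \<le> t / 2"
      using Basis_le_norm[of b "y - x"] by (simp add: dist_norm norm_minus_commute)
  qed auto
  have bd: "fps_bd (t / 2) (\<phi> n) (A n)" for n
    unfolding \<phi>_def A_def
    using fps_bd_power[OF fps_bd_linear[of "t / 2" "t / 2"]] t
    by (intro fps_bd_mult fps_bd_prod fps_bd_const) auto
  have "f y = (\<Sum>n. g n y)" if "y \<in> ball x (t / 2)" for y
  proof -
    have "t < r + r" unfolding t_def using r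
      by (auto simp: field_simps intro!: add_pos_nonneg mult_nonneg_nonneg)
    then have "y \<in> ball x r" using that by simp
    from hs[OF this] have "((\<lambda>n. g n y) has_sum f y) UNIV"
      unfolding g_def using has_sum_reindex_bij_betw[OF bij] by fastforce
    then show ?thesis using has_sum_imp_sums sums_unique by blast
  qed
  then have "maj (ball x (t / 2)) f (geo (\<Sum>k. A k) (t / 2))"
    using maj_cong[OF open_ball _ maj_series_bd(1)[OF open_ball maj bd _ sA]] t by auto
  moreover have "0 \<le> A n" for n unfolding A_def using t by (intro mult_nonneg_nonneg prod_nonneg) auto
  then have "0 \<le> (\<Sum>k. A k)" by (intro suminf_nonneg sA)
  ultimately show ?thesis using t by (intro exI[of _ "t / 2"] exI[of _ "\<Sum>k. A k"]) auto
qed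

subsection \<open>Geometric majorants imply real analyticity\<close>

primrec dirn :: "'a::real_normed_vector \<Rightarrow> nat \<Rightarrow> ('a \<Rightarrow> real) \<Rightarrow> 'a \<Rightarrow> real" where
  "dirn h 0 f = f"
| "dirn h (Suc n) f = dird h (dirn h n f)"

text \<open>Majorants speak of basis directions; a general direction costs the l1-norm of
  \<open>h\<close>.\<close>

lemma maj_dird':
  assumes "open U" "maj U f \<phi>"
  shows "maj U (dird h f) (fps_const (\<Sum>b\<in>Basis. \<bar>h \<bullet> b\<bar>) * fps_deriv \<phi>)"
proof -
  have "maj U (\<lambda>x. \<Sum>b\<in>Basis. (h \<bullet> b) * dird b f x) (\<Sum>b\<in>Basis. fps_const \<bar>h \<bullet> b\<bar> * fps_deriv \<phi>)"
    by (intro maj_sum maj_cmult maj_dird assms) auto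
  also have "(\<Sum>b\<in>Basis. fps_const \<bar>h \<bullet> b\<bar> * fps_deriv \<phi>) = fps_const (\<Sum>b\<in>Basis. \<bar>h \<bullet> b\<bar>) * fps_deriv \<phi>"
    by (rule fps_ext) (simp add: fps_sum_nth sum_distrib_right)
  finally show ?thesis
    by (rule maj_cong[OF assms(1), rotated]) (metis assms(2) dird_basis_sum maj_differentiable)
qed

lemma maj_dirn:
  assumes "open U" "maj U f \<phi>"
  shows "maj U (dirn h n f) (fps_const ((\<Sum>b\<in>Basis. \<bar>h \<bullet> b\<bar>) ^ n) * (fps_deriv ^^ n) \<phi>)"
proof (induction n)
  case 0
  then show ?case using assms by simp
next
  case (Suc n)
  from maj_dird'[OF assms(1) this, of h] show ?case by (simp add: mult.assoc[symmetric])
qed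

text \<open>Along the segment the \<open>n\<close>-th directional derivative is at most
  \<open>n! K q^n\<close>, where \<open>q < 1\<close> is the l1-norm of \<open>h\<close> divided by
  \<open>\<tau>\<close>; so the Lagrange remainder tends to 0.\<close>

lemma maj_taylor:
  fixes f :: "'a::euclidean_space \<Rightarrow> real"
  assumes U: "open U" and maj: "maj U f (geo K \<tau>)" and \<tau>: "0 < \<tau>"
    and seg: "\<And>t. 0 \<le> t \<Longrightarrow> t \<le> 1 \<Longrightarrow> x + t *\<^sub>R h \<in> U"
    and h: "(\<Sum>b\<in>Basis. \<bar>h \<bullet> b\<bar>) < \<tau>"
  shows "(\<lambda>n. dirn h n f x / fact n) sums f (x + h)"
    and "summable (\<lambda>n. \<bar>dirn h n f x / fact n\<bar>)"
proof -
  define q where "q = (\<Sum>b\<in>Basis. \<bar>h \<bullet> b\<bar>) / \<tau>"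
  have q: "0 \<le> q" "q < 1" using h \<tau> by (auto simp: q_def sum_nonneg)
  have bd: "\<bar>dirn h n f y / fact n\<bar> \<le> K * q ^ n" if "y \<in> U" for n y
    using maj_bound[OF maj_dirn[OF U maj] that, of h n]
    by (simp add: fps_0th_higher_deriv q_def power_divide field_simps)
  have der: "((\<lambda>t. dirn h m f (x + t *\<^sub>R h)) has_real_derivative dirn h (Suc m) f (x + t *\<^sub>R h)) (at t)"
    if "0 \<le> t" "t \<le> 1" for m t
    using dird_line[OF maj_differentiable[OF maj_dirn[OF U maj] seg[OF that]]] by simp
  have rem: "\<bar>f (x + h) - (\<Sum>m<n. dirn h m f x / fact m)\<bar> \<le> K * q ^ n" if n: "n > 0" for n
  proof -
    obtain t where t: "0 < t" "t < 1" and eq: "f (x + 1 *\<^sub>R h) =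
        (\<Sum>m<n. dirn h m f (x + 0 *\<^sub>R h) / fact m * 1 ^ m) + dirn h n f (x + t *\<^sub>R h) / fact n * 1 ^ n"
      using Maclaurin[of 1 n "\<lambda>m t. dirn h m f (x + t *\<^sub>R h)" "\<lambda>t. f (x + t *\<^sub>R h)"] n der
      by auto
    then show ?thesis using bd[of "x + t *\<^sub>R h" n] seg[of t] by simp
  qed
  have lim: "(\<lambda>n. K * q ^ n) \<longlonglongrightarrow> 0"
    using tendsto_mult_right_zero[OF LIMSEQ_power_zero[of q]] q by simp
  have "(\<lambda>n. f (x + h) - (\<Sum>m<n. dirn h m f x / fact m)) \<longlonglongrightarrow> 0"
    by (rule Lim_null_comparison[OF _ lim]) (use rem in \<open>auto simp: eventually_sequentially intro!: exI[of
        _ 1]\<close>)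
  from tendsto_diff[OF tendsto_const[of "f (x + h)"] this]
  show "(\<lambda>n. dirn h n f x / fact n) sums f (x + h)" unfolding sums_def by simp
  show "summable (\<lambda>n. \<bar>dirn h n f x / fact n\<bar>)"
    by (rule summable_comparison_test'[of "\<lambda>n. K * q ^ n" 0])
      (use bd[of x] seg[of 0] q in \<open>auto intro: summable_mult summable_geometric\<close>)
qed

primrec pdl :: "'a::real_normed_vector list \<Rightarrow> ('a \<Rightarrow> real) \<Rightarrow> 'a \<Rightarrow> real" where
  "pdl [] f = f"
| "pdl (b # l) f = dird b (pdl l f)"

lemma maj_pdl: "maj U f \<phi> \<Longrightarrow> set l \<subseteq> Basis \<Longrightarrow> maj U (pdl l f) ((fps_deriv ^^ length l) \<phi>)"
  by (induction l) (auto intro: maj_dird)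

lemma lists_length_Suc_sum:
  assumes "finite B"
  shows "(\<Sum>l | set l \<subseteq> B \<and> length l = Suc n. F l) = (\<Sum>b\<in>B. \<Sum>l | set l \<subseteq> B \<and> length l = n. F (b # l))"
proof -
  have "(\<Sum>l | set l \<subseteq> B \<and> length l = Suc n. F l)
      = sum F ((\<lambda>(xs, b). b # xs) ` ({l. set l \<subseteq> B \<and> length l = n} \<times> B))"
    by (simp add: lists_length_Suc_eq)
  also have "\<dots> = (\<Sum>(l, b)\<in>{l. set l \<subseteq> B \<and> length l = n} \<times> B. F (b # l))"
    by (subst sum.reindex) (auto simp: inj_on_def case_prod_unfold)
  also have "\<dots> = (\<Sum>b\<in>B. \<Sum>l | set l \<subseteq> B \<and> length l = n. F (b # l))"
    by (simp add: sum.cartesian_product[symmetric] sum.swap[of _ B])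
  finally show ?thesis .
qed

text \<open>The multinomial expansion over words of directions, with the orderings of one
  multi-index kept apart.\<close>

lemma dirn_eq_sum_pdl:
  fixes f :: "'a::euclidean_space \<Rightarrow> real"
  assumes U: "open U" and maj: "maj U f \<phi>"
  shows "x \<in> U \<Longrightarrow> dirn h n f x =
    (\<Sum>l | set l \<subseteq> Basis \<and> length l = n. prod_list (map (\<lambda>b. h \<bullet> b) l) * pdl l f x)"
proof (induction n arbitrary: x)
  case 0
  have "{l. set l \<subseteq> (Basis :: 'a set) \<and> length l = 0} = {[]}" by auto
  then show ?case by simp
next
  case (Suc n)
  let ?L = "{l. set l \<subseteq> (Basis :: 'a set) \<and> length l = n}"
  have d: "pdl l f differentiable (at x)" if "l \<in> ?L" for l
    using that maj_differentiable[OF maj_pdl[OF maj] Suc.prems] by auto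
  have "dirn h (Suc n) f x = (\<Sum>b\<in>Basis. (h \<bullet> b) * dird b (dirn h n f) x)"
    unfolding dirn.simps by (rule dird_basis_sum[OF maj_differentiable[OF maj_dirn[OF U maj] Suc.prems]])
  also have "\<dots> = (\<Sum>b\<in>Basis. (h \<bullet> b) * (\<Sum>l\<in>?L. prod_list (map (\<lambda>b. h \<bullet> b) l) * dird b (pdl l f) x))"
  proof (intro sum.cong refl arg_cong2[where f="(*)"])
    fix b :: 'a assume "b \<in> Basis"
    have "dird b (dirn h n f) x = dird b (\<lambda>x. \<Sum>l\<in>?L. prod_list (map (\<lambda>b. h \<bullet> b) l) * pdl l f x) x"
      by (rule dird_cong[OF U Suc.prems]) (rule Suc.IH)
    also have "\<dots> = (\<Sum>l\<in>?L. dird b (\<lambda>x. prod_list (map (\<lambda>b. h \<bullet> b) l) * pdl l f x) x)"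
      by (rule dird_sum) (use d in \<open>auto intro: differentiable_mult\<close>)
    finally show "dird b (dirn h n f) x = (\<Sum>l\<in>?L. prod_list (map (\<lambda>b. h \<bullet> b) l) * dird b (pdl l f) x)"
      using d by (simp add: dird_cmult)
  qed
  also have "\<dots> = (\<Sum>l | set l \<subseteq> Basis \<and> length l = Suc n. prod_list (map (\<lambda>b. h \<bullet> b) l) * pdl l f x)"
    by (subst lists_length_Suc_sum) (auto simp: sum_distrib_left mult.assoc)
  finally show ?case .
qed

lemma prod_list_eq_prod_count:
  fixes g :: "'a \<Rightarrow> real"
  assumes "finite B"
  shows "set l \<subseteq> B \<Longrightarrow> prod_list (map g l) = (\<Prod>b\<in>B. g b ^ count_list l b)"
proof (induction l)
  case (Cons c l)
  have "(\<Prod>b\<in>B. g b ^ count_list (c # l) b) = (\<Prod>b\<in>B. (if b = c then g b else 1) * g b ^ count_list l b)"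
    by (rule prod.cong) auto
  also have "\<dots> = g c * (\<Prod>b\<in>B. g b ^ count_list l b)"
    using Cons.prems assms by (simp add: prod.distrib prod.delta')
  finally show ?case using Cons by simp
qed simp

text \<open>Taylor's formula along \<open>y - x\<close> is expanded over words of basis directions,
  and the words are regrouped by their letter counts, which are the multi-indices. Absolute
  summability over all words justifies the regrouping.\<close>

lemma maj_imp_real_analytic:
  fixes f :: "'a::euclidean_space \<Rightarrow> real"
  assumes U: "open U" and maj: "maj U f (geo K \<tau>)" and \<tau>: "0 < \<tau>"
  shows "real_analytic_on f U"
  unfolding real_analytic_on_def
proof
  fix x assume x: "x \<in> U"
  let ?B = "Basis :: 'a set"
  let ?I = "?B \<rightarrow>\<^sub>E (UNIV :: nat set)"
  define L where "L n = {l. set l \<subseteq> ?B \<and> length l = n}" for n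
  define M where "M k = {l. set l \<subseteq> ?B \<and> (\<forall>b\<in>?B. count_list l b = k b)}" for k
  \<comment> \<open>There are \<open>|k|! / k!\<close> words with letter counts \<open>k\<close>, so
    this is the usual Taylor coefficient, the \<open>k\<close>-th derivative divided by
    \<open>k!\<close>.\<close>
  define a where "a k = (\<Sum>l\<in>M k. pdl l f x / fact (length l))" for k
  obtain r0 where r0: "r0 > 0" "ball x r0 \<subseteq> U" using U x openE by metis
  \<comment> \<open>A radius of at most \<open>\<tau> / DIM('a)\<close> makes the l1-norm of
    \<open>y - x\<close> less than \<open>\<tau>\<close>.\<close>
  define r where "r = min r0 (\<tau> / real DIM('a))"
  have r: "r > 0" using r0 \<tau> by (simp add: r_def)
  have finL: "finite (L n)" for n unfolding L_def by (simp add: finite_lists_length_eq)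
  have finM: "finite (M k)" for k
  proof (rule finite_subset)
    show "M k \<subseteq> L (\<Sum>b\<in>?B. k b)"
    proof
      fix l assume l: "l \<in> M k"
      then have "(\<Sum>b\<in>?B. count_list l b) = length l" by (intro sum_count_set) (auto simp: M_def)
      moreover have "(\<Sum>b\<in>?B. count_list l b) = (\<Sum>b\<in>?B. k b)" using l by (simp add: M_def)
      ultimately show "l \<in> L (\<Sum>b\<in>?B. k b)" using l by (auto simp: M_def L_def)
    qed
  qed (rule finL)
  have "((\<lambda>k. a k * (\<Prod>b\<in>?B. ((y - x) \<bullet> b) ^ k b)) has_sum f y) ?I" if y: "y \<in> ball x r" for y
  proof -
    define h where "h = y - x"
    define T where "T l = prod_list (map (\<lambda>b. h \<bullet> b) l) * pdl l f x / fact (length l)" for l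
    define q where "q = (\<Sum>b\<in>?B. \<bar>h \<bullet> b\<bar>)"
    have nh: "norm h < r" using y by (simp add: h_def dist_norm norm_minus_commute)
    have "q \<le> (\<Sum>b\<in>?B. norm h)" unfolding q_def by (intro sum_mono Basis_le_norm)
    also have "\<dots> < \<tau>" using nh by (simp add: r_def field_simps)
    finally have q: "q < \<tau>" .
    have q0: "q \<ge> 0" by (simp add: q_def sum_nonneg)
    have seg: "x + t *\<^sub>R h \<in> U" if "0 \<le> t" "t \<le> 1" for t
    proof -
      have "norm (t *\<^sub>R h) \<le> norm h" using that by (simp add: mult_left_le_one_le)
      then show ?thesis using nh r0 by (auto simp: r_def dist_norm subset_iff)
    qed
    have Tsum: "(\<Sum>l\<in>L n. T l) = dirn h n f x / fact n" for n
      unfolding dirn_eq_sum_pdl[OF U maj x] sum_divide_distrib by (rule sum.cong) (auto simp: L_def T_def)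
    have Tabs: "(\<Sum>l\<in>L n. \<bar>T l\<bar>) \<le> K * (q / \<tau>) ^ n" for n
    proof -
      have pb: "\<bar>pdl l f x\<bar> / fact n \<le> K / \<tau> ^ n" if "l \<in> L n" for l
        using that maj_bound[OF maj_pdl[OF maj] x, of l]
        by (simp add: L_def fps_0th_higher_deriv field_simps)
      have "(\<Sum>l\<in>L n. \<bar>T l\<bar>) \<le> (\<Sum>l\<in>L n. prod_list (map (\<lambda>b. \<bar>h \<bullet> b\<bar>) l) * (K / \<tau> ^ n))"
      proof (rule sum_mono)
        fix l assume l: "l \<in> L n"
        have "\<bar>prod_list (map (\<lambda>b. h \<bullet> b) l)\<bar> = prod_list (map (\<lambda>b. \<bar>h \<bullet> b\<bar>) l)"
          by (induction l) (auto simp: abs_mult)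
        then have "\<bar>T l\<bar> = prod_list (map (\<lambda>b. \<bar>h \<bullet> b\<bar>) l) * (\<bar>pdl l f x\<bar> / fact n)"
          using l by (simp add: T_def L_def abs_mult)
        also have "\<dots> \<le> prod_list (map (\<lambda>b. \<bar>h \<bullet> b\<bar>) l) * (K / \<tau> ^ n)"
          by (rule mult_left_mono[OF pb[OF l]]) (induction l, auto)
        finally show "\<bar>T l\<bar> \<le> prod_list (map (\<lambda>b. \<bar>h \<bullet> b\<bar>) l) * (K / \<tau> ^ n)" .
      qed
      also have "\<dots> = (\<Sum>l\<in>L n. prod_list (map (\<lambda>b. \<bar>h \<bullet> b\<bar>) l)) * (K / \<tau> ^ n)"
        by (rule sum_distrib_right[symmetric])
      also have "(\<Sum>l\<in>L n. prod_list (map (\<lambda>b. \<bar>h \<bullet> b\<bar>) l)) = q ^ n"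
      proof (induction n)
        case 0
        have "{l. set l \<subseteq> ?B \<and> length l = 0} = {[]}" by auto
        then show ?case by (simp add: L_def)
      next
        case (Suc n)
        then show ?case unfolding L_def
          by (subst lists_length_Suc_sum) (auto simp: sum_distrib_left[symmetric]
        sum_distrib_right[symmetric] q_def)
      qed
      finally show ?thesis by (simp add: power_divide mult.commute)
    qed
    have tay: "(\<lambda>n. \<Sum>l\<in>L n. T l) sums f y" "summable (\<lambda>n. \<bar>\<Sum>l\<in>L n. T l\<bar>)"
      using maj_taylor[OF U maj \<tau> seg q[unfolded q_def]] by (auto simp: Tsum h_def)
    have "((\<lambda>z. T (snd z)) has_sum f y) (Sigma UNIV L)"
    proof (rule has_sum_SigmaI)
      show "((\<lambda>l. T (snd (n, l))) has_sum (\<Sum>l\<in>L n. T l)) (L n)" for n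
        using has_sum_finite[OF finL] by simp
      show "((\<lambda>n. \<Sum>l\<in>L n. T l) has_sum f y) UNIV"
        using norm_summable_imp_has_sum[OF _ tay(1)] tay(2) by simp
      have "(\<lambda>z. \<bar>T (snd z)\<bar>) summable_on Sigma UNIV L"
      proof (rule summable_on_SigmaI)
        show "((\<lambda>l. \<bar>T (snd (n, l))\<bar>) has_sum (\<Sum>l\<in>L n. \<bar>T l\<bar>)) (L n)" for n
          using has_sum_finite[OF finL] by simp
        have "summable (\<lambda>n. \<Sum>l\<in>L n. \<bar>T l\<bar>)"
        proof (rule summable_comparison_test'[of "\<lambda>n. K * (q / \<tau>) ^ n" 0])
          show "summable (\<lambda>n. K * (q / \<tau>) ^ n)"
            using q q0 \<tau> by (intro summable_mult summable_geometric) simp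
          show "norm (\<Sum>l\<in>L n. \<bar>T l\<bar>) \<le> K * (q / \<tau>) ^ n" for n
            using Tabs[of n] by (simp add: sum_nonneg)
        qed
        then show "(\<lambda>n. \<Sum>l\<in>L n. \<bar>T l\<bar>) summable_on UNIV"
          by (subst summable_on_UNIV_nonneg_real_iff) (auto intro: sum_nonneg)
      qed auto
      then show "(\<lambda>z. T (snd z)) summable_on Sigma UNIV L"
        by (subst summable_on_iff_abs_summable_on_real) simp
    qed
    \<comment> \<open>The word is kept and only its label changes, from its length to its letter
      counts.\<close>
    also have "((\<lambda>z. T (snd z)) has_sum f y) (Sigma UNIV L) \<longleftrightarrow> ((\<lambda>z. T (snd z)) has_sum f y) (Sigma ?I M)"
      by (rule has_sum_reindex_bij_witness[of _ "\<lambda>(k, l). (length l, l)"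
            "\<lambda>(n, l). (restrict (count_list l) ?B, l)"])
        (auto simp: L_def M_def fun_eq_iff PiE_def extensional_def restrict_def)
    finally have S: "((\<lambda>z. T (snd z)) has_sum f y) (Sigma ?I M)" .
    show ?thesis
    proof (rule has_sum_SigmaD[OF S])
      fix k assume "k \<in> ?I"
      have "(\<Sum>l\<in>M k. T l) = a k * (\<Prod>b\<in>?B. ((y - x) \<bullet> b) ^ k b)"
        unfolding a_def sum_distrib_right
        by (rule sum.cong) (auto simp: T_def M_def prod_list_eq_prod_count[of ?B] h_def)
      then show "((\<lambda>l. T (snd (k, l))) has_sum a k * (\<Prod>b\<in>?B. ((y - x) \<bullet> b) ^ k b)) (M k)"
        using has_sum_finite[OF finM[of k], of T] by simp
    qed
  qed
  then show "\<exists>a r. 0 < r \<and> (\<forall>y\<in>ball x r.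
      ((\<lambda>k. a k * (\<Prod>b\<in>?B. ((y - x) \<bullet> b) ^ k b)) has_sum f y) ?I)"
    using r by blast
qed

text \<open>Majorants exist only near each point, so the induction over the order carries local
  smoothness as its hypothesis.\<close>

lemma real_analytic_imp_smooth:
  fixes f :: "'a::euclidean_space \<Rightarrow> real"
  assumes "real_analytic_on f S"
  shows "smooth_on f S"
proof -
  have "\<exists>V. open V \<and> x \<in> V \<and> smooth_on f V" if "x \<in> S" for x
    using real_analytic_imp_maj[OF assms that] maj_smooth open_ball centre_in_ball by metis
  moreover have "(\<And>x. x \<in> S \<Longrightarrow> \<exists>V. open V \<and> x \<in> V \<and> smooth_on f V) \<Longrightarrow> ck_on n f S" for n
  proof (induction n arbitrary: f)
    case 0
    then show ?case
      by (auto intro!: continuous_at_imp_continuous_on differentiable_imp_continuous_within)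
        (meson smooth_on_differentiable)
  next
    case (Suc n)
    have "f differentiable (at x)" if "x \<in> S" for x
      using Suc.prems[OF that] smooth_on_differentiable by blast
    moreover have "ck_on n (dird b f) S" for b
      by (rule Suc.IH) (meson Suc.prems smooth_on_dird)
    ultimately show ?case by (simp add: dird_def)
  qed
  ultimately show ?thesis unfolding smooth_on_def by blast
qed

section \<open>The Monge-Ampere operator in real coordinates\<close>

lemma Basis_surf: "(Basis :: surf set) = {(1, 0), (\<i>, 0), (0, 1), (0, \<i>)}"
  by (auto simp: Basis_prod_def Basis_complex_def)

lemma surf_basis_in [simp]: "(1, 0) \<in> (Basis :: surf set)" "(\<i>, 0) \<in> (Basis :: surf set)"
  "(0, 1) \<in> (Basis :: surf set)" "(0, \<i>) \<in> (Basis :: surf set)"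
  by (simp_all add: Basis_surf)

lemma base_basis_in [simp]: "(e, 0) \<in> (Basis :: base set) \<longleftrightarrow> e \<in> Basis" "(0, 1) \<in> (Basis :: base set)"
  by (auto simp: Basis_prod_def)

text \<open>For the complex Hessian of \<open>f\<close>, \<open>P / 4\<close> and
  \<open>Q / 4\<close> are the diagonal entries and \<open>(R + i T) / 4\<close> is the entry in row
  1 and column 2.\<close>

definition opP :: "(surf \<Rightarrow> real) \<Rightarrow> surf \<Rightarrow> real" where
  "opP f z = dird (1, 0) (dird (1, 0) f) z + dird (\<i>, 0) (dird (\<i>, 0) f) z"
definition opQ :: "(surf \<Rightarrow> real) \<Rightarrow> surf \<Rightarrow> real" where
  "opQ f z = dird (0, 1) (dird (0, 1) f) z + dird (0, \<i>) (dird (0, \<i>) f) z"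
definition opR :: "(surf \<Rightarrow> real) \<Rightarrow> surf \<Rightarrow> real" where
  "opR f z = dird (1, 0) (dird (0, 1) f) z + dird (\<i>, 0) (dird (0, \<i>) f) z"
definition opT :: "(surf \<Rightarrow> real) \<Rightarrow> surf \<Rightarrow> real" where
  "opT f z = dird (1, 0) (dird (0, \<i>) f) z - dird (\<i>, 0) (dird (0, 1) f) z"

lemmas op_defs = opP_def opQ_def opR_def opT_def

text \<open>A bilinear form whose diagonal is 16 times the determinant of the complex Hessian. It is
  not symmetric, but a sum over all \<open>i + j = N\<close> contains both orders.\<close>

definition polar :: "(surf \<Rightarrow> real) \<Rightarrow> (surf \<Rightarrow> real) \<Rightarrow> surf \<Rightarrow> real" where
  "polar f g z = opP f z * opQ g z - opR f z * opR g z - opT f z * opT g z"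

lemma maj_op:
  assumes U: "open U" and f: "maj U f \<phi>"
  shows "maj U (opP f) (fps_const 2 * fps_deriv (fps_deriv \<phi>))"
    "maj U (opQ f) (fps_const 2 * fps_deriv (fps_deriv \<phi>))"
    "maj U (opR f) (fps_const 2 * fps_deriv (fps_deriv \<phi>))"
    "maj U (opT f) (fps_const 2 * fps_deriv (fps_deriv \<phi>))"
proof -
  have *: "fps_const 2 * \<psi> = \<psi> + \<psi>" for \<psi> :: "real fps" by (rule fps_ext) simp
  have D: "maj U (dird a (dird b f)) (fps_deriv (fps_deriv \<phi>))" if "a \<in> Basis" "b \<in> Basis" for a b
    using that by (intro maj_dird f)
  show "maj U (opP f) (fps_const 2 * fps_deriv (fps_deriv \<phi>))"
    "maj U (opQ f) (fps_const 2 * fps_deriv (fps_deriv \<phi>))"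
    "maj U (opR f) (fps_const 2 * fps_deriv (fps_deriv \<phi>))"
    "maj U (opT f) (fps_const 2 * fps_deriv (fps_deriv \<phi>))"
    unfolding op_defs[abs_def] * by (intro maj_add maj_diff D U; simp)+
qed

text \<open>The constant is 3 products times 2 times 2, each factor being a sum of two second
  derivatives.\<close>

lemma maj_polar:
  assumes U: "open U" and f: "maj U f \<phi>" and g: "maj U g \<psi>"
  shows "maj U (polar f g)
    (fps_const 12 * (fps_deriv (fps_deriv \<phi>) * fps_deriv (fps_deriv \<psi>)))"
proof -
  let ?a = "fps_const 2 * fps_deriv (fps_deriv \<phi>)" and ?b = "fps_const 2 * fps_deriv (fps_deriv \<psi>)"
  have "maj U (polar f g) (?a * ?b + ?a * ?b + ?a * ?b)"
    unfolding polar_def[abs_def] by (intro maj_diff maj_mult maj_op f g U)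
  also have "?a * ?b + ?a * ?b + ?a * ?b = fps_const 12 * (fps_deriv (fps_deriv \<phi>) * fps_deriv (fps_deriv \<psi>))"
  proof -
    have "fps_const 12 = (fps_const 2 * fps_const 2 + fps_const 2 * fps_const 2 + fps_const 2 * fps_const
        2 :: real fps)"
      by (simp flip: fps_const_add)
    then show ?thesis by (simp only: algebra_simps)
  qed
  finally show ?thesis .
qed

subsection \<open>The Cauchy--Kovalevskaya recursion\<close>

text \<open>Coefficients of \<open>F = \<Sum> s\<^sup>n f\<^sub>n\<close>.  The truncated subtractions are harmless: the sums are empty when they
  truncate.\<close>

fun ck :: "real \<Rightarrow> real \<Rightarrow> (surf \<Rightarrow> real) \<Rightarrow> (surf \<Rightarrow> real) \<Rightarrow> nat \<Rightarrow> surf \<Rightarrow> real" where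
  "ck \<kappa> c F0 F1 0 = F0"
| "ck \<kappa> c F0 F1 (Suc 0) = F1"
| "ck \<kappa> c F0 F1 (Suc (Suc n)) = (\<lambda>z. \<kappa> / ((real n + 2) * (real n + 1)) *
     (c * (\<Sum>i<n. polar (ck \<kappa> c F0 F1 i) (ck \<kappa> c F0 F1 (n - 1 - i)) z) +
      (\<Sum>i<n - 1. polar (ck \<kappa> c F0 F1 i) (ck \<kappa> c F0 F1 (n - 2 - i)) z)))"

abbreviation gfps :: "real \<Rightarrow> real fps" where
  "gfps R \<equiv> Abs_fps (\<lambda>m. R ^ m)"

lemma fps_deriv_gfps: "fps_deriv (gfps R) = fps_const R * gfps R ^ 2"
proof (rule fps_ext)
  fix m
  have "(gfps R ^ 2) $ m = (\<Sum>i=0..m. R ^ i * R ^ (m - i))"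
    by (simp add: power2_eq_square fps_mult_nth)
  also have "\<dots> = (\<Sum>i=0..m. R ^ m)" by (rule sum.cong) (auto simp flip: power_add)
  finally show "fps_deriv (gfps R) $ m = (fps_const R * gfps R ^ 2) $ m" by simp
qed

lemma fps_deriv2_gfps_power:
  "fps_deriv (fps_deriv (gfps R ^ Suc k)) =
    fps_const (real (Suc k) * real (Suc (Suc k)) * R ^ 2) * gfps R ^ (k + 3)"
proof -
  have *: "fps_deriv (gfps R ^ Suc k) = fps_const (real (Suc k) * R) * gfps R ^ Suc (Suc k)" for k
  proof (induction k)
    case (Suc k)
    have "fps_const (real (Suc (Suc k)) * R) = fps_const (real (Suc k) * R) + fps_const R"
      by (simp add: algebra_simps)
    then show ?case
      unfolding power_Suc[of _ "Suc k"] fps_deriv_mult Suc fps_deriv_gfps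
      by (simp only: algebra_simps power2_eq_square power_Suc)
  qed (simp add: fps_deriv_gfps power2_eq_square)
  have "fps_deriv (fps_deriv (gfps R ^ Suc k)) = fps_const (real (Suc k) * R) * fps_deriv (gfps R ^ Suc
      (Suc k))"
    unfolding *[of k] by (rule fps_deriv_mult_const_left)
  also have "\<dots> = fps_const ((real (Suc k) * R) * (real (Suc (Suc k)) * R)) * gfps R ^ Suc (Suc (Suc k))"
    unfolding *[of "Suc k"] by (simp only: mult.assoc[symmetric] fps_const_mult)
  also have "(real (Suc k) * R) * (real (Suc (Suc k)) * R) = real (Suc k) * real (Suc (Suc k)) * R ^ 2"
    by (simp only: power2_eq_square mult_ac)
  also have "Suc (Suc (Suc k)) = k + 3" by simp
  finally show ?thesis .
qed

lemma gfps_power_nonneg: "0 \<le> R \<Longrightarrow> 0 \<le> (gfps R ^ k) $ m"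
  by (induction k arbitrary: m) (auto simp: fps_mult_nth intro!: sum_nonneg)

text \<open>The constant coefficient of \<open>G\<close> is 1 and all others are nonnegative, so a
  further factor \<open>G\<close> only increases coefficients. This brings terms with different
  exponents to a common one.\<close>

lemma gfps_power_mono:
  assumes "0 \<le> R" "j \<le> k"
  shows "(gfps R ^ j) $ m \<le> (gfps R ^ k) $ m"
  using assms(2)
proof (induction k rule: dec_induct)
  case (step k)
  have "(gfps R ^ k) $ m = gfps R $ 0 * (gfps R ^ k) $ (m - 0)" by simp
  also have "\<dots> \<le> (\<Sum>i=0..m. gfps R $ i * (gfps R ^ k) $ (m - i))"
    by (rule member_le_sum) (use assms(1) in \<open>auto intro!: mult_nonneg_nonneg gfps_power_nonneg\<close>)
  also have "\<dots> = (gfps R ^ Suc k) $ m" by (simp add: fps_mult_nth)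
  finally show ?case using step by linarith
qed simp

lemma gfps_bd:
  assumes "0 \<le> R" "0 \<le> \<tau>" "R * \<tau> \<le> 1 / 2"
  shows "fps_bd \<tau> (gfps R) 2"
proof -
  have "(\<Sum>m\<le>M. R ^ m * \<tau> ^ m) \<le> 2 - (1/2) ^ M" for M
  proof (induction M)
    case (Suc M)
    have "(R * \<tau>) ^ Suc M \<le> (1 / 2) ^ Suc M" using assms by (intro power_mono) auto
    then show ?case using Suc by (simp add: power_mult_distrib mult_ac)
  qed simp
  moreover have "2 - (1/2) ^ M \<le> (2::real)" for M :: nat by simp
  ultimately have "(\<Sum>m\<le>M. R ^ m * \<tau> ^ m) \<le> 2" for M using order_trans by blast
  then show ?thesis unfolding fps_bd_def using assms(1) by auto
qed

text \<open>The subtracted term makes the induction telescope.\<close>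

lemma sum_inverse_squares: "(\<Sum>i\<le>N. 1 / (real i + 1) ^ 2) \<le> 2 - 1 / (real N + 1)"
proof (induction N)
  case (Suc N)
  have "1 / (real N + 2) ^ 2 \<le> 1 / ((real N + 1) * (real N + 2))"
    by (rule divide_left_mono) (auto simp: power2_eq_square)
  also have "\<dots> = 1 / (real N + 1) - 1 / (real N + 2)" by (simp add: field_simps)
  finally show ?case using Suc by (simp add: add_ac)
qed simp

text \<open>With \<open>a + b = N + 2\<close>, the square of
  \<open>1 / (a b) = (1 / a + 1 / b) / (a + b)\<close> is at most
  \<open>2 (1 / a^2 + 1 / b^2) / (a + b)^2\<close>, and the two sums of inverse squares are at most
  2 each.\<close>

lemma convolution_inverse_squares:
  "(\<Sum>i\<le>N. 1 / ((real i + 1) ^ 2 * (real (N - i) + 1) ^ 2)) \<le> 8 / (real N + 2) ^ 2"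
proof -
  have key: "1 / (a ^ 2 * b ^ 2) \<le> 2 / (a + b) ^ 2 * (1 / a ^ 2 + 1 / b ^ 2)" if "a > 0" "b > 0" for a b :: real
  proof -
    have "(a + b) ^ 2 \<le> 2 * (a ^ 2 + b ^ 2)" using sum_squares_ge_zero[of "a - b" 0]
      by (simp add: power2_eq_square algebra_simps)
    then have "(a + b) ^ 2 / (a ^ 2 * b ^ 2 * (a + b) ^ 2) \<le> 2 * (a ^ 2 + b ^ 2) / (a ^ 2 * b ^ 2 * (a +
        b) ^ 2)"
      by (rule divide_right_mono) simp
    also have "(a + b) ^ 2 / (a ^ 2 * b ^ 2 * (a + b) ^ 2) = 1 / (a ^ 2 * b ^ 2)" using that by simp
    also have "2 * (a ^ 2 + b ^ 2) / (a ^ 2 * b ^ 2 * (a + b) ^ 2) = 2 / (a + b) ^ 2 * (1 / a ^ 2 + 1 / b ^ 2)"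
      using that by (simp add: divide_simps)
    finally show ?thesis .
  qed
  let ?S = "\<Sum>i\<le>N. 1 / (real i + 1) ^ 2"
  have S: "?S \<le> 2" by (rule order_trans[OF sum_inverse_squares]) simp
  have rev: "(\<Sum>i\<le>N. 1 / (real (N - i) + 1) ^ 2) = ?S"
    using sum.nat_diff_reindex[of "\<lambda>i. 1 / (real i + 1) ^ 2" "Suc N"] by (simp add: lessThan_Suc_atMost)
  have "(\<Sum>i\<le>N. 1 / ((real i + 1) ^ 2 * (real (N - i) + 1) ^ 2))
    \<le> (\<Sum>i\<le>N. 2 / (real N + 2) ^ 2 * (1 / (real i + 1) ^ 2 + 1 / (real (N - i) + 1) ^ 2))"
  proof (rule sum_mono)
    fix i assume "i \<in> {..N}"
    then have eq: "(real i + 1) + (real (N - i) + 1) = real N + 2" by auto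
    have "0 < real i + 1" "0 < real (N - i) + 1" by auto
    from key[OF this] show "1 / ((real i + 1) ^ 2 * (real (N - i) + 1) ^ 2)
      \<le> 2 / (real N + 2) ^ 2 * (1 / (real i + 1) ^ 2 + 1 / (real (N - i) + 1) ^ 2)"
      unfolding eq .
  qed
  also have "\<dots> = 2 / (real N + 2) ^ 2 * (?S + ?S)"
    unfolding sum_distrib_left[symmetric] sum.distrib rev ..
  also have "\<dots> \<le> 2 / (real N + 2) ^ 2 * 4" using S by (intro mult_left_mono) auto
  finally show ?thesis by simp
qed

text \<open>The weights \<open>(i + 1)^-4\<close> drop to inverse squares, because two derivatives
  of \<open>G^(2 i + 2)\<close> cost \<open>(2 i + 2) (2 i + 3) \<le> 6 (i + 1)^2\<close>. The
  constant is \<open>12 * 6 * 6 * 8\<close>, with 12 from \<open>maj_polar\<close> and 8 from the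
  convolution.\<close>

lemma maj_polar_convolution:
  assumes U: "open U" and nn: "0 \<le> A" "0 \<le> K" "0 \<le> R"
    and f: "\<And>i. i \<le> N \<Longrightarrow> maj U (f i) (fps_const (A * K ^ i / (real i + 1) ^ 4) * gfps R ^ (2 * i + 2))"
    and p: "2 * N + 8 \<le> p"
  shows "maj U (\<lambda>z. \<Sum>i\<le>N. polar (f i) (f (N - i)) z)
    (fps_const (3456 * R ^ 4 * A ^ 2 * K ^ N / (real N + 2) ^ 2) * gfps R ^ p)"
proof -
  let ?\<phi> = "\<lambda>i. fps_const (A * K ^ i / (real i + 1) ^ 4) * gfps R ^ (2 * i + 2)"
  let ?\<psi> = "\<lambda>i. fps_const 12 * (fps_deriv (fps_deriv (?\<phi> i)) * fps_deriv (fps_deriv (?\<phi> (N - i))))"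
  let ?C = "432 * R ^ 4 * A ^ 2 * K ^ N"
  have dd: "fps_deriv (fps_deriv (?\<phi> i)) =
      fps_const (A * K ^ i / (real i + 1) ^ 4 * (real (2 * i + 2) * real (2 * i + 3) * R ^ 2)) * gfps R ^
          (2 * i + 4)" for i
    using fps_deriv2_gfps_power[of R "2 * i + 1"]
    by (simp add: eval_nat_numeral mult.assoc flip: fps_const_mult)
  have small: "A * K ^ i / (real i + 1) ^ 4 * (real (2 * i + 2) * real (2 * i + 3) * R ^ 2)
      \<le> 6 * R ^ 2 * A * K ^ i / (real i + 1) ^ 2" for i
  proof -
    have "real (2 * i + 2) * real (2 * i + 3) \<le> 6 * (real i + 1) ^ 2"
      by (simp add: power2_eq_square algebra_simps)
    then have "A * K ^ i * R ^ 2 / (real i + 1) ^ 4 * (real (2 * i + 2) * real (2 * i + 3))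
      \<le> A * K ^ i * R ^ 2 / (real i + 1) ^ 4 * (6 * (real i + 1) ^ 2)"
      using nn by (intro mult_left_mono) auto
    also have "\<dots> = 6 * R ^ 2 * A * K ^ i / (real i + 1) ^ 2"
      by (simp add: divide_simps)
    finally show ?thesis by (simp add: mult_ac)
  qed
  have le: "?\<psi> i $ m \<le> (fps_const (?C * (1 / ((real i + 1) ^ 2 * (real (N - i) + 1) ^ 2))) * gfps R ^ p) $ m"
    if i: "i \<le> N" for i m
  proof -
    let ?x = "\<lambda>i. A * K ^ i / (real i + 1) ^ 4 * (real (2 * i + 2) * real (2 * i + 3) * R ^ 2)"
    let ?y = "\<lambda>i. 6 * R ^ 2 * A * K ^ i / (real i + 1) ^ 2"
    have "?\<psi> i = fps_const (12 * (?x i * ?x (N - i))) * gfps R ^ (2 * N + 8)"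
    proof -
      have "gfps R ^ (2 * i + 4) * gfps R ^ (2 * (N - i) + 4) = gfps R ^ (2 * N + 8)"
        using i by (simp flip: power_add) (simp add: algebra_simps)
      moreover have "fps_const 12 * (fps_const u * g * (fps_const v * h)) = fps_const (12 * (u * v)) * (g * h)"
        for u v :: real and g h
      proof -
        have "fps_const (12 * (u * v)) = fps_const 12 * (fps_const u * fps_const v)" by simp
        then show ?thesis by (simp only: mult_ac)
      qed
      ultimately show ?thesis unfolding dd by (simp only:)
    qed
    then have "?\<psi> i $ m = (12 * (?x i * ?x (N - i))) * (gfps R ^ (2 * N + 8)) $ m"
      by (simp only: fps_mult_left_const_nth)
    also have "\<dots> \<le> (12 * (?y i * ?y (N - i))) * (gfps R ^ p) $ m"
      using nn by (intro mult_mono small gfps_power_mono p gfps_power_nonneg) auto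
    also have "12 * (?y i * ?y (N - i)) = ?C * (1 / ((real i + 1) ^ 2 * (real (N - i) + 1) ^ 2))"
    proof -
      have "K ^ N = K ^ i * K ^ (N - i)" using i by (simp flip: power_add)
      then show ?thesis by (simp add: eval_nat_numeral)
    qed
    finally show ?thesis by (simp only: fps_mult_left_const_nth)
  qed
  have "maj U (\<lambda>z. \<Sum>i\<le>N. polar (f i) (f (N - i)) z) (\<Sum>i\<le>N. ?\<psi> i)"
    by (intro maj_sum U maj_polar f) auto
  then show ?thesis
  proof (rule maj_mono)
    fix m
    have "(\<Sum>i\<le>N. ?\<psi> i) $ m \<le> (\<Sum>i\<le>N. ?C * (1 / ((real i + 1) ^ 2 * (real (N - i) + 1) ^ 2)) * (gfps R ^ p) $ m)"
      unfolding fps_sum_nth using le by (intro sum_mono) (simp only: fps_mult_left_const_nth atMost_iff)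
    also have "\<dots> = ?C * (\<Sum>i\<le>N. 1 / ((real i + 1) ^ 2 * (real (N - i) + 1) ^ 2)) * (gfps R ^ p) $ m"
      by (simp only: sum_distrib_left sum_distrib_right)
    also have "\<dots> \<le> ?C * (8 / (real N + 2) ^ 2) * (gfps R ^ p) $ m"
      using nn by (intro mult_right_mono mult_left_mono convolution_inverse_squares gfps_power_nonneg) auto
    finally show "(\<Sum>i\<le>N. ?\<psi> i) $ m
      \<le> (fps_const (3456 * R ^ 4 * A ^ 2 * K ^ N / (real N + 2) ^ 2) * gfps R ^ p) $ m"
      by simp
  qed
qed

lemma maj_const_mono:
  assumes "maj U f (fps_const a * gfps R ^ p)" "a \<le> b" "0 \<le> R"
  shows "maj U f (fps_const b * gfps R ^ p)"
proof (rule maj_mono[OF assms(1)])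
  show "(fps_const a * gfps R ^ p) $ m \<le> (fps_const b * gfps R ^ p) $ m" for m
    unfolding fps_mult_left_const_nth by (intro mult_right_mono assms gfps_power_nonneg)
qed

text \<open>The 16 in the bound of \<open>F1\<close> is the weight \<open>(n + 1)^4\<close> at
  \<open>n = 1\<close>. In the step, the division by \<open>(m + 2) (m + 1)\<close> restores the
  fourth power at the price of a factor 81, and \<open>279936 = 81 * 3456\<close>. The sum
  \<open>c + 4\<close> collects the two parts of \<open>s (s + c)\<close>, and a surplus power of
  \<open>K\<close> absorbs all constants.\<close>

lemma maj_ck:
  assumes U: "open U" and nn: "0 \<le> A" "1 \<le> K" "0 \<le> R" "0 \<le> c"
    and F0: "maj U F0 (fps_const A * gfps R)" and F1: "maj U F1 (fps_const (A / 16) * gfps R)"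
    and K: "279936 * \<bar>\<kappa>\<bar> * (c + 4) * R ^ 4 * A \<le> K"
  shows "maj U (ck \<kappa> c F0 F1 n) (fps_const (A * K ^ n / (real n + 1) ^ 4) * gfps R ^ (2 * n + 2))"
proof (induction n rule: less_induct)
  case (less n)
  consider "n = 0" | "n = 1" | m where "n = Suc (Suc m)"
    by (metis One_nat_def not0_implies_Suc)
  then show ?case
  proof cases
    case 1
    have "maj U F0 (fps_const A * gfps R ^ 2)"
      using nn gfps_power_mono[of R 1 2] by (intro maj_mono[OF F0]) (auto intro!: mult_left_mono)
    then show ?thesis using 1 by (simp add: power2_eq_square)
  next
    case 2
    have "maj U F1 (fps_const (A * K / 16) * gfps R ^ 4)"
      using nn gfps_power_mono[of R 1 4]
      by (intro maj_mono[OF F1]) (auto intro!: mult_mono gfps_power_nonneg simp: mult_le_cancel_left1)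
    then show ?thesis using 2 by simp
  next
    case (3 m)
    let ?f = "ck \<kappa> c F0 F1"
    \<comment> \<open>\<open>B\<close> bounds the convolution over \<open>i + j = m - 1\<close>; the
      one over \<open>i + j = m - 2\<close> has weight \<open>1 / m^2\<close> and takes the factor 4
      to be compared with \<open>1 / (m + 1)^2\<close>.\<close>
    define B where "B = 3456 * R ^ 4 * A ^ 2 * K ^ m / (real m + 1) ^ 2"
    have B: "0 \<le> B" using nn by (simp add: B_def)
    have Z: "maj U (\<lambda>z. 0) (fps_const x * gfps R ^ (2 * m + 6))" if "0 \<le> x" for x
      using that nn gfps_power_nonneg by (intro maj_zero) simp
    have S1: "maj U (\<lambda>z. \<Sum>i<m. polar (?f i) (?f (m - 1 - i)) z) (fps_const B * gfps R ^ (2 * m + 6))"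
    proof (cases m)
      case 0
      then show ?thesis using Z[OF B] by simp
    next
      case (Suc N)
      have "maj U (\<lambda>z. \<Sum>i\<le>N. polar (?f i) (?f (N - i)) z)
        (fps_const (3456 * R ^ 4 * A ^ 2 * K ^ N / (real N + 2) ^ 2) * gfps R ^ (2 * m + 6))"
        by (rule maj_polar_convolution[OF U]) (use nn less.IH 3 Suc in auto)
      moreover have "3456 * R ^ 4 * A ^ 2 * K ^ N / (real N + 2) ^ 2 \<le> B"
      proof -
        have "K ^ N \<le> K ^ m" using nn Suc by (intro power_increasing) auto
        then have "3456 * R ^ 4 * A ^ 2 * K ^ N / (real N + 2) ^ 2 \<le> 3456 * R ^ 4 * A ^ 2 * K ^ m / (real
            N + 2) ^ 2"
          using nn by (intro divide_right_mono mult_left_mono) auto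
        then show ?thesis using Suc by (simp add: B_def add.commute)
      qed
      ultimately have "maj U (\<lambda>z. \<Sum>i\<le>N. polar (?f i) (?f (N - i)) z) (fps_const B * gfps R ^ (2 * m + 6))"
        by (rule maj_const_mono) (rule nn)
      then show ?thesis using Suc by (simp add: lessThan_Suc_atMost)
    qed
    have S2: "maj U (\<lambda>z. \<Sum>i<m - 1. polar (?f i) (?f (m - 2 - i)) z) (fps_const (4 * B) * gfps R ^ (2 * m + 6))"
    proof (cases "m \<le> 1")
      case True
      then have "{..<m - 1} = {}" by auto
      then show ?thesis using Z[of "4 * B"] B by simp
    next
      case False
      define N where "N = m - 2"
      have m: "m = N + 2" using False by (simp add: N_def)
      have "maj U (\<lambda>z. \<Sum>i\<le>N. polar (?f i) (?f (N - i)) z)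
        (fps_const (3456 * R ^ 4 * A ^ 2 * K ^ N / (real N + 2) ^ 2) * gfps R ^ (2 * m + 6))"
        by (rule maj_polar_convolution[OF U]) (use nn less.IH 3 m in auto)
      moreover have "3456 * R ^ 4 * A ^ 2 * K ^ N / (real N + 2) ^ 2 \<le> 4 * B"
      proof -
        have "K ^ N \<le> K ^ m" using nn m by (intro power_increasing) auto
        then have "3456 * R ^ 4 * A ^ 2 * K ^ N / (real N + 2) ^ 2 \<le> 3456 * R ^ 4 * A ^ 2 * K ^ m / (real
            N + 2) ^ 2"
          using nn by (intro divide_right_mono mult_left_mono) auto
        also have "\<dots> \<le> 3456 * R ^ 4 * A ^ 2 * K ^ m * (4 / (real m + 1) ^ 2)"
        proof -
          have "(real m + 1) ^ 2 \<le> 4 * (real N + 2) ^ 2" by (simp add: m power2_eq_square algebra_simps)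
          then have "1 / (real N + 2) ^ 2 \<le> 4 / (real m + 1) ^ 2" by (simp add: field_simps)
          from mult_left_mono[OF this, of "3456 * R ^ 4 * A ^ 2 * K ^ m"] show ?thesis using nn by simp
        qed
        finally show ?thesis by (simp add: B_def)
      qed
      ultimately have "maj U (\<lambda>z. \<Sum>i\<le>N. polar (?f i) (?f (N - i)) z) (fps_const (4 * B) * gfps R ^ (2 * m + 6))"
        by (rule maj_const_mono) (rule nn)
      then show ?thesis using m by (simp add: lessThan_Suc_atMost)
    qed
    let ?k = "\<kappa> / ((real m + 2) * (real m + 1))"
    have "maj U (?f n) (fps_const \<bar>?k\<bar> * (fps_const \<bar>c\<bar> * (fps_const B * gfps R ^ (2 * m + 6))
        + fps_const (4 * B) * gfps R ^ (2 * m + 6)))"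
      unfolding 3 ck.simps by (intro maj_cmult maj_add S1 S2 U)
    then show ?thesis
    proof (rule maj_mono)
      fix j
      have le: "\<bar>?k\<bar> * ((c + 4) * B) \<le> A * K ^ n / (real n + 1) ^ 4"
      proof -
        define M where "M = real m + 1"
        have M: "M \<ge> 1" by (simp add: M_def)
        have "\<bar>?k\<bar> * ((c + 4) * B) = \<bar>\<kappa>\<bar> * (c + 4) * (3456 * R ^ 4 * A ^ 2 * K ^ m) / ((M + 1) * M * M ^ 2)"
        proof -
          have "\<bar>?k\<bar> = \<bar>\<kappa>\<bar> / ((M + 1) * M)"
            unfolding M_def by (simp add: abs_divide abs_mult add_ac)
          moreover have "B = 3456 * R ^ 4 * A ^ 2 * K ^ m / M ^ 2" by (simp add: B_def M_def)
          moreover have "x / y * ((c + 4) * (b / z)) = x * (c + 4) * b / (y * z)" for x y b z :: real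
            by simp
          ultimately show ?thesis by (simp only:)
        qed
        also have "\<dots> \<le> \<bar>\<kappa>\<bar> * (c + 4) * (3456 * R ^ 4 * A ^ 2 * K ^ m) * (81 / (M + 2) ^ 4)"
        proof -
          \<comment> \<open>Here \<open>M = m + 1\<close> is at least 1, so
            \<open>M + 2 \<le> 3 M\<close>; the 81 is \<open>3^4\<close>.\<close>
          have "(M + 2) ^ 4 \<le> (3 * M) ^ 4" using M by (intro power_mono) auto
          also have "\<dots> = 81 * (M * M * M ^ 2)" by (simp add: eval_nat_numeral)
          also have "\<dots> \<le> 81 * ((M + 1) * M * M ^ 2)" using M by (intro mult_left_mono mult_right_mono) auto
          finally have "(M + 2) ^ 4 \<le> 81 * ((M + 1) * M * M ^ 2)" .
          moreover have "0 < (M + 1) * M * M ^ 2" "0 < (M + 2) ^ 4" using M by auto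
          moreover have "1 / y \<le> 81 / x" if "x \<le> 81 * y" "0 < y" "0 < x" for x y :: real
            using that by (simp add: field_simps)
          ultimately have "1 / ((M + 1) * M * M ^ 2) \<le> 81 / (M + 2) ^ 4" by blast
          from mult_left_mono[OF this, of "\<bar>\<kappa>\<bar> * (c + 4) * (3456 * R ^ 4 * A ^ 2 * K ^ m)"]
          show ?thesis using nn by simp
        qed
        also have "\<dots> = (279936 * \<bar>\<kappa>\<bar> * (c + 4) * R ^ 4 * A) * (A * K ^ m / (M + 2) ^ 4)"
          by (simp add: power2_eq_square)
        also have "\<dots> \<le> K * (A * K ^ m / (M + 2) ^ 4)"
          using nn M by (intro mult_right_mono K) auto
        also have "\<dots> = A * K ^ Suc m / (M + 2) ^ 4" by simp
        also have "\<dots> \<le> A * K ^ n / (M + 2) ^ 4"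
          using nn M 3 by (intro divide_right_mono mult_left_mono power_increasing) auto
        finally show ?thesis by (simp add: M_def 3 add_ac)
      qed
      have "(fps_const \<bar>?k\<bar> * (fps_const \<bar>c\<bar> * (fps_const B * gfps R ^ (2 * m + 6))
        + fps_const (4 * B) * gfps R ^ (2 * m + 6))) $ j = \<bar>?k\<bar> * ((c + 4) * B) * (gfps R ^ (2 * m + 6)) $ j"
        unfolding fps_mult_left_const_nth fps_add_nth abs_of_nonneg[OF nn(4)] by (simp only: algebra_simps)
      also have "\<dots> \<le> A * K ^ n / (real n + 1) ^ 4 * (gfps R ^ (2 * m + 6)) $ j"
        using nn by (intro mult_right_mono le gfps_power_nonneg)
      finally show "(fps_const \<bar>?k\<bar> * (fps_const \<bar>c\<bar> * (fps_const B * gfps R ^ (2 * m + 6))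
        + fps_const (4 * B) * gfps R ^ (2 * m + 6))) $ j
        \<le> (fps_const (A * K ^ n / (real n + 1) ^ 4) * gfps R ^ (2 * n + 2)) $ j"
        by (simp add: 3 add_ac eval_nat_numeral)
    qed
  qed
qed

section \<open>Functions on the base and their slices\<close>

lemma dird_slice:
  fixes F :: "base \<Rightarrow> real"
  assumes "F differentiable (at (z, s))"
  shows "dird e (\<lambda>w. F (w, s)) z = dird (e, 0) F (z, s)"
    and "(\<lambda>w. F (w, s)) differentiable (at z)"
proof -
  have "((\<lambda>w. (w, s)) has_derivative (\<lambda>h. (h, 0))) (at z)"
    by (auto intro!: derivative_eq_intros)
  from has_derivative_compose[OF this has_derivative_dird[OF assms]]
  have *: "((\<lambda>w. F (w, s)) has_derivative (\<lambda>h. dird (h, 0) F (z, s))) (at z)" .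
  show "dird e (\<lambda>w. F (w, s)) z = dird (e, 0) F (z, s)" by (rule dird_eq[OF *])
  show "(\<lambda>w. F (w, s)) differentiable (at z)" using * by (rule differentiableI)
qed

lemma open_slice: "open W \<Longrightarrow> open {w. (w, s) \<in> W}" for W :: "base set"
  using continuous_open_vimage[of W "\<lambda>w. (w, s)"] by (auto simp: vimage_def intro!: continuous_intros)

lemma smooth_on_slice:
  fixes F :: "base \<Rightarrow> real"
  assumes W: "open W" and F: "smooth_on F W"
  shows "smooth_on (\<lambda>w. F (w, s)) {w. (w, s) \<in> W}"
proof -
  let ?V = "{w. (w, s) \<in> W}"
  have "smooth_on F W \<Longrightarrow> ck_on n (\<lambda>w. F (w, s)) ?V" for n
  proof (induction n arbitrary: F)
    case 0
    then show ?case
      by (auto intro!: continuous_at_imp_continuous_on differentiable_imp_continuous_within dird_slice(2)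
          dest: smooth_on_differentiable)
  next
    case (Suc n)
    have "ck_on n (dird b (\<lambda>w. F (w, s))) ?V" for b
      by (rule ck_on_cong[OF open_slice[OF W], where f="\<lambda>w. dird (b, 0) F (w, s)"])
        (use Suc W in \<open>auto simp: dird_slice smooth_on_differentiable intro!: Suc.IH smooth_on_dird\<close>)
    then show ?case using Suc.prems
      by (auto simp: dird_def dird_slice(2) smooth_on_differentiable)
  qed
  then show ?thesis using F unfolding smooth_on_def[of _ ?V] by blast
qed

lemma dird2_slice:
  fixes F :: "base \<Rightarrow> real"
  assumes W: "open W" "smooth_on F W" "(z, s) \<in> W"
  shows "dird a (dird b (\<lambda>w. F (w, s))) z = dird (a, 0) (dird (b, 0) F) (z, s)"
proof -
  have "dird a (dird b (\<lambda>w. F (w, s))) z = dird a (\<lambda>w. dird (b, 0) F (w, s)) z"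
    by (rule dird_cong[OF open_slice[OF W(1)]])
      (use W in \<open>auto intro!: dird_slice smooth_on_differentiable\<close>)
  also have "\<dots> = dird (a, 0) (dird (b, 0) F) (z, s)"
    by (rule dird_slice) (use W in \<open>auto intro!: smooth_on_differentiable smooth_on_dird\<close>)
  finally show ?thesis .
qed

lemma s_deriv_eq:
  fixes F :: "base \<Rightarrow> real"
  assumes "F differentiable (at b)"
  shows "s_deriv F b = dird (0, 1) F b"
    and "((\<lambda>t. F (fst b, t)) has_real_derivative dird (0, 1) F b) (at (snd b))"
proof -
  show *: "((\<lambda>t. F (fst b, t)) has_real_derivative dird (0, 1) F b) (at (snd b))"
    using dird_line[of F "(fst b, 0)" "snd b" "(0, 1)"] assms by simp
  then show "s_deriv F b = dird (0, 1) F b"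
    unfolding s_deriv_def by (rule DERIV_imp_deriv)
qed

text \<open>\<open>s_deriv\<close> is a pointwise \<open>deriv\<close>; it agrees with
  \<open>dird (0, 1)\<close> on all of the open set and so can be differentiated once more.\<close>

lemma s_deriv2_eq:
  fixes F :: "base \<Rightarrow> real"
  assumes W: "open W" "smooth_on F W" "b \<in> W"
  shows "s_deriv (s_deriv F) b = dird (0, 1) (dird (0, 1) F) b"
proof -
  have "dird (0, 1) F differentiable (at b)"
    using W smooth_on_differentiable smooth_on_dird by blast
  moreover have *: "dird (0, 1) F b' = s_deriv F b'" if "b' \<in> W" for b'
    using s_deriv_eq(1) smooth_on_differentiable[OF W(2) that] by metis
  ultimately have "s_deriv F differentiable (at b)"
    using differentiable_cong_open[OF W(1,3)] by metis
  then have "s_deriv (s_deriv F) b = dird (0, 1) (s_deriv F) b" by (rule s_deriv_eq)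
  also have "\<dots> = dird (0, 1) (dird (0, 1) F) b"
    by (rule dird_cong[OF W(1,3)]) (use * in simp)
  finally show ?thesis .
qed

text \<open>The operators \<open>opP\<close> to \<open>opT\<close> in the surface directions of the
  base, where they can also be differentiated in \<open>s\<close>.\<close>

definition coP :: "(base \<Rightarrow> real) \<Rightarrow> base \<Rightarrow> real" where
  "coP F b = dird ((1, 0), 0) (dird ((1, 0), 0) F) b + dird ((\<i>, 0), 0) (dird ((\<i>, 0), 0) F) b"
definition coQ :: "(base \<Rightarrow> real) \<Rightarrow> base \<Rightarrow> real" where
  "coQ F b = dird ((0, 1), 0) (dird ((0, 1), 0) F) b + dird ((0, \<i>), 0) (dird ((0, \<i>), 0) F) b"
definition coR :: "(base \<Rightarrow> real) \<Rightarrow> base \<Rightarrow> real" where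
  "coR F b = dird ((1, 0), 0) (dird ((0, 1), 0) F) b + dird ((\<i>, 0), 0) (dird ((0, \<i>), 0) F) b"
definition coT :: "(base \<Rightarrow> real) \<Rightarrow> base \<Rightarrow> real" where
  "coT F b = dird ((1, 0), 0) (dird ((0, \<i>), 0) F) b - dird ((\<i>, 0), 0) (dird ((0, 1), 0) F) b"

lemmas co_defs = coP_def coQ_def coR_def coT_def

text \<open>16 times the determinant of the complex Hessian of the slice at fixed
  \<open>s\<close>.\<close>

definition Delta :: "(base \<Rightarrow> real) \<Rightarrow> base \<Rightarrow> real" where
  "Delta F b = coP F b * coQ F b - coR F b ^ 2 - coT F b ^ 2"

lemma op_slice:
  fixes F :: "base \<Rightarrow> real"
  assumes "open W" "smooth_on F W" "(z, s) \<in> W"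
  shows "opP (\<lambda>w. F (w, s)) z = coP F (z, s)" "opQ (\<lambda>w. F (w, s)) z = coQ F (z, s)"
    "opR (\<lambda>w. F (w, s)) z = coR F (z, s)" "opT (\<lambda>w. F (w, s)) z = coT F (z, s)"
  unfolding op_defs co_defs by (simp_all add: dird2_slice[OF assms])

text \<open>The equation is \<open>\<kappa> = 1/4\<close>, the volume condition \<open>\<kappa> = 1\<close>.\<close>

definition pde :: "real \<Rightarrow> real \<Rightarrow> (base \<Rightarrow> real) \<Rightarrow> base \<Rightarrow> bool" where
  "pde \<kappa> c F b \<longleftrightarrow>
     dird (0, 1) (dird (0, 1) F) b = \<kappa> * (snd b * (snd b + c)) * Delta F b"

lemma smooth_on_co:
  assumes "open W" "smooth_on F W"
  shows "smooth_on (coP F) W" "smooth_on (coQ F) W" "smooth_on (coR F) W" "smooth_on (coT F) W"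
  unfolding co_defs[abs_def] using assms
  by (auto intro!: smooth_on_add smooth_on_diff smooth_on_dird)

subsection \<open>Existence\<close>

lemma summable_abs_add:
  fixes f g :: "nat \<Rightarrow> real"
  assumes "summable (\<lambda>n. \<bar>f n\<bar>)" "summable (\<lambda>n. \<bar>g n\<bar>)"
  shows "summable (\<lambda>n. \<bar>f n + g n\<bar>)" "summable (\<lambda>n. \<bar>f n - g n\<bar>)"
  by (rule summable_comparison_test'[OF summable_add[OF assms], of 0]; simp)+

text \<open>At radius \<open>\<delta>\<close> the majorant of \<open>s^n f_n\<close> has a value of
  at most \<open>(2 \<delta>)^n A K^n 2^(2 n + 2) = 4 A (8 K \<delta>)^n\<close>, the term of a
  convergent geometric series. So derivatives may be taken termwise, and the equation is a
  comparison of coefficients.\<close>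

lemma ck_solution:
  fixes F0 F1 :: "surf \<Rightarrow> real"
  assumes U: "open U" and R: "0 < R" and A: "0 \<le> A" and c: "0 \<le> c"
    and F0: "maj U F0 (fps_const A * gfps R)" and F1: "maj U F1 (fps_const (A / 16) * gfps R)"
  shows "\<exists>\<delta> F K. 0 < \<delta> \<and> maj (U \<times> {-\<delta><..<\<delta>}) F (geo K \<delta>) \<and>
    (\<forall>z\<in>U. F (z, 0) = F0 z \<and> dird (0, 1) F (z, 0) = F1 z) \<and>
    (\<forall>b\<in>U \<times> {-\<delta><..<\<delta>}. pde \<kappa> c F b)"
proof -
  define K where "K = max 1 (279936 * \<bar>\<kappa>\<bar> * (c + 4) * R ^ 4 * A)"
  define f where "f = ck \<kappa> c F0 F1"
  have K1: "1 \<le> K" by (simp add: K_def)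
  have maj_f: "maj U (f n) (fps_const (A * K ^ n / (real n + 1) ^ 4) * gfps R ^ (2 * n + 2))" for n
    unfolding f_def by (rule maj_ck[OF U A K1 _ c F0 F1]) (use R in \<open>auto simp: K_def\<close>)
  \<comment> \<open>The first bound makes the value of \<open>G\<close> at \<open>\<delta>\<close>
    at most 2, the second makes the ratio \<open>8 K \<delta>\<close> at most 1/2.\<close>
  define \<delta> where "\<delta> = min (1 / (2 * R)) (1 / (16 * K))"
  have \<delta>: "0 < \<delta>" using R K1 by (simp add: \<delta>_def)
  have \<delta>1: "R * \<delta> \<le> 1 / 2"
  proof -
    have "R * \<delta> \<le> R * (1 / (2 * R))" using R by (intro mult_left_mono) (auto simp: \<delta>_def)
    then show ?thesis using R by simp
  qed
  have \<delta>2: "8 * K * \<delta> \<le> 1 / 2"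
  proof -
    have "8 * K * \<delta> \<le> 8 * K * (1 / (16 * K))" using K1 by (intro mult_left_mono) (auto simp: \<delta>_def)
    then show ?thesis using K1 by simp
  qed
  let ?V = "U \<times> {-\<delta><..<\<delta>}"
  have V: "open ?V" using U by (simp add: open_Times)
  define g where "g n b = snd b ^ n * f n (fst b)" for n and b :: base
  define \<phi> where "\<phi> n = (fps_const \<delta> + fps_X) ^ n *
    (fps_const (A * K ^ n / (real n + 1) ^ 4) * gfps R ^ (2 * n + 2))" for n
  have maj_s: "maj ?V (\<lambda>b. snd b) (fps_const \<delta> + fps_X)"
  proof -
    have "maj ?V (\<lambda>b. (b - 0) \<bullet> ((0, 1) :: base)) (fps_const \<delta> + fps_X)"
      by (rule maj_coord) (auto simp: inner_prod_def)
    then show ?thesis by (simp add: inner_prod_def)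
  qed
  have maj_g: "maj ?V (g n) (\<phi> n)" for n
    unfolding g_def \<phi>_def
  proof (intro maj_mult maj_power maj_s V)
    show "maj ?V (\<lambda>b. f n (fst b)) (fps_const (A * K ^ n / (real n + 1) ^ 4) * gfps R ^ (2 * n + 2))"
    proof (rule maj_compose_linear[OF U V bounded_linear_fst _ _ maj_f])
      show "fst b \<in> insert 0 Basis" if "b \<in> Basis" for b :: base using that by (auto simp: Basis_prod_def)
      show "0 \<le> (fps_const (A * K ^ n / (real n + 1) ^ 4) * gfps R ^ (2 * n + 2)) $ m" for m
        unfolding fps_mult_left_const_nth using A K1 R by (intro mult_nonneg_nonneg gfps_power_nonneg) auto
    qed auto
  qed
  have bd_g: "fps_bd \<delta> (\<phi> n) (4 * A * (8 * K * \<delta>) ^ n)" for n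
  proof -
    have "fps_bd \<delta> (\<phi> n) ((\<delta> + \<delta>) ^ n * (A * K ^ n / (real n + 1) ^ 4 * 2 ^ (2 * n + 2)))"
      unfolding \<phi>_def using \<delta> \<delta>1 R A K1
      by (intro fps_bd_mult fps_bd_power fps_bd_linear fps_bd_const gfps_bd) auto
    moreover have "(\<delta> + \<delta>) ^ n * (A * K ^ n / (real n + 1) ^ 4 * 2 ^ (2 * n + 2)) \<le> 4 * A * (8 * K * \<delta>) ^ n"
    proof -
      have "A * K ^ n / (real n + 1) ^ 4 \<le> A * K ^ n / 1"
        using A K1 by (intro divide_left_mono) auto
      then have "(\<delta> + \<delta>) ^ n * (A * K ^ n / (real n + 1) ^ 4 * 2 ^ (2 * n + 2))
        \<le> (\<delta> + \<delta>) ^ n * (A * K ^ n * 2 ^ (2 * n + 2))"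
        using \<delta> by (intro mult_left_mono mult_right_mono) auto
      also have "\<dots> = 4 * A * ((\<delta> + \<delta>) * K * 4) ^ n"
      proof -
        have "x ^ n * (A * K ^ n * 2 ^ (2 * n + 2)) = 4 * A * (x * K * 4) ^ n" for x
          by (simp add: power_mult_distrib power_add power_mult)
        then show ?thesis .
      qed
      also have "(\<delta> + \<delta>) * K * 4 = 8 * K * \<delta>" by simp
      finally show ?thesis .
    qed
    ultimately show ?thesis unfolding fps_bd_def by (meson order_trans)
  qed
  have sK: "summable (\<lambda>n. 4 * A * (8 * K * \<delta>) ^ n)"
    using \<delta>2 K1 \<delta> by (intro summable_mult summable_geometric) auto
  have s\<phi>: "summable (\<lambda>k. \<phi> k $ m)" for m
    by (rule maj_series_bd(2)[OF V maj_g bd_g \<delta> sK])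
  define F where "F b = (\<Sum>n. g n b)" for b
  have maj_F: "maj ?V F (geo (\<Sum>n. 4 * A * (8 * K * \<delta>) ^ n) \<delta>)"
    unfolding F_def by (rule maj_series_bd(1)[OF V maj_g bd_g \<delta> sK])
  have d_F: "dird b F x = (\<Sum>n. dird b (g n) x)" if "x \<in> ?V" "b \<in> Basis" for x b
    unfolding F_def by (rule maj_series(2)[OF V maj_g s\<phi> that])
  have s1: "summable (\<lambda>k. fps_deriv (\<phi> k) $ m)" for m using s\<phi> by (simp add: summable_mult)
  have s2: "summable (\<lambda>k. fps_deriv (fps_deriv (\<phi> k)) $ m)" for m
    using s1 by (simp only: fps_deriv_nth) (rule summable_mult, simp)
  have d2_F: "dird a (dird b F) x = (\<Sum>n. dird a (dird b (g n)) x)"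
    and d2_sum: "summable (\<lambda>n. \<bar>dird a (dird b (g n)) x\<bar>)"
    if x: "x \<in> ?V" and ab: "a \<in> Basis" "b \<in> Basis" for x a b
  proof -
    have "dird a (dird b F) x = dird a (\<lambda>x. \<Sum>n. dird b (g n) x) x"
      by (rule dird_cong[OF V x]) (use d_F ab in auto)
    also have "\<dots> = (\<Sum>n. dird a (dird b (g n)) x)"
      by (rule maj_series(2)[OF V maj_dird[OF maj_g ab(2)] s1 x ab(1)])
    finally show "dird a (dird b F) x = (\<Sum>n. dird a (dird b (g n)) x)" .
    show "summable (\<lambda>n. \<bar>dird a (dird b (g n)) x\<bar>)"
      by (rule maj_series(3)[OF V maj_dird[OF maj_dird[OF maj_g ab(2)] ab(1)] s2 x])
  qed
  have df: "f n differentiable (at z)" "dird b (f n) differentiable (at z)" if "z \<in> U" for n z b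
    using that maj_smooth[OF maj_f] smooth_on_dird[OF U] smooth_on_differentiable by blast+
  have dg0: "dird (e, 0) (\<lambda>b. snd b ^ n * h (fst b)) (z, s) = s ^ n * dird e h z"
    and dg1: "dird (0, 1) (\<lambda>b. snd b ^ n * h (fst b)) (z, s) = real n * s ^ (n - 1) * h z"
    if "h differentiable (at z)" for h :: "surf \<Rightarrow> real" and e z s n
  proof -
    have "((\<lambda>b::base. h (fst b)) has_derivative (\<lambda>v. dird (fst v) h z)) (at (z, s))"
      using has_derivative_compose[OF bounded_linear_imp_has_derivative[OF bounded_linear_fst], of h _ "(z, s)"]
        has_derivative_dird[OF that] by auto
    moreover have "((\<lambda>b::base. snd b ^ n) has_derivative (\<lambda>v. real n * snd v * s ^ (n - 1))) (at (z, s))"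
      by (auto intro!: derivative_eq_intros)
    ultimately have *: "((\<lambda>b::base. snd b ^ n * h (fst b)) has_derivative
      (\<lambda>v. s ^ n * dird (fst v) h z + real n * snd v * s ^ (n - 1) * h z)) (at (z, s))"
      by (auto intro!: derivative_eq_intros simp: mult_ac)
    have "dird 0 h z = 0" using linear_0[OF linear_dird[OF that]] .
    then show "dird (e, 0) (\<lambda>b. snd b ^ n * h (fst b)) (z, s) = s ^ n * dird e h z"
      "dird (0, 1) (\<lambda>b. snd b ^ n * h (fst b)) (z, s) = real n * s ^ (n - 1) * h z"
      using dird_eq[OF *] by auto
  qed
  have dgg: "dird (a, 0) (dird (b, 0) (g n)) (z, s) = s ^ n * dird a (dird b (f n)) z"
    if "(z, s) \<in> ?V" for n z s a b
  proof -
    have "dird (a, 0) (dird (b, 0) (g n)) (z, s) = dird (a, 0) (\<lambda>x. snd x ^ n * dird b (f n) (fst x)) (z, s)"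
    proof (rule dird_cong[OF V that])
      fix y assume "y \<in> ?V"
      then have "fst y \<in> U" by auto
      from dg0[OF df(1)[OF this], of b n n "snd y"]
      show "dird (b, 0) (g n) y = snd y ^ n * dird b (f n) (fst y)" by (simp add: g_def[abs_def])
    qed
    then show ?thesis using dg0 df that by auto
  qed
  have dss: "dird (0, 1) (dird (0, 1) (g n)) (z, s) = real n * (real (n - 1) * s ^ (n - 2)) * f n z"
    if "(z, s) \<in> ?V" for n z s
  proof -
    have "dird (0, 1) (dird (0, 1) (g n)) (z, s)
      = dird (0, 1) (\<lambda>x. snd x ^ (n - 1) * (real n * f n (fst x))) (z, s)"
      by (rule dird_cong[OF V that]) (use dg1 df in \<open>auto simp: g_def[abs_def]\<close>)
    also have "\<dots> = real (n - 1) * s ^ (n - 1 - 1) * (real n * f n z)"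
      by (rule dg1) (use df that in \<open>auto intro!: differentiable_mult\<close>)
    finally show ?thesis by (simp add: numeral_2_eq_2)
  qed
  have init: "F (z, 0) = F0 z \<and> dird (0, 1) F (z, 0) = F1 z" if z: "z \<in> U" for z
  proof
    have "F (z, 0) = (\<Sum>n. if n = 0 then F0 z else 0)"
      unfolding F_def by (rule suminf_cong) (auto simp: g_def f_def)
    then show "F (z, 0) = F0 z" using suminf_finite[of "{0}" "\<lambda>n. if n = 0 then F0 z else 0"] by simp
    have "dird (0, 1) F (z, 0) = (\<Sum>n. dird (0, 1) (g n) (z, 0))"
      by (rule d_F) (use z \<delta> in auto)
    also have "\<dots> = (\<Sum>n. if n = 1 then F1 z else 0)"
      using dg1[of "f _" z _ 0] df[OF z] by (intro suminf_cong) (auto simp: g_def[abs_def] f_def)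
    finally show "dird (0, 1) F (z, 0) = F1 z"
      using suminf_finite[of "{1}" "\<lambda>n. if n = 1 then F1 z else 0"] by simp
  qed
  have eq: "pde \<kappa> c F (z, s)" if zs: "(z, s) \<in> ?V" for z s
  proof -
    have opF: "dird (a, 0) (dird (b, 0) F) (z, s) = (\<Sum>n. s ^ n * dird a (dird b (f n)) z)"
      and sm: "summable (\<lambda>n. \<bar>s ^ n * dird a (dird b (f n)) z\<bar>)"
      if "a \<in> Basis" "b \<in> Basis" for a b
      using d2_F[OF zs, of "(a, 0)" "(b, 0)"] d2_sum[OF zs, of "(a, 0)" "(b, 0)"] dgg[OF zs] that by simp_all
    note smc = summable_rabs_cancel[OF sm]
    have coX: "coP F (z, s) = (\<Sum>n. s ^ n * opP (f n) z)" "coQ F (z, s) = (\<Sum>n. s ^ n * opQ (f n) z)"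
      "coR F (z, s) = (\<Sum>n. s ^ n * opR (f n) z)" "coT F (z, s) = (\<Sum>n. s ^ n * opT (f n) z)"
      unfolding co_defs op_defs distrib_left right_diff_distrib
      by (simp_all add: opF suminf_add[symmetric] suminf_diff[symmetric] smc)
    have absX: "summable (\<lambda>n. \<bar>s ^ n * opP (f n) z\<bar>)" "summable (\<lambda>n. \<bar>s ^ n * opQ (f n) z\<bar>)"
      "summable (\<lambda>n. \<bar>s ^ n * opR (f n) z\<bar>)" "summable (\<lambda>n. \<bar>s ^ n * opT (f n) z\<bar>)"
      unfolding op_defs distrib_left right_diff_distrib
      by (intro summable_abs_add sm; simp)+
    \<comment> \<open>By the Cauchy product \<open>q N\<close> is the \<open>N\<close>-th
      coefficient of \<open>Delta F\<close> in \<open>s\<close>; multiplication by \<open>s\<close>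
      and \<open>s^2\<close> shifts these to \<open>q1\<close> and \<open>q2\<close> below.\<close>
    define q where "q N = (\<Sum>i\<le>N. polar (f i) (f (N - i)) z)" for N
    have "(\<lambda>N. s ^ N * q N) sums Delta F (z, s)"
    proof -
      have C: "(\<lambda>N. \<Sum>i\<le>N. (s ^ i * X i) * (s ^ (N - i) * Y (N - i))) sums
          ((\<Sum>n. s ^ n * X n) * (\<Sum>n. s ^ n * Y n))"
        if "summable (\<lambda>n. \<bar>s ^ n * X n\<bar>)" "summable (\<lambda>n. \<bar>s ^ n * Y n\<bar>)" for X Y
        by (rule Cauchy_product_sums) (use that in simp_all)
      have "(\<lambda>N. (\<Sum>i\<le>N. (s ^ i * opP (f i) z) * (s ^ (N - i) * opQ (f (N - i)) z))
          - (\<Sum>i\<le>N. (s ^ i * opR (f i) z) * (s ^ (N - i) * opR (f (N - i)) z))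
          - (\<Sum>i\<le>N. (s ^ i * opT (f i) z) * (s ^ (N - i) * opT (f (N - i)) z))) sums Delta F (z, s)"
        unfolding Delta_def coX power2_eq_square by (intro sums_diff C absX)
      also have "(\<lambda>N. (\<Sum>i\<le>N. (s ^ i * opP (f i) z) * (s ^ (N - i) * opQ (f (N - i)) z))
          - (\<Sum>i\<le>N. (s ^ i * opR (f i) z) * (s ^ (N - i) * opR (f (N - i)) z))
          - (\<Sum>i\<le>N. (s ^ i * opT (f i) z) * (s ^ (N - i) * opT (f (N - i)) z))) = (\<lambda>N. s ^ N * q N)"
      proof
        fix N
        have "s ^ N * polar (f i) (f (N - i)) z = (s ^ i * opP (f i) z) * (s ^ (N - i) * opQ (f (N - i)) z)
          - (s ^ i * opR (f i) z) * (s ^ (N - i) * opR (f (N - i)) z)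
          - (s ^ i * opT (f i) z) * (s ^ (N - i) * opT (f (N - i)) z)" if "i \<in> {..N}" for i
        proof -
          have "s ^ N = s ^ i * s ^ (N - i)" using that by (simp flip: power_add)
          then show ?thesis by (simp add: polar_def algebra_simps)
        qed
        then show "(\<Sum>i\<le>N. (s ^ i * opP (f i) z) * (s ^ (N - i) * opQ (f (N - i)) z))
          - (\<Sum>i\<le>N. (s ^ i * opR (f i) z) * (s ^ (N - i) * opR (f (N - i)) z))
          - (\<Sum>i\<le>N. (s ^ i * opT (f i) z) * (s ^ (N - i) * opT (f (N - i)) z)) = s ^ N * q N"
          unfolding q_def sum_distrib_left sum_subtractf[symmetric] by (intro sum.cong) auto
      qed
      finally show ?thesis .
    qed
    then have D0: "(\<lambda>N. s ^ N * q N) sums Delta F (z, s)" .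
    define q1 where "q1 n = (case n of 0 \<Rightarrow> 0 | Suc N \<Rightarrow> q N)" for n
    define q2 where "q2 n = (case n of 0 \<Rightarrow> 0 | Suc N \<Rightarrow> q1 N)" for n
    have D1: "(\<lambda>n. s ^ n * q1 n) sums (s * Delta F (z, s))"
    proof -
      have "(\<lambda>n. s ^ Suc n * q1 (Suc n)) sums (s * Delta F (z, s))"
        using sums_mult[OF D0, of s] by (simp add: q1_def mult.assoc)
      from sums_Suc[OF this] show ?thesis by (simp add: q1_def)
    qed
    have D2: "(\<lambda>n. s ^ n * q2 n) sums (s * (s * Delta F (z, s)))"
    proof -
      have "(\<lambda>n. s ^ Suc n * q2 (Suc n)) sums (s * (s * Delta F (z, s)))"
        using sums_mult[OF D1, of s] by (simp add: q2_def mult.assoc)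
      from sums_Suc[OF this] show ?thesis by (simp add: q2_def)
    qed
    have q12: "q1 n = (\<Sum>i<n. polar (f i) (f (n - 1 - i)) z)"
      "q2 n = (\<Sum>i<n - 1. polar (f i) (f (n - 2 - i)) z)" for n
      by (cases n; cases "n - 1"; simp add: q1_def q2_def q_def lessThan_Suc_atMost)+
    have "(\<lambda>n. s ^ n * (\<kappa> * (c * q1 n + q2 n))) sums (\<kappa> * (c * (s * Delta F (z, s)) + s * (s * Delta F (z,
        s))))"
      using sums_mult[OF sums_add[OF sums_mult[OF D1, of c] D2], of \<kappa>] by (simp add: algebra_simps)
    \<comment> \<open>This is the recursion of \<open>ck\<close>: the factor
      \<open>(n + 2) (n + 1)\<close> of the second derivative cancels its denominator.\<close>
    moreover have "s ^ n * (\<kappa> * (c * q1 n + q2 n)) = dird (0, 1) (dird (0, 1) (g (n + 2))) (z, s)" for n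
      unfolding dss[OF zs] q12 by (simp add: f_def add_ac)
    ultimately have "(\<lambda>n. dird (0, 1) (dird (0, 1) (g (n + 2))) (z, s)) sums
        (\<kappa> * (c * (s * Delta F (z, s)) + s * (s * Delta F (z, s))))" by simp
    \<comment> \<open>The terms for \<open>n = 0\<close> and \<open>n = 1\<close> have vanishing
      second \<open>s\<close>-derivative, so the shift by two drops nothing.\<close>
    then have "(\<lambda>n. dird (0, 1) (dird (0, 1) (g n)) (z, s)) sums
        (\<kappa> * (c * (s * Delta F (z, s)) + s * (s * Delta F (z, s))))"
      by (subst (asm) sums_iff_shift) (simp add: dss[OF zs] lessThan_Suc numeral_2_eq_2)
    then have "dird (0, 1) (dird (0, 1) F) (z, s) = \<kappa> * (c * (s * Delta F (z, s)) + s * (s * Delta F (z, s)))"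
      using d2_F[OF zs, of "(0, 1)" "(0, 1)"] by (simp add: sums_iff)
    then show ?thesis unfolding pde_def by (simp add: algebra_simps)
  qed
  show ?thesis
    using \<delta> maj_F init eq by (intro exI[of _ \<delta>] exI[of _ F] exI conjI) auto
qed

subsection \<open>Uniqueness\<close>

lemma dirn_Suc_right: "dirn h (Suc n) f = dirn h n (dird h f)"
  by (induction n) auto

lemma smooth_on_dirn: "open W \<Longrightarrow> smooth_on f W \<Longrightarrow> smooth_on (dirn h n f) W"
  by (induction n) (auto intro: smooth_on_dird)

lemma dirn_cong: "open W \<Longrightarrow> (\<And>x. x \<in> W \<Longrightarrow> f x = g x) \<Longrightarrow> x \<in> W \<Longrightarrow> dirn h n f x = dirn h n g x"
  by (induction n arbitrary: x) (auto intro: dird_cong)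

lemma dirn_add:
  assumes "open W" "smooth_on f W" "smooth_on g W"
  shows "x \<in> W \<Longrightarrow> dirn h n (\<lambda>x. f x + g x) x = dirn h n f x + dirn h n g x"
proof (induction n arbitrary: x)
  case (Suc n)
  have "dird h (dirn h n (\<lambda>x. f x + g x)) x = dird h (\<lambda>x. dirn h n f x + dirn h n g x) x"
    by (rule dird_cong[OF assms(1) Suc.prems]) (rule Suc.IH)
  then show ?case
    using smooth_on_differentiable[OF smooth_on_dirn[OF assms(1,2)] Suc.prems]
      smooth_on_differentiable[OF smooth_on_dirn[OF assms(1,3)] Suc.prems] by (simp add: dird_add)
qed simp

lemma dirn_scale:
  fixes f :: "'a::euclidean_space \<Rightarrow> real"
  assumes "open W" "smooth_on f W"
  shows "x \<in> W \<Longrightarrow> dirn (k *\<^sub>R h) n f x = k ^ n * dirn h n f x"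
proof (induction n arbitrary: x)
  case (Suc n)
  have d: "dirn h n f differentiable (at x)"
    using smooth_on_dirn[OF assms] Suc.prems smooth_on_differentiable by blast
  have "dird (k *\<^sub>R h) (dirn (k *\<^sub>R h) n f) x = dird (k *\<^sub>R h) (\<lambda>x. k ^ n * dirn h n f x) x"
    by (rule dird_cong[OF assms(1) Suc.prems]) (rule Suc.IH)
  also have "\<dots> = k ^ n * dird (k *\<^sub>R h) (dirn h n f) x" by (rule dird_cmult[OF d])
  also have "dird (k *\<^sub>R h) (dirn h n f) x = k * dird h (dirn h n f) x"
    using linear_scale[OF linear_dird[OF d]] by simp
  finally show ?case by simp
qed simp

lemma dirn_dird_commute:
  fixes f :: "'a::euclidean_space \<Rightarrow> real"
  assumes "open W" "smooth_on f W"
  shows "x \<in> W \<Longrightarrow> dirn h n (dird a f) x = dird a (dirn h n f) x"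
proof (induction n arbitrary: x)
  case (Suc n)
  have "dird h (dirn h n (dird a f)) x = dird h (dird a (dirn h n f)) x"
    by (rule dird_cong[OF assms(1) Suc.prems]) (rule Suc.IH)
  also have "\<dots> = dird a (dird h (dirn h n f)) x"
    by (rule dird_commute[OF assms(1) smooth_on_dirn[OF assms] Suc.prems])
  finally show ?case by simp
qed simp

text \<open>Vanishing to order \<open>m\<close> in \<open>s\<close> along \<open>s = 0\<close>.
  Asking for it over the whole open set \<open>U\<close> makes it stable under surface
  derivatives.\<close>

definition flat :: "nat \<Rightarrow> surf set \<Rightarrow> (base \<Rightarrow> real) \<Rightarrow> bool" where
  "flat m U g \<longleftrightarrow> (\<forall>j<m. \<forall>z\<in>U. dirn (0, 1) j g (z, 0) = 0)"

lemma flat_Suc: "flat (Suc m) U g \<longleftrightarrow> (\<forall>z\<in>U. g (z, 0) = 0) \<and> flat m U (dird (0, 1) g)"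
  unfolding flat_def by (auto simp: All_less_Suc2 dirn_Suc_right simp del: dirn.simps(2))

lemma flat_mono: "flat m U g \<Longrightarrow> k \<le> m \<Longrightarrow> flat k U g"
  unfolding flat_def by auto

context
  fixes U :: "surf set" and W :: "base set"
  assumes U: "open U" and W: "open W" and sub: "U \<times> {0} \<subseteq> W"
begin

lemma in_W: "z \<in> U \<Longrightarrow> (z, 0) \<in> W" using sub by auto

lemma flat_cong: "(\<And>x. x \<in> W \<Longrightarrow> f x = g x) \<Longrightarrow> flat m U f \<Longrightarrow> flat m U g"
  unfolding flat_def using dirn_cong[OF W, of f g] in_W by metis

lemma flat_add: "smooth_on f W \<Longrightarrow> smooth_on g W \<Longrightarrow> flat m U f \<Longrightarrow> flat m U g \<Longrightarrow> flat m U (\<lambda>x. f x + g x)"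
  unfolding flat_def using dirn_add[OF W, of f g] in_W by simp

text \<open>Flat functions form an ideal in the smooth functions, by induction with the product
  rule.\<close>

lemma flat_mult: "smooth_on h W \<Longrightarrow> smooth_on g W \<Longrightarrow> flat m U g \<Longrightarrow> flat m U (\<lambda>x. h x * g x)"
proof (induction m arbitrary: h g)
  case 0
  then show ?case by (simp add: flat_def)
next
  case (Suc m)
  have "flat m U (\<lambda>x. h x * dird (0, 1) g x + dird (0, 1) h x * g x)"
    using Suc.prems flat_Suc flat_mono[of "Suc m" U g m]
    by (intro flat_add Suc.IH smooth_on_mult smooth_on_dird W) auto
  then have "flat m U (dird (0, 1) (\<lambda>x. h x * g x))"
    by (rule flat_cong[rotated]) (use Suc.prems in \<open>simp add: dird_mult smooth_on_differentiable\<close>)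
  then show ?case using Suc.prems flat_Suc by simp
qed

lemma flat_diff: "smooth_on f W \<Longrightarrow> smooth_on g W \<Longrightarrow> flat m U f \<Longrightarrow> flat m U g \<Longrightarrow> flat m U (\<lambda>x. f x - g x)"
  using flat_add[of f "\<lambda>x. -1 * g x" m] flat_mult[of "\<lambda>x. -1" g m] smooth_on_minus[OF W, of g] by simp

text \<open>A surface derivative commutes with the \<open>s\<close>-derivatives, and these vanish
  identically on the slice over the open set \<open>U\<close>.\<close>

lemma flat_dird:
  assumes g: "smooth_on g W" and f: "flat m U g"
  shows "flat m U (dird (a, 0) g)"
  unfolding flat_def
proof (intro allI impI ballI)
  fix j z assume j: "j < m" and z: "z \<in> U"
  let ?G = "dirn (0, 1) j g"
  have "dirn (0, 1) j (dird (a, 0) g) (z, 0) = dird (a, 0) ?G (z, 0)"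
    by (rule dirn_dird_commute[OF W g in_W[OF z]])
  also have "\<dots> = dird a (\<lambda>w. ?G (w, 0)) z"
    by (rule dird_slice(1)[symmetric]) (rule smooth_on_differentiable[OF smooth_on_dirn[OF W g] in_W[OF z]])
  also have "\<dots> = dird a (\<lambda>w. 0) z"
    by (rule dird_cong[OF U z]) (use f j in \<open>auto simp: flat_def\<close>)
  finally show "dirn (0, 1) j (dird (a, 0) g) (z, 0) = 0" by simp
qed

lemma co_diff:
  assumes "smooth_on F W" "smooth_on G W" "x \<in> W"
  shows "coP (\<lambda>x. F x - G x) x = coP F x - coP G x" "coQ (\<lambda>x. F x - G x) x = coQ F x - coQ G x"
    "coR (\<lambda>x. F x - G x) x = coR F x - coR G x" "coT (\<lambda>x. F x - G x) x = coT F x - coT G x"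
proof -
  have "dird a (dird b (\<lambda>x. F x - G x)) x = dird a (dird b F) x - dird a (dird b G) x" for a b
  proof -
    have "dird a (dird b (\<lambda>x. F x - G x)) x = dird a (\<lambda>x. dird b F x - dird b G x) x"
      by (rule dird_cong[OF W assms(3)]) (use assms in \<open>simp add: dird_diff smooth_on_differentiable\<close>)
    then show ?thesis using smooth_on_differentiable[OF smooth_on_dird[OF W assms(1)] assms(3)]
        smooth_on_differentiable[OF smooth_on_dird[OF W assms(2)] assms(3)] by (simp add: dird_diff)
  qed
  then show "coP (\<lambda>x. F x - G x) x = coP F x - coP G x" "coQ (\<lambda>x. F x - G x) x = coQ F x - coQ G x"
    "coR (\<lambda>x. F x - G x) x = coR F x - coR G x" "coT (\<lambda>x. F x - G x) x = coT F x - coT G x"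
    unfolding co_defs by simp_all
qed

lemma flat_co:
  assumes g: "smooth_on g W" and f: "flat m U g"
  shows "flat m U (coP g)" "flat m U (coQ g)" "flat m U (coR g)" "flat m U (coT g)"
  unfolding co_defs[abs_def]
  by (intro flat_add flat_diff flat_dird smooth_on_dird W g f)+

text \<open>The difference \<open>H\<close> of two solutions satisfies a linear equation: its second
  \<open>s\<close>-derivative is a combination of \<open>coP H\<close> to \<open>coT H\<close> with
  smooth coefficients. Hence flatness of \<open>H\<close> passes to the second
  \<open>s\<close>-derivative, and the equal initial data raise its order.\<close>

lemma pde_unique_flat:
  assumes F: "smooth_on F W" and G: "smooth_on G W"
    and eqF: "\<And>x. x \<in> W \<Longrightarrow> pde \<kappa> c F x" and eqG: "\<And>x. x \<in> W \<Longrightarrow> pde \<kappa> c G x"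
    and i0: "\<And>z. z \<in> U \<Longrightarrow> F (z, 0) = G (z, 0)"
    and i1: "\<And>z. z \<in> U \<Longrightarrow> dird (0, 1) F (z, 0) = dird (0, 1) G (z, 0)"
  shows "flat m U (\<lambda>x. F x - G x)"
proof (induction m)
  case 0
  then show ?case by (simp add: flat_def)
next
  case (Suc m)
  define H where "H = (\<lambda>x. F x - G x)"
  have H: "smooth_on H W" unfolding H_def by (intro smooth_on_diff W F G)
  have IH: "flat m U H" using Suc by (simp add: H_def)
  have dH: "dird (0, 1) H x = dird (0, 1) F x - dird (0, 1) G x" if "x \<in> W" for x
    unfolding H_def using F G that by (simp add: dird_diff smooth_on_differentiable)
  have ddH: "dird (0, 1) (dird (0, 1) H) x = dird (0, 1) (dird (0, 1) F) x - dird (0, 1) (dird (0, 1) G) x"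
    if "x \<in> W" for x
  proof -
    have "dird (0, 1) (dird (0, 1) H) x = dird (0, 1) (\<lambda>x. dird (0, 1) F x - dird (0, 1) G x) x"
      by (rule dird_cong[OF W that]) (rule dH)
    then show ?thesis using smooth_on_differentiable[OF smooth_on_dird[OF W F] that]
        smooth_on_differentiable[OF smooth_on_dird[OF W G] that] by (simp add: dird_diff)
  qed
  \<comment> \<open>Mixed products are split as
    \<open>P_F Q_F - P_G Q_G = P_F Q_H + Q_G P_H\<close>, and squares as sum times
    difference.\<close>
  let ?X = "\<lambda>x. \<kappa> * (snd x * (snd x + c)) * (coP F x * coQ H x + coQ G x * coP H x
      - (coR F x + coR G x) * coR H x - (coT F x + coT G x) * coT H x)"
  note sm = smooth_on_co[OF W F] smooth_on_co[OF W G] smooth_on_co[OF W H]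
  have ssnd: "smooth_on (\<lambda>x::base. snd x) W" by (rule smooth_on_linear[OF bounded_linear_snd])
  have "flat m U ?X"
    by (rule flat_mult; (intro flat_mult flat_add flat_diff flat_co smooth_on_add smooth_on_diff smooth_on_mult
        smooth_on_const ssnd sm W H IH)?)
  then have "flat m U (dird (0, 1) (dird (0, 1) H))"
  proof (rule flat_cong[rotated])
    fix x assume x: "x \<in> W"
    show "?X x = dird (0, 1) (dird (0, 1) H) x"
      using eqF[OF x] eqG[OF x] unfolding ddH[OF x] pde_def Delta_def
      by (simp add: H_def co_diff[OF F G x] power2_eq_square algebra_simps)
  qed
  \<comment> \<open>The two initial data gain two orders, of which one is passed on.\<close>
  then have "flat (Suc (Suc m)) U H"
    unfolding flat_Suc using i0 i1 dH in_W by (auto simp: H_def)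
  then show ?case unfolding H_def by (rule flat_mono) simp
qed

end

lemma maj_diff_geo:
  assumes "open U" "maj U f (geo K \<tau>)" "maj U g (geo L \<sigma>)" "0 < \<tau>" "0 < \<sigma>" "0 \<le> K" "0 \<le> L"
  shows "maj U (\<lambda>x. f x - g x) (geo (K + L) (min \<tau> \<sigma>))"
proof (rule maj_mono[OF maj_diff[OF assms(1-3)]])
  fix m
  have "K / \<tau> ^ m \<le> K / min \<tau> \<sigma> ^ m" "L / \<sigma> ^ m \<le> L / min \<tau> \<sigma> ^ m"
    using assms by (auto intro!: divide_left_mono power_mono mult_pos_pos)
  then show "(geo K \<tau> + geo L \<sigma>) $ m \<le> geo (K + L) (min \<tau> \<sigma>) $ m"
    by (simp add: add_divide_distrib)
qed

text \<open>Everything happens on one line \<open>{z} \<times> {a<..<b}\<close>. The set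
  \<open>Z\<close> of parameters where all \<open>s\<close>-derivatives of the difference vanish is
  closed by continuity, open by Taylor's formula and contains 0; the interval is connected.\<close>

lemma analytic_diff_unique:
  fixes F G :: "base \<Rightarrow> real"
  assumes U: "open U" and ab: "a < 0" "0 < b"
    and F: "real_analytic_on F (U \<times> {a<..<b})" and G: "real_analytic_on G (U \<times> {a<..<b})"
    and flat: "\<And>m. flat m U (\<lambda>x. F x - G x)"
    and x: "x \<in> U \<times> {a<..<b}"
  shows "F x = G x"
proof -
  let ?W = "U \<times> {a<..<b}"
  define H where "H = (\<lambda>x. F x - G x)"
  have W: "open ?W" using U by (simp add: open_Times)
  have smH: "smooth_on H ?W"
    unfolding H_def by (intro smooth_on_diff W real_analytic_imp_smooth F G)
  obtain z s where zs: "x = (z, s)" "z \<in> U" "s \<in> {a<..<b}" using x by auto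
  define Z where "Z = {t \<in> {a<..<b}. \<forall>j. dirn (0, 1) j H (z, t) = 0}"
  have der: "((\<lambda>t. dirn (0, 1) j H (z, t)) has_real_derivative dirn (0, 1) (Suc j) H (z, t)) (at t)"
    if "t \<in> {a<..<b}" for j t
    using s_deriv_eq(2)[of "dirn (0, 1) j H" "(z, t)"] smooth_on_differentiable[OF smooth_on_dirn[OF W smH]]
      that zs by simp
  have "open Z"
  proof (subst open_subopen, rule ballI)
    fix t assume t: "t \<in> Z"
    then have tW: "(z, t) \<in> ?W" using zs by (auto simp: Z_def)
    obtain \<rho> K \<tau> where F': "0 < \<rho>" "0 < \<tau>" "0 \<le> K" "maj (ball (z, t) \<rho>) F (geo K \<tau>)"
      using real_analytic_imp_maj[OF F tW] by blast
    obtain \<rho>' K' \<tau>' where G': "0 < \<rho>'" "0 < \<tau>'" "0 \<le> K'" "maj (ball (z, t) \<rho>') G (geo K' \<tau>')"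
      using real_analytic_imp_maj[OF G tW] by blast
    obtain r0 where r0: "r0 > 0" "ball (z, t) r0 \<subseteq> ?W" using W tW openE by metis
    define r where "r = Min {\<rho>, \<rho>', r0, min \<tau> \<tau>'}"
    have r: "r > 0" "r \<le> \<rho>" "r \<le> \<rho>'" "r \<le> r0" "r \<le> min \<tau> \<tau>'"
      using F' G' r0 by (auto simp: r_def)
    have maj: "maj (ball (z, t) r) H (geo (K + K') (min \<tau> \<tau>'))"
      unfolding H_def
      by (rule maj_diff_geo[OF open_ball maj_subset[OF F'(4)] maj_subset[OF G'(4)]])
        (use r F' G' in auto)
    have zero: "H (z, t') = 0" if t': "\<bar>t' - t\<bar> < r" for t'
    proof -
      let ?h = "(0, t' - t) :: base"
      \<comment> \<open>The Taylor series along the \<open>s\<close>-direction has only vanishing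
        terms, as \<open>dirn_scale\<close> reduces them to the \<open>s\<close>-derivatives at
        \<open>t\<close>.\<close>
      have "(\<lambda>n. dirn ?h n H (z, t) / fact n) sums H ((z, t) + ?h)"
      proof (rule maj_taylor(1)[OF open_ball maj])
        show "(z, t) + \<theta> *\<^sub>R ?h \<in> ball (z, t) r" if "0 \<le> \<theta>" "\<theta> \<le> 1" for \<theta>
        proof -
          have "\<theta> * \<bar>t' - t\<bar> \<le> \<bar>t' - t\<bar>" using that by (simp add: mult_left_le_one_le)
          then show ?thesis using t' that by (simp add: dist_norm norm_Pair abs_mult)
        qed
        have "(\<Sum>b\<in>(Basis::base set). \<bar>?h \<bullet> b\<bar>) = \<bar>t' - t\<bar>"
        proof -
          have "(\<Sum>b\<in>(Basis::base set). \<bar>?h \<bullet> b\<bar>) = (\<Sum>b\<in>{(0, 1)::base}. \<bar>?h \<bullet> b\<bar>)"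
            by (rule sum.mono_neutral_right) (auto simp: Basis_prod_def inner_prod_def)
          then show ?thesis by (simp add: inner_prod_def)
        qed
        then show "(\<Sum>b\<in>(Basis::base set). \<bar>?h \<bullet> b\<bar>) < min \<tau> \<tau>'" using t' r by simp
        show "0 < min \<tau> \<tau>'" using F' G' by simp
      qed
      moreover have "dirn ?h n H (z, t) = 0" for n
      proof -
        have "?h = (t' - t) *\<^sub>R (0, 1)" by simp
        then show ?thesis using dirn_scale[OF W smH tW, of "t' - t" "(0, 1)" n] t by (simp add: Z_def)
      qed
      ultimately have "(\<lambda>n. 0) sums H (z, t')" by simp
      then show ?thesis using sums_zero sums_unique2 by blast
    qed
    have inI: "t' \<in> {a<..<b}" if "\<bar>t' - t\<bar> < r" for t'
    proof -
      have "(z, t') \<in> ball (z, t) r0" using that r by (simp add: dist_norm norm_Pair abs_minus_commute)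
      then show ?thesis using r0 by auto
    qed
    \<comment> \<open>Vanishing near \<open>t\<close> passes from one \<open>s\<close>-derivative to
      the next, because it holds on a whole interval.\<close>
    have "dirn (0, 1) j H (z, t') = 0" if "\<bar>t' - t\<bar> < r" for j t'
      using that
    proof (induction j arbitrary: t')
      case 0
      then show ?case using zero by simp
    next
      case (Suc j)
      have "((\<lambda>t. dirn (0, 1) j H (z, t)) has_real_derivative 0) (at t')"
      proof (rule DERIV_cong_ev[THEN iffD2, OF refl _ refl DERIV_const])
        have "t' \<in> ball t r" using Suc.prems by (simp add: dist_real_def abs_minus_commute)
        then have "\<forall>\<^sub>F y in nhds t'. y \<in> ball t r" by (intro eventually_nhds_in_open) auto
        then show "\<forall>\<^sub>F y in nhds t'. dirn (0, 1) j H (z, y) = 0"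
          by (rule eventually_mono) (auto intro!: Suc.IH simp: dist_real_def abs_minus_commute)
      qed
      then show ?case using der[OF inI[OF Suc.prems], of j] DERIV_unique by blast
    qed
    then have "ball t r \<subseteq> Z"
      using inI by (auto simp: Z_def dist_real_def abs_minus_commute)
    then show "\<exists>T. open T \<and> t \<in> T \<and> T \<subseteq> Z" using r by (intro exI[of _ "ball t r"]) auto
  qed
  then have "openin (top_of_set {a<..<b}) Z"
    by (subst openin_open_eq) (auto simp: Z_def)
  moreover have "closedin (top_of_set {a<..<b}) Z"
  proof -
    have "closedin (top_of_set {a<..<b}) {t \<in> {a<..<b}. dirn (0, 1) j H (z, t) = 0}" for j
      by (rule continuous_closedin_preimage_constant)
        (use DERIV_isCont[OF der] in \<open>auto intro!: continuous_at_imp_continuous_on\<close>)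
    then have "closedin (top_of_set {a<..<b}) (\<Inter>j. {t \<in> {a<..<b}. dirn (0, 1) j H (z, t) = 0})"
      by (intro closedin_INT) auto
    also have "(\<Inter>j. {t \<in> {a<..<b}. dirn (0, 1) j H (z, t) = 0}) = Z" by (auto simp: Z_def)
    finally show ?thesis .
  qed
  moreover have "0 \<in> Z"
    using flat zs ab unfolding Z_def flat_def H_def[symmetric] by auto
  ultimately have "Z = {a<..<b}"
    using connected_Ioo[of a b] unfolding connected_clopen by blast
  then have "dirn (0, 1) 0 H x = 0" using zs unfolding Z_def by blast
  then show ?thesis by (simp add: H_def)
qed

unbundle no fps_syntax and vec_syntax

subsection \<open>Products of 1-forms\<close>

definition skip :: "nat \<Rightarrow> (nat \<Rightarrow> 'v) \<Rightarrow> nat \<Rightarrow> 'v" where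
  "skip i v = (\<lambda>j. if j < i then v j else v (Suc j))"

text \<open>The wedge product of a 1-form with an \<open>n\<close>-form, expanded along the argument
  given to the 1-form. A general ring of values serves the real forms and the complex form
  \<open>hol_symp\<close> alike.\<close>

definition wone :: "nat \<Rightarrow> ('v \<Rightarrow> 'b::comm_ring_1) \<Rightarrow> ('v, 'b) covec \<Rightarrow> ('v, 'b) covec" where
  "wone n a \<gamma> v = (\<Sum>i\<le>n. (-1) ^ i * a (v i) * \<gamma> (skip i v))"

text \<open>The wedge product of a list of 1-forms by Laplace expansion along its head.\<close>

primrec wl :: "('v \<Rightarrow> 'b::comm_ring_1) list \<Rightarrow> ('v, 'b) covec" where
  "wl [] v = 1"
| "wl (a # as) v = wone (length as) a (wl as) v"

lemma skip_skip: "j < i \<Longrightarrow> skip j (skip i v) = skip (i - 1) (skip j v)"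
  by (cases i) (auto simp: skip_def fun_eq_iff)

text \<open>Removing two arguments in either order leaves the same rest with opposite sign, so
  symmetric expressions cancel in pairs. This one cancellation yields the anticommutation of
  1-forms, the vanishing of squares and the Leibniz rule for \<open>ext_d\<close>.\<close>

lemma double_skip_sum_eq_0:
  fixes Y :: "'v \<Rightarrow> 'v \<Rightarrow> (nat \<Rightarrow> 'v) \<Rightarrow> 'b::comm_ring_1"
  assumes Y: "\<And>p q w. Y p q w = Y q p w"
  shows "(\<Sum>i\<le>Suc n. \<Sum>j\<le>n. (-1) ^ (i + j) * Y (v i) (skip i v j) (skip j (skip i v))) = 0"
proof -
  define G where "G = (\<lambda>(i, j). (-1) ^ (i + j) * Y (v i) (skip i v j) (skip j (skip i v)))"
  let ?A = "{(i, j). i \<le> Suc n \<and> j \<le> n \<and> j < i}" and ?B = "{(i, j). i \<le> Suc n \<and> j \<le> n \<and> i \<le> j}"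
  have fin: "finite ?A" "finite ?B"
    by (rule finite_subset[of _ "{..Suc n} \<times> {..n}"]; auto)+
  have "(\<Sum>i\<le>Suc n. \<Sum>j\<le>n. (-1) ^ (i + j) * Y (v i) (skip i v j) (skip j (skip i v))) = sum G ({..Suc n} \<times> {..n})"
    by (simp add: sum.cartesian_product G_def)
  also have "{..Suc n} \<times> {..n} = ?A \<union> ?B" by auto
  also have "sum G (?A \<union> ?B) = sum G ?A + sum G ?B"
    by (rule sum.union_disjoint) (use fin in auto)
  \<comment> \<open>The pair \<open>(i, j)\<close> with \<open>j < i\<close> is matched with
    \<open>(j, i - 1)\<close>, the same two arguments removed in the other order.\<close>
  also have "sum G ?A = (\<Sum>x\<in>?B. - G x)"
  proof (rule sum.reindex_bij_witness[where i="\<lambda>(i, j). (Suc j, i)" and j="\<lambda>(i, j). (j, i - 1)"])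
    fix x assume "x \<in> ?A"
    then obtain i j where x: "x = (Suc i, j)" "i \<le> n" "j \<le> i"
      by (cases x; cases "fst x") auto
    show "- G (case x of (i, j) \<Rightarrow> (j, i - 1)) = G x"
      using x Y[of "v (Suc i)" "v j"] skip_skip[of j "Suc i" v]
      by (simp add: G_def skip_def[of "Suc i" v] skip_def[of j v] add.commute)
  qed auto
  finally show ?thesis by (simp add: sum_negf)
qed

lemma wone_cong: "(\<And>w. \<gamma> w = \<delta> w) \<Longrightarrow> wone n a \<gamma> v = wone n a \<delta> v"
  unfolding wone_def by simp

lemma wone_wone:
  "wone (Suc n) a (wone n b \<gamma>) v =
    (\<Sum>i\<le>Suc n. \<Sum>j\<le>n. (-1) ^ (i + j) * (a (v i) * b (skip i v j) * \<gamma> (skip j (skip i v))))"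
  unfolding wone_def sum_distrib_left by (intro sum.cong refl) (simp add: power_add mult_ac)

lemma wone_swap: "wone (Suc n) a (wone n b \<gamma>) v = - wone (Suc n) b (wone n a \<gamma>) v"
proof -
  have "wone (Suc n) a (wone n b \<gamma>) v + wone (Suc n) b (wone n a \<gamma>) v = 0"
    unfolding wone_wone sum.distrib[symmetric] distrib_left[symmetric]
    by (rule double_skip_sum_eq_0[where Y="\<lambda>p q w. a p * b q * \<gamma> w + b p * a q * \<gamma> w"]) (simp add:
        algebra_simps)
  then show ?thesis by (simp add: add_eq_0_iff2)
qed

lemma wone_same: "wone (Suc n) a (wone n a \<gamma>) v = 0"
  unfolding wone_wone
  by (rule double_skip_sum_eq_0[where Y="\<lambda>p q w. a p * a q * \<gamma> w"]) (simp add: algebra_simps)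

lemma wone_add: "wone n a (\<lambda>w. \<gamma> w + \<delta> w) v = wone n a \<gamma> v + wone n a \<delta> v"
  unfolding wone_def by (simp add: algebra_simps sum.distrib)

lemma wone_cmult: "wone n a (\<lambda>w. k * \<gamma> w) v = k * wone n a \<gamma> v"
  unfolding wone_def sum_distrib_left by (intro sum.cong refl) (simp add: algebra_simps)

lemma wone_zero [simp]: "wone n a (\<lambda>w. 0) v = 0"
  unfolding wone_def by simp

text \<open>The sign of the sorting permutation as the parity of inversions; a repeated index gives
  0, as does the product of 1-forms.\<close>

primrec psign :: "nat list \<Rightarrow> int" where
  "psign [] = 1"
| "psign (x # xs) = (if x \<in> set xs then 0 else (-1) ^ length (filter (\<lambda>y. y < x) xs) * psign xs)"

lemma wl_insort:
  "sorted ys \<Longrightarrow> x \<notin> set ys \<Longrightarrow>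
    wl (\<theta> x # map \<theta> ys) v = (-1) ^ length (filter (\<lambda>y. y < x) ys) * wl (map \<theta> (insort x ys)) v"
proof (induction ys arbitrary: v)
  case (Cons y ys)
  show ?case
  proof (cases "x \<le> y")
    case True
    then have "filter (\<lambda>z. z < x) (y # ys) = []" using Cons.prems by (auto simp: filter_empty_conv)
    then show ?thesis using True by simp
  next
    case False
    have "wl (\<theta> x # map \<theta> (y # ys)) v = - wone (Suc (length ys)) (\<theta> y) (wl (\<theta> x # map \<theta> ys)) v"
      using wone_swap[of "length ys" "\<theta> x" "\<theta> y"] by (simp add: wone_cong[OF wl.simps(2)])
    also have "\<dots> = - wone (Suc (length ys)) (\<theta> y)
        (\<lambda>w. (-1) ^ length (filter (\<lambda>y. y < x) ys) * wl (map \<theta> (insort x ys)) w) v"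
      using Cons by (intro arg_cong[where f=uminus] wone_cong) auto
    finally show ?thesis using False by (simp add: wone_cmult)
  qed
qed simp

lemma wl_repeat: "x \<in> set ys \<Longrightarrow> wl (\<theta> x # map \<theta> ys) v = 0"
proof (induction ys arbitrary: v)
  case (Cons y ys)
  show ?case
  proof (cases "x = y")
    case True
    then show ?thesis using wone_same[of "length ys" "\<theta> x"] by (simp add: wone_cong[OF wl.simps(2)])
  next
    case False
    have "wl (\<theta> x # map \<theta> (y # ys)) v = - wone (Suc (length ys)) (\<theta> y) (wl (\<theta> x # map \<theta> ys)) v"
      using wone_swap[of "length ys" "\<theta> x" "\<theta> y"] by (simp add: wone_cong[OF wl.simps(2)])
    also have "wone (Suc (length ys)) (\<theta> y) (wl (\<theta> x # map \<theta> ys)) v = wone (Suc (length ys)) (\<theta> y) (\<lambda>w. 0) v"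
      by (rule wone_cong) (use Cons False in auto)
    finally show ?thesis by simp
  qed
qed simp

text \<open>The normal form of products of coframe elements: increasing words remain, and identities
  of forms become identities of their coefficients.\<close>

lemma wl_sort: "wl (map \<theta> is) v = of_int (psign is) * wl (map \<theta> (sort is)) v"
proof (induction "is" arbitrary: v)
  case (Cons x xs)
  have "wl (map \<theta> (x # xs)) v = wone (length xs) (\<theta> x) (\<lambda>w. of_int (psign xs) * wl (map \<theta> (sort xs)) w) v"
    using Cons by (simp add: wone_cong[OF Cons])
  also have "\<dots> = of_int (psign xs) * wl (\<theta> x # map \<theta> (sort xs)) v" by (simp add: wone_cmult)
  also have "\<dots> = of_int (psign (x # xs)) * wl (map \<theta> (sort (x # xs))) v"
  proof (cases "x \<in> set xs")
    case True
    then show ?thesis using wl_repeat[of x "sort xs" \<theta> v] by simp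
  next
    case False
    have "length (filter (\<lambda>y. y < x) (sort xs)) = length (filter (\<lambda>y. y < x) xs)"
      by (metis mset_filter mset_sort size_mset)
    then show ?thesis using wl_insort[of "sort xs" x \<theta> v] False by (simp add: mult_ac)
  qed
  finally show ?case .
qed simp

text \<open>A form as a linear combination of products of the 1-forms \<open>\<theta> i\<close>.
  Words may be unsorted or occur several times; normalisation is left to
  \<open>wl_sort\<close>.\<close>

definition ev :: "(nat \<Rightarrow> 'v \<Rightarrow> 'b::comm_ring_1) \<Rightarrow> ('b \<times> nat list) list \<Rightarrow> ('v, 'b) covec" where
  "ev \<theta> cs v = (\<Sum>(c, is)\<leftarrow>cs. c * wl (map \<theta> is) v)"

lemma ev_Nil [simp]: "ev \<theta> [] v = 0"
  and ev_Cons [simp]: "ev \<theta> ((c, is) # cs) v = c * wl (map \<theta> is) v + ev \<theta> cs v"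
  and ev_append [simp]: "ev \<theta> (cs @ ds) v = ev \<theta> cs v + ev \<theta> ds v"
  by (simp_all add: ev_def)

lemma wone_ev:
  "(\<And>c is. (c, is) \<in> set cs \<Longrightarrow> length is = n) \<Longrightarrow>
    wone n (\<theta> k) (ev \<theta> cs) v = ev \<theta> (map (\<lambda>(c, is). (c, k # is)) cs) v"
proof (induction cs)
  case (Cons x cs)
  obtain c "is" where x: "x = (c, is)" by (cases x)
  have "wone n (\<theta> k) (ev \<theta> cs) v = ev \<theta> (map (\<lambda>(c, is). (c, k # is)) cs) v"
    by (rule Cons.IH) (use Cons.prems in auto)
  moreover have "length is = n" using Cons.prems x by auto
  ultimately show ?case using x by (simp add: wone_add wone_cmult)
qed (simp add: wone_cong[OF ev_Nil])

subsection \<open>Leibniz formula and wedge products\<close>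

text \<open>The cycle that puts argument \<open>i\<close> in front; on the remaining positions it
  acts as \<open>skip i\<close> does.\<close>

primrec cyc :: "nat \<Rightarrow> nat \<Rightarrow> nat" where
  "cyc 0 = id"
| "cyc (Suc i) = Transposition.transpose i (Suc i) \<circ> cyc i"

lemma cyc_0: "cyc i 0 = i"
  by (induction i) (auto simp: Transposition.transpose_def)

lemma cyc_Suc: "cyc i (Suc k) = (if k < i then k else Suc k)"
  by (induction i) (auto simp: Transposition.transpose_def)

lemma cyc_permutes: "i \<le> n \<Longrightarrow> cyc i permutes {..<Suc n}"
  by (induction i) (auto simp: permutes_id intro!: permutes_compose permutes_swap_id)

lemma sign_cyc: "sign (cyc i) = (-1) ^ i"
proof (induction i)
  case (Suc i)
  have "permutation (cyc i)"
    using cyc_permutes[of i i] by (auto simp: permutation_permutes)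
  then show ?case
    unfolding cyc.simps sign_compose[OF permutation_swap_id \<open>permutation (cyc i)\<close>] Suc by (simp add:
        sign_swap_id)
qed simp

text \<open>The permutation \<open>\<tau>\<close> of the first \<open>n\<close> numbers, moved to
  the block that starts at \<open>p\<close>.\<close>

definition shp :: "nat \<Rightarrow> nat \<Rightarrow> (nat \<Rightarrow> nat) \<Rightarrow> nat \<Rightarrow> nat" where
  "shp p n \<tau> = map_permutation {..<n} (\<lambda>j. p + j) \<tau>"

lemma shp_permutes: "\<tau> permutes {..<n} \<Longrightarrow> shp p n \<tau> permutes {p..<p + n}"
proof -
  have "bij_betw (\<lambda>j. p + j) {..<n} {p..<p + n}"
    by (rule bij_betw_byWitness[where f'="\<lambda>j. j - p"]) auto
  then show "\<tau> permutes {..<n} \<Longrightarrow> shp p n \<tau> permutes {p..<p + n}"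
    unfolding shp_def by (rule map_permutation_permutes)
qed

lemma shp_apply: "j < n \<Longrightarrow> shp p n \<tau> (p + j) = p + \<tau> j"
  unfolding shp_def by (rule map_permutation_apply) auto

lemma sign_shp: "\<tau> permutes {..<n} \<Longrightarrow> sign (shp p n \<tau>) = sign \<tau>"
  unfolding shp_def by (rule sign_map_permutation) auto

text \<open>A permutation is determined by the image \<open>i\<close> of 0 and a permutation of the
  rest, and its sign is \<open>(-1)^i\<close> times that of the rest.\<close>

lemma sum_permutes_Suc:
  fixes F :: "(nat \<Rightarrow> nat) \<Rightarrow> 'b::comm_ring_1"
  shows "(\<Sum>\<sigma> | \<sigma> permutes {..<Suc n}. of_int (sign \<sigma>) * F \<sigma>) =
    (\<Sum>i\<le>n. (-1) ^ i * (\<Sum>\<tau> | \<tau> permutes {..<n}. of_int (sign \<tau>) * F (cyc i \<circ> shp 1 n \<tau>)))"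
proof -
  let ?P = "\<lambda>n. {\<sigma>::nat \<Rightarrow> nat. \<sigma> permutes {..<n}}"
  define h where "h = (\<lambda>(i, \<tau>). cyc i \<circ> shp 1 n \<tau>)"
  have sh: "shp 1 n \<tau> permutes {..<Suc n}" if "\<tau> permutes {..<n}" for \<tau>
    by (rule permutes_subset[OF shp_permutes[OF that]]) auto
  have h0: "h (i, \<tau>) 0 = i" if "\<tau> permutes {..<n}" for i \<tau>
    using permutes_not_in[OF shp_permutes[OF that, of 1], of 0] by (simp add: h_def cyc_0)
  have sub: "h ` ({..n} \<times> ?P n) \<subseteq> ?P (Suc n)"
    using permutes_compose[OF sh cyc_permutes] by (auto simp: h_def)
  have inj: "inj_on h ({..n} \<times> ?P n)"
  proof (rule inj_onI)
    fix x y assume x: "x \<in> {..n} \<times> ?P n" and y: "y \<in> {..n} \<times> ?P n" and e: "h x = h y"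
    obtain i \<tau> where x': "x = (i, \<tau>)" by (cases x)
    obtain k \<rho> where y': "y = (k, \<rho>)" by (cases y)
    have ik: "i = k" using h0[of \<tau> i] h0[of \<rho> k] x y x' y' e by auto
    have "\<tau> j = \<rho> j" for j
    proof (cases "j < n")
      case True
      have "cyc i (Suc (\<tau> j)) = cyc i (Suc (\<rho> j))"
        using fun_cong[OF e, of "1 + j"] True shp_apply[of j n 1] by (simp add: h_def x' y' ik)
      moreover have "inj (cyc i)" using cyc_permutes[of i i] permutes_inj by blast
      ultimately show ?thesis by (auto dest: injD)
    next
      case False
      then show ?thesis
        using x y x' y' permutes_not_in[of \<tau> "{..<n}" j] permutes_not_in[of \<rho> "{..<n}" j] by auto
    qed
    then show "x = y" using ik x' y' by auto
  qed
  \<comment> \<open>Injectivity and \<open>(n + 1)! = (n + 1) n!\<close> give surjectivity.\<close>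
  have "card (h ` ({..n} \<times> ?P n)) = card (?P (Suc n))"
    using card_image[OF inj] card_permutations[of "{..<n}" n] card_permutations[of "{..<Suc n}" "Suc n"]
        by (simp add: card_cartesian_product)
  then have img: "h ` ({..n} \<times> ?P n) = ?P (Suc n)"
    by (intro card_subset_eq sub) (simp_all add: finite_permutations)
  have sg: "sign (h (i, \<tau>)) = (-1) ^ i * sign \<tau>" if "\<tau> permutes {..<n}" for i \<tau>
  proof -
    have "permutation (cyc i)" using cyc_permutes[of i i] by (auto simp: permutation_permutes)
    moreover have "permutation (shp 1 n \<tau>)" using sh[OF that] by (auto simp: permutation_permutes)
    ultimately show ?thesis by (simp add: h_def sign_compose sign_cyc sign_shp[OF that])
  qed
  have "(\<Sum>\<sigma>\<in>?P (Suc n). of_int (sign \<sigma>) * F \<sigma>) = (\<Sum>x\<in>{..n} \<times> ?P n. of_int (sign (h x)) * F (h x))"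
    unfolding img[symmetric] by (subst sum.reindex[OF inj]) simp
  also have "\<dots> = (\<Sum>i\<le>n. \<Sum>\<tau>\<in>?P n. of_int (sign (h (i, \<tau>))) * F (h (i, \<tau>)))"
    by (simp add: sum.cartesian_product)
  also have "\<dots> = (\<Sum>i\<le>n. (-1) ^ i * (\<Sum>\<tau>\<in>?P n. of_int (sign \<tau>) * F (cyc i \<circ> shp 1 n \<tau>)))"
    unfolding sum_distrib_left
    by (intro sum.cong refl) (simp add: sg mult.assoc, simp add: h_def)
  finally show ?thesis .
qed

text \<open>Iterated Laplace expansion along the first row is the Leibniz formula;
  \<open>sum_permutes_Suc\<close> is the inductive step.\<close>

lemma wl_leibniz:
  "(\<Sum>\<sigma> | \<sigma> permutes {..<length as}. of_int (sign \<sigma>) * (\<Prod>j<length as. (as ! j) (v (\<sigma> j)))) = wl as v"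
proof (induction as arbitrary: v)
  case (Cons a as)
  let ?n = "length as"
  have eq: "(\<Prod>j<Suc ?n. ((a # as) ! j) (v ((cyc i \<circ> shp 1 ?n \<tau>) j)))
      = a (v i) * (\<Prod>j<?n. (as ! j) (skip i v (\<tau> j)))" if \<tau>: "\<tau> permutes {..<?n}" for i \<tau>
  proof -
    have "(cyc i \<circ> shp 1 ?n \<tau>) 0 = i"
      using permutes_not_in[OF shp_permutes[OF \<tau>, of 1], of 0] by (simp add: cyc_0)
    moreover have "v ((cyc i \<circ> shp 1 ?n \<tau>) (Suc j)) = skip i v (\<tau> j)" if "j < ?n" for j
      using shp_apply[OF that, of 1 \<tau>] by (simp add: cyc_Suc skip_def)
    ultimately show ?thesis
      unfolding prod.lessThan_Suc_shift by (auto intro!: prod.cong)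
  qed
  have "(\<Sum>\<sigma> | \<sigma> permutes {..<Suc ?n}. of_int (sign \<sigma>) * (\<Prod>j<Suc ?n. ((a # as) ! j) (v (\<sigma> j))))
    = (\<Sum>i\<le>?n. (-1) ^ i * (\<Sum>\<tau> | \<tau> permutes {..<?n}. of_int (sign \<tau>) *
        (\<Prod>j<Suc ?n. ((a # as) ! j) (v ((cyc i \<circ> shp 1 ?n \<tau>) j)))))"
    by (rule sum_permutes_Suc)
  also have "\<dots> = (\<Sum>i\<le>?n. (-1) ^ i * (\<Sum>\<tau> | \<tau> permutes {..<?n}. of_int (sign \<tau>) *
        (a (v i) * (\<Prod>j<?n. (as ! j) (skip i v (\<tau> j))))))"
    by (intro sum.cong refl arg_cong2[where f="(*)"] eq) auto
  also have "\<dots> = (\<Sum>i\<le>?n. (-1) ^ i * (a (v i) * wl as (skip i v)))"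
    by (simp add: Cons.IH[symmetric] sum_distrib_left mult_ac)
  finally show ?case by (simp add: wone_def mult.assoc)
qed simp

text \<open>Permutations of the two blocks can be absorbed into the outer permutation together with
  their signs. Each of the \<open>p! q!\<close> pairs contributes the same, which the denominator of
  \<open>wedge\<close> cancels.\<close>

lemma wedge_wl:
  fixes as bs :: "('v \<Rightarrow> 'b::field_char_0) list"
  assumes "length as = p" "length bs = q"
  shows "wedge p q (wl as) (wl bs) v = wl (as @ bs) v"
proof -
  let ?P = "\<lambda>n. {\<sigma>::nat \<Rightarrow> nat. \<sigma> permutes {..<n}}"
  define F where "F \<sigma> = (\<Prod>k<p + q. ((as @ bs) ! k) (v (\<sigma> k)))" for \<sigma> :: "nat \<Rightarrow> nat"
  have F: "(\<Prod>i<p. (as ! i) (v (\<sigma> (\<tau> i)))) * (\<Prod>j<q. (bs ! j) (v (\<sigma> (p + \<rho> j)))) = F (\<sigma> \<circ> (\<tau> \<circ> shp p q \<rho>))"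
    if \<tau>: "\<tau> permutes {..<p}" and \<rho>: "\<rho> permutes {..<q}" for \<sigma> \<tau> \<rho>
  proof -
    have 1: "shp p q \<rho> i = i" if "i < p" for i
      using permutes_not_in[OF shp_permutes[OF \<rho>, of p], of i] that by simp
    have 2: "\<tau> (shp p q \<rho> (p + j)) = p + \<rho> j" if "j < q" for j
      using permutes_not_in[OF \<tau>, of "p + \<rho> j"] shp_apply[OF that, of p \<rho>] by simp
    have "F (\<sigma> \<circ> (\<tau> \<circ> shp p q \<rho>)) = (\<Prod>k<p. ((as @ bs) ! k) (v (\<sigma> (\<tau> (shp p q \<rho> k)))))
        * (\<Prod>j<q. ((as @ bs) ! (p + j)) (v (\<sigma> (\<tau> (shp p q \<rho> (p + j))))))"
    proof -
      have "(\<Prod>k<p + q. h k) = (\<Prod>k<p. h k) * (\<Prod>j<q. h (p + j))" for h :: "nat \<Rightarrow> 'b"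
        by (induction q) (auto simp: mult_ac)
      then show ?thesis unfolding F_def by simp
    qed
    then show ?thesis using assms 1 2 by (simp add: nth_append)
  qed
  have inner: "(\<Sum>\<sigma>\<in>?P (p + q). of_int (sign \<sigma>) * (of_int (sign \<tau>) * of_int (sign \<rho>) * F (\<sigma> \<circ> (\<tau> \<circ> shp p q \<rho>))))
      = wl (as @ bs) v" if \<tau>: "\<tau> permutes {..<p}" and \<rho>: "\<rho> permutes {..<q}" for \<tau> \<rho>
  proof -
    let ?\<pi> = "\<tau> \<circ> shp p q \<rho>"
    have \<tau>': "\<tau> permutes {..<p + q}" by (rule permutes_subset[OF \<tau>]) auto
    have \<rho>': "shp p q \<rho> permutes {..<p + q}" by (rule permutes_subset[OF shp_permutes[OF \<rho>]]) auto
    have \<pi>: "?\<pi> permutes {..<p + q}" by (rule permutes_compose[OF \<rho>' \<tau>'])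
    have pm: "permutation \<tau>" "permutation (shp p q \<rho>)" "permutation ?\<pi>"
      using \<tau>' \<rho>' \<pi> by (auto simp: permutation_permutes)
    have s\<pi>: "sign ?\<pi> = sign \<tau> * sign \<rho>" using pm by (simp add: sign_compose sign_shp[OF \<rho>])
    have "(\<Sum>\<sigma>\<in>?P (p + q). of_int (sign \<sigma>) * (of_int (sign \<tau>) * of_int (sign \<rho>) * F (\<sigma> \<circ> ?\<pi>)))
      = (\<Sum>\<sigma>\<in>?P (p + q). of_int (sign (\<sigma> \<circ> ?\<pi>)) * F (\<sigma> \<circ> ?\<pi>))"
    proof (rule sum.cong[OF refl])
      fix \<sigma> assume "\<sigma> \<in> ?P (p + q)"
      then have "permutation \<sigma>" by (auto simp: permutation_permutes)
      then show "of_int (sign \<sigma>) * (of_int (sign \<tau>) * of_int (sign \<rho>) * F (\<sigma> \<circ> ?\<pi>))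
        = of_int (sign (\<sigma> \<circ> ?\<pi>)) * F (\<sigma> \<circ> ?\<pi>)"
        using sign_compose[OF _ pm(3)] s\<pi> by (simp add: mult.assoc)
    qed
    also have "\<dots> = (\<Sum>\<sigma>\<in>?P (p + q). of_int (sign \<sigma>) * F \<sigma>)"
      by (rule sum_permutations_compose_right[OF \<pi>, symmetric])
    also have "\<dots> = wl (as @ bs) v"
      using wl_leibniz[of "as @ bs" v] assms by (simp add: F_def)
    finally show ?thesis .
  qed
  have "(\<Sum>\<sigma>\<in>?P (p + q). of_int (sign \<sigma>) * wl as (\<lambda>i. v (\<sigma> i)) * wl bs (\<lambda>i. v (\<sigma> (p + i))))
    = (\<Sum>\<sigma>\<in>?P (p + q). \<Sum>\<tau>\<in>?P p. \<Sum>\<rho>\<in>?P q.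
        of_int (sign \<sigma>) * (of_int (sign \<tau>) * of_int (sign \<rho>) * F (\<sigma> \<circ> (\<tau> \<circ> shp p q \<rho>))))"
  proof (rule sum.cong[OF refl])
    fix \<sigma>
    have "wl as (\<lambda>i. v (\<sigma> i)) * wl bs (\<lambda>i. v (\<sigma> (p + i))) =
      (\<Sum>\<tau>\<in>?P p. \<Sum>\<rho>\<in>?P q. (of_int (sign \<tau>) * (\<Prod>i<p. (as ! i) (v (\<sigma> (\<tau> i))))) *
        (of_int (sign \<rho>) * (\<Prod>j<q. (bs ! j) (v (\<sigma> (p + \<rho> j))))))"
      unfolding wl_leibniz[symmetric] assms by (rule sum_product)
    also have "\<dots> = (\<Sum>\<tau>\<in>?P p. \<Sum>\<rho>\<in>?P q. of_int (sign \<tau>) * of_int (sign \<rho>) * F (\<sigma> \<circ> (\<tau> \<circ> shp p q \<rho>)))"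
      by (intro sum.cong refl) (simp add: F[symmetric] mult_ac)
    finally show "of_int (sign \<sigma>) * wl as (\<lambda>i. v (\<sigma> i)) * wl bs (\<lambda>i. v (\<sigma> (p + i))) = (\<Sum>\<tau>\<in>?P p. \<Sum>\<rho>\<in>?P q.
        of_int (sign \<sigma>) * (of_int (sign \<tau>) * of_int (sign \<rho>) * F (\<sigma> \<circ> (\<tau> \<circ> shp p q \<rho>))))"
      by (simp only: mult.assoc sum_distrib_left)
  qed
  also have "\<dots> = (\<Sum>\<tau>\<in>?P p. \<Sum>\<rho>\<in>?P q. \<Sum>\<sigma>\<in>?P (p + q).
        of_int (sign \<sigma>) * (of_int (sign \<tau>) * of_int (sign \<rho>) * F (\<sigma> \<circ> (\<tau> \<circ> shp p q \<rho>))))"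
    by (subst sum.swap, rule sum.cong[OF refl], rule sum.swap)
  also have "\<dots> = (\<Sum>\<tau>\<in>?P p. \<Sum>\<rho>\<in>?P q. wl (as @ bs) v)"
    by (intro sum.cong refl inner) auto
  also have "\<dots> = fact p * fact q * wl (as @ bs) v"
    by (simp add: card_permutations[of _ p] card_permutations[of _ q])
  finally show ?thesis unfolding wedge_def by simp
qed

lemma wedge_ev:
  fixes \<theta> :: "nat \<Rightarrow> 'v \<Rightarrow> 'b::field_char_0"
  assumes "\<And>c is. (c, is) \<in> set cs \<Longrightarrow> length is = p" "\<And>c is. (c, is) \<in> set ds \<Longrightarrow> length is = q"
  shows "wedge p q (ev \<theta> cs) (ev \<theta> ds) v =
    ev \<theta> (concat (map (\<lambda>(c, is). map (\<lambda>(d, js). (c * d, is @ js)) ds) cs)) v"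
proof -
  let ?P = "{\<sigma>::nat \<Rightarrow> nat. \<sigma> permutes {..<p + q}}"
  have lin1: "wedge p q (\<lambda>w. c * \<beta> w + \<beta>' w) \<gamma> v = c * wedge p q \<beta> \<gamma> v + wedge p q \<beta>' \<gamma> v"
    for c and \<beta> \<beta>' \<gamma> :: "('v, 'b) covec"
    unfolding wedge_def by (simp add: algebra_simps sum.distrib sum_distrib_left add_divide_distrib)
  have lin2: "wedge p q \<beta> (\<lambda>w. c * \<gamma> w + \<gamma>' w) v = c * wedge p q \<beta> \<gamma> v + wedge p q \<beta> \<gamma>' v"
    for c and \<beta> \<gamma> \<gamma>' :: "('v, 'b) covec"
    unfolding wedge_def by (simp add: algebra_simps sum.distrib sum_distrib_left add_divide_distrib)
  have z1: "wedge p q (\<lambda>w. 0) \<gamma> v = 0" and z2: "wedge p q \<gamma> (\<lambda>w. 0) v = 0" for \<gamma> :: "('v, 'b) covec"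
    unfolding wedge_def by simp_all
  have one: "wedge p q (wl (map \<theta> is)) (ev \<theta> ds) v = ev \<theta> (map (\<lambda>(d, js). (d, is @ js)) ds) v"
    if "length is = p" for "is"
    using assms(2)
  proof (induction ds)
    case Nil
    then show ?case using z2 by (simp add: ev_def)
  next
    case (Cons y ds)
    obtain d js where y: "y = (d, js)" by (cases y)
    have "ev \<theta> (y # ds) = (\<lambda>w. d * wl (map \<theta> js) w + ev \<theta> ds w)" by (simp add: y fun_eq_iff)
    moreover have "wedge p q (wl (map \<theta> is)) (wl (map \<theta> js)) v = wl (map \<theta> (is @ js)) v"
      using wedge_wl[of "map \<theta> is" p "map \<theta> js" q v] that Cons.prems[of d js] by (simp add: y)
    moreover have "wedge p q (wl (map \<theta> is)) (ev \<theta> ds) v = ev \<theta> (map (\<lambda>(d, js). (d, is @ js)) ds) v"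
      by (rule Cons.IH) (use Cons.prems in auto)
    ultimately show ?case by (simp add: lin2 y)
  qed
  have sc: "ev \<theta> (map (\<lambda>(d, js). (c * d, is @ js)) ds) v = c * ev \<theta> (map (\<lambda>(d, js). (d, is @ js)) ds) v"
      for c "is" ds
    by (induction ds) (auto simp: algebra_simps)
  show ?thesis
    using assms(1)
  proof (induction cs)
    case Nil
    then show ?case using z1 by (simp add: ev_def)
  next
    case (Cons x cs)
    obtain c "is" where x: "x = (c, is)" by (cases x)
    have "ev \<theta> (x # cs) = (\<lambda>w. c * wl (map \<theta> is) w + ev \<theta> cs w)" by (simp add: x fun_eq_iff)
    moreover have "wedge p q (ev \<theta> cs) (ev \<theta> ds) v =
      ev \<theta> (concat (map (\<lambda>(c, is). map (\<lambda>(d, js). (c * d, is @ js)) ds) cs)) v"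
      by (rule Cons.IH) (use Cons.prems in auto)
    moreover have "length is = p" using Cons.prems x by auto
    ultimately show ?case using one[of "is"] by (simp add: lin1 x sc)
  qed
qed

lemma dx_eq_wl: "dx is v = wl (map (\<lambda>i x. x $ i) is) v"
  unfolding dx_def wl_leibniz[symmetric] by (auto intro!: sum.cong prod.cong)

subsection \<open>Exterior derivative of products of 1-forms\<close>

lemma ext_d_dird: "ext_d k \<beta> x v = (\<Sum>i\<le>k. (-1) ^ i * dird (v i) (\<lambda>y. \<beta> y (skip i v)) x)"
  by (simp add: ext_d_def dird_def skip_def)

text \<open>The rule \<open>d(a \<and> \<gamma>) = da \<and> \<gamma> - a \<and> d\<gamma>\<close>,
  where the structure equation \<open>S\<close> gives \<open>da\<close> as a sum of products
  \<open>c b \<and> b'\<close>.\<close>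

lemma ext_d_wone:
  assumes da: "\<And>p. (\<lambda>y. a y p) differentiable (at x)"
    and dg: "\<And>w. (\<lambda>y. \<gamma> y w) differentiable (at x)"
    and st: "\<And>p q. dird p (\<lambda>y. a y q) x - dird q (\<lambda>y. a y p) x =
      (\<Sum>(c, b, b')\<leftarrow>S. c * (b p * b' q - b q * b' p))"
  shows "ext_d (Suc n) (\<lambda>y. wone n (a y) (\<gamma> y)) x v =
    (\<Sum>(c, b, b')\<leftarrow>S. c * wone (Suc n) b (wone n b' (\<gamma> x)) v) - wone (Suc n) (a x) (ext_d n \<gamma> x) v"
proof -
  define D where "D p q = dird p (\<lambda>y. a y q) x" for p q
  define G where "G p w = dird p (\<lambda>y. \<gamma> y w) x" for p w
  define s where "s p q = (\<Sum>(c, b, b')\<leftarrow>S. c * (b p * b' q - b q * b' p))" for p q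
  let ?sum = "\<lambda>Y. \<Sum>i\<le>Suc n. \<Sum>j\<le>n. (-1) ^ (i + j) * (Y (v i) (skip i v j) (skip j (skip i v)) :: real)"
  have sum_add: "?sum (\<lambda>p q w. X p q w + Y p q w) = ?sum X + ?sum Y" for X Y
    by (simp add: distrib_left sum.distrib)
  have "ext_d (Suc n) (\<lambda>y. wone n (a y) (\<gamma> y)) x v =
      (\<Sum>i\<le>Suc n. (-1) ^ i * dird (v i) (\<lambda>y. \<Sum>j\<le>n. (-1) ^ j * (a y (skip i v j) * \<gamma> y (skip j (skip i v)))) x)"
    unfolding ext_d_dird wone_def by (simp add: mult.assoc)
  also have "\<dots> = (\<Sum>i\<le>Suc n. (-1) ^ i * (\<Sum>j\<le>n. (-1) ^ j *
      (a x (skip i v j) * G (v i) (skip j (skip i v)) + D (v i) (skip i v j) * \<gamma> x (skip j (skip i v)))))"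
    using da dg by (simp add: dird_sum dird_cmult dird_mult D_def G_def)
  also have "\<dots> = ?sum (\<lambda>p q w. a x q * G p w + D p q * \<gamma> x w)"
    unfolding sum_distrib_left by (simp add: power_add mult.assoc)
  also have "\<dots> = ?sum (\<lambda>p q w. a x q * G p w) + ?sum (\<lambda>p q w. D p q * \<gamma> x w)" by (rule sum_add)
  also have "?sum (\<lambda>p q w. a x q * G p w) = - wone (Suc n) (a x) (ext_d n \<gamma> x) v"
  proof -
    have "?sum (\<lambda>p q w. a x p * G q w + a x q * G p w) = 0"
      by (rule double_skip_sum_eq_0[where Y="\<lambda>p q w. a x p * G q w + a x q * G p w"]) simp
    then have "?sum (\<lambda>p q w. a x p * G q w) + ?sum (\<lambda>p q w. a x q * G p w) = 0"
      using sum_add[of "\<lambda>p q w. a x p * G q w" "\<lambda>p q w. a x q * G p w"] by (simp only:)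
    moreover have "wone (Suc n) (a x) (ext_d n \<gamma> x) v = ?sum (\<lambda>p q w. a x p * G q w)"
      unfolding wone_def ext_d_dird sum_distrib_left
      by (intro sum.cong refl) (simp add: G_def power_add mult_ac)
    moreover have "A + B = 0 \<Longrightarrow> C = A \<Longrightarrow> B = - C" for A B C :: real by simp
    ultimately show ?thesis by blast
  qed
  also have "?sum (\<lambda>p q w. D p q * \<gamma> x w) = (\<Sum>(c, b, b')\<leftarrow>S. c * wone (Suc n) b (wone n b' (\<gamma> x)) v)"
  proof -
    \<comment> \<open>The symmetric part of \<open>D\<close> cancels, so twice the sum depends on
      the antisymmetric part alone, which \<open>S\<close> describes.\<close>
    have "?sum (\<lambda>p q w. D p q * \<gamma> x w + D q p * \<gamma> x w) = 0"
      by (rule double_skip_sum_eq_0[where Y="\<lambda>p q w. D p q * \<gamma> x w + D q p * \<gamma> x w"]) simp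
    then have "?sum (\<lambda>p q w. s p q * \<gamma> x w) + 0 =
        ?sum (\<lambda>p q w. s p q * \<gamma> x w) + ?sum (\<lambda>p q w. D p q * \<gamma> x w + D q p * \<gamma> x w)"
      by (simp only:)
    also have "\<dots> = ?sum (\<lambda>p q w. s p q * \<gamma> x w + (D p q * \<gamma> x w + D q p * \<gamma> x w))"
      by (rule sum_add[symmetric])
    also have "\<dots> = ?sum (\<lambda>p q w. D p q * \<gamma> x w + D p q * \<gamma> x w)"
    proof (intro sum.cong refl arg_cong2[where f="(*)"])
      fix i j
      have "D q p = D p q - s p q" for p q using st[of p q] by (simp add: D_def s_def)
      note eq = this[of "skip i v j" "v i"]
      show "s (v i) (skip i v j) * \<gamma> x (skip j (skip i v)) + (D (v i) (skip i v j) * \<gamma> x (skip j (skip i v)) +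
          D (skip i v j) (v i) * \<gamma> x (skip j (skip i v))) =
        D (v i) (skip i v j) * \<gamma> x (skip j (skip i v)) + D (v i) (skip i v j) * \<gamma> x (skip j (skip i v))"
        unfolding eq by (simp add: left_diff_distrib)
    qed
    also have "\<dots> = ?sum (\<lambda>p q w. D p q * \<gamma> x w) + ?sum (\<lambda>p q w. D p q * \<gamma> x w)" by (rule sum_add)
    finally have "2 * ?sum (\<lambda>p q w. D p q * \<gamma> x w) = ?sum (\<lambda>p q w. s p q * \<gamma> x w)"
      by (simp only: mult_2 add_0_right)
    also have "?sum (\<lambda>p q w. s p q * \<gamma> x w) = 2 * (\<Sum>(c, b, b')\<leftarrow>S. c * wone (Suc n) b (wone n b' (\<gamma> x)) v)"
      unfolding s_def
    proof (induction S)
      case (Cons t S)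
      obtain c b b' where t: "t = (c, b, b')" by (cases t)
      have "?sum (\<lambda>p q w. c * (b p * b' q - b q * b' p) * \<gamma> x w)
        = ?sum (\<lambda>p q w. c * (b p * b' q * \<gamma> x w) + (- c) * (b' p * b q * \<gamma> x w))"
        by (intro sum.cong refl) (simp add: algebra_simps)
      also have "\<dots> = c * wone (Suc n) b (wone n b' (\<gamma> x)) v - c * wone (Suc n) b' (wone n b (\<gamma> x)) v"
        unfolding wone_wone sum_distrib_left sum_subtractf[symmetric]
        by (intro sum.cong refl) (simp add: algebra_simps)
      also have "\<dots> = 2 * (c * wone (Suc n) b (wone n b' (\<gamma> x)) v)"
        using wone_swap[of n b' b "\<gamma> x" v] by simp
      finally have one: "?sum (\<lambda>p q w. c * (b p * b' q - b q * b' p) * \<gamma> x w)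
        = 2 * (c * wone (Suc n) b (wone n b' (\<gamma> x)) v)" .
      have "?sum (\<lambda>p q w. (\<Sum>(c, b, b')\<leftarrow>t # S. c * (b p * b' q - b q * b' p)) * \<gamma> x w)
        = ?sum (\<lambda>p q w. c * (b p * b' q - b q * b' p) * \<gamma> x w
            + (\<Sum>(c, b, b')\<leftarrow>S. c * (b p * b' q - b q * b' p)) * \<gamma> x w)"
        by (intro sum.cong refl) (simp add: t distrib_right)
      also have "\<dots> = ?sum (\<lambda>p q w. c * (b p * b' q - b q * b' p) * \<gamma> x w)
            + ?sum (\<lambda>p q w. (\<Sum>(c, b, b')\<leftarrow>S. c * (b p * b' q - b q * b' p)) * \<gamma> x w)"
        by (rule sum_add)
      finally show ?case unfolding one Cons by (simp add: t)
    qed simp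
    finally show ?thesis by simp
  qed
  finally show ?thesis by simp
qed

text \<open>The exterior derivative of a product of coframe elements, where \<open>st i\<close> lists the terms \<open>c \<theta>\<^sub>k \<and> \<theta>\<^sub>l\<close>
    of \<open>d\<theta>\<^sub>i\<close>.\<close>

primrec dE :: "(nat \<Rightarrow> (real \<times> nat \<times> nat) list) \<Rightarrow> nat list \<Rightarrow> (real \<times> nat list) list" where
  "dE st [] = []"
| "dE st (i # is) = map (\<lambda>(c, k, l). (c, k # l # is)) (st i) @ map (\<lambda>(c, js). (- c, i # js)) (dE st is)"

lemma length_dE: "(c, js) \<in> set (dE st is) \<Longrightarrow> length js = Suc (length is)"
  by (induction "is" arbitrary: c js) auto

lemma wone_differentiable:
  assumes "\<And>p. (\<lambda>y. a y p) differentiable (at x)" "\<And>w. (\<lambda>y. \<gamma> y w) differentiable (at x)"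
  shows "(\<lambda>y. wone n (a y) (\<gamma> y) w :: real) differentiable (at x)"
  unfolding wone_def by (auto intro!: differentiable_sum differentiable_mult assms)

lemma wl_differentiable:
  assumes "\<And>i p. (\<lambda>y. \<theta> i y p) differentiable (at x)"
  shows "(\<lambda>y. wl (map (\<lambda>i. \<theta> i y) is) w :: real) differentiable (at x)"
  by (induction "is" arbitrary: w) (auto intro: wone_differentiable assms)

lemma ext_d_wl:
  fixes \<theta> :: "nat \<Rightarrow> 'v::real_normed_vector \<Rightarrow> 'v \<Rightarrow> real"
  assumes d: "\<And>i p. (\<lambda>y. \<theta> i y p) differentiable (at x)"
    and st: "\<And>i p q. dird p (\<lambda>y. \<theta> i y q) x - dird q (\<lambda>y. \<theta> i y p) x =
      (\<Sum>(c, k, l)\<leftarrow>st i. c * (\<theta> k x p * \<theta> l x q - \<theta> k x q * \<theta> l x p))"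
  shows "ext_d (length is) (\<lambda>y. wl (map (\<lambda>i. \<theta> i y) is)) x v = ev (\<lambda>i. \<theta> i x) (dE st is) v"
proof (induction "is" arbitrary: v)
  case Nil
  then show ?case by (simp add: ext_d_dird)
next
  case (Cons i "is")
  let ?n = "length is" and ?S = "map (\<lambda>(c, k, l). (c, \<theta> k x, \<theta> l x)) (st i)"
  have "ext_d (Suc ?n) (\<lambda>y. wone ?n (\<theta> i y) (wl (map (\<lambda>i. \<theta> i y) is))) x v
    = (\<Sum>(c, b, b')\<leftarrow>?S. c * wone (Suc ?n) b (wone ?n b' (wl (map (\<lambda>i. \<theta> i x) is))) v)
      - wone (Suc ?n) (\<theta> i x) (ext_d ?n (\<lambda>y. wl (map (\<lambda>i. \<theta> i y) is)) x) v"
  proof (rule ext_d_wone)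
    show "dird p (\<lambda>y. \<theta> i y q) x - dird q (\<lambda>y. \<theta> i y p) x = (\<Sum>(c, b, b')\<leftarrow>?S. c * (b p * b' q - b q * b'
        p))" for p q
      unfolding st by (simp add: o_def case_prod_unfold)
  qed (use d wl_differentiable[OF d] in auto)
  also have "wone (Suc ?n) (\<theta> i x) (ext_d ?n (\<lambda>y. wl (map (\<lambda>i. \<theta> i y) is)) x) v
    = ev (\<lambda>i. \<theta> i x) (map (\<lambda>(c, js). (c, i # js)) (dE st is)) v"
    unfolding wone_cong[OF Cons.IH] by (rule wone_ev) (rule length_dE)
  also have "(\<Sum>(c, b, b')\<leftarrow>?S. c * wone (Suc ?n) b (wone ?n b' (wl (map (\<lambda>i. \<theta> i x) is))) v)
    = ev (\<lambda>i. \<theta> i x) (map (\<lambda>(c, k, l). (c, k # l # is)) (st i)) v"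
  proof -
    have w: "wl (\<theta> k x # \<theta> l x # map (\<lambda>i. \<theta> i x) is) v =
      wone (Suc ?n) (\<theta> k x) (wone ?n (\<theta> l x) (wl (map (\<lambda>i. \<theta> i x) is))) v" for k l
      by (simp add: wone_cong[OF wl.simps(2)])
    show ?thesis unfolding ev_def by (simp add: o_def case_prod_unfold w del: wl.simps)
  qed
  also have "ev (\<lambda>i. \<theta> i x) (map (\<lambda>(c, k, l). (c, k # l # is)) (st i)) v
      - ev (\<lambda>i. \<theta> i x) (map (\<lambda>(c, js). (c, i # js)) (dE st is)) v = ev (\<lambda>i. \<theta> i x) (dE st (i # is)) v"
    by (simp add: ev_def o_def case_prod_unfold sum_list_subtractf uminus_sum_list_map)
  finally show ?case by simp
qed

lemma ext_d_add:
  assumes "\<And>w. (\<lambda>y. \<beta> y w) differentiable (at x)" "\<And>w. (\<lambda>y. \<gamma> y w) differentiable (at x)"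
  shows "ext_d n (\<lambda>y w. \<beta> y w + \<gamma> y w) x v = ext_d n \<beta> x v + ext_d n \<gamma> x v"
  unfolding ext_d_dird using assms by (simp add: dird_add distrib_left sum.distrib)

lemma ext_d_fmult:
  assumes "f differentiable (at x)" "\<And>w. (\<lambda>y. \<gamma> y w) differentiable (at x)"
  shows "ext_d n (\<lambda>y w. f y * \<gamma> y w) x v = wone n (\<lambda>p. dird p f x) (\<gamma> x) v + f x * ext_d n \<gamma> x v"
proof -
  have "ext_d n (\<lambda>y w. f y * \<gamma> y w) x v =
    (\<Sum>i\<le>n. (-1) ^ i * dird (v i) f x * \<gamma> x (skip i v) + f x * ((-1) ^ i * dird (v i) (\<lambda>y. \<gamma> y (skip i v)) x))"
    unfolding ext_d_dird using assms by (intro sum.cong refl) (simp add: dird_mult algebra_simps)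
  then show ?thesis by (simp add: ext_d_dird wone_def sum.distrib sum_distrib_left)
qed

text \<open>Differentials of the coefficients are to lie in the span of the coframe elements listed
  in \<open>ks\<close>, with \<open>bas k\<close> the direction belonging to
  \<open>\<theta> k\<close>. On the bundles these are the five base directions, because the
  coefficients depend on the base point only.\<close>

lemma ext_d_ev:
  fixes \<theta> :: "nat \<Rightarrow> 'v::real_normed_vector \<Rightarrow> 'v \<Rightarrow> real"
  assumes d: "\<And>i p. (\<lambda>y. \<theta> i y p) differentiable (at x)"
    and st: "\<And>i p q. dird p (\<lambda>y. \<theta> i y q) x - dird q (\<lambda>y. \<theta> i y p) x =
      (\<Sum>(c, k, l)\<leftarrow>st i. c * (\<theta> k x p * \<theta> l x q - \<theta> k x q * \<theta> l x p))"
    and f: "\<And>f is. (f, is) \<in> set L \<Longrightarrow> length is = n \<and> f differentiable (at x) \<and>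
      (\<forall>p. dird p f x = (\<Sum>k\<leftarrow>ks. dird (bas k) f x * \<theta> k x p))"
  shows "ext_d n (\<lambda>y. ev (\<lambda>i. \<theta> i y) (map (\<lambda>(f, is). (f y, is)) L)) x v =
    ev (\<lambda>i. \<theta> i x) (concat (map (\<lambda>(f, is). map (\<lambda>k. (dird (bas k) f x, k # is)) ks @
      map (\<lambda>(c, js). (f x * c, js)) (dE st is)) L)) v"
  using f
proof (induction L)
  case Nil
  have "dird p (\<lambda>y. 0) x = 0" for p :: 'v by simp
  then show ?case by (simp add: ext_d_dird)
next
  case (Cons t L)
  obtain f "is" where t: "t = (f, is)" by (cases t)
  let ?E = "\<lambda>y. wl (map (\<lambda>i. \<theta> i y) is)"
  have mem: "(f, is) \<in> set (t # L)" using t by simp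
  have fi: "length is = n" "f differentiable (at x)"
    "\<And>p. dird p f x = (\<Sum>k\<leftarrow>ks. dird (bas k) f x * \<theta> k x p)"
    using Cons.prems[OF mem] by blast+
  have dL: "(\<lambda>y. ev (\<lambda>i. \<theta> i y) (map (\<lambda>(f, is). (f y, is)) L) w) differentiable (at x)" for w
  proof -
    have "(\<And>f is. (f, is) \<in> set L \<Longrightarrow> f differentiable (at x)) \<Longrightarrow> ?thesis"
      by (induction L) (auto simp: ev_def intro!: differentiable_add differentiable_mult
          wl_differentiable[OF d])
    then show ?thesis using Cons.prems by auto
  qed
  have "ext_d n (\<lambda>y. ev (\<lambda>i. \<theta> i y) (map (\<lambda>(f, is). (f y, is)) (t # L))) x v
    = ext_d n (\<lambda>y w. f y * ?E y w + ev (\<lambda>i. \<theta> i y) (map (\<lambda>(f, is). (f y, is)) L) w) x v"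
    by (rule arg_cong[where f="\<lambda>\<beta>. ext_d n \<beta> x v"]) (simp add: t fun_eq_iff)
  also have "\<dots> = ext_d n (\<lambda>y w. f y * ?E y w) x v + ext_d n (\<lambda>y. ev (\<lambda>i. \<theta> i y) (map (\<lambda>(f, is). (f y, is))
      L)) x v"
    using dL fi by (intro ext_d_add) (auto intro!: differentiable_mult wl_differentiable[OF d])
  also have "ext_d n (\<lambda>y w. f y * ?E y w) x v = wone n (\<lambda>p. dird p f x) (?E x) v + f x * ext_d n ?E x v"
    by (rule ext_d_fmult) (auto intro: fi wl_differentiable[OF d])
  also have "ext_d n ?E x v = ev (\<lambda>i. \<theta> i x) (dE st is) v"
    using ext_d_wl[where \<theta>=\<theta> and st=st and x=x, OF d st, of "is" v] fi(1) by simp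
  also have "f x * ev (\<lambda>i. \<theta> i x) (dE st is) v = ev (\<lambda>i. \<theta> i x) (map (\<lambda>(c, js). (f x * c, js)) (dE st is)) v"
    unfolding ev_def by (simp add: o_def case_prod_unfold sum_list_const_mult mult.assoc)
  also have "wone n (\<lambda>p. dird p f x) (?E x) v = ev (\<lambda>i. \<theta> i x) (map (\<lambda>k. (dird (bas k) f x, k # is)) ks) v"
  proof -
    have "wone n (\<lambda>p. \<Sum>k\<leftarrow>ks. c k * \<theta> k x p) \<gamma> v = (\<Sum>k\<leftarrow>ks. c k * wone n (\<theta> k x) \<gamma> v)" for c \<gamma>
    proof (induction ks)
      case Nil
      then show ?case by (simp add: wone_def)
    next
      case (Cons k ks)
      have "wone n (\<lambda>p. c k * \<theta> k x p + (\<Sum>k\<leftarrow>ks. c k * \<theta> k x p)) \<gamma> v =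
        c k * wone n (\<theta> k x) \<gamma> v + wone n (\<lambda>p. \<Sum>k\<leftarrow>ks. c k * \<theta> k x p) \<gamma> v"
        unfolding wone_def by (simp add: algebra_simps sum.distrib sum_distrib_left)
      then show ?case using Cons by simp
    qed
    moreover have "(\<lambda>p. dird p f x) = (\<lambda>p. \<Sum>k\<leftarrow>ks. dird (bas k) f x * \<theta> k x p)"
      by (rule ext) (rule fi(3))
    ultimately show ?thesis by (simp add: ev_def o_def fi(1))
  qed
  also have "ext_d n (\<lambda>y. ev (\<lambda>i. \<theta> i y) (map (\<lambda>(f, is). (f y, is)) L)) x v =
    ev (\<lambda>i. \<theta> i x) (concat (map (\<lambda>(f, is). map (\<lambda>k. (dird (bas k) f x, k # is)) ks @
      map (\<lambda>(c, js). (f x * c, js)) (dE st is)) L)) v"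
    by (rule Cons.IH) (rule Cons.prems, simp)
  finally show ?case by (simp add: t)
qed

section \<open>Alternation and smoothness of products of 1-forms\<close>

lemma wl_cong: "(\<And>i. i < length as \<Longrightarrow> v i = w i) \<Longrightarrow> wl as v = wl as w"
proof (induction as arbitrary: v w)
  case (Cons a as)
  have "wl as (skip i v) = wl as (skip i w)" for i
    by (rule Cons.IH) (use Cons.prems in \<open>auto simp: skip_def\<close>)
  then show ?case using Cons.prems by (simp add: wone_def)
qed simp

lemma skip_upd: "skip i (v(i := x)) = skip i v"
  "i \<noteq> k \<Longrightarrow> skip k (v(i := x)) = (skip k v)(if i < k then i else i - 1 := x)"
  by (auto simp: skip_def fun_eq_iff)

lemma linear_wl:
  fixes as :: "('v::real_vector \<Rightarrow> real) list"
  assumes "\<And>a. a \<in> set as \<Longrightarrow> linear a" "i < length as"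
  shows "linear (\<lambda>x. wl as (v(i := x)))"
  using assms
proof (induction as arbitrary: v i)
  case (Cons a as)
  have "linear (\<lambda>x. a ((v(i := x)) k) * wl as (skip k (v(i := x))))" if "k \<le> length as" for k
  proof (cases "k = i")
    case True
    have "linear (\<lambda>x. a x * wl as (skip i v))"
      using linear_compose_scale_right[of "\<lambda>x. a x" "wl as (skip i v)"] Cons.prems(1)[of a] by (simp add:
          mult.commute)
    then show ?thesis using True by (simp add: skip_upd)
  next
    case False
    have "linear (\<lambda>x. wl as ((skip k v)(if i < k then i else i - 1 := x)))"
      using False Cons.prems that by (intro Cons.IH) auto
    then have "linear (\<lambda>x. a (v k) * wl as ((skip k v)(if i < k then i else i - 1 := x)))"
      using linear_compose_scale_right[of "\<lambda>x. wl as ((skip k v)(if i < k then i else i - 1 := x))" "a (v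
          k)"] by simp
    then show ?thesis using False by (simp add: skip_upd)
  qed
  then have "linear (\<lambda>x. \<Sum>k\<le>length as. (-1) ^ k *\<^sub>R (a ((v(i := x)) k) * wl as (skip k (v(i := x)))))"
    by (intro linear_compose_sum ballI linear_compose_scale_right) auto
  then show ?case by (simp only: wl.simps wone_def mult.assoc real_scaleR_def)
qed simp

text \<open>Composing every permutation with the transposition of \<open>i\<close> and
  \<open>j\<close> changes the sign but not the product, so the sum is its own negative.\<close>

lemma wl_repeated_vector:
  fixes as :: "('v \<Rightarrow> real) list"
  assumes "i < length as" "j < length as" "i \<noteq> j" "v i = v j"
  shows "wl as v = 0"
proof -
  let ?t = "Transposition.transpose i j" and ?P = "{\<sigma>. \<sigma> permutes {..<length as}}"
  define F where "F \<sigma> = (\<Prod>k<length as. (as ! k) (v (\<sigma> k)))" for \<sigma>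
  have t: "?t permutes {..<length as}" using assms by (intro permutes_swap_id) auto
  have vt: "v (?t k) = v k" for k using assms(4) by (auto simp: Transposition.transpose_def)
  have "(\<Sum>\<sigma>\<in>?P. of_int (sign \<sigma>) * F \<sigma>) = (\<Sum>\<sigma>\<in>?P. of_int (sign (?t \<circ> \<sigma>)) * F (?t \<circ> \<sigma>))"
    by (rule sum.reindex_bij_witness[of _ "(\<circ>) ?t" "(\<circ>) ?t"])
      (auto simp: comp_assoc[symmetric] permutes_compose[OF _ t] simp del: comp_apply)
  also have "\<dots> = (\<Sum>\<sigma>\<in>?P. - (of_int (sign \<sigma>) * F \<sigma>))"
  proof (rule sum.cong[OF refl])
    fix \<sigma> assume "\<sigma> \<in> ?P"
    then have "permutation \<sigma>" by (auto simp: permutation_permutes)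
    then have "sign (?t \<circ> \<sigma>) = - sign \<sigma>"
      using assms(3) by (simp add: sign_compose[OF permutation_swap_id] sign_swap_id del: comp_apply)
    moreover have "F (?t \<circ> \<sigma>) = F \<sigma>" by (simp add: F_def vt)
    ultimately show "of_int (sign (?t \<circ> \<sigma>)) * F (?t \<circ> \<sigma>) = - (of_int (sign \<sigma>) * F \<sigma>)" by simp
  qed
  finally have "(\<Sum>\<sigma>\<in>?P. of_int (sign \<sigma>) * F \<sigma>) = 0" by (simp add: sum_negf)
  then show ?thesis using wl_leibniz[of as v] by (simp add: F_def)
qed

lemma alternating_wl:
  fixes as :: "('v::real_vector \<Rightarrow> real) list"
  assumes "\<And>a. a \<in> set as \<Longrightarrow> linear a"
  shows "alternating (length as) (wl as)"
  unfolding alternating_def using wl_cong[of as] linear_wl[OF assms] wl_repeated_vector[of _ as] by blast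

lemma alternating_lincomb:
  assumes "alternating k \<beta>" "alternating k \<gamma>"
  shows "alternating k (\<lambda>v. c * \<beta> v + \<gamma> v)"
proof -
  have "linear (\<lambda>x. c * \<beta> (v(i := x)) + \<gamma> (v(i := x)))" if "i < k" for v i
    using assms that linear_compose_add[OF linear_compose_scale_right[of "\<lambda>x. \<beta> (v(i := x))" c], of "\<lambda>x. \<gamma>
        (v(i := x))"]
    unfolding alternating_def by simp
  moreover have "c * \<beta> v + \<gamma> v = c * \<beta> w + \<gamma> w" if "\<forall>i<k. v i = w i" for v w
  proof -
    have "\<beta> v = \<beta> w" "\<gamma> v = \<gamma> w"
      using assms[unfolded alternating_def, THEN conjunct1, rule_format] that by blast+
    then show ?thesis by simp
  qed
  moreover have "c * \<beta> v + \<gamma> v = 0" if "i < k" "j < k" "i \<noteq> j \<and> v i = v j" for v i j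
  proof -
    have "\<beta> v = 0" "\<gamma> v = 0"
      using assms[unfolded alternating_def, THEN conjunct2, THEN conjunct2, rule_format] that by blast+
    then show ?thesis by simp
  qed
  ultimately show ?thesis unfolding alternating_def by blast
qed

lemma alternating_ev:
  fixes \<theta> :: "nat \<Rightarrow> 'v::real_vector \<Rightarrow> real"
  assumes "\<And>i. linear (\<theta> i)" "\<And>c is. (c, is) \<in> set cs \<Longrightarrow> length is = k"
  shows "alternating k (ev \<theta> cs)"
  using assms(2)
proof (induction cs)
  case Nil
  have "linear (\<lambda>x::'v. 0 :: real)" by (rule linear_zero)
  then show ?case by (simp add: alternating_def ev_def)
next
  case (Cons t cs)
  obtain c "is" where t: "t = (c, is)" by (cases t)
  have "alternating (length (map \<theta> is)) (wl (map \<theta> is))" by (rule alternating_wl) (use assms(1) in auto)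
  moreover have "length is = k" using Cons.prems t by auto
  moreover have "alternating k (ev \<theta> cs)" by (rule Cons.IH) (use Cons.prems in auto)
  moreover have "ev \<theta> (t # cs) = (\<lambda>v. c * wl (map \<theta> is) v + ev \<theta> cs v)" by (simp add: t fun_eq_iff)
  ultimately show ?case by (simp add: alternating_lincomb)
qed

lemma smooth_on_wl:
  fixes \<theta> :: "nat \<Rightarrow> 'v::euclidean_space \<Rightarrow> 'v \<Rightarrow> real"
  assumes S: "open S" and \<theta>: "\<And>i p. smooth_on (\<lambda>y. \<theta> i y p) S"
  shows "smooth_on (\<lambda>y. wl (map (\<lambda>i. \<theta> i y) is) v) S"
  by (induction "is" arbitrary: v)
    (auto simp: wone_def intro!: smooth_on_sum[OF S] smooth_on_mult[OF S] \<theta>)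

lemma smooth_on_ev:
  fixes \<theta> :: "nat \<Rightarrow> 'v::euclidean_space \<Rightarrow> 'v \<Rightarrow> real"
  assumes S: "open S" and \<theta>: "\<And>i p. smooth_on (\<lambda>y. \<theta> i y p) S"
  shows "(\<And>f is. (f, is) \<in> set L \<Longrightarrow> smooth_on f S) \<Longrightarrow>
    smooth_on (\<lambda>y. ev (\<lambda>i. \<theta> i y) (map (\<lambda>(f, is). (f y, is)) L) v) S"
proof (induction L)
  case (Cons t L)
  obtain f "is" where t: "t = (f, is)" by (cases t)
  have "smooth_on f S" by (rule Cons.prems[of f "is"]) (simp add: t)
  moreover have "smooth_on (\<lambda>y. ev (\<lambda>i. \<theta> i y) (map (\<lambda>(f, is). (f y, is)) L) v) S"
    by (rule Cons.IH) (metis Cons.prems list.set_intros(2))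
  ultimately show ?case
    by (auto simp: t intro!: smooth_on_add[OF S] smooth_on_mult[OF S] smooth_on_wl[OF S \<theta>])
qed simp

lemma smooth_form_ev:
  fixes \<theta> :: "nat \<Rightarrow> 'v::euclidean_space \<Rightarrow> 'v \<Rightarrow> real"
  assumes S: "open S" and \<theta>: "\<And>i p. smooth_on (\<lambda>y. \<theta> i y p) S"
    and lin: "\<And>i y. y \<in> S \<Longrightarrow> linear (\<theta> i y)"
    and L: "\<And>f is. (f, is) \<in> set L \<Longrightarrow> smooth_on f S \<and> length is = k"
  shows "smooth_form k S (\<lambda>y. ev (\<lambda>i. \<theta> i y) (map (\<lambda>(f, is). (f y, is)) L))"
  unfolding smooth_form_def
proof (intro conjI ballI allI)
  show "alternating k (ev (\<lambda>i. \<theta> i x) (map (\<lambda>(f, is). (f x, is)) L))" if "x \<in> S" for x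
    by (rule alternating_ev) (use lin[OF that] L in auto)
  show "smooth_on (\<lambda>x. ev (\<lambda>i. \<theta> i x) (map (\<lambda>(f, is). (f x, is)) L) v) S" for v
    by (rule smooth_on_ev[OF S \<theta>]) (use L in blast)
qed

subsection \<open>The cross product on \<open>R7\<close>\<close>

lemma UNIV_8: "(UNIV :: 8 set) = {0, 1, 2, 3, 4, 5, 6, 7}"
proof -
  have "card {0, 1, 2, 3, 4, 5, 6, 7 :: 8} = CARD(8)" by simp
  then show ?thesis by (metis card_subset_eq finite subset_UNIV)
qed

lemma inner_8: "(x :: real ^ 8) \<bullet> y =
    x $ 0 * y $ 0 + x $ 1 * y $ 1 + x $ 2 * y $ 2 + x $ 3 * y $ 3 +
    x $ 4 * y $ 4 + x $ 5 * y $ 5 + x $ 6 * y $ 6 + x $ 7 * y $ 7"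
  unfolding inner_vec_def UNIV_8 by simp

text \<open>The Pluecker coordinates of the plane spanned by \<open>u\<close> and
  \<open>v\<close>.\<close>

definition mn :: "real ^ 8 \<Rightarrow> real ^ 8 \<Rightarrow> 8 \<Rightarrow> 8 \<Rightarrow> real" where
  "mn u v i j = u $ i * v $ j - u $ j * v $ i"

text \<open>Read off from \<open>phi0\<close> so that \<open>cross7 u v \<bullet> w\<close> is its
  value on \<open>u, v, w\<close>, see \<open>phi0_cross\<close>.\<close>

definition cross7 :: "real ^ 8 \<Rightarrow> real ^ 8 \<Rightarrow> real ^ 8" where
  "cross7 u v = (\<chi> i. if i = 1 then mn u v 2 3 + mn u v 4 5 + mn u v 6 7
    else if i = 2 then - mn u v 1 3 + mn u v 4 6 - mn u v 5 7
    else if i = 3 then mn u v 1 2 - mn u v 4 7 - mn u v 5 6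
    else if i = 4 then - mn u v 1 5 - mn u v 2 6 + mn u v 3 7
    else if i = 5 then mn u v 1 4 + mn u v 2 7 + mn u v 3 6
    else if i = 6 then - mn u v 1 7 + mn u v 2 4 - mn u v 3 5
    else if i = 7 then mn u v 1 6 - mn u v 2 5 - mn u v 3 4 else 0)"

lemma cross7_nth [simp]:
  "cross7 u v $ 0 = 0"
  "cross7 u v $ 1 = mn u v 2 3 + mn u v 4 5 + mn u v 6 7"
  "cross7 u v $ 2 = - mn u v 1 3 + mn u v 4 6 - mn u v 5 7"
  "cross7 u v $ 3 = mn u v 1 2 - mn u v 4 7 - mn u v 5 6"
  "cross7 u v $ 4 = - mn u v 1 5 - mn u v 2 6 + mn u v 3 7"
  "cross7 u v $ 5 = mn u v 1 4 + mn u v 2 7 + mn u v 3 6"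
  "cross7 u v $ 6 = - mn u v 1 7 + mn u v 2 4 - mn u v 3 5"
  "cross7 u v $ 7 = mn u v 1 6 - mn u v 2 5 - mn u v 3 4"
  by (simp_all add: cross7_def)

text \<open>Coordinates are indexed by natural numbers, because words of indices are sorted and
  given signs by \<open>psign\<close>.\<close>

definition kc :: "nat \<Rightarrow> real ^ 8 \<Rightarrow> real" where
  "kc i x = x $ (of_nat i)"

definition phi_terms :: "(real \<times> nat list) list" where
  "phi_terms = [(1, [1,2,3]), (1, [1,4,5]), (1, [1,6,7]), (1, [2,4,6]), (-1, [2,5,7]), (-1, [3,4,7]), (-1,
      [3,5,6])]"

definition psi_terms :: "(real \<times> nat list) list" where
  "psi_terms = [(1, [2,3,4,5]), (1, [2,3,6,7]), (1, [4,5,6,7]), (-1, [1,2,4,7]), (-1, [1,2,5,6]),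
    (-1, [1,3,4,6]), (1, [1,3,5,7])]"

text \<open>In each term of the sum over permutations some factor receives the argument
  \<open>v 0\<close>.\<close>

lemma wl_kill:
  fixes as :: "('v \<Rightarrow> real) list"
  assumes "as \<noteq> []" "\<And>a. a \<in> set as \<Longrightarrow> a (v 0) = 0"
  shows "wl as v = 0"
  unfolding wl_leibniz[symmetric]
proof (intro sum.neutral ballI)
  fix \<sigma> assume "\<sigma> \<in> {\<sigma>. \<sigma> permutes {..<length as}}"
  then have \<sigma>: "\<sigma> permutes {..<length as}" by simp
  then obtain j where j: "j < length as" "\<sigma> j = 0"
    using permutes_image[OF \<sigma>] assms(1) by (metis imageE length_greater_0_conv lessThan_iff)
  then have "(as ! j) (v (\<sigma> j)) = 0" using assms(2) by simp
  then have "(\<Prod>j<length as. (as ! j) (v (\<sigma> j))) = 0"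
    using j by (intro prod_zero bexI[of _ j]) auto
  then show "of_int (sign \<sigma>) * (\<Prod>j<length as. (as ! j) (v (\<sigma> j))) = 0" by simp
qed

lemma wl_dual_first:
  fixes as :: "('v \<Rightarrow> real) list"
  assumes "a (v 0) = 1" "\<And>b. b \<in> set as \<Longrightarrow> b (v 0) = 0"
  shows "wl (a # as) v = wl as (skip 0 v)"
proof -
  have "(-1) ^ i * a (v i) * wl as (skip i v) = (if i = 0 then wl as (skip 0 v) else 0)" if "i \<le> length
      as" for i
  proof (cases "i = 0")
    case False
    then have "wl as (skip i v) = 0" using assms(2) that by (intro wl_kill) (auto simp: skip_def)
    then show ?thesis using False by simp
  qed (use assms in simp)
  then show ?thesis by (simp add: wone_def)
qed

lemma kc_axis [simp]: "kc i (axis j 1) = (if of_nat i = j then 1 else 0)"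
  by (simp add: kc_def axis_def)

lemma dx_kc: "dx (map of_nat is) v = wl (map kc is) v"
  by (simp add: dx_eq_wl o_def kc_def[abs_def])

lemma skip_0_case_nat [simp]: "skip 0 (case_nat x v) = v"
  by (simp add: skip_def fun_eq_iff)

lemma dx_kc_4: "dx [of_nat a, of_nat b, of_nat c, of_nat d] v = wl [kc a, kc b, kc c, kc d] v"
  using dx_kc[of "[a, b, c, d]" v] by (simp del: wl.simps)

lemma Phi0_wl: "Phi0 v = ev kc (map (\<lambda>(c, is). (c, 0 # is)) phi_terms @ psi_terms) v"
proof -
  note dx =
    dx_kc_4[of 0 1 2 3 v, unfolded of_nat_0 of_nat_1 of_nat_numeral]
    dx_kc_4[of 0 1 4 5 v, unfolded of_nat_0 of_nat_1 of_nat_numeral]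
    dx_kc_4[of 0 1 6 7 v, unfolded of_nat_0 of_nat_1 of_nat_numeral]
    dx_kc_4[of 0 2 4 6 v, unfolded of_nat_0 of_nat_1 of_nat_numeral]
    dx_kc_4[of 0 2 5 7 v, unfolded of_nat_0 of_nat_1 of_nat_numeral]
    dx_kc_4[of 0 3 4 7 v, unfolded of_nat_0 of_nat_1 of_nat_numeral]
    dx_kc_4[of 0 3 5 6 v, unfolded of_nat_0 of_nat_1 of_nat_numeral]
    dx_kc_4[of 2 3 4 5 v, unfolded of_nat_0 of_nat_1 of_nat_numeral]
    dx_kc_4[of 2 3 6 7 v, unfolded of_nat_0 of_nat_1 of_nat_numeral]
    dx_kc_4[of 4 5 6 7 v, unfolded of_nat_0 of_nat_1 of_nat_numeral]
    dx_kc_4[of 1 2 4 7 v, unfolded of_nat_0 of_nat_1 of_nat_numeral]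
    dx_kc_4[of 1 2 5 6 v, unfolded of_nat_0 of_nat_1 of_nat_numeral]
    dx_kc_4[of 1 3 4 6 v, unfolded of_nat_0 of_nat_1 of_nat_numeral]
    dx_kc_4[of 1 3 5 7 v, unfolded of_nat_0 of_nat_1 of_nat_numeral]
  show ?thesis by (simp add: Phi0_def phi_terms_def psi_terms_def dx del: wl.simps)
qed

text \<open>Contraction with the 0-th basis vector strips the leading 0 from the words of the first
  part and kills the words of \<open>psi_terms\<close>, which do not contain 0.\<close>

lemma phi0_wl: "phi0 v = ev kc phi_terms v"
proof -
  have A: "wl (kc 0 # map kc is) (case_nat (axis 0 1) v) = wl (map kc is) v"
    if "\<forall>i\<in>set is. (of_nat i :: 8) \<noteq> 0" for "is"
  proof -
    have "wl (kc 0 # map kc is) (case_nat (axis 0 1) v) = wl (map kc is) (skip 0 (case_nat (axis 0 1) v))"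
      by (rule wl_dual_first) (use that in auto)
    then show ?thesis by (simp del: wl.simps)
  qed
  have B: "wl (map kc is) (case_nat (axis 0 1) v) = 0"
    if "is \<noteq> []" "\<forall>i\<in>set is. (of_nat i :: 8) \<noteq> 0" for "is"
    by (rule wl_kill) (use that in auto)
  have A': "ev kc (map (\<lambda>(c, is). (c, 0 # is)) L) (case_nat (axis 0 1) v) = ev kc L v"
    if "\<forall>(c, is)\<in>set L. \<forall>i\<in>set is. (of_nat i :: 8) \<noteq> 0" for L
    using that
  proof (induction L)
    case (Cons t L)
    then show ?case using A[of "snd t"] by (cases t) (simp del: wl.simps)
  qed simp
  have B': "ev kc L (case_nat (axis 0 1) v) = 0"
    if "\<forall>(c, is)\<in>set L. is \<noteq> [] \<and> (\<forall>i\<in>set is. (of_nat i :: 8) \<noteq> 0)" for L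
    using that
  proof (induction L)
    case (Cons t L)
    then show ?case using B[of "snd t"] by (cases t) (simp del: wl.simps)
  qed simp
  show ?thesis
    unfolding phi0_def interior_prod_def Phi0_wl ev_append
    by (subst A', simp add: phi_terms_def, subst B', simp_all add: psi_terms_def)
qed

definition tri :: "'v \<Rightarrow> 'v \<Rightarrow> 'v \<Rightarrow> nat \<Rightarrow> 'v" where
  "tri u v w i = (if i = 0 then u else if i = 1 then v else w)"

lemma phi0_cross: "phi0 v = cross7 (v 0) (v 1) \<bullet> v 2"
  by (simp add: phi0_wl phi_terms_def inner_8 wone_def skip_def mn_def kc_def atMost_Suc numeral_2_eq_2
      algebra_simps)

text \<open>The identity that ties the metric to \<open>phi0\<close>; the stabiliser argument rests
  on it.\<close>

lemma norm_cross7: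
  assumes "u \<in> R7" "v \<in> R7"
  shows "cross7 u v \<bullet> cross7 u v = (u \<bullet> u) * (v \<bullet> v) - (u \<bullet> v)\<^sup>2"
  using assms unfolding inner_8 R7_def
  by (simp add: mn_def power2_eq_square algebra_simps)

lemma wl_3: "wl [a, b, c] v = a (v 0) * (b (v 1) * c (v 2) - b (v 2) * c (v 1))
    - a (v 1) * (b (v 0) * c (v 2) - b (v 2) * c (v 0)) + a (v 2) * (b (v 0) * c (v 1) - b (v 1) * c (v 0))"
  by (simp add: wone_def skip_def atMost_Suc numeral_2_eq_2 algebra_simps)

lemma wl_4: "wl [a, b, c, d] v = a (v 0) * wl [b, c, d] (skip 0 v) - a (v 1) * wl [b, c, d] (skip 1 v)
    + a (v 2) * wl [b, c, d] (skip 2 v) - a (v 3) * wl [b, c, d] (skip 3 v)"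
  by (subst wl.simps(2)) (simp add: wone_def atMost_Suc eval_nat_numeral algebra_simps del: wl.simps)

text \<open>Laplace expansion along the two pairs of arguments \<open>(v 0, v 3)\<close> and
  \<open>(v 1, v 2)\<close>, the pairing that occurs in \<open>psi_cross\<close>.\<close>

lemma wl_4_minors:
  fixes a b c d :: "'v \<Rightarrow> real" and v :: "nat \<Rightarrow> 'v"
  defines "m \<equiv> \<lambda>p q. p (v 0) * q (v 3) - q (v 0) * p (v 3)"
    and "n \<equiv> \<lambda>p q. p (v 1) * q (v 2) - q (v 1) * p (v 2)"
  shows "wl [a, b, c, d] v =
    m a b * n c d - m a c * n b d + m a d * n b c + m b c * n a d - m b d * n a c + m c d * n a b"
proof -
  have sk: "skip 0 v 0 = v 1" "skip 0 v 1 = v 2" "skip 0 v 2 = v 3"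
    "skip 1 v 0 = v 0" "skip 1 v 1 = v 2" "skip 1 v 2 = v 3"
    "skip 2 v 0 = v 0" "skip 2 v 1 = v 1" "skip 2 v 2 = v 3"
    "skip 3 v 0 = v 0" "skip 3 v 1 = v 1" "skip 3 v 2 = v 2"
    by (simp_all add: skip_def eval_nat_numeral)
  show ?thesis unfolding wl_4 wl_3 sk m_def n_def by (simp only: algebra_simps)
qed

text \<open>The Cauchy-Binet identity for the pairs \<open>(a, d)\<close> and \<open>(b, c)\<close>,
  with the 21 minors of R^7.\<close>

lemma inner_minors:
  assumes "a \<in> R7" "b \<in> R7" "c \<in> R7" "d \<in> R7"
  shows "(a \<bullet> b) * (d \<bullet> c) - (a \<bullet> c) * (d \<bullet> b) =
    mn a d 1 2 * mn b c 1 2 + mn a d 1 3 * mn b c 1 3 + mn a d 1 4 * mn b c 1 4 + mn a d 1 5 * mn b c 1 5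
    + mn a d 1 6 * mn b c 1 6 + mn a d 1 7 * mn b c 1 7 + mn a d 2 3 * mn b c 2 3 + mn a d 2 4 * mn b c 2 4
    + mn a d 2 5 * mn b c 2 5 + mn a d 2 6 * mn b c 2 6 + mn a d 2 7 * mn b c 2 7 + mn a d 3 4 * mn b c 3 4
    + mn a d 3 5 * mn b c 3 5 + mn a d 3 6 * mn b c 3 6 + mn a d 3 7 * mn b c 3 7 + mn a d 4 5 * mn b c 4 5
    + mn a d 4 6 * mn b c 4 6 + mn a d 4 7 * mn b c 4 7 + mn a d 5 6 * mn b c 5 6 + mn a d 5 7 * mn b c 5 7
    + mn a d 6 7 * mn b c 6 7"
  using assms unfolding inner_8 R7_def mn_def by (simp add: algebra_simps)

text \<open>This writes the 4-form in terms of the cross product and the metric, so that a map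
  preserving both preserves it too. Both sides are bilinear in the minors of
  \<open>(v 0, v 3)\<close> and \<open>(v 1, v 2)\<close>, where they can be compared.\<close>

lemma psi_cross:
  assumes "\<And>i. v i \<in> R7"
  shows "ev kc psi_terms v = cross7 (v 0) (v 3) \<bullet> cross7 (v 1) (v 2)
    - ((v 0 \<bullet> v 1) * (v 3 \<bullet> v 2) - (v 0 \<bullet> v 2) * (v 3 \<bullet> v 1))"
proof -
  have w: "wl [kc i, kc j, kc k, kc l] v =
      mn (v 0) (v 3) (of_nat i) (of_nat j) * mn (v 1) (v 2) (of_nat k) (of_nat l)
    - mn (v 0) (v 3) (of_nat i) (of_nat k) * mn (v 1) (v 2) (of_nat j) (of_nat l)
    + mn (v 0) (v 3) (of_nat i) (of_nat l) * mn (v 1) (v 2) (of_nat j) (of_nat k)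
    + mn (v 0) (v 3) (of_nat j) (of_nat k) * mn (v 1) (v 2) (of_nat i) (of_nat l)
    - mn (v 0) (v 3) (of_nat j) (of_nat l) * mn (v 1) (v 2) (of_nat i) (of_nat k)
    + mn (v 0) (v 3) (of_nat k) (of_nat l) * mn (v 1) (v 2) (of_nat i) (of_nat j)" for i j k l
    unfolding wl_4_minors by (simp add: kc_def mn_def)
  show ?thesis
    unfolding inner_minors[OF assms assms assms assms]
    by (simp add: psi_terms_def w inner_8 algebra_simps del: wl.simps)
qed

subsection \<open>The stabiliser of \<open>phi0\<close> is orthogonal\<close>

lemma subspace_R7: "subspace R7"
  by (auto simp: subspace_def R7_def)

lemma cross7_in_R7 [simp]: "cross7 u v \<in> R7"
  by (simp add: R7_def)

lemma cross7_cyclic: "cross7 u v \<bullet> w = cross7 w u \<bullet> v"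
  by (simp add: inner_8 mn_def algebra_simps)

lemma cross7_antisym: "cross7 u v \<bullet> w = - (cross7 u w \<bullet> v)"
  by (simp add: inner_8 mn_def algebra_simps)

lemma cross7_orth: "cross7 u v \<bullet> u = 0" "cross7 u v \<bullet> v = 0"
  by (simp_all add: inner_8 mn_def algebra_simps)

lemma quadratic_nonneg_imp_linear_0:
  fixes a b :: real
  assumes "\<And>t. 0 \<le> a * t\<^sup>2 + 2 * b * t"
  shows "b = 0"
proof (rule ccontr)
  assume b: "b \<noteq> 0"
  \<comment> \<open>Any positive \<open>k\<close> larger than \<open>a / 2\<close> serves: at
    \<open>t = - b / k\<close> the value is \<open>(b / k)^2 (a - 2 k) < 0\<close>.\<close>
  define k where "k = 1 + \<bar>a\<bar>"
  have k: "k > 0" "a < 2 * k" by (auto simp: k_def)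
  have "0 \<le> a * (- b / k)\<^sup>2 + 2 * b * (- b / k)" by (rule assms)
  also have "\<dots> = (b / k)\<^sup>2 * (a - 2 * k)" using k by (simp add: power2_eq_square field_simps)
  also have "\<dots> < 0" using b k by (intro mult_pos_neg) auto
  finally show False by simp
qed

text \<open>Together with the axis normal to \<open>R7\<close> there are at most four linear
  conditions in dimension 8.\<close>

lemma ex_orthogonal_R7:
  obtains v where "v \<in> R7" "v \<noteq> 0" "v \<bullet> a = 0" "v \<bullet> b = 0" "v \<bullet> c = 0"
proof -
  have "dim {axis 0 1, a, b, c :: real ^ 8} \<le> card {axis 0 1, a, b, c}"
    by (rule dim_le_card) (auto intro: span_base)
  also have "\<dots> \<le> 4" using card_length[of "[axis 0 1, a, b, c]"] by simp
  also have "\<dots> < DIM(real ^ 8)" by simp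
  finally obtain v where v: "v \<noteq> 0" "\<And>y. y \<in> span {axis 0 1, a, b, c} \<Longrightarrow> orthogonal v y"
    using orthogonal_to_subspace_exists by blast
  have "v \<bullet> y = 0" if "y \<in> {axis 0 1, a, b, c}" for y
    using v(2)[OF span_base[OF that]] by (simp add: orthogonal_def)
  then have "v \<bullet> axis 0 1 = 0" "v \<bullet> a = 0" "v \<bullet> b = 0" "v \<bullet> c = 0" by blast+
  then show thesis using v(1) by (intro that[of v]) (auto simp: R7_def inner_axis)
qed

text \<open>An element of the stabiliser in GL(7), extended to R^8 by fixing the axis normal to
  \<open>R7\<close>; thus inverse and adjoint are those of a map on a whole type.\<close>

context
  fixes A :: "real ^ 8 \<Rightarrow> real ^ 8"
  assumes lin: "linear A" and bij: "bij A" and A0: "A (axis 0 1) = axis 0 1"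
    and A7: "\<And>x. x \<in> R7 \<Longrightarrow> A x \<in> R7"
    and pres: "\<And>u v w. cross7 (A u) (A v) \<bullet> A w = cross7 u v \<bullet> w"
begin

interpretation A: linear A by (rule lin)

text \<open>The contragredient of \<open>A\<close>. Cross products transform by it, since
  \<open>phi0\<close> pairs them with vectors; orthogonality of \<open>A\<close> means that
  \<open>cogr\<close> and \<open>A\<close> agree.\<close>

definition cogr :: "real ^ 8 \<Rightarrow> real ^ 8" where
  "cogr = adjoint (inv A)"

lemma linear_invA: "linear (inv A)"
  using inj_linear_imp_inv_linear lin bij bij_is_inj by blast

lemma cogr_inner: "A x \<bullet> cogr y = x \<bullet> y"
  unfolding cogr_def adjoint_works[OF linear_invA] using bij by (simp add: bij_is_inj)

lemma cogr_unique: "(\<And>x. A x \<bullet> z = x \<bullet> y) \<Longrightarrow> z = cogr y"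
proof -
  assume *: "\<And>x. A x \<bullet> z = x \<bullet> y"
  have "x \<bullet> z = x \<bullet> cogr y" for x
    using *[of "inv A x"] cogr_inner[of "inv A x" y] bij by (simp add: bij_is_surj surj_f_inv_f)
  then show ?thesis by (metis vector_eq_rdot inner_commute)
qed

lemma cross7_A: "cross7 (A u) (A v) = cogr (cross7 u v)"
  by (rule cogr_unique) (metis pres inner_commute)

lemma cogr_R7: "y \<in> R7 \<Longrightarrow> cogr y \<in> R7"
  using cogr_inner[of "axis 0 1" y] by (simp add: A0 R7_def inner_axis')

lemma invA_R7: "x \<in> R7 \<Longrightarrow> inv A x \<in> R7"
proof -
  assume x: "x \<in> R7"
  let ?y = "inv A x"
  let ?z = "?y - (?y $ 0) *\<^sub>R axis 0 1"
  have "A ?z \<in> R7" by (rule A7) (simp add: R7_def axis_def)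
  moreover have "A ?z = x - (?y $ 0) *\<^sub>R axis 0 1"
    using bij by (simp add: A.diff A.scale A0 bij_is_surj surj_f_inv_f)
  ultimately show "?y \<in> R7" using x by (simp add: R7_def axis_def)
qed

text \<open>At \<open>u\<close> the quadratic form \<open>e (|A x|^2 - k |x|^2)\<close> attains its
  minimum 0 over \<open>R7\<close>, so its first variation in direction \<open>v\<close> vanishes.
  The sign \<open>e\<close> treats maximal and minimal stretch together.\<close>

lemma extremal_orth:
  assumes q: "\<And>x. x \<in> R7 \<Longrightarrow> 0 \<le> e * ((norm (A x))\<^sup>2 - k * (norm x)\<^sup>2)"
    and e: "e = 1 \<or> e = -1" and u: "u \<in> R7" "(norm (A u))\<^sup>2 = k * (norm u)\<^sup>2" and v: "v \<in> R7"
  shows "A u \<bullet> A v = k * (u \<bullet> v)"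
proof -
  have "0 \<le> (e * ((norm (A v))\<^sup>2 - k * (norm v)\<^sup>2)) * t\<^sup>2 + 2 * (e * (A u \<bullet> A v - k * (u \<bullet> v))) * t" for t
  proof -
    have "u + t *\<^sub>R v \<in> R7" using u v subspace_R7 by (simp add: subspace_add subspace_scale)
    from q[OF this] have "0 \<le> e * ((A u + t *\<^sub>R A v) \<bullet> (A u + t *\<^sub>R A v) - k * ((u + t *\<^sub>R v) \<bullet> (u + t *\<^sub>R v)))"
      by (simp add: A.add A.scale power2_norm_eq_inner)
    also have "\<dots> = e * (A u \<bullet> A u - k * (u \<bullet> u)) + (e * (A v \<bullet> A v - k * (v \<bullet> v))) * t\<^sup>2
        + 2 * (e * (A u \<bullet> A v - k * (u \<bullet> v))) * t"
      by (simp add: inner_add_left inner_add_right inner_commute[of v u] inner_commute[of "A v" "A u"]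
          power2_eq_square algebra_simps)
    also have "A u \<bullet> A u - k * (u \<bullet> u) = 0" using u(2) by (simp add: power2_norm_eq_inner)
    finally show ?thesis by (simp add: power2_norm_eq_inner)
  qed
  from quadratic_nonneg_imp_linear_0[OF this] show ?thesis using e by auto
qed

text \<open>At directions of maximal and minimal stretch \<open>l\<close> and \<open>n\<close> the cross product forces the stretch of
    everything
  orthogonal to both to be \<open>1 / (l n)\<close>.  Comparing the contragredient map along the two directions gives
  \<open>l = n\<close>, hence \<open>l\<^sup>3 = 1\<close>.\<close>

lemma stabiliser_norm: "x \<in> R7 \<Longrightarrow> norm (A x) = norm x"
proof -
  define S where "S = {x :: real ^ 8. x \<in> R7 \<and> norm x = 1}"
  have "S = R7 \<inter> sphere 0 1" by (auto simp: S_def)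
  then have cS: "compact S"
    using closed_subspace[OF subspace_R7] compact_sphere by (metis closed_Int_compact)
  have ne: "S \<noteq> {}" using norm_axis_1[of "1 :: 8"] by (auto simp: S_def R7_def axis_def intro!: exI[of _
      "axis 1 1"])
  have cont: "continuous_on S (\<lambda>x. norm (A x))"
    by (intro continuous_on_norm linear_continuous_on) (simp add: lin linear_conv_bounded_linear[symmetric])
  obtain u0 where u0: "u0 \<in> S" "\<And>x. x \<in> S \<Longrightarrow> norm (A x) \<le> norm (A u0)"
    using continuous_attains_sup[OF cS ne cont] by blast
  obtain v0 where v0: "v0 \<in> S" "\<And>x. x \<in> S \<Longrightarrow> norm (A v0) \<le> norm (A x)"
    using continuous_attains_inf[OF cS ne cont] by blast
  define l n where "l = norm (A u0)" and "n = norm (A v0)"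
  have u07: "u0 \<in> R7" "norm u0 = 1" and v07: "v0 \<in> R7" "norm v0 = 1" using u0 v0 by (auto simp: S_def)
  have inj0: "A x = 0 \<Longrightarrow> x = 0" for x using bij A.zero by (metis bij_is_inj injD)
  have n: "n > 0" using v07 inj0[of v0] by (auto simp: n_def)
  have l: "l > 0" using u07 inj0[of u0] by (auto simp: l_def)
  have bnd: "n * norm x \<le> norm (A x) \<and> norm (A x) \<le> l * norm x" if x: "x \<in> R7" for x
  proof (cases "x = 0")
    case False
    let ?y = "x /\<^sub>R norm x"
    have "?y \<in> S" using False x by (simp add: S_def subspace_scale[OF subspace_R7])
    then have "norm (A v0) \<le> norm (A ?y)" "norm (A ?y) \<le> norm (A u0)" using u0(2) v0(2) by blast+
    moreover have "norm x > 0" using False by simp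
    ultimately show ?thesis by (simp add: l_def n_def A.scale field_simps)
  qed (simp add: A.zero)
  \<comment> \<open>Since \<open>A\<close> stretches \<open>R7\<close> by factors between
    \<open>n\<close> and \<open>l\<close>, its contragredient stretches by factors between
    \<open>1 / l\<close> and \<open>1 / n\<close>.\<close>
  have bl: "norm x \<le> l * norm (cogr x)" and bn: "n * norm (cogr x) \<le> norm x" if x: "x \<in> R7" for x
  proof -
    have "(norm x)\<^sup>2 = A x \<bullet> cogr x" by (simp add: cogr_inner power2_norm_eq_inner)
    also have "\<dots> \<le> norm (A x) * norm (cogr x)" by (rule norm_cauchy_schwarz)
    also have "\<dots> \<le> l * norm x * norm (cogr x)" using bnd[OF x] by (intro mult_right_mono) auto
    finally show "norm x \<le> l * norm (cogr x)"
      by (cases "x = 0") (use l in \<open>auto simp: power2_eq_square mult.assoc mult.left_commute[of l]\<close>)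
    let ?y = "inv A (cogr x)"
    have y: "?y \<in> R7" "A ?y = cogr x"
      using invA_R7[OF cogr_R7[OF x]] bij by (auto simp: bij_is_surj surj_f_inv_f)
    have "(norm (cogr x))\<^sup>2 = A ?y \<bullet> cogr x" by (simp add: y power2_norm_eq_inner)
    also have "\<dots> = ?y \<bullet> x" by (rule cogr_inner)
    also have "\<dots> \<le> norm ?y * norm x" by (rule norm_cauchy_schwarz)
    finally have "n * (norm (cogr x))\<^sup>2 \<le> n * norm ?y * norm x" using n by (simp add: mult.assoc)
    also have "\<dots> \<le> norm (cogr x) * norm x" using bnd[OF y(1)] y(2) by (intro mult_right_mono) auto
    finally show "n * norm (cogr x) \<le> norm x"
      by (cases "norm (cogr x) = 0") (auto simp: power2_eq_square mult.left_commute[of n])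
  qed
  have ou: "A u0 \<bullet> A v = l\<^sup>2 * (u0 \<bullet> v)" if "v \<in> R7" for v
  proof (rule extremal_orth[where e="-1"])
    show "0 \<le> - 1 * ((norm (A x))\<^sup>2 - l\<^sup>2 * (norm x)\<^sup>2)" if "x \<in> R7" for x
      using power_mono[OF conjunct2[OF bnd[OF that]] norm_ge_zero, of 2] by (simp add: power_mult_distrib)
  qed (use u07 that in \<open>auto simp: l_def\<close>)
  have ov: "A v0 \<bullet> A v = n\<^sup>2 * (v0 \<bullet> v)" if "v \<in> R7" for v
  proof (rule extremal_orth[where e="1"])
    show "0 \<le> 1 * ((norm (A x))\<^sup>2 - n\<^sup>2 * (norm x)\<^sup>2)" if "x \<in> R7" for x
      using power_mono[OF conjunct1[OF bnd[OF that]], of 2] n by (simp add: power_mult_distrib)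
  qed (use v07 that in \<open>auto simp: n_def\<close>)
  have nc: "norm (cross7 a b) = norm a * norm b" if "a \<in> R7" "b \<in> R7" "a \<bullet> b = 0" for a b
  proof -
    have "(norm (cross7 a b))\<^sup>2 = (norm a * norm b)\<^sup>2"
      using norm_cross7[OF that(1,2)] that(3) by (simp add: power2_norm_eq_inner power_mult_distrib)
    then show ?thesis by (metis norm_ge_zero mult_nonneg_nonneg power2_eq_imp_eq)
  qed
  \<comment> \<open>By extremality \<open>A\<close> maps vectors orthogonal to \<open>u0\<close> to
    vectors orthogonal to \<open>A u0\<close>, so the norm of the cross product of the images is the
    product of their norms.\<close>
  have cu: "norm (cogr (cross7 u0 v)) = l * norm (A v)" if "v \<in> R7" "u0 \<bullet> v = 0" for v
    using nc[OF A7[OF u07(1)] A7[OF that(1)]] ou[OF that(1)] that(2) by (simp add: cross7_A l_def)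
  have cv: "norm (cogr (cross7 v0 v)) = n * norm (A v)" if "v \<in> R7" "v0 \<bullet> v = 0" for v
    using nc[OF A7[OF v07(1)] A7[OF that(1)]] ov[OF that(1)] that(2) by (simp add: cross7_A n_def)
  \<comment> \<open>The bounds on \<open>cogr\<close> and the equations \<open>cu\<close> and
    \<open>cv\<close> give one inequality for each extremal direction; on vectors orthogonal to both
    directions the inequalities meet.\<close>
  have up: "n * l * norm (A v) \<le> norm v" if "v \<in> R7" "u0 \<bullet> v = 0" for v
    using bn[of "cross7 u0 v"] cu[OF that] nc[OF u07(1) that] u07 by (simp add: mult.assoc)
  have lo: "norm v \<le> n * l * norm (A v)" if "v \<in> R7" "v0 \<bullet> v = 0" for v
    using bl[of "cross7 v0 v"] cv[OF that] nc[OF v07(1) that] v07 by (simp add: mult_ac)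
  define t where "t = 1 / (n * l)"
  have t: "t > 0" "n * l * t = 1" using n l by (auto simp: t_def)
  have tau: "norm (A v) = t * norm v" if "v \<in> R7" "u0 \<bullet> v = 0" "v0 \<bullet> v = 0" for v
    using up[OF that(1,2)] lo[OF that(1,3)] n l by (simp add: t_def field_simps)
  \<comment> \<open>Orthogonality to \<open>cross7 u0 v0\<close> puts \<open>cross7 u0 v\<close> and
    \<open>cross7 v0 v\<close> into the complement of both \<open>u0\<close> and \<open>v0\<close>,
    where the stretch is known.\<close>
  obtain v where v: "v \<in> R7" "v \<noteq> 0" "v \<bullet> u0 = 0" "v \<bullet> v0 = 0" "v \<bullet> cross7 u0 v0 = 0"
    by (rule ex_orthogonal_R7)
  have v': "u0 \<bullet> v = 0" "v0 \<bullet> v = 0" using v by (auto simp: inner_commute)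
  have "l = n"
  proof (rule ccontr)
    assume "l \<noteq> n"
    then have "l\<^sup>2 \<noteq> n\<^sup>2" using l n by (simp add: power2_eq_iff_nonneg)
    moreover have "l\<^sup>2 * (u0 \<bullet> v0) = n\<^sup>2 * (u0 \<bullet> v0)"
      using ou[OF v07(1)] ov[OF u07(1)] by (simp add: inner_commute)
    ultimately have uv: "u0 \<bullet> v0 = 0" by simp
    \<comment> \<open>On the complement \<open>A\<close> is \<open>t\<close> times an isometry, with
      image orthogonal to \<open>A u0\<close> and \<open>A v0\<close>; so \<open>cogr\<close> is
      \<open>A / t^2\<close> there and stretches by \<open>1 / t\<close>.\<close>
    have cogr_eq: "norm (cogr x) = norm x / t" if x: "x \<in> R7" "u0 \<bullet> x = 0" "v0 \<bullet> x = 0" for x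
    proof -
      have pol: "A x \<bullet> A y = t\<^sup>2 * (x \<bullet> y)" if y: "y \<in> R7" "u0 \<bullet> y = 0" "v0 \<bullet> y = 0" for y
      proof -
        have "(norm (A (x + y)))\<^sup>2 = t\<^sup>2 * (norm (x + y))\<^sup>2"
          using tau[of "x + y"] x y subspace_R7 by (simp add: subspace_add inner_add_right power_mult_distrib)
        moreover have "(norm (A x))\<^sup>2 = t\<^sup>2 * (norm x)\<^sup>2" "(norm (A y))\<^sup>2 = t\<^sup>2 * (norm y)\<^sup>2"
          using tau[OF x] tau[OF y] by (simp_all add: power_mult_distrib)
        ultimately show ?thesis
          by (simp add: A.add power2_norm_eq_inner inner_add_left inner_add_right
              inner_commute[of y x] inner_commute[of "A y" "A x"] algebra_simps)
      qed
      have "(1 / t\<^sup>2) *\<^sub>R A x = cogr x"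
      proof (rule cogr_unique)
        fix y :: "real ^ 8"
        define y7 where "y7 = y - (y $ 0) *\<^sub>R axis 0 1"
        define y' where "y' = y7 - (u0 \<bullet> y7) *\<^sub>R u0 - (v0 \<bullet> y7) *\<^sub>R v0"
        have y7: "y7 \<in> R7" by (simp add: y7_def R7_def axis_def)
        have y'7: "y' \<in> R7" using y7 u07 v07 subspace_R7 unfolding y'_def by (simp add: subspace_diff
            subspace_scale)
        have uu: "u0 \<bullet> u0 = 1" "v0 \<bullet> v0 = 1" using u07 v07 by (simp_all add: dot_square_norm)
        have y'o: "u0 \<bullet> y' = 0" "v0 \<bullet> y' = 0"
          unfolding y'_def using uu uv by (simp_all add: inner_diff_right inner_commute[of v0 u0])
        have e: "y = y' + (u0 \<bullet> y7) *\<^sub>R u0 + (v0 \<bullet> y7) *\<^sub>R v0 + (y $ 0) *\<^sub>R axis 0 1"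
          by (simp add: y'_def y7_def)
        have yd: "A y = A y' + (u0 \<bullet> y7) *\<^sub>R A u0 + (v0 \<bullet> y7) *\<^sub>R A v0 + (y $ 0) *\<^sub>R axis 0 1"
          "x \<bullet> y = x \<bullet> y' + (u0 \<bullet> y7) * (u0 \<bullet> x) + (v0 \<bullet> y7) * (v0 \<bullet> x) + (y $ 0) * (x \<bullet> axis 0 1)"
          using arg_cong[OF e, of A] arg_cong[OF e, of "(\<bullet>) x"]
          unfolding A.add A.scale A0 inner_add_right inner_scaleR_right inner_commute[of x u0]
        inner_commute[of x v0]
          by blast+
        have "A x \<bullet> axis 0 1 = 0" "x \<bullet> axis 0 1 = 0" using A7[OF x(1)] x(1) by (auto simp: R7_def inner_axis)
        then have "A x \<bullet> A y = t\<^sup>2 * (x \<bullet> y)"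
          unfolding yd using pol[OF y'7 y'o] ou[OF x(1)] ov[OF x(1)] x
          by (simp add: inner_add_right inner_commute[of "A x" "A u0"] inner_commute[of "A x" "A v0"])
        then show "A y \<bullet> ((1 / t\<^sup>2) *\<^sub>R A x) = y \<bullet> x" using t by (simp add: inner_commute)
      qed
      then have "norm (cogr x) = norm (A x) / t\<^sup>2" using t by (metis norm_scaleR abs_of_nonneg divide_inverse
            zero_le_power2 inverse_eq_divide mult.commute norm_ge_zero zero_le_divide_1_iff)
      then show ?thesis using tau[OF x] t by (simp add: power2_eq_square)
    qed
    have a: "cross7 u0 v \<in> R7" "u0 \<bullet> cross7 u0 v = 0" "v0 \<bullet> cross7 u0 v = 0"
      using cross7_orth[of u0 v] cross7_antisym[of u0 v v0] v(5) by (simp_all add: inner_commute)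
    have b: "cross7 v0 v \<in> R7" "u0 \<bullet> cross7 v0 v = 0" "v0 \<bullet> cross7 v0 v = 0"
      using cross7_orth[of v0 v] cross7_cyclic[of v0 v u0] v(5) by (simp_all add: inner_commute)
    have "l * (t * norm v) = norm v / t"
      using cu[OF v(1) v'(1)] cogr_eq[OF a] tau[OF v(1) v'] nc[OF u07(1) v(1) v'(1)] u07 by simp
    moreover have "n * (t * norm v) = norm v / t"
      using cv[OF v(1) v'(2)] cogr_eq[OF b] tau[OF v(1) v'] nc[OF v07(1) v(1) v'(2)] v07 by simp
    ultimately have "l * (t * norm v) = n * (t * norm v)" by simp
    then show False using v(2) t \<open>l \<noteq> n\<close> by simp
  qed
  \<comment> \<open>With \<open>l = n\<close> every vector is stretched by \<open>l\<close>, in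
    particular \<open>v\<close>, whose stretch is \<open>t = 1 / l^2\<close>.\<close>
  have "norm (A v) = l * norm v" using bnd[OF v(1)] \<open>l = n\<close> by simp
  then have "l = t" using tau[OF v(1) v'] v(2) by simp
  then have "l ^ 3 = 1" using t \<open>l = n\<close> by (simp add: power3_eq_cube)
  then have "l = 1" using l power_eq_imp_eq_base[of l 3 1] by simp
  then show "x \<in> R7 \<Longrightarrow> norm (A x) = norm x" using bnd[of x] \<open>l = n\<close> by simp
qed

lemma stabiliser_inner: "x \<in> R7 \<Longrightarrow> y \<in> R7 \<Longrightarrow> A x \<bullet> A y = x \<bullet> y"
proof -
  assume xy: "x \<in> R7" "y \<in> R7"
  then have "(norm (A (x + y)))\<^sup>2 = (norm (x + y))\<^sup>2" "(norm (A x))\<^sup>2 = (norm x)\<^sup>2" "(norm (A y))\<^sup>2 =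
      (norm y)\<^sup>2"
    using stabiliser_norm subspace_R7 by (simp_all add: subspace_add)
  then show ?thesis
    by (simp add: A.add power2_norm_eq_inner inner_add_left inner_add_right
        inner_commute[of y x] inner_commute[of "A y" "A x"])
qed

text \<open>Once \<open>A\<close> is orthogonal, \<open>cogr\<close> agrees with \<open>A\<close> on
  cross products, so \<open>A\<close> commutes with the cross product and \<open>psi_cross\<close>
  applies.\<close>

lemma stabiliser_psi:
  assumes v: "\<And>i. v i \<in> R7"
  shows "ev kc psi_terms (\<lambda>i. A (v i)) = ev kc psi_terms v"
proof -
  have "cross7 (A a) (A b) = A (cross7 a b)" if "a \<in> R7" "b \<in> R7" for a b
  proof -
    have "A x \<bullet> A (cross7 a b) = x \<bullet> cross7 a b" for x
    proof -
      define x7 where "x7 = x - (x $ 0) *\<^sub>R axis 0 1"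
      have x7: "x7 \<in> R7" by (simp add: x7_def R7_def axis_def)
      have x: "x = x7 + (x $ 0) *\<^sub>R axis 0 1" by (simp add: x7_def)
      have "A x = A x7 + (x $ 0) *\<^sub>R axis 0 1" by (metis x A.add A.scale A0)
      moreover have "axis 0 1 \<bullet> A (cross7 a b) = 0" "axis 0 1 \<bullet> cross7 a b = 0"
        using A7[of "cross7 a b"] by (simp_all add: R7_def inner_axis')
      ultimately show ?thesis
        using stabiliser_inner[OF x7, of "cross7 a b"] x by (metis add.right_neutral cross7_in_R7 inner_add_left
            inner_scaleR_left mult_zero_right)
    qed
    then show ?thesis unfolding cross7_A by (rule cogr_unique[symmetric])
  qed
  then show ?thesis
    using v A7 by (simp add: psi_cross stabiliser_inner)
qed

end

subsection \<open>The Hodge star of a \<open>G\<^sub>2\<close>-form\<close>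

lemma wl_permute:
  fixes as :: "('v \<Rightarrow> real) list"
  assumes \<sigma>: "\<sigma> permutes {..<length as}"
  shows "wl as (\<lambda>i. v (\<sigma> i)) = of_int (sign \<sigma>) * wl as v"
proof -
  let ?P = "{\<tau>. \<tau> permutes {..<length as}}"
  define F where "F \<tau> = (\<Prod>j<length as. (as ! j) (v (\<tau> j)))" for \<tau>
  have p\<sigma>: "permutation \<sigma>" using \<sigma> by (auto simp: permutation_permutes)
  have "wl as (\<lambda>i. v (\<sigma> i)) = (\<Sum>\<tau>\<in>?P. of_int (sign \<tau>) * F (\<sigma> \<circ> \<tau>))"
    unfolding wl_leibniz[symmetric] F_def by simp
  also have "\<dots> = (\<Sum>\<tau>\<in>?P. of_int (sign \<sigma>) * (of_int (sign (\<sigma> \<circ> \<tau>)) * F (\<sigma> \<circ> \<tau>)))"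
  proof (rule sum.cong[OF refl])
    fix \<tau> assume "\<tau> \<in> ?P"
    then have "permutation \<tau>" by (auto simp: permutation_permutes)
    then have "sign \<tau> = sign \<sigma> * sign (\<sigma> \<circ> \<tau>)"
      by (simp add: sign_compose[OF p\<sigma>] mult.assoc[symmetric] del: comp_apply)
    then show "of_int (sign \<tau>) * F (\<sigma> \<circ> \<tau>) = of_int (sign \<sigma>) * (of_int (sign (\<sigma> \<circ> \<tau>)) * F (\<sigma> \<circ> \<tau>))"
      by simp
  qed
  also have "\<dots> = of_int (sign \<sigma>) * (\<Sum>\<tau>\<in>?P. of_int (sign (\<sigma> \<circ> \<tau>)) * F (\<sigma> \<circ> \<tau>))"
    by (rule sum_distrib_left[symmetric])
  also have "(\<Sum>\<tau>\<in>?P. of_int (sign (\<sigma> \<circ> \<tau>)) * F (\<sigma> \<circ> \<tau>)) = (\<Sum>\<tau>\<in>?P. of_int (sign \<tau>) * F \<tau>)"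
  proof (rule sum.reindex_bij_witness[where i="(\<circ>) (inv \<sigma>)" and j="(\<circ>) \<sigma>"])
    show "inv \<sigma> \<circ> (\<sigma> \<circ> \<tau>) = \<tau>" "\<sigma> \<circ> (inv \<sigma> \<circ> \<tau>) = \<tau>" for \<tau>
      using permutes_inv_o[OF \<sigma>] by (simp_all add: comp_assoc[symmetric] del: comp_apply)
  qed (auto simp: permutes_compose[OF _ \<sigma>] permutes_compose[OF _ permutes_inv[OF \<sigma>]])
  finally show ?thesis unfolding F_def wl_leibniz .
qed

definition fill :: "(nat \<Rightarrow> 8) \<Rightarrow> (nat \<Rightarrow> real ^ 8) \<Rightarrow> nat \<Rightarrow> real ^ 8" where
  "fill f w = (\<lambda>j. if j < 3 then axis (f j) 1 else w (j - 3))"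

text \<open>Among the index triples \<open>f\<close> only the permutations of \<open>is\<close>
  contribute, and all equally, because both factors change by the same sign. The 6 cancels the
  \<open>fact 3\<close> of \<open>star7\<close>.\<close>

lemma star7_term:
  assumes len: "length is = 3" and nz: "\<forall>i\<in>set is. (of_nat i :: 8) \<noteq> 0"
    and ks: "length ks \<ge> 3"
  shows "(\<Sum>f\<in>{..<3} \<rightarrow>\<^sub>E (UNIV - {0}). wl (map kc is) (\<lambda>j. axis (f j) 1) * wl (map kc ks) (fill f w))
    = 6 * wl (map kc ks) (fill (\<lambda>m. of_nat (is ! m)) w)"
proof -
  let ?P = "{\<sigma>::nat \<Rightarrow> nat. \<sigma> permutes {..<3}}" and ?F = "{..<3::nat} \<rightarrow>\<^sub>E (UNIV - {0 :: 8})"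
  let ?H = "\<lambda>f. wl (map kc ks) (fill f w)"
  define f0 :: "nat \<Rightarrow> 8" where "f0 = (\<lambda>m. of_nat (is ! m))"
  define g where "g \<sigma> = restrict (\<lambda>m. f0 (inv \<sigma> m)) {..<3}" for \<sigma> :: "nat \<Rightarrow> nat"
  have g: "g \<sigma> \<in> ?F" if \<sigma>: "\<sigma> permutes {..<3}" for \<sigma>
    using permutes_in_image[OF permutes_inv[OF \<sigma>]] nz len by (auto simp: g_def f0_def)
  have delta: "(\<Prod>j<3. (map kc is ! j) (axis (f (\<sigma> j)) 1)) = (if f = g \<sigma> then 1 else 0)"
    if f: "f \<in> ?F" and \<sigma>: "\<sigma> permutes {..<3}" for f \<sigma>
  proof -
    have kx: "(map kc is ! j) (axis (f (\<sigma> j)) 1) = (if f0 j = f (\<sigma> j) then 1 else 0)" if "j < 3" for j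
      using that len by (simp add: f0_def)
    show ?thesis
    proof (cases "f = g \<sigma>")
      case True
      have "f0 j = f (\<sigma> j)" if "j < 3" for j
        using that permutes_in_image[OF \<sigma>, of j] True by (simp add: g_def permutes_inverses[OF \<sigma>])
      then show ?thesis using True kx by simp
    next
      case False
      have "\<exists>m<3. f m \<noteq> f0 (inv \<sigma> m)"
      proof (rule ccontr)
        assume "\<not> ?thesis"
        then have "f = g \<sigma>" using f by (auto simp: g_def fun_eq_iff PiE_def extensional_def restrict_def)
        then show False using False by simp
      qed
      then obtain m where m: "m < 3" "f m \<noteq> f0 (inv \<sigma> m)" by blast
      have j: "inv \<sigma> m < 3" using permutes_in_image[OF permutes_inv[OF \<sigma>], of m] m by simp
      have "(map kc is ! inv \<sigma> m) (axis (f (\<sigma> (inv \<sigma> m))) 1) = 0"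
        unfolding kx[OF j] using m by (simp add: permutes_inverses[OF \<sigma>])
      then have "(\<Prod>j<3. (map kc is ! j) (axis (f (\<sigma> j)) 1)) = 0"
        using j by (intro prod_zero bexI[of _ "inv \<sigma> m"]) auto
      then show ?thesis using False by simp
    qed
  qed
  have H: "?H (g \<sigma>) = of_int (sign \<sigma>) * ?H f0" if \<sigma>: "\<sigma> permutes {..<3}" for \<sigma>
  proof -
    have i\<sigma>: "inv \<sigma> permutes {..<3}" by (rule permutes_inv[OF \<sigma>])
    have "fill (g \<sigma>) w = (\<lambda>j. fill f0 w (inv \<sigma> j))"
    proof
      fix j
      show "fill (g \<sigma>) w j = fill f0 w (inv \<sigma> j)"
        using permutes_in_image[OF i\<sigma>, of j] permutes_not_in[OF i\<sigma>, of j]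
        by (cases "j < 3") (auto simp: fill_def g_def)
    qed
    moreover have "inv \<sigma> permutes {..<length (map kc ks)}"
      by (rule permutes_subset[OF i\<sigma>]) (use ks in auto)
    moreover have "sign (inv \<sigma>) = sign \<sigma>" using \<sigma> by (intro sign_inverse) (auto simp: permutation_permutes)
    ultimately show ?thesis using wl_permute[of "inv \<sigma>" "map kc ks" "fill f0 w"] by simp
  qed
  have "(\<Sum>f\<in>?F. wl (map kc is) (\<lambda>j. axis (f j) 1) * ?H f)
    = (\<Sum>f\<in>?F. \<Sum>\<sigma>\<in>?P. of_int (sign \<sigma>) * ((if f = g \<sigma> then 1 else 0) * ?H f))"
  proof (rule sum.cong[OF refl])
    fix f assume f: "f \<in> ?F"
    have "wl (map kc is) (\<lambda>j. axis (f j) 1) = (\<Sum>\<sigma>\<in>?P. of_int (sign \<sigma>) * (if f = g \<sigma> then 1 else 0))"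
      using wl_leibniz[of "map kc is" "\<lambda>j. axis (f j) 1"] delta[OF f] len by simp
    then show "wl (map kc is) (\<lambda>j. axis (f j) 1) * ?H f
      = (\<Sum>\<sigma>\<in>?P. of_int (sign \<sigma>) * ((if f = g \<sigma> then 1 else 0) * ?H f))"
      by (simp only: sum_distrib_right mult.assoc)
  qed
  also have "\<dots> = (\<Sum>\<sigma>\<in>?P. of_int (sign \<sigma>) * (\<Sum>f\<in>?F. (if f = g \<sigma> then ?H f else 0)))"
    unfolding sum_distrib_left by (rule trans[OF sum.swap]) (intro sum.cong refl, simp)
  also have "\<dots> = (\<Sum>\<sigma>\<in>?P. of_int (sign \<sigma>) * ?H (g \<sigma>))"
    using g by (intro sum.cong refl) (auto simp: sum.delta' finite_PiE)
  also have "\<dots> = (\<Sum>\<sigma>\<in>?P. ?H f0)"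
    by (intro sum.cong refl) (simp add: H mult.assoc[symmetric] flip: of_int_mult)
  also have "\<dots> = 6 * ?H f0"
    by (simp add: card_permutations[of "{..<3}" 3] fact_numeral)
  finally show ?thesis by (simp add: f0_def)
qed

text \<open>Inserting three basis vectors into the volume form leaves the product of the
  complementary coordinates, listed in an order that makes the whole permutation even.\<close>

lemma wl_kc_dual:
  assumes "sort ([i, j, k] @ rest) = [1, 2, 3, 4, 5, 6, 7]"
    and ne: "\<forall>m\<in>set rest. (of_nat m :: 8) \<noteq> of_nat i \<and> (of_nat m :: 8) \<noteq> of_nat j \<and> (of_nat m :: 8) \<noteq> of_nat k"
      "(of_nat i :: 8) \<noteq> of_nat j" "(of_nat i :: 8) \<noteq> of_nat k" "(of_nat j :: 8) \<noteq> of_nat k"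
    and ps: "psign ([i, j, k] @ rest) = 1"
  shows "wl (map kc [1, 2, 3, 4, 5, 6, 7]) (fill (\<lambda>m. of_nat ([i, j, k] ! m)) w) = wl (map kc rest) w"
proof -
  let ?v = "fill (\<lambda>m. of_nat ([i, j, k] ! m)) w"
  have v: "?v 0 = axis (of_nat i) 1" "skip 0 ?v 0 = axis (of_nat j) 1" "skip 0 (skip 0 ?v) 0 = axis
      (of_nat k) 1"
    "skip 0 (skip 0 (skip 0 ?v)) = w"
  proof -
    have sk: "skip 0 u = (\<lambda>j. u (Suc j))" for u :: "nat \<Rightarrow> real ^ 8" by (simp add: skip_def)
    have "Suc (Suc (Suc m)) - 3 = m" "\<not> Suc (Suc (Suc m)) < 3" for m by simp_all
    then show "?v 0 = axis (of_nat i) 1" "skip 0 ?v 0 = axis (of_nat j) 1"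
      "skip 0 (skip 0 ?v) 0 = axis (of_nat k) 1" "skip 0 (skip 0 (skip 0 ?v)) = w"
      unfolding sk fill_def by simp_all
  qed
  have "wl (map kc [1, 2, 3, 4, 5, 6, 7]) ?v = wl (kc i # kc j # kc k # map kc rest) ?v"
    using wl_sort[of kc "[i, j, k] @ rest" ?v] unfolding assms(1) ps by (simp del: wl.simps)
  also have "\<dots> = wl (kc j # kc k # map kc rest) (skip 0 ?v)"
    by (rule wl_dual_first) (use ne in \<open>auto simp: v\<close>)
  also have "\<dots> = wl (kc k # map kc rest) (skip 0 (skip 0 ?v))"
    by (rule wl_dual_first) (use ne in \<open>auto simp: v\<close>)
  also have "\<dots> = wl (map kc rest) (skip 0 (skip 0 (skip 0 ?v)))"
    by (rule wl_dual_first) (use ne in \<open>auto simp: v\<close>)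
  finally show ?thesis by (simp only: v(4))
qed

lemma dx_kc_7: "dx [1, 2, 3, 4, 5, 6, 7] v = wl (map kc [1, 2, 3, 4, 5, 6, 7]) v"
  using dx_kc[of "[1, 2, 3, 4, 5, 6, 7]" v] by (simp del: wl.simps)

lemma star7_phi0: "star7 3 phi0 w = ev kc psi_terms w"
proof -
  let ?F = "{..<3::nat} \<rightarrow>\<^sub>E (UNIV - {0 :: 8})" and ?ks = "[1, 2, 3, 4, 5, 6, 7] :: nat list"
  have T: "(\<Sum>f\<in>?F. wl (map kc [i, j, k]) (\<lambda>j. axis (f j) 1) * wl (map kc ?ks) (fill f w)) = 6 * wl (map kc
      rest) w"
    if "sort ([i, j, k] @ rest) = ?ks" "\<forall>m\<in>set [i, j, k]. (of_nat m :: 8) \<noteq> 0"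
      "\<forall>m\<in>set rest. (of_nat m :: 8) \<noteq> of_nat i \<and> (of_nat m :: 8) \<noteq> of_nat j \<and> (of_nat m :: 8) \<noteq> of_nat k"
      "(of_nat i :: 8) \<noteq> of_nat j" "(of_nat i :: 8) \<noteq> of_nat k" "(of_nat j :: 8) \<noteq> of_nat k"
      "psign ([i, j, k] @ rest) = 1" for i j k rest
    using star7_term[of "[i, j, k]" ?ks w] wl_kc_dual[OF that(1,3-7), of w] that(2) by (simp del: wl.simps
        list.map)
  have "6 * star7 3 phi0 w = (\<Sum>f\<in>?F. ev kc phi_terms (\<lambda>j. axis (f j) 1) * wl (map kc ?ks) (fill f w))"
    unfolding star7_def phi0_wl dx_kc_7 fill_def[symmetric] by (simp add: fact_numeral del: wl.simps list.map)
  also have "\<dots> = (\<Sum>(c, is)\<leftarrow>phi_terms. c * (\<Sum>f\<in>?F. wl (map kc is) (\<lambda>j. axis (f j) 1) * wl (map kc ?ks)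
      (fill f w)))"
  proof -
    have "(\<Sum>f\<in>?F. ev kc cs (X f) * H f) = (\<Sum>(c, is)\<leftarrow>cs. c * (\<Sum>f\<in>?F. wl (map kc is) (X f) * H f))" for cs X H
      by (induction cs) (auto simp: distrib_right sum.distrib sum_distrib_left mult.assoc)
    then show ?thesis .
  qed
  also have "\<dots> = 6 * ev kc psi_terms w"
    using T[of 1 2 3 "[4, 5, 6, 7]"] T[of 1 4 5 "[2, 3, 6, 7]"] T[of 1 6 7 "[2, 3, 4, 5]"] T[of 2 4 6 "[1,
        3, 5, 7]"]
      T[of 2 5 7 "[1, 3, 4, 6]"] T[of 3 4 7 "[1, 2, 5, 6]"] T[of 3 5 6 "[1, 2, 4, 7]"]
    by (simp add: phi_terms_def psi_terms_def del: wl.simps)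
  finally show ?thesis by simp
qed

lemma star7_cong:
  assumes "\<And>f. f \<in> {..<k} \<rightarrow>\<^sub>E (UNIV - {0}) \<Longrightarrow> \<beta> (\<lambda>j. axis (f j) 1) = \<gamma> (\<lambda>j. axis (f j) 1)"
  shows "star7 k \<beta> = star7 k \<gamma>"
  unfolding star7_def using assms by (auto intro!: sum.cong)

lemma phi0_cong: "v 0 = w 0 \<Longrightarrow> v 1 = w 1 \<Longrightarrow> v 2 = w 2 \<Longrightarrow> phi0 v = phi0 w"
  by (simp add: phi0_cross)

lemma cross7_proj: "cross7 u v \<bullet> w = cross7 (u - (u $ 0) *\<^sub>R axis 0 1) (v - (v $ 0) *\<^sub>R axis 0 1) \<bullet> (w -
    (w $ 0) *\<^sub>R axis 0 1)"
  by (simp add: inner_8 mn_def axis_def)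

text \<open>\<open>g2_star\<close> rests on a frame \<open>L\<close> picked by choice. A given frame
  \<open>L0\<close> differs from it by an element of the stabiliser of \<open>phi0\<close>, which
  leaves the form \<open>psi_terms\<close> unchanged; so an explicit frame computes the
  star.\<close>

lemma g2_star_frame:
  fixes \<phi> :: "('v::euclidean_space, real) covec"
  assumes L0: "g2_frame \<phi> L0"
  shows "g2_star \<phi> 3 \<phi> = pullback L0 (ev kc psi_terms)"
proof -
  define L where "L = (SOME L. g2_frame \<phi> L)"
  have L: "g2_frame \<phi> L" unfolding L_def by (rule someI_ex[of "g2_frame \<phi>", OF exI[of _ L0], OF L0])
  have lin: "linear L" "linear L0" and bij: "bij_betw L UNIV R7" "bij_betw L0 UNIV R7"
    and eq: "\<phi> = pullback L phi0" "\<phi> = pullback L0 phi0"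
    using L L0 by (auto simp: g2_frame_def)
  have star: "star7 3 (pullback (inv_into UNIV L) \<phi>) = star7 3 phi0"
  proof (rule star7_cong)
    fix f :: "nat \<Rightarrow> 8" assume f: "f \<in> {..<3} \<rightarrow>\<^sub>E (UNIV - {0})"
    have "L (inv_into UNIV L (axis (f j) 1)) = axis (f j) 1" if "j < 3" for j
    proof -
      have "f j \<noteq> 0" using f that by auto
      then have "axis (f j) 1 \<in> range L" using bij by (auto simp: bij_betw_def R7_def axis_def)
      then show ?thesis by (rule f_inv_into_f)
    qed
    then show "pullback (inv_into UNIV L) \<phi> (\<lambda>j. axis (f j) 1) = phi0 (\<lambda>j. axis (f j) 1)"
      unfolding eq(1) pullback_def by (intro phi0_cong) auto
  qed
  have "inj L0" "inj L" using bij by (auto simp: bij_betw_def)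
  obtain g where g: "linear g" "g \<circ> L0 = id"
    using linear_injective_left_inverse[OF lin(2) \<open>inj L0\<close>] by blast
  have gL0: "g (L0 x) = x" for x using g(2) by (metis comp_apply id_apply)
  have L0g: "L0 (g y) = y" if "y \<in> R7" for y
    using that bij(2) gL0 by (metis bij_betw_imp_surj_on imageE)
  let ?pr = "\<lambda>x::real ^ 8. x - (x $ 0) *\<^sub>R axis 0 1"
  \<comment> \<open>On \<open>R7\<close> this is \<open>L\<close> after the inverse of
    \<open>L0\<close>; the normal axis is fixed.\<close>
  define A where "A x = L (g (?pr x)) + (x $ 0) *\<^sub>R axis 0 1" for x
  have prR: "?pr x \<in> R7" for x by (simp add: R7_def axis_def)
  have LR: "L x \<in> R7" for x using bij(1) by (auto simp: bij_betw_def)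
  have linpr: "linear ?pr" by (rule linearI) (auto simp: algebra_simps)
  have "linear (\<lambda>x. L (g (?pr x)))"
    using linear_compose[OF linear_compose[OF linpr g(1)] lin(1)] by (simp add: o_def)
  moreover have "linear (\<lambda>x::real ^ 8. (x $ 0) *\<^sub>R axis (0::8) (1::real))" by (rule linearI) (auto simp:
      algebra_simps)
  ultimately have linA: "linear A" unfolding A_def[abs_def] by (rule linear_compose_add)
  have A0: "A (axis 0 1) = axis 0 1"
    using linear_0[OF lin(1)] linear_0[OF g(1)] by (simp add: A_def axis_def)
  have AL: "A x = L (g x)" if "x \<in> R7" for x using that by (simp add: A_def R7_def)
  have A7: "A x \<in> R7" if "x \<in> R7" for x using AL[OF that] LR by simp
  have A_comp0: "A x $ 0 = x $ 0" for x using LR[of "g (?pr x)"] by (simp add: A_def R7_def)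
  have "inj A"
  proof (rule linear_injective_0[THEN iffD2, OF linA], intro allI impI)
    fix x assume x: "A x = 0"
    then have x0: "x $ 0 = 0" using A_comp0[of x] by simp
    then have xR: "x \<in> R7" by (simp add: R7_def)
    have "L (g x) = L 0" using x AL[OF xR] linear_0[OF lin(1)] by simp
    then have "g x = 0" using \<open>inj L\<close> by (auto dest: injD)
    then show "x = 0" using L0g[OF xR] linear_0[OF lin(2)] by simp
  qed
  then have bijA: "bij A" using linear_injective_imp_surjective[OF linA] by (simp add: bij_def)
  have pres: "cross7 (A u) (A v) \<bullet> A w = cross7 u v \<bullet> w" for u v w
  proof -
    have pA: "?pr (A x) = L (g (?pr x))" for x unfolding A_comp0 by (simp add: A_def)
    have "cross7 (A u) (A v) \<bullet> A w = cross7 (L (g (?pr u))) (L (g (?pr v))) \<bullet> L (g (?pr w))"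
      unfolding cross7_proj[of "A u"] pA ..
    also have "\<dots> = pullback L phi0 (tri (g (?pr u)) (g (?pr v)) (g (?pr w)))"
      by (simp add: pullback_def phi0_cross tri_def)
    also have "pullback L phi0 = pullback L0 phi0" using eq by simp
    also have "pullback L0 phi0 (tri (g (?pr u)) (g (?pr v)) (g (?pr w))) = cross7 (?pr u) (?pr v) \<bullet> ?pr w"
      unfolding pullback_def phi0_cross tri_def using L0g[OF prR] by simp
    also have "\<dots> = cross7 u v \<bullet> w" by (rule cross7_proj[symmetric])
    finally show ?thesis .
  qed
  have "ev kc psi_terms (\<lambda>i. L (v i)) = ev kc psi_terms (\<lambda>i. L0 (v i))" for v
  proof -
    have L0R: "L0 (v i) \<in> R7" for i using bij(2) by (auto simp: bij_betw_def)
    have "L (v i) = A (L0 (v i))" for i using AL[OF L0R] gL0 by simp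
    then show ?thesis
      using stabiliser_psi[OF linA bijA A0 A7 pres, of "\<lambda>i. L0 (v i)"] L0R by simp
  qed
  then show ?thesis
    unfolding g2_star_def Let_def L_def[symmetric] star by (simp add: pullback_def star7_phi0 fun_eq_iff)
qed

subsection \<open>Forms on the base in coordinates\<close>

text \<open>Indices from 5 on give 0, since a family of 1-forms is a function on all natural
  numbers.\<close>

definition bco :: "nat \<Rightarrow> base \<Rightarrow> real" where
  "bco i p = (if i = 0 then Re (fst (fst p)) else if i = 1 then Im (fst (fst p))
    else if i = 2 then Re (snd (fst p)) else if i = 3 then Im (snd (fst p))
    else if i = 4 then snd p else 0)"

definition eb :: "nat \<Rightarrow> base" where
  "eb i = (if i = 0 then ((1, 0), 0) else if i = 1 then ((\<i>, 0), 0)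
    else if i = 2 then ((0, 1), 0) else if i = 3 then ((0, \<i>), 0) else (0, 1))"

lemma bco_simps [simp]: "bco 0 p = Re (fst (fst p))" "bco (Suc 0) p = Im (fst (fst p))"
  "bco 2 p = Re (snd (fst p))" "bco 3 p = Im (snd (fst p))" "bco 4 p = snd p"
  by (simp_all add: bco_def)

lemma eb_simps [simp]: "eb 0 = ((1, 0), 0)" "eb (Suc 0) = ((\<i>, 0), 0)" "eb 2 = ((0, 1), 0)"
  "eb 3 = ((0, \<i>), 0)" "eb 4 = (0, 1)"
  by (simp_all add: eb_def)

lemma linear_bco: "linear (bco i)"
  by (rule linearI) (auto simp: bco_def)

lemma base_decomp: "p = bco 0 p *\<^sub>R eb 0 + bco 1 p *\<^sub>R eb 1 + bco 2 p *\<^sub>R eb 2 + bco 3 p *\<^sub>R eb 3 + bco 4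
    p *\<^sub>R eb 4"
  by (simp add: prod_eq_iff complex_eq_iff)

lemma surf_decomp: "p = Re (fst p) *\<^sub>R (1, 0) + Im (fst p) *\<^sub>R (\<i>, 0) + Re (snd p) *\<^sub>R (0, 1) + Im (snd p)
    *\<^sub>R (0, \<i>)"
  for p :: surf
  by (simp add: prod_eq_iff complex_eq_iff)

lemma dird_base:
  assumes "f differentiable (at b)"
  shows "dird p f b = (\<Sum>k\<leftarrow>[0, 1, 2, 3, 4]. dird (eb k) f b * bco k p)"
proof -
  interpret linear "\<lambda>h. dird h f b" by (rule linear_dird[OF assms])
  show ?thesis by (subst base_decomp) (simp add: add scale del: eb_simps)
qed

lemma dird_surf:
  fixes f :: "surf \<Rightarrow> real"
  assumes "f differentiable (at z)"
  shows "dird p f z = Re (fst p) * dird (1, 0) f z + Im (fst p) * dird (\<i>, 0) f z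
    + Re (snd p) * dird (0, 1) f z + Im (snd p) * dird (0, \<i>) f z"
proof -
  interpret linear "\<lambda>h. dird h f z" by (rule linear_dird[OF assms])
  show ?thesis by (subst surf_decomp) (simp only: add scale real_scaleR_def)
qed

lemma dird_dird_surf:
  fixes f :: "surf \<Rightarrow> real"
  assumes V: "open V" "smooth_on f V" "z \<in> V"
  shows "dird q (dird p f) z = Re (fst p) * dird q (dird (1, 0) f) z + Im (fst p) * dird q (dird (\<i>, 0) f) z
    + Re (snd p) * dird q (dird (0, 1) f) z + Im (snd p) * dird q (dird (0, \<i>) f) z"
proof -
  have d: "dird e f differentiable (at z)" for e
    using V smooth_on_differentiable smooth_on_dird by blast
  have "dird q (dird p f) z = dird q (\<lambda>z. Re (fst p) * dird (1, 0) f z + Im (fst p) * dird (\<i>, 0) f z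
    + Re (snd p) * dird (0, 1) f z + Im (snd p) * dird (0, \<i>) f z) z"
    by (rule dird_cong[OF V(1,3)]) (rule dird_surf, use V smooth_on_differentiable in blast)
  also have "\<dots> = Re (fst p) * dird q (dird (1, 0) f) z + Im (fst p) * dird q (dird (\<i>, 0) f) z
    + Re (snd p) * dird q (dird (0, 1) f) z + Im (snd p) * dird q (dird (0, \<i>) f) z"
    using d by (simp add: dird_add dird_cmult)
  finally show ?thesis .
qed

definition sco :: "nat \<Rightarrow> surf \<Rightarrow> real" where
  "sco i p = bco i (p, 0)"

lemma sco_simps [simp]: "sco 0 p = Re (fst p)" "sco (Suc 0) p = Im (fst p)"
  "sco 2 p = Re (snd p)" "sco 3 p = Im (snd p)"
  by (simp_all add: sco_def)

lemma wl_2: "wl [a, b] v = a (v 0) * b (v 1) - a (v 1) * b (v 0)"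
  by (simp add: wone_def skip_def)

lemma wl_1: "wl [a] v = a (v 0)"
  by (simp add: wone_def)

lemma dd_c_alt: "dd_c f z v = dird (v 0) (dird (J1 (v 1)) f) z - dird (v 1) (dird (J1 (v 0)) f) z"
  unfolding dd_c_def ext_d_dird by (simp add: d_c_def skip_def dird_def)

lemma dd_c_ev:
  assumes V: "open V" "smooth_on f V" "z \<in> V"
  shows "dd_c f z v = ev sco [(- opP f z, [0, 1]), (- opQ f z, [2, 3]), (opT f z, [0, 2]), (opT f z, [1, 3]),
    (- opR f z, [0, 3]), (opR f z, [1, 2])] v"
proof -
  have sm: "smooth_on (dird e f) V" for e using V smooth_on_dird by blast
  have d: "dird e f differentiable (at z)" for e using sm V smooth_on_differentiable by blast
  note c = dird_commute[OF V, of "(\<i>, 0)" "(1, 0)"] dird_commute[OF V, of "(0, 1)" "(1, 0)"]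
    dird_commute[OF V, of "(0, \<i>)" "(1, 0)"] dird_commute[OF V, of "(0, 1)" "(\<i>, 0)"]
    dird_commute[OF V, of "(0, \<i>)" "(\<i>, 0)"] dird_commute[OF V, of "(0, \<i>)" "(0, 1)"]
  show ?thesis
    unfolding dd_c_alt dird_dird_surf[OF V, of "v 0" "J1 (v 1)"] dird_dird_surf[OF V, of "v 1" "J1 (v 0)"]
    unfolding dird_surf[OF d, of "v 0"] dird_surf[OF d, of "v 1"] c
    by (simp add: J1_def wl_2 op_defs algebra_simps del: wl.simps)
qed

lemma wl_compose: "wl (map (\<lambda>a p. a (f p)) as) v = wl as (\<lambda>i. f (v i))"
proof (induction as arbitrary: v)
  case (Cons a as)
  have "(\<lambda>j. f (skip i v j)) = skip i (\<lambda>j. f (v j))" for i by (auto simp: skip_def)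
  then show ?case using Cons by (simp add: wone_def)
qed simp

lemma ev_compose: "ev (\<lambda>i p. \<theta> i (f p)) cs v = ev \<theta> cs (\<lambda>i. f (v i))"
proof -
  have "wl (map (\<lambda>i p. \<theta> i (f p)) is) v = wl (map \<theta> is) (\<lambda>i. f (v i))" for "is"
    using wl_compose[of f "map \<theta> is" v] by (simp add: o_def)
  then show ?thesis by (simp add: ev_def)
qed

lemma ev_cong:
  assumes "\<And>c is i. (c, is) \<in> set cs \<Longrightarrow> i \<in> set is \<Longrightarrow> \<theta> i = \<theta>' i"
  shows "ev \<theta> cs v = ev \<theta>' cs v"
proof -
  have "map \<theta> is = map \<theta>' is" if "(c, is) \<in> set cs" for c "is" using assms that by simp
  then have "(case x of (c, is) \<Rightarrow> c * wl (map \<theta> is) v) = (case x of (c, is) \<Rightarrow> c * wl (map \<theta>' is) v)"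
    if "x \<in> set cs" for x
    using that by (metis (no_types, lifting) case_prod_conv surj_pair)
  then show ?thesis unfolding ev_def by (intro arg_cong[where f=sum_list] map_cong refl)
qed

text \<open>The shape of every real (1,1)-form on the surface: \<open>J1\<close>-invariance makes
  the coefficients of \<open>[0, 2]\<close> and \<open>[1, 3]\<close> equal and those of
  \<open>[0, 3]\<close> and \<open>[1, 2]\<close> opposite.\<close>

definition om1 :: "real \<Rightarrow> real \<Rightarrow> real \<Rightarrow> real \<Rightarrow> (real \<times> nat list) list" where
  "om1 P Q R T = [(- P, [0, 1]), (- Q, [2, 3]), (T, [0, 2]), (T, [1, 3]), (- R, [0, 3]), (R, [1, 2])]"

lemma omega1t_ev:
  assumes W: "open W" "smooth_on F W" "b \<in> W"
  shows "omega1t F b v = ev bco (om1 (coP F b) (coQ F b) (coR F b) (coT F b)) v"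
proof -
  have b: "(fst b, snd b) \<in> W" using W by simp
  have "dd_c (\<lambda>w. F (w, snd b)) (fst b) (\<lambda>i. fst (v i)) =
    ev sco (om1 (coP F b) (coQ F b) (coR F b) (coT F b)) (\<lambda>i. fst (v i))"
    using dd_c_ev[OF open_slice[OF W(1)] smooth_on_slice[OF W(1,2)], of "fst b" "snd b"] b op_slice[OF W(1,2) b]
    by (simp add: om1_def del: ev_Cons)
  also have "\<dots> = ev (\<lambda>i p. sco i (fst p)) (om1 (coP F b) (coQ F b) (coR F b) (coT F b)) v"
    by (rule ev_compose[symmetric])
  also have "\<dots> = ev bco (om1 (coP F b) (coQ F b) (coR F b) (coT F b)) v"
    by (rule ev_cong) (auto simp: om1_def fun_eq_iff)
  finally show ?thesis by (simp add: omega1t_def pullback_def)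
qed

lemma hol_symp_alt: "hol_symp v = fst (v 0) * snd (v 1) - fst (v 1) * snd (v 0)"
proof -
  have "(\<lambda>v. fst (v 0)) = wl [fst :: surf \<Rightarrow> complex]" "(\<lambda>v. snd (v 0)) = wl [snd :: surf \<Rightarrow> complex]"
    by (simp_all add: wl_1 fun_eq_iff del: wl.simps)
  then have "hol_symp v = wl [fst, snd] v"
    unfolding hol_symp_def using wedge_wl[of "[fst :: surf \<Rightarrow> complex]" 1 "[snd]" 1 v] by (simp del: wl.simps)
  then show ?thesis by (simp only: wl_2)
qed

lemma omega2_base_ev: "omega2_base b v = ev bco [(1, [0, 2]), (-1, [1, 3])] v"
  by (simp add: omega2_base_def pullback_def omega2_def hol_symp_alt wl_2 del: wl.simps)

lemma omega3_base_ev: "omega3_base b v = ev bco [(1, [0, 3]), (1, [1, 2])] v"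
  by (simp add: omega3_base_def pullback_def omega3_def hol_symp_alt wl_2 del: wl.simps)

lemma ds_base_ev: "ds_base b v = ev bco [(1, [4])] v"
  by (simp add: ds_base_def wl_1 del: wl.simps)

subsection \<open>The two forms of the equation\<close>

lemma dird2_scale_F:
  fixes F :: "base \<Rightarrow> real"
  assumes W: "open W" "smooth_on F W" "b \<in> W"
  shows "dird a (dird e (\<lambda>b. k * F b)) b = k * dird a (dird e F) b"
proof -
  have d: "F differentiable (at y)" "dird e F differentiable (at y)" if "y \<in> W" for y
    using W that smooth_on_differentiable smooth_on_dird by blast+
  have "dird a (dird e (\<lambda>b. k * F b)) b = dird a (\<lambda>b. k * dird e F b) b"
    by (rule dird_cong[OF W(1,3)]) (simp add: dird_cmult d)
  then show ?thesis using d W by (simp add: dird_cmult)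
qed

lemma co_scale:
  fixes F :: "base \<Rightarrow> real"
  assumes W: "open W" "smooth_on F W" "b \<in> W"
  shows "coP (\<lambda>b. k * F b) b = k * coP F b" "coQ (\<lambda>b. k * F b) b = k * coQ F b"
    "coR (\<lambda>b. k * F b) b = k * coR F b" "coT (\<lambda>b. k * F b) b = k * coT F b"
  by (simp_all add: co_defs dird2_scale_F[OF W] algebra_simps)

text \<open>The left-hand side is linear in \<open>F\<close> and the right-hand side quadratic, so
  division of \<open>F\<close> by 4 multiplies \<open>\<kappa>\<close> by 4.\<close>

lemma pde_scale:
  fixes F :: "base \<Rightarrow> real"
  assumes W: "open W" "smooth_on F W" "b \<in> W" and "pde (1 / 4) c F b"
  shows "pde 1 c (\<lambda>b. F b / 4) b"
proof -
  have "(\<lambda>b. F b / 4) = (\<lambda>b. 1 / 4 * F b)" by simp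
  then show ?thesis
    using assms(4) unfolding pde_def Delta_def
    by (simp only: co_scale[OF W] dird2_scale_F[OF W]) (simp add: power2_eq_square field_simps)
qed

lemma frechet_of_real:
  assumes g: "g1 differentiable (at z)" "g2 differentiable (at z)"
  shows "frechet_derivative (\<lambda>w. (complex_of_real (g1 w) + \<i> * of_real (g2 w)) / 2) (at z) e
    = (of_real (dird e g1 z) + \<i> * of_real (dird e g2 z)) / 2"
proof -
  have "((\<lambda>w. (complex_of_real (g1 w) + \<i> * of_real (g2 w)) / 2) has_derivative
    (\<lambda>e. (of_real (dird e g1 z) + \<i> * of_real (dird e g2 z)) / 2)) (at z)"
    unfolding divide_inverse by (intro has_derivative_mult_left has_derivative_add
        has_derivative_mult_right has_derivative_of_real
        has_derivative_dird g)
  from fun_cong[OF frechet_derivative_at[OF this], of e] show ?thesis by (rule sym)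
qed

lemma complex_hessian_entry:
  fixes f :: "surf \<Rightarrow> real"
  assumes V: "open V" "smooth_on f V" "z \<in> V"
  shows "complex_hessian f z $ i $ j =
    (of_real (dird (unit_dir i 1) (dird (unit_dir j 1) f) z + dird (unit_dir i \<i>) (dird (unit_dir j \<i>) f) z)
     + \<i> * of_real (dird (unit_dir i 1) (dird (unit_dir j \<i>) f) z - dird (unit_dir i \<i>) (dird (unit_dir j
         1) f) z)) / 4"
proof -
  have d: "f differentiable (at y)" "dird e f differentiable (at y)" if "y \<in> V" for e y
    using V that smooth_on_differentiable smooth_on_dird by blast+
  let ?g = "\<lambda>w. (complex_of_real (dird (unit_dir j 1) f w) + \<i> * of_real (dird (unit_dir j \<i>) f w)) / 2"
  have zb: "d_zbar j (\<lambda>w. complex_of_real (f w)) w = ?g w" if "w \<in> V" for w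
  proof -
    have *: "((\<lambda>w. complex_of_real (f w)) has_derivative (\<lambda>e. of_real (dird e f w))) (at w)"
      by (intro has_derivative_of_real has_derivative_dird d that)
    show ?thesis
      unfolding d_zbar_def frechet_derivative_at[OF *, symmetric] ..
  qed
  have fr: "frechet_derivative (d_zbar j (\<lambda>w. complex_of_real (f w))) (at z) = frechet_derivative ?g (at z)"
    by (rule frechet_derivative_cong_open[OF V(1,3)]) (rule zb)
  have "complex_hessian f z $ i $ j = d_z i (d_zbar j (\<lambda>w. complex_of_real (f w))) z"
    by (simp add: complex_hessian_def)
  also have "\<dots> = (frechet_derivative ?g (at z) (unit_dir i 1) - \<i> * frechet_derivative ?g (at z) (unit_dir
      i \<i>)) / 2"
    unfolding d_z_def fr ..
  also have "\<dots> = (of_real (dird (unit_dir i 1) (dird (unit_dir j 1) f) z + dird (unit_dir i \<i>) (dird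
      (unit_dir j \<i>) f) z)
     + \<i> * of_real (dird (unit_dir i 1) (dird (unit_dir j \<i>) f) z - dird (unit_dir i \<i>) (dird (unit_dir j
         1) f) z)) / 4"
    unfolding frechet_of_real[OF d(2) d(2), OF V(3) V(3)] by (simp add: complex_eq_iff field_simps)
  finally show ?thesis .
qed

lemma det_complex_hessian:
  fixes f :: "surf \<Rightarrow> real"
  assumes V: "open V" "smooth_on f V" "z \<in> V"
  shows "det (complex_hessian f z) = of_real ((opP f z * opQ f z - opR f z ^ 2 - opT f z ^ 2) / 16)"
proof -
  have c: "dird (0, 1) (dird (1, 0) f) z = dird (1, 0) (dird (0, 1) f) z"
    "dird (0, \<i>) (dird (\<i>, 0) f) z = dird (\<i>, 0) (dird (0, \<i>) f) z"
    "dird (0, 1) (dird (\<i>, 0) f) z = dird (\<i>, 0) (dird (0, 1) f) z"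
    "dird (0, \<i>) (dird (1, 0) f) z = dird (1, 0) (dird (0, \<i>) f) z"
    "dird (\<i>, 0) (dird (1, 0) f) z = dird (1, 0) (dird (\<i>, 0) f) z"
    "dird (0, \<i>) (dird (0, 1) f) z = dird (0, 1) (dird (0, \<i>) f) z"
    by (rule dird_commute[OF V])+
  have "(2::2) \<noteq> 1" by simp
  then show ?thesis
    unfolding det_2 complex_hessian_entry[OF V] unit_dir_def op_defs
    by (simp add: c complex_eq_iff power2_eq_square field_simps)
qed

text \<open>Four times the determinant is \<open>Delta F b / 4\<close>, whence
  \<open>\<kappa> = 1 / 4\<close>.\<close>

lemma ma_equation_iff:
  fixes F :: "base \<Rightarrow> real"
  assumes W: "open W" "smooth_on F W" "b \<in> W"
  shows "ma_equation c F b \<longleftrightarrow> pde (1 / 4) c F b"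
proof -
  have b: "(fst b, snd b) \<in> W" using W by simp
  have "det (complex_hessian (\<lambda>w. F (w, snd b)) (fst b)) = of_real (Delta F b / 16)"
    using det_complex_hessian[OF open_slice[OF W(1)] smooth_on_slice[OF W(1,2)], of "fst b" "snd b"] b
      op_slice[OF W(1,2) b] by (simp add: Delta_def)
  then have "ma_equation c F b \<longleftrightarrow> complex_of_real (dird (0, 1) (dird (0, 1) F) b)
      = of_real (snd b * (snd b + c) * (4 * (Delta F b / 16)))"
    unfolding ma_equation_def Let_def s_deriv2_eq[OF W] by (simp only: of_real_mult of_real_numeral)
  also have "\<dots> \<longleftrightarrow> dird (0, 1) (dird (0, 1) F) b = snd b * (snd b + c) * (4 * (Delta F b / 16))"
    by (rule of_real_eq_iff)
  finally show ?thesis unfolding pde_def by simp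
qed

lemma wl_of_real: "wl (map (\<lambda>a p. complex_of_real (a p)) as) v = of_real (wl as v)"
  by (induction as arbitrary: v) (simp_all add: wone_def)

text \<open>Both sides are multiples of the Euclidean volume form:
  \<open>\<omega> \<and> \<omega>\<close> is \<open>2 Delta\<close> times it, and the product of the
  holomorphic symplectic form with its conjugate is 4 times it.\<close>

lemma volume_condition_iff:
  fixes F :: "base \<Rightarrow> real"
  assumes W: "open W" "smooth_on F W" "b \<in> W"
  shows "volume_condition c F b \<longleftrightarrow> pde 1 c F b"
proof -
  have b: "(fst b, snd b) \<in> W" using W by simp
  let ?om = "om1 (coP F b) (coQ F b) (coR F b) (coT F b)"
  let ?W = "\<lambda>v. wl (map sco [0, 1, 2, 3]) v"
  define tc where "tc i p = complex_of_real (sco i p)" for i p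
  have om: "dd_c (\<lambda>w. F (w, snd b)) (fst b) = ev sco ?om"
    using dd_c_ev[OF open_slice[OF W(1)] smooth_on_slice[OF W(1,2)], of "fst b" "snd b"] b op_slice[OF W(1,2) b]
    by (simp add: om1_def fun_eq_iff del: ev_Cons)
  have srt: "wl (map sco is) v = of_int (psign is) * wl (map sco (sort is)) v" for "is" v by (rule wl_sort)
  have "wedge 2 2 (ev sco ?om) (ev sco ?om) v =
    ev sco (concat (map (\<lambda>(c, is). map (\<lambda>(d, js). (c * d, is @ js)) ?om) ?om)) v" for v
    by (rule wedge_ev) (auto simp: om1_def)
  moreover have "ev sco (concat (map (\<lambda>(c, is). map (\<lambda>(d, js). (c * d, is @ js)) ?om) ?om)) v
    = (\<Sum>(c, is)\<leftarrow>concat (map (\<lambda>(c, is). map (\<lambda>(d, js). (c * d, is @ js)) ?om) ?om).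
        c * (of_int (psign is) * wl (map sco (sort is)) v))" for v
    unfolding ev_def using srt by metis
  moreover have "(\<Sum>(c, is)\<leftarrow>concat (map (\<lambda>(c, is). map (\<lambda>(d, js). (c * d, is @ js)) ?om) ?om).
        c * (of_int (psign is) * wl (map sco (sort is)) v)) = 2 * Delta F b * ?W v" for v
    by (simp add: om1_def Delta_def power2_eq_square algebra_simps del: wl.simps)
  ultimately have w1: "wedge 2 2 (ev sco ?om) (ev sco ?om) v = 2 * Delta F b * ?W v" for v by (simp only:)
  let ?h = "[(1, [0, 2]), (\<i>, [0, 3]), (\<i>, [1, 2]), (-1, [1, 3])]"
  let ?k = "[(1, [0, 2]), (- \<i>, [0, 3]), (- \<i>, [1, 2]), (-1, [1, 3])]"
  have h: "hol_symp = ev tc ?h" "(\<lambda>w. cnj (hol_symp w)) = ev tc ?k"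
    by (auto simp: fun_eq_iff hol_symp_alt wl_2 tc_def complex_eq_iff simp del: wl.simps)
  have "wedge 2 2 (ev tc ?h) (ev tc ?k) v =
    ev tc (concat (map (\<lambda>(c, is). map (\<lambda>(d, js). (c * d, is @ js)) ?k) ?h)) v" for v
    by (rule wedge_ev) auto
  moreover have "ev tc (concat (map (\<lambda>(c, is). map (\<lambda>(d, js). (c * d, is @ js)) ?k) ?h)) v
    = (\<Sum>(c, is)\<leftarrow>concat (map (\<lambda>(c, is). map (\<lambda>(d, js). (c * d, is @ js)) ?k) ?h).
        c * (of_int (psign is) * wl (map tc (sort is)) v))" for v
    unfolding ev_def using wl_sort[of tc] by metis
  moreover have "(\<Sum>(c, is)\<leftarrow>concat (map (\<lambda>(c, is). map (\<lambda>(d, js). (c * d, is @ js)) ?k) ?h).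
        c * (of_int (psign is) * wl (map tc (sort is)) v)) = 4 * wl (map tc [0, 1, 2, 3]) v" for v
    by (simp del: wl.simps)
  moreover have "wl (map tc [0, 1, 2, 3]) v = of_real (?W v)" for v
    using wl_of_real[of "map sco [0, 1, 2, 3]" v] by (simp add: tc_def[abs_def] del: wl.simps)
  ultimately have w2: "wedge 2 2 hol_symp (\<lambda>w. cnj (hol_symp w)) v = 4 * of_real (?W v)" for v
    unfolding h(2) unfolding h(1) by (simp only:)
  have "volume_condition c F b \<longleftrightarrow> (\<forall>v. of_real (1 / 2 * dird (0, 1) (dird (0, 1) F) b) * (4 *
      complex_of_real (?W v))
      = of_real (snd b * (snd b + c) * (2 * Delta F b * ?W v)))"
    unfolding volume_condition_def Let_def om s_deriv2_eq[OF W] w1 w2 ..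
  also have "\<dots> \<longleftrightarrow> (\<forall>v. complex_of_real (1 / 2 * dird (0, 1) (dird (0, 1) F) b * (4 * ?W v))
      = of_real (snd b * (snd b + c) * (2 * Delta F b * ?W v)))" by simp
  also have "\<dots> \<longleftrightarrow> (\<forall>v. 1 / 2 * dird (0, 1) (dird (0, 1) F) b * (4 * ?W v)
      = snd b * (snd b + c) * (2 * Delta F b * ?W v))" unfolding of_real_eq_iff ..
  also have "\<dots> \<longleftrightarrow> dird (0, 1) (dird (0, 1) F) b = snd b * (snd b + c) * Delta F b"
  proof
    assume *: "\<forall>v. 1 / 2 * dird (0, 1) (dird (0, 1) F) b * (4 * ?W v) = snd b * (snd b + c) * (2 * Delta F
        b * ?W v)"
    \<comment> \<open>On the standard basis the volume form is 1, which extracts the scalar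
      equation.\<close>
    define v :: "nat \<Rightarrow> surf" where "v i = fst (eb i)" for i
    have "?W v = 1"
      by (simp add: wl_4_minors v_def del: wl.simps)
    then show "dird (0, 1) (dird (0, 1) F) b = snd b * (snd b + c) * Delta F b" using spec[OF *, of v] by simp
  qed simp
  finally show ?thesis unfolding pde_def by simp
qed

subsection \<open>Coframes on the torus bundles\<close>

type_synonym bform = "base \<Rightarrow> (base, real) covec"

text \<open>Indices of coframes: \<open>0, \<dots>, 3\<close> for \<open>dx\<^sub>1, dy\<^sub>1, dx\<^sub>2, dy\<^sub>2\<close>, and \<open>4, 5, 6, 7\<close> for \<open>ds, \<xi>, \<alpha>, \<eta>\<close>.\<close>

definition co7 :: "bform \<Rightarrow> bform \<Rightarrow> nat \<Rightarrow> tot7 \<Rightarrow> tot7 \<Rightarrow> real" where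
  "co7 X A i x p = (if i = 5 then fst (snd p) + X (fst x) (\<lambda>_. fst p)
    else if i = 6 then snd (snd p) + A (fst x) (\<lambda>_. fst p) else bco i (fst p))"

definition co8 :: "bform \<Rightarrow> bform \<Rightarrow> bform \<Rightarrow> nat \<Rightarrow> tot8 \<Rightarrow> tot8 \<Rightarrow> real" where
  "co8 X Y A i x p = (if i = 7 then fst p + Y (fst (snd x)) (\<lambda>_. fst (snd p)) else co7 X A i (snd x) (snd p))"

lemma one_form_arg: "smooth_form 1 B X \<Longrightarrow> b \<in> B \<Longrightarrow> X b v = X b (\<lambda>_. v 0)"
proof -
  assume "smooth_form 1 B X" "b \<in> B"
  then have "\<forall>v w. (\<forall>i<1. v i = w i) \<longrightarrow> X b v = X b w" unfolding smooth_form_def alternating_def by blast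
  then show ?thesis by (metis less_one)
qed

lemma one_form_linear: "smooth_form 1 B X \<Longrightarrow> b \<in> B \<Longrightarrow> linear (\<lambda>p. X b (\<lambda>_. p))"
proof -
  assume X: "smooth_form 1 B X" and b: "b \<in> B"
  have "\<forall>v. \<forall>i<1. linear (\<lambda>p. X b (v(i := p)))"
    using X b unfolding smooth_form_def alternating_def by blast
  then have "linear (\<lambda>p. X b ((\<lambda>_. 0)(0 := p)))" by blast
  moreover have "X b ((\<lambda>_. 0)(0 := p)) = X b (\<lambda>_. p)" for p
    using one_form_arg[OF X b, of "(\<lambda>_. 0)(0 := p)"] by simp
  ultimately show ?thesis by simp
qed

lemma one_form_smooth: "smooth_form 1 B X \<Longrightarrow> smooth_on (\<lambda>b. X b v) B"
  by (simp add: smooth_form_def)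

lemma bounded_linear_fst_snd: "bounded_linear (\<lambda>x. fst (snd x))"
  by (intro bounded_linear_compose[OF bounded_linear_fst bounded_linear_snd])

lemma open_base7: "open B \<Longrightarrow> open (B \<times> (UNIV :: (real \<times> real) set))"
  by (simp add: open_Times)

lemma open_base8: "open B \<Longrightarrow> open ((UNIV :: real set) \<times> B \<times> (UNIV :: (real \<times> real) set))"
  by (simp add: open_Times)

lemma smooth_on_co7:
  assumes "open B" "smooth_form 1 B X" "smooth_form 1 B A"
  shows "smooth_on (\<lambda>y. co7 X A i y p) (B \<times> UNIV)"
proof -
  have "smooth_on (\<lambda>y. Z (fst y) (\<lambda>_. fst p)) (B \<times> (UNIV :: (real \<times> real) set))" if "smooth_form 1 B Z"
      for Z :: bform
    by (rule smooth_on_compose_linear[OF assms(1) open_base7[OF assms(1)] bounded_linear_fst _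
        one_form_smooth[OF that]]) auto
  then show ?thesis using assms open_base7[OF assms(1)]
    by (cases "i = 5"; cases "i = 6") (auto simp: co7_def intro!: smooth_on_add)
qed

lemma smooth_on_co8:
  assumes "open B" "smooth_form 1 B X" "smooth_form 1 B Y" "smooth_form 1 B A"
  shows "smooth_on (\<lambda>y. co8 X Y A i y p) (UNIV \<times> B \<times> UNIV)"
proof (cases "i = 7")
  case True
  have "smooth_on (\<lambda>y::tot8. Y (fst (snd y)) (\<lambda>_. fst (snd p))) (UNIV \<times> B \<times> UNIV)"
    by (rule smooth_on_compose_linear[OF assms(1) open_base8[OF assms(1)] bounded_linear_fst_snd _
        one_form_smooth[OF assms(3)]]) auto
  then show ?thesis using True open_base8[OF assms(1)] by (auto simp: co8_def intro!: smooth_on_add)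
next
  case False
  have "smooth_on (\<lambda>y::tot8. co7 X A i (snd y) (snd p)) (UNIV \<times> B \<times> UNIV)"
    by (rule smooth_on_compose_linear[OF open_base7[OF assms(1)] open_base8[OF assms(1)] bounded_linear_snd _
          smooth_on_co7[OF assms(1,2,4)]]) auto
  then show ?thesis using False by (simp add: co8_def)
qed

lemma linear_co7:
  assumes "smooth_form 1 B X" "smooth_form 1 B A" "x \<in> B \<times> UNIV"
  shows "linear (co7 X A i x)"
proof -
  have b: "fst x \<in> B" using assms(3) by auto
  have "linear (\<lambda>p::tot7. fst (snd p))" "linear (\<lambda>p::tot7. snd (snd p))" "linear (\<lambda>p::tot7. bco i (fst p))"
    using linear_compose[OF linear_fst linear_bco[of i]] by (auto intro!: linearI simp: o_def)
  moreover have "linear (\<lambda>p::tot7. Z (fst x) (\<lambda>_. fst p))" if "smooth_form 1 B Z" for Z :: bform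
    using linear_compose[OF _ one_form_linear[OF that b], of fst] by (simp add: o_def linear_fst)
  ultimately show ?thesis using assms
    by (cases "i = 5"; cases "i = 6") (auto simp: co7_def[abs_def] intro!: linear_compose_add)
qed

lemma linear_co8:
  assumes "smooth_form 1 B X" "smooth_form 1 B Y" "smooth_form 1 B A" "x \<in> UNIV \<times> B \<times> UNIV"
  shows "linear (co8 X Y A i x)"
proof (cases "i = 7")
  case True
  have b: "fst (snd x) \<in> B" using assms(4) by auto
  have "linear (\<lambda>p::tot8. Y (fst (snd x)) (\<lambda>_. fst (snd p)))"
    using linear_compose[OF _ one_form_linear[OF assms(2) b], of "\<lambda>p. fst (snd p)"]
      bounded_linear.linear[OF bounded_linear_fst_snd] by (simp add: o_def)
  then show ?thesis using True by (auto simp: co8_def[abs_def] intro!: linear_compose_add linear_fst)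
next
  case False
  have "snd x \<in> B \<times> UNIV" using assms(4) by auto
  from linear_compose[OF linear_snd linear_co7[OF assms(1,3) this, of i]]
  show ?thesis using False by (simp add: co8_def[abs_def] o_def)
qed

subsection \<open>Curvatures\<close>

lemma ext_d_1: "ext_d 1 \<beta> x v = dird (v 0) (\<lambda>y. \<beta> y (skip 0 v)) x - dird (v 1) (\<lambda>y. \<beta> y (skip 1 v)) x"
  by (simp add: ext_d_dird)

text \<open>The fibre part \<open>k\<close> does not depend on the point, so only the potential
  \<open>X\<close> on the base contributes.\<close>

lemma ext_d_conn:
  fixes \<pi> :: "'v::euclidean_space \<Rightarrow> base"
  assumes B: "open B" "smooth_form 1 B X" and \<pi>: "bounded_linear \<pi>" and x: "\<pi> x \<in> B"
    and V: "open V" "x \<in> V" "\<And>y. y \<in> V \<Longrightarrow> \<pi> y \<in> B"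
    and \<beta>: "\<And>y w. y \<in> V \<Longrightarrow> \<beta> y w = k (w 0) + X (\<pi> y) (\<lambda>_. \<pi> (w 0))"
  shows "ext_d 1 \<beta> x v = dird (\<pi> (v 0)) (\<lambda>b. X b (\<lambda>_. \<pi> (v 1))) (\<pi> x)
    - dird (\<pi> (v 1)) (\<lambda>b. X b (\<lambda>_. \<pi> (v 0))) (\<pi> x)"
proof -
  have D: "dird p (\<lambda>y. \<beta> y w) x = dird (\<pi> p) (\<lambda>b. X b (\<lambda>_. \<pi> (w 0))) (\<pi> x)" for p w
  proof -
    have d: "(\<lambda>b. X b (\<lambda>_. \<pi> (w 0))) differentiable (at (\<pi> x))"
      using smooth_on_differentiable[OF one_form_smooth[OF B(2)] x] .
    have "dird p (\<lambda>y. \<beta> y w) x = dird p (\<lambda>y. k (w 0) + X (\<pi> y) (\<lambda>_. \<pi> (w 0))) x"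
      by (rule dird_cong[OF V(1,2)]) (rule \<beta>)
    also have "\<dots> = dird (\<pi> p) (\<lambda>b. X b (\<lambda>_. \<pi> (w 0))) (\<pi> x)"
      using dird_compose_linear[OF \<pi> d] by (simp add: dird_add)
    finally show ?thesis .
  qed
  show ?thesis unfolding ext_d_1 D by (simp add: skip_def)
qed

text \<open>The exterior derivative of the 1-form \<open>X\<close> on the constant fields
  \<open>p\<close> and \<open>q\<close>.\<close>

definition curl :: "bform \<Rightarrow> base \<Rightarrow> base \<Rightarrow> base \<Rightarrow> real" where
  "curl X b p q = dird p (\<lambda>b. X b (\<lambda>_. q)) b - dird q (\<lambda>b. X b (\<lambda>_. p)) b"

lemma conn_forms:
  assumes "smooth_form 1 B X"
  shows "y \<in> B \<times> UNIV \<Longrightarrow> conn_xi X y w = fst (snd (w 0)) + X (fst y) (\<lambda>_. fst (w 0))"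
    and "y \<in> B \<times> UNIV \<Longrightarrow> conn_alpha X y w = snd (snd (w 0)) + X (fst y) (\<lambda>_. fst (w 0))"
    and "z \<in> UNIV \<times> B \<times> UNIV \<Longrightarrow> conn_eta X z u = fst (u 0) + X (fst (snd z)) (\<lambda>_. fst (snd (u 0)))"
  using one_form_arg[OF assms, of "fst y" "\<lambda>i. fst (w i)"] one_form_arg[OF assms, of "fst (snd z)" "\<lambda>i.
      fst (snd (u i))"]
  by (auto simp: conn_xi_def conn_alpha_def conn_eta_def pull_form_def pullback_def)

lemma ext_d_conn_xi_alpha:
  assumes B: "open B" "smooth_form 1 B X" and x: "x \<in> B \<times> UNIV"
  shows "ext_d 1 (conn_xi X) x v = curl X (fst x) (fst (v 0)) (fst (v 1))"
    and "ext_d 1 (conn_alpha X) x v = curl X (fst x) (fst (v 0)) (fst (v 1))"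
proof -
  have "fst x \<in> B" using x by auto
  note * = ext_d_conn[OF B bounded_linear_fst this open_base7[OF B(1)] x]
  show "ext_d 1 (conn_xi X) x v = curl X (fst x) (fst (v 0)) (fst (v 1))"
    unfolding curl_def by (rule *) (auto intro: conn_forms(1)[OF B(2)])
  show "ext_d 1 (conn_alpha X) x v = curl X (fst x) (fst (v 0)) (fst (v 1))"
    unfolding curl_def by (rule *) (auto intro: conn_forms(2)[OF B(2)])
qed

lemma ext_d_conn_eta:
  assumes B: "open B" "smooth_form 1 B X" and x: "x \<in> UNIV \<times> B \<times> UNIV"
  shows "ext_d 1 (conn_eta X) x v = curl X (fst (snd x)) (fst (snd (v 0))) (fst (snd (v 1)))"
proof -
  have "fst (snd x) \<in> B" using x by auto
  note * = ext_d_conn[OF B bounded_linear_fst_snd this open_base8[OF B(1)] x]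
  show ?thesis
    unfolding curl_def by (rule *) (auto intro: conn_forms(3)[OF B(2)])
qed

definition uu :: "(base \<Rightarrow> real) \<Rightarrow> base \<Rightarrow> real" where
  "uu F = dird (0, 1) (dird (0, 1) F)"

definition two :: "(nat \<Rightarrow> 'v \<Rightarrow> real) \<Rightarrow> (real \<times> nat \<times> nat) list \<Rightarrow> 'v \<Rightarrow> 'v \<Rightarrow> real" where
  "two \<theta> cs p q = (\<Sum>(c, k, l)\<leftarrow>cs. c * (\<theta> k p * \<theta> l q - \<theta> k q * \<theta> l p))"

text \<open>The first four entries are \<open>- d^c u \<and> ds\<close>, the other six the
  \<open>s\<close>-derivative of \<open>om1\<close>.\<close>

definition curv_terms :: "(base \<Rightarrow> real) \<Rightarrow> base \<Rightarrow> (real \<times> nat \<times> nat) list" where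
  "curv_terms F b = [(- dird (eb 1) (uu F) b, 0, 4), (dird (eb 0) (uu F) b, 1, 4),
    (- dird (eb 3) (uu F) b, 2, 4), (dird (eb 2) (uu F) b, 3, 4),
    (- dird (eb 4) (coP F) b, 0, 1), (- dird (eb 4) (coQ F) b, 2, 3), (dird (eb 4) (coT F) b, 0, 2),
    (dird (eb 4) (coT F) b, 1, 3), (- dird (eb 4) (coR F) b, 0, 3), (dird (eb 4) (coR F) b, 1, 2)]"

lemma wedge_ev_all:
  assumes "list_all (\<lambda>(c, is). length is = p) cs" "list_all (\<lambda>(c, is). length is = q) ds"
  shows "wedge p q (ev \<theta> cs) (ev \<theta> ds) v =
    ev \<theta> (concat (map (\<lambda>(c, is). map (\<lambda>(d, js). (c * d, is @ js)) ds) cs)) v"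
  by (rule wedge_ev) (use assms in \<open>auto simp: list_all_def\<close>)

lemma curv_alpha_eq:
  assumes B: "open B" "smooth_on F B" "b \<in> B"
  shows "curv_alpha F b v = two bco (curv_terms F b) (v 0) (v 1)"
proof -
  have smu: "smooth_on (uu F) B" unfolding uu_def using B smooth_on_dird by blast
  have ueq: "s_deriv (s_deriv F) y = uu F y" if "y \<in> B" for y
    unfolding uu_def by (rule s_deriv2_eq[OF B(1,2) that])
  have du: "s_deriv (s_deriv F) differentiable (at b)"
    using smooth_on_differentiable[OF smu B(3)] differentiable_cong_open[OF B(1,3), of "s_deriv (s_deriv
        F)" "uu F"] ueq by blast
  have dc: "dc_base (s_deriv (s_deriv F)) b w =
    ev bco [(dird (eb 1) (uu F) b, [0]), (- dird (eb 0) (uu F) b, [1]),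
      (dird (eb 3) (uu F) b, [2]), (- dird (eb 2) (uu F) b, [3])] w" for w
  proof -
    have "dc_base (s_deriv (s_deriv F)) b w = dird (J1 (fst (w 0))) (\<lambda>z. s_deriv (s_deriv F) (z, snd b))
        (fst b)"
      by (simp add: dc_base_def pullback_def d_c_def dird_def)
    also have "\<dots> = dird (J1 (fst (w 0)), 0) (s_deriv (s_deriv F)) b"
      using dird_slice(1)[of "s_deriv (s_deriv F)" "fst b" "snd b"] du by simp
    also have "\<dots> = dird (J1 (fst (w 0)), 0) (uu F) b"
      by (rule dird_cong[OF B(1,3)]) (rule ueq)
    finally show ?thesis
      unfolding dird_base[OF smooth_on_differentiable[OF smu B(3)], of "(J1 (fst (w 0)), 0)"]
      by (simp add: J1_def wl_1 del: wl.simps eb_simps)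
  qed
  have "wedge 1 1 (dc_base (s_deriv (s_deriv F)) b) (ds_base b) v =
    ev bco [(dird (eb 1) (uu F) b, [0, 4]), (- dird (eb 0) (uu F) b, [1, 4]),
      (dird (eb 3) (uu F) b, [2, 4]), (- dird (eb 2) (uu F) b, [3, 4])] v"
  proof -
    have "dc_base (s_deriv (s_deriv F)) b = ev bco [(dird (eb 1) (uu F) b, [0]), (- dird (eb 0) (uu F) b, [1]),
      (dird (eb 3) (uu F) b, [2]), (- dird (eb 2) (uu F) b, [3])]" by (rule ext) (rule dc)
    moreover have "ds_base b = ev bco [(1, [4])]" by (rule ext) (rule ds_base_ev)
    ultimately show ?thesis
      by (simp add: wedge_ev_all del: wl.simps eb_simps ev_Cons)
  qed
  moreover have "ds_omega1t F b v = ev bco (om1 (dird (eb 4) (coP F) b) (dird (eb 4) (coQ F) b)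
    (dird (eb 4) (coR F) b) (dird (eb 4) (coT F) b)) v"
  proof -
    let ?G = "\<lambda>b. ev bco (om1 (coP F b) (coQ F b) (coR F b) (coT F b)) v"
    have d: "coP F differentiable (at b)" "coQ F differentiable (at b)"
      "coR F differentiable (at b)" "coT F differentiable (at b)"
      using smooth_on_co[OF B(1,2)] smooth_on_differentiable B(3) by blast+
    have dG: "?G differentiable (at b)" using d by (simp add: om1_def del: wl.simps)
    have eq: "omega1t F y v = ?G y" if "y \<in> B" for y by (rule omega1t_ev[OF B(1,2) that])
    have "(\<lambda>y. omega1t F y v) differentiable (at b)" using dG differentiable_cong_open[OF B(1,3), of "\<lambda>y.
        omega1t F y v" ?G] eq by blast
    from s_deriv_eq(1)[OF this] have "ds_omega1t F b v = dird (0, 1) (\<lambda>y. omega1t F y v) b"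
      by (simp add: ds_omega1t_def s_deriv_def)
    also have "\<dots> = dird (0, 1) ?G b" by (rule dird_cong[OF B(1,3) eq])
    also have "\<dots> = ev bco (om1 (dird (0, 1) (coP F) b) (dird (0, 1) (coQ F) b)
      (dird (0, 1) (coR F) b) (dird (0, 1) (coT F) b)) v"
      using d by (simp add: om1_def dird_add dird_minus dird_mult dird_diff del: wl.simps)
    finally show ?thesis by simp
  qed
  ultimately show ?thesis
    unfolding curv_alpha_def by (simp add: two_def curv_terms_def om1_def wl_2 algebra_simps del: wl.simps
        eb_simps)
qed

definition xi_terms :: "(real \<times> nat \<times> nat) list" where "xi_terms = [(-1, 0, 2), (1, 1, 3)]"
definition eta_terms :: "(real \<times> nat \<times> nat) list" where "eta_terms = [(-1, 0, 3), (-1, 1, 2)]"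

text \<open>Fibre directions enter on neither side, so the curvature conditions on the bundles
  become equations for \<open>curl\<close> on the base.\<close>

lemma prescribed_curvatures_iff:
  assumes B: "open B" "smooth_on F B"
  shows "prescribed_curvatures B F X Y A \<longleftrightarrow>
    smooth_form 1 B X \<and> smooth_form 1 B Y \<and> smooth_form 1 B A \<and>
    (\<forall>b\<in>B. \<forall>p q. curl X b p q = two bco xi_terms p q \<and> curl Y b p q = two bco eta_terms p q \<and>
      curl A b p q = two bco (curv_terms F b) p q)"
proof -
  have x: "- pull_form fst omega2_base x v = two bco xi_terms (fst (v 0)) (fst (v 1))" for x :: tot7 and v
    unfolding pull_form_def pullback_def omega2_base_ev
    by (simp add: two_def xi_terms_def wl_2 del: wl.simps)
  have y: "- pull_form (fst \<circ> snd) omega3_base x v = two bco eta_terms (fst (snd (v 0))) (fst (snd (v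
      1)))" for x :: tot8 and v
    unfolding pull_form_def pullback_def omega3_base_ev
    by (simp add: two_def eta_terms_def wl_2 del: wl.simps)
  have a: "pull_form fst (curv_alpha F) x v = two bco (curv_terms F (fst x)) (fst (v 0)) (fst (v 1))"
    if "x \<in> B \<times> UNIV" for x :: tot7 and v
    unfolding pull_form_def pullback_def using that by (subst curv_alpha_eq[OF B]) auto
  have E7: "(\<forall>x\<in>B \<times> (UNIV :: (real \<times> real) set). \<forall>v::nat \<Rightarrow> tot7. curl Z (fst x) (fst (v 0 :: tot7)) (fst
      (v 1)) = f (fst x) (fst (v 0)) (fst (v 1)))
    \<longleftrightarrow> (\<forall>b\<in>B. \<forall>p q. curl Z b p q = f b p q)" for Z f
  proof (intro iffI ballI allI)
    fix b p q assume *: "\<forall>x\<in>B \<times> (UNIV :: (real \<times> real) set). \<forall>v::nat \<Rightarrow> tot7. curl Z (fst x) (fst (v 0 ::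
        tot7)) (fst (v 1)) = f (fst x) (fst (v 0)) (fst (v 1))"
      and b: "b \<in> B"
    show "curl Z b p q = f b p q"
      using b spec[OF bspec[OF *, of "(b, 0)"], of "\<lambda>i. if i = 0 then (p, 0) else (q, 0)"] by simp
  next
    fix x v assume *: "\<forall>b\<in>B. \<forall>p q. curl Z b p q = f b p q" and "x \<in> B \<times> (UNIV :: (real \<times> real) set)"
    then have "fst x \<in> B" by (simp add: mem_Times_iff)
    with * show "curl Z (fst x) (fst (v 0 :: tot7)) (fst (v 1)) = f (fst x) (fst (v 0)) (fst (v (1 ::
        nat)))" by blast
  qed
  have E8: "(\<forall>x\<in>(UNIV :: real set) \<times> B \<times> (UNIV :: (real \<times> real) set). \<forall>v::nat \<Rightarrow> tot8. curl Z (fst (snd x))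
      (fst (snd (v 0 :: tot8))) (fst (snd (v 1)))
      = f (fst (snd x)) (fst (snd (v 0))) (fst (snd (v 1))))
    \<longleftrightarrow> (\<forall>b\<in>B. \<forall>p q. curl Z b p q = f b p q)" for Z f
  proof (intro iffI ballI allI)
    fix b p q assume *: "\<forall>x\<in>(UNIV :: real set) \<times> B \<times> (UNIV :: (real \<times> real) set). \<forall>v::nat \<Rightarrow> tot8. curl Z
        (fst (snd x)) (fst (snd (v 0 :: tot8))) (fst (snd (v 1)))
      = f (fst (snd x)) (fst (snd (v 0))) (fst (snd (v 1)))"
      and b: "b \<in> B"
    show "curl Z b p q = f b p q"
      using b spec[OF bspec[OF *, of "(0, b, 0)"], of "\<lambda>i. if i = 0 then (0, p, 0) else (0, q, 0)"] by simp
  next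
    fix x v assume *: "\<forall>b\<in>B. \<forall>p q. curl Z b p q = f b p q" and "x \<in> (UNIV :: real set) \<times> B \<times> (UNIV ::
        (real \<times> real) set)"
    then have "fst (snd x) \<in> B" by (simp add: mem_Times_iff)
    with * show "curl Z (fst (snd x)) (fst (snd (v 0 :: tot8))) (fst (snd (v 1)))
      = f (fst (snd x)) (fst (snd (v 0))) (fst (snd (v (1 :: nat))))" by blast
  qed
  show ?thesis
  proof (cases "smooth_form 1 B X \<and> smooth_form 1 B Y \<and> smooth_form 1 B A")
    case True
    then have sm: "smooth_form 1 B X" "smooth_form 1 B Y" "smooth_form 1 B A" by auto
    have "(\<forall>x\<in>B \<times> UNIV. ext_d 1 (conn_xi X) x = (\<lambda>v. - pull_form fst omega2_base x v))
        \<longleftrightarrow> (\<forall>b\<in>B. \<forall>p q. curl X b p q = two bco xi_terms p q)"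
      unfolding fun_eq_iff x E7[of X "\<lambda>b. two bco xi_terms", symmetric]
      by (intro ball_cong refl) (simp only: ext_d_conn_xi_alpha[OF B(1) sm(1)])
    moreover have "(\<forall>x\<in>UNIV \<times> B \<times> UNIV. ext_d 1 (conn_eta Y) x = (\<lambda>v. - pull_form (fst \<circ> snd) omega3_base x v))
        \<longleftrightarrow> (\<forall>b\<in>B. \<forall>p q. curl Y b p q = two bco eta_terms p q)"
      unfolding fun_eq_iff y E8[of Y "\<lambda>b. two bco eta_terms", symmetric]
      by (intro ball_cong refl) (simp only: ext_d_conn_eta[OF B(1) sm(2)])
    moreover have "(\<forall>x\<in>B \<times> UNIV. ext_d 1 (conn_alpha A) x = pull_form fst (curv_alpha F) x)
        \<longleftrightarrow> (\<forall>b\<in>B. \<forall>p q. curl A b p q = two bco (curv_terms F b) p q)"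
      unfolding fun_eq_iff E7[of A "\<lambda>b. two bco (curv_terms F b)", symmetric]
      by (intro ball_cong refl) (simp only: ext_d_conn_xi_alpha[OF B(1) sm(3)] a)
    ultimately show ?thesis unfolding prescribed_curvatures_def using sm by blast
  next
    case False
    then show ?thesis unfolding prescribed_curvatures_def by blast
  qed
qed

lemma smooth_form_1I:
  assumes "\<And>b. b \<in> B \<Longrightarrow> linear (f b)" "\<And>p. smooth_on (\<lambda>b. f b p) B"
  shows "smooth_form 1 B (\<lambda>b v. f b (v 0))"
  using assms by (auto simp: smooth_form_def alternating_def)

text \<open>The potentials are explicit: \<open>X\<close> and \<open>Y\<close> are minus the real
  and imaginary parts of \<open>z1 dz2\<close>, and \<open>A\<close> is \<open>d^c\<close> of the
  \<open>s\<close>-derivative of \<open>F\<close>. The surface part of \<open>dA\<close> is the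
  \<open>s\<close>-derivative of \<open>dd^c F\<close>, the mixed part is
  \<open>ds \<and> d^c u\<close>.\<close>

lemma ex_prescribed_curvatures:
  assumes B: "open B" "smooth_on F B"
  shows "\<exists>X Y A. prescribed_curvatures B F X Y A"
proof -
  define X :: bform where "X = (\<lambda>b v. - (bco 0 b * bco 2 (v 0) - bco 1 b * bco 3 (v 0)))"
  define Y :: bform where "Y = (\<lambda>b v. - (bco 0 b * bco 3 (v 0) + bco 1 b * bco 2 (v 0)))"
  define G where "G = dird (0, 1) F"
  define A :: bform where "A = (\<lambda>b v. dird (J1 (fst (v 0)), 0) G b)"
  have G: "smooth_on G B" unfolding G_def using B smooth_on_dird by blast
  have bl: "bounded_linear (bco i)" for i using linear_bco linear_conv_bounded_linear by blast
  have db: "dird p (bco i) b = bco i p" for p i b by (rule dird_bounded_linear[OF bl])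
  have dfb: "bco i differentiable (at b)" for i b using bl by (rule bounded_linear_imp_differentiable)
  have "linear (\<lambda>p. - (x * bco i p - y * bco j p))" "linear (\<lambda>p. - (x * bco i p + y * bco j p))" for x y i j
    by (rule linearI; simp add: linear_add[OF linear_bco] linear_scale[OF linear_bco] algebra_simps)+
  moreover have "smooth_on (\<lambda>b. - (bco 0 b * x - bco 1 b * y)) B" "smooth_on (\<lambda>b. - (bco 0 b * x + bco 1 b
      * y)) B" for x y
    by (intro smooth_on_minus smooth_on_diff smooth_on_add smooth_on_mult smooth_on_const smooth_on_linear
        bl B(1))+
  ultimately have sX: "smooth_form 1 B X" "smooth_form 1 B Y"
    unfolding X_def Y_def
    using smooth_form_1I[of B "\<lambda>b p. - (bco 0 b * bco 2 p - bco 1 b * bco 3 p)"]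
      smooth_form_1I[of B "\<lambda>b p. - (bco 0 b * bco 3 p + bco 1 b * bco 2 p)"] by blast+
  have sA: "smooth_form 1 B A"
    unfolding A_def
  proof (rule smooth_form_1I)
    fix b assume "b \<in> B"
    then have "linear (\<lambda>h. dird h G b)" using linear_dird smooth_on_differentiable[OF G] by blast
    moreover have "linear (\<lambda>p::base. (J1 (fst p), 0 :: real))" by (rule linearI) (auto simp: J1_def
        algebra_simps)
    ultimately show "linear (\<lambda>p::base. dird (J1 (fst p), 0) G b)" using linear_compose[of "\<lambda>p::base. (J1
        (fst p), 0 :: real)"] by (simp add: o_def)
  qed (rule smooth_on_dird[OF B(1) G])
  have cX: "curl X b p q = two bco xi_terms p q" "curl Y b p q = two bco eta_terms p q" for b p q
    unfolding curl_def X_def Y_def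
    by (simp_all add: dird_minus dird_diff dird_add dird_mult db dfb two_def xi_terms_def eta_terms_def
        algebra_simps
        del: bco_simps)
  \<comment> \<open>Both sides are built from second derivatives of \<open>G\<close>:
    \<open>u\<close> is its \<open>s\<close>-derivative, and the \<open>s\<close>-derivatives of
    \<open>coP F\<close> to \<open>coT F\<close> are \<open>coP G\<close> to
    \<open>coT G\<close>.\<close>
  have cA: "curl A b p q = two bco (curv_terms F b) p q" if b: "b \<in> B" for b p q
  proof -
    have dG: "G differentiable (at y)" if "y \<in> B" for y using G that smooth_on_differentiable by blast
    have ddG: "dird e G differentiable (at b)" for e using smooth_on_differentiable[OF smooth_on_dird[OF
        B(1) G] b] .
    have A1: "dird p (\<lambda>b. A b (\<lambda>_. q)) b = (\<Sum>k\<leftarrow>[0, 1, 2, 3, 4]. bco k (J1 (fst q), 0) * dird p (dird (eb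
        k) G) b)" for p q
    proof -
      have "dird p (\<lambda>b. A b (\<lambda>_. q)) b = dird p (\<lambda>b. \<Sum>k\<leftarrow>[0, 1, 2, 3, 4]. bco k (J1 (fst q), 0) * dird (eb
          k) G b) b"
        unfolding A_def by (rule dird_cong[OF B(1) b]) (subst dird_base[OF dG], auto simp: mult.commute
            simp del: bco_simps eb_simps)
      then show ?thesis using ddG by (simp add: dird_add dird_cmult del: bco_simps eb_simps)
    qed
    have co4: "dird (0, 1) (coP F) b = coP G b" "dird (0, 1) (coQ F) b = coQ G b"
      "dird (0, 1) (coR F) b = coR G b" "dird (0, 1) (coT F) b = coT G b"
    proof -
      have d2: "dird a (dird e F) differentiable (at b)" for a e
        using smooth_on_differentiable[OF smooth_on_dird[OF B(1) smooth_on_dird[OF B]] b] .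
      have "dird (0, 1) (dird a (dird e F)) b = dird a (dird e G) b" for a e
      proof -
        have "dird (0, 1) (dird a (dird e F)) b = dird a (dird (0, 1) (dird e F)) b"
          by (rule dird_commute[OF B(1) smooth_on_dird[OF B] b])
        also have "\<dots> = dird a (dird e G) b"
          unfolding G_def by (rule dird_cong[OF B(1) b]) (rule dird_commute[OF B])
        finally show ?thesis .
      qed
      then show "dird (0, 1) (coP F) b = coP G b" "dird (0, 1) (coQ F) b = coQ G b"
        "dird (0, 1) (coR F) b = coR G b" "dird (0, 1) (coT F) b = coT G b"
        unfolding co_defs[abs_def] using d2 by (simp_all add: dird_add dird_diff)
    qed
    have u: "uu F = dird (eb 4) G" by (simp add: uu_def G_def)
    note c = dird_commute[OF B(1) G b]
    have cc: "dird (eb i) (dird (eb j) G) b = dird (eb j) (dird (eb i) G) b" for i j by (rule c)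
    have co: "coP G b = dird (eb 0) (dird (eb 0) G) b + dird (eb 1) (dird (eb 1) G) b"
      "coQ G b = dird (eb 2) (dird (eb 2) G) b + dird (eb 3) (dird (eb 3) G) b"
      "coR G b = dird (eb 0) (dird (eb 2) G) b + dird (eb 1) (dird (eb 3) G) b"
      "coT G b = dird (eb 0) (dird (eb 3) G) b - dird (eb 1) (dird (eb 2) G) b"
      by (simp_all add: co_defs)
    have co4': "dird (eb 4) (coP F) b = coP G b" "dird (eb 4) (coQ F) b = coQ G b"
      "dird (eb 4) (coR F) b = coR G b" "dird (eb 4) (coT F) b = coT G b" using co4 by simp_all
    note e = dird_base[OF ddG]
    show ?thesis
      unfolding curl_def A1 e[of p] e[of q] two_def curv_terms_def co4' co u
      by (simp add: J1_def cc[of "Suc 0" 0] cc[of 2 0] cc[of 3 0] cc[of 4 0] cc[of 2 "Suc 0"] cc[of 3 "Suc 0"]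
          cc[of 4 "Suc 0"] cc[of 3 2] cc[of 4 2] cc[of 4 3] del: eb_simps)
        (simp only: algebra_simps)
  qed
  have "prescribed_curvatures B F X Y A"
    unfolding prescribed_curvatures_iff[OF B] using sX sA cX cA by simp
  then show ?thesis by blast
qed

subsection \<open>Frames adapted to the 3-form\<close>

text \<open>\<open>W\<close> stands for the unknown values of the sorted products. An identity that
  holds for every \<open>W\<close> is an identity of coefficients, which simplification can
  settle.\<close>

definition nf :: "(nat list \<Rightarrow> real) \<Rightarrow> (real \<times> nat list) list \<Rightarrow> real" where
  "nf W cs = (\<Sum>(c, is)\<leftarrow>cs. c * (of_int (psign is) * W (sort is)))"

lemma nf_simps [simp]: "nf W [] = 0" "nf W ((c, is) # cs) = c * (of_int (psign is) * W (sort is)) + nf W cs"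
  "nf W (cs @ ds) = nf W cs + nf W ds"
  by (simp_all add: nf_def)

lemma ev_nf: "ev \<theta> cs v = nf (\<lambda>is. wl (map \<theta> is) v) cs"
  unfolding ev_def nf_def by (simp flip: wl_sort)

text \<open>The substitution of a linear change of coframe into a product, multiplied out.\<close>

primrec expand :: "(nat \<Rightarrow> (real \<times> nat) list) \<Rightarrow> nat list \<Rightarrow> (real \<times> nat list) list" where
  "expand m [] = [(1, [])]"
| "expand m (i # is) = concat (map (\<lambda>(c, j). map (\<lambda>(d, js). (c * d, j # js)) (expand m is)) (m i))"

lemma length_expand: "(c, js) \<in> set (expand m is) \<Longrightarrow> length js = length is"
  by (induction "is" arbitrary: c js) auto

lemma wone_lincomb: "wone n (\<lambda>p. c * a p + b p) \<gamma> v = c * wone n a \<gamma> v + wone n b \<gamma> v"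
  by (simp add: wone_def algebra_simps sum.distrib sum_distrib_left)

lemma wl_expand:
  fixes \<theta> :: "nat \<Rightarrow> 'v \<Rightarrow> real"
  shows "wl (map (\<lambda>i p. \<Sum>(c, j)\<leftarrow>m i. c * \<theta> j p) is) v = ev \<theta> (expand m is) v"
proof (induction "is" arbitrary: v)
  case (Cons i "is")
  have sc: "ev \<theta> (map (\<lambda>(d, js). (c * d, js)) cs) v = c * ev \<theta> cs v" for c cs
    by (induction cs) (auto simp: algebra_simps)
  have "wl (map (\<lambda>i p. \<Sum>(c, j)\<leftarrow>m i. c * \<theta> j p) (i # is)) v =
      wone (length is) (\<lambda>p. \<Sum>(c, j)\<leftarrow>m i. c * \<theta> j p) (ev \<theta> (expand m is)) v"
    by (simp add: wone_cong[OF Cons])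
  also have "\<dots> = ev \<theta> (concat (map (\<lambda>(c, j). map (\<lambda>(d, js). (c * d, j # js)) (expand m is)) ms)) v" if "ms
      = m i" for ms
    unfolding that[symmetric]
  proof (induction ms)
    case Nil
    then show ?case by (simp add: wone_def)
  next
    case (Cons x ms)
    obtain c j where x: "x = (c, j)" by (cases x)
    have "wone (length is) (\<theta> j) (ev \<theta> (expand m is)) v = ev \<theta> (map (\<lambda>(d, js). (d, j # js)) (expand m is)) v"
      by (rule wone_ev) (rule length_expand)
    moreover have "map (\<lambda>(d, js). (c * d, j # js)) (expand m is) =
        map (\<lambda>(d, js). (c * d, js)) (map (\<lambda>(d, js). (d, j # js)) (expand m is))"
      by auto
    ultimately show ?case using Cons by (simp add: x wone_lincomb sc del: map_map)
  qed
  finally show ?case by simp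
qed simp

lemma ev_expand:
  fixes \<theta> :: "nat \<Rightarrow> 'v \<Rightarrow> real"
  shows "ev (\<lambda>i p. \<Sum>(c, j)\<leftarrow>m i. c * \<theta> j p) cs v =
    (\<Sum>(c, is)\<leftarrow>cs. c * nf (\<lambda>is. wl (map \<theta> is) v) (expand m is))"
  unfolding ev_def wl_expand ev_nf[symmetric] ..

text \<open>\<open>P, Q, R, T\<close> are the coefficients of
  \<open>\<xi> \<and> \<omega>_1\<close>; \<open>h\<close>, \<open>k\<close>, \<open>l\<close>
  belong to \<open>\<xi> \<and> ds \<and> \<alpha>\<close>,
  \<open>\<omega>_2 \<and> \<alpha>\<close> and \<open>\<omega>_3 \<and> ds\<close>.\<close>

definition phiT :: "real \<Rightarrow> real \<Rightarrow> real \<Rightarrow> real \<Rightarrow> real \<Rightarrow> real \<Rightarrow> real \<Rightarrow> (real \<times> nat list) list" where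
  "phiT P Q R T h k l = [(- P, [5, 0, 1]), (- Q, [5, 2, 3]), (T, [5, 0, 2]), (T, [5, 1, 3]), (- R, [5, 0, 3]),
    (R, [5, 1, 2]), (h, [5, 4, 6]), (k, [0, 2, 6]), (- k, [1, 3, 6]), (l, [0, 3, 4]), (l, [1, 2, 4])]"

text \<open>\<open>h\<close> belongs to the volume form of the surface, \<open>P, Q, R, T\<close> to
  \<open>\<omega>_1 \<and> ds \<and> \<alpha>\<close>, \<open>k\<close> to
  \<open>\<xi> \<and> ds \<and> \<omega>_2\<close> and \<open>l\<close> to
  \<open>- \<xi> \<and> \<alpha> \<and> \<omega>_3\<close>.\<close>

definition psiT :: "real \<Rightarrow> real \<Rightarrow> real \<Rightarrow> real \<Rightarrow> real \<Rightarrow> real \<Rightarrow> real \<Rightarrow> (real \<times> nat list) list" where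
  "psiT P Q R T h k l = [(h, [0, 1, 2, 3]), (- P, [0, 1, 4, 6]), (- Q, [2, 3, 4, 6]), (T, [0, 2, 4, 6]),
    (T, [1, 3, 4, 6]), (- R, [0, 3, 4, 6]), (R, [1, 2, 4, 6]),
    (k, [5, 4, 0, 2]), (- k, [5, 4, 1, 3]), (- l, [5, 6, 0, 3]), (- l, [5, 6, 1, 2])]"

text \<open>The pairs \<open>e\<^sub>4, e\<^sub>5\<close> and \<open>e\<^sub>6, e\<^sub>7\<close> complete the square in \<open>\<omega>\<^sub>1\<close>, while \<open>\<omega>\<^sub>2\<close> and \<open>\<omega>\<^sub>3\<close> stay
    multiples of the
  two remaining self-dual forms.\<close>

definition frame_coeffs ::
  "real \<Rightarrow> real \<Rightarrow> real \<Rightarrow> real \<Rightarrow> real \<Rightarrow> real \<Rightarrow> real \<Rightarrow> nat \<Rightarrow> (real \<times> nat) list" where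
  "frame_coeffs p q r a x y d i =
    (if i = 1 then [(p, 5)] else if i = 2 then [(q, 4)] else if i = 3 then [(r, 6)]
     else if i = 4 then [(a, 0), (x, 2), (- y, 3)] else if i = 5 then [(a, 1), (y, 2), (x, 3)]
     else if i = 6 then [(d, 3)] else if i = 7 then [(- d, 2)] else [])"

definition frame7 ::
  "real \<Rightarrow> real \<Rightarrow> real \<Rightarrow> real \<Rightarrow> real \<Rightarrow> real \<Rightarrow> real \<Rightarrow> (nat \<Rightarrow> 'v \<Rightarrow> real) \<Rightarrow> nat \<Rightarrow> 'v \<Rightarrow> real" where
  "frame7 p q r a x y d \<theta> i w = (\<Sum>(c, j)\<leftarrow>frame_coeffs p q r a x y d i. c * \<theta> j w)"

lemma frame_phi:
  "ev (frame7 p q r a x y d \<theta>) phi_terms v = ev \<theta> (phiT (- (p * a\<^sup>2)) (- (p * (x\<^sup>2 + y\<^sup>2 + d\<^sup>2))) (- (p *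
      a * x))
    (p * a * y) (p * q * r) (r * a * d) (q * a * d)) v"
proof -
  have "(\<Sum>(c, is)\<leftarrow>phi_terms. c * nf W (expand (frame_coeffs p q r a x y d) is)) = nf W (phiT (- (p * a\<^sup>2))
      (- (p * (x\<^sup>2 + y\<^sup>2 + d\<^sup>2)))
      (- (p * a * x)) (p * a * y) (p * q * r) (r * a * d) (q * a * d))" for W
    by (simp add: phi_terms_def phiT_def frame_coeffs_def power2_eq_square algebra_simps)
  then show ?thesis unfolding frame7_def[abs_def] ev_expand ev_nf .
qed

lemma frame_psi:
  "ev (frame7 p q r a x y d \<theta>) psi_terms v = ev \<theta> (psiT (- (q * r * a\<^sup>2)) (- (q * r * (x\<^sup>2 + y\<^sup>2 + d\<^sup>2)))
      (- (q * r * a * x))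
    (q * r * a * y) (a\<^sup>2 * d\<^sup>2) (p * q * a * d) (p * r * a * d)) v"
proof -
  have "(\<Sum>(c, is)\<leftarrow>psi_terms. c * nf W (expand (frame_coeffs p q r a x y d) is)) = nf W (psiT (- (q * r *
      a\<^sup>2)) (- (q * r * (x\<^sup>2 + y\<^sup>2 + d\<^sup>2)))
      (- (q * r * a * x)) (q * r * a * y) (a\<^sup>2 * d\<^sup>2) (p * q * a * d) (p * r * a * d))" for W
    by (simp add: psi_terms_def psiT_def frame_coeffs_def power2_eq_square algebra_simps)
  then show ?thesis unfolding frame7_def[abs_def] ev_expand ev_nf .
qed


section \<open>Linear isomorphisms from frames\<close>

lemma all_less_7: "(\<forall>i<7. P i) \<longleftrightarrow> P 0 \<and> P 1 \<and> P 2 \<and> P 3 \<and> P 4 \<and> P 5 \<and> P (6 :: nat)"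
  by (simp add: eval_nat_numeral All_less_Suc) blast

lemma all_less_8: "(\<forall>i<8. P i) \<longleftrightarrow> P 0 \<and> P 1 \<and> P 2 \<and> P 3 \<and> P 4 \<and> P 5 \<and> P 6 \<and> P (7 :: nat)"
  by (simp add: eval_nat_numeral All_less_Suc) blast

text \<open>The inverse of the frame by back substitution: entries 2 and 3 come from
  \<open>e 7\<close> and \<open>e 6\<close> and are then eliminated from \<open>e 4\<close> and
  \<open>e 5\<close>.\<close>

definition frame_solution ::
  "real \<Rightarrow> real \<Rightarrow> real \<Rightarrow> real \<Rightarrow> real \<Rightarrow> real \<Rightarrow> real \<Rightarrow> (nat \<Rightarrow> real) \<Rightarrow> nat \<Rightarrow> real" where
  "frame_solution p q r a x y d e i =
    (if i = 0 then (e 4 + x * e 7 / d + y * e 6 / d) / a else if i = 1 then (e 5 + y * e 7 / d - x * e 6 /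
        d) / a
     else if i = 2 then - e 7 / d else if i = 3 then e 6 / d else if i = 4 then e 2 / q
     else if i = 5 then e 1 / p else e 3 / r)"

lemma frame7_solve:
  assumes "p \<noteq> 0" "q \<noteq> 0" "r \<noteq> 0" "a \<noteq> 0" "d \<noteq> 0"
  shows "frame7 p q r a x y d \<theta> 1 w = e 1 \<and> frame7 p q r a x y d \<theta> 2 w = e 2 \<and> frame7 p q r a x y d \<theta> 3 w
      = e 3 \<and>
      frame7 p q r a x y d \<theta> 4 w = e 4 \<and> frame7 p q r a x y d \<theta> 5 w = e 5 \<and> frame7 p q r a x y d \<theta> 6 w = e 6 \<and>
      frame7 p q r a x y d \<theta> 7 w = e 7 \<longleftrightarrow> (\<forall>i<7. \<theta> i w = frame_solution p q r a x y d e i)"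
proof -
  have *: "frame7 p q r a x y d \<theta> 1 w = e 1 \<longleftrightarrow> \<theta> 5 w = e 1 / p"
    "frame7 p q r a x y d \<theta> 2 w = e 2 \<longleftrightarrow> \<theta> 4 w = e 2 / q"
    "frame7 p q r a x y d \<theta> 3 w = e 3 \<longleftrightarrow> \<theta> 6 w = e 3 / r"
    "frame7 p q r a x y d \<theta> 6 w = e 6 \<longleftrightarrow> \<theta> 3 w = e 6 / d"
    "frame7 p q r a x y d \<theta> 7 w = e 7 \<longleftrightarrow> \<theta> 2 w = - e 7 / d"
    "frame7 p q r a x y d \<theta> 4 w = e 4 \<longleftrightarrow> \<theta> 0 w = (e 4 - x * \<theta> 2 w + y * \<theta> 3 w) / a"
    "frame7 p q r a x y d \<theta> 5 w = e 5 \<longleftrightarrow> \<theta> 1 w = (e 5 - y * \<theta> 2 w - x * \<theta> 3 w) / a"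
    using assms by (auto simp: frame7_def frame_coeffs_def field_simps)
  show ?thesis unfolding * all_less_7 by (auto simp: frame_solution_def)
qed

definition to8 :: "(nat \<Rightarrow> 'v \<Rightarrow> real) \<Rightarrow> 'v \<Rightarrow> real ^ 8" where
  "to8 E w = (\<Sum>i<8. E i w *\<^sub>R axis (of_nat i) 1)"

lemma to8_nth: "to8 E w $ 0 = E 0 w" "to8 E w $ 1 = E 1 w" "to8 E w $ 2 = E 2 w" "to8 E w $ 3 = E 3 w"
  "to8 E w $ 4 = E 4 w" "to8 E w $ 5 = E 5 w" "to8 E w $ 6 = E 6 w" "to8 E w $ 7 = E 7 w"
proof -
  have "{..<8::nat} = {0, 1, 2, 3, 4, 5, 6, 7}" by (auto simp: eval_nat_numeral less_Suc_eq)
  then show "to8 E w $ 0 = E 0 w" "to8 E w $ 1 = E 1 w" "to8 E w $ 2 = E 2 w" "to8 E w $ 3 = E 3 w"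
    "to8 E w $ 4 = E 4 w" "to8 E w $ 5 = E 5 w" "to8 E w $ 6 = E 6 w" "to8 E w $ 7 = E 7 w"
    by (simp_all add: to8_def axis_def)
qed

lemma kc_to8: "i < 8 \<Longrightarrow> kc i (to8 E w) = E i w"
  using all_less_8[of "\<lambda>i. kc i (to8 E w) = E i w"] by (simp add: kc_def to8_nth)

lemma linear_to8:
  assumes "\<And>i. linear (E i)"
  shows "linear (to8 E)"
  unfolding to8_def[abs_def]
  by (rule linearI)
    (simp_all add: linear_add[OF assms] linear_scale[OF assms] scaleR_add_left sum.distrib scaleR_sum_right)

lemma vec8_eq_iff: "(z :: real ^ 8) = w \<longleftrightarrow> z $ 0 = w $ 0 \<and> z $ 1 = w $ 1 \<and> z $ 2 = w $ 2 \<and> z $ 3 = w $ 3 \<and>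
  z $ 4 = w $ 4 \<and> z $ 5 = w $ 5 \<and> z $ 6 = w $ 6 \<and> z $ 7 = w $ 7"
proof -
  have "z = w \<longleftrightarrow> (\<forall>i\<in>{0, 1, 2, 3, 4, 5, 6, 7}. z $ i = w $ i)" unfolding vec_eq_iff UNIV_8[symmetric] by simp
  then show ?thesis by simp
qed

lemma linear_frame7:
  assumes "\<And>i. linear (\<theta> i)"
  shows "linear (frame7 p q r a x y d \<theta> i)"
  unfolding frame7_def[abs_def] frame_coeffs_def
  by (rule linearI) (simp_all add: linear_add[OF assms] linear_scale[OF assms] algebra_simps)

lemma bij_frame7:
  assumes nz: "p \<noteq> 0" "q \<noteq> 0" "r \<noteq> 0" "a \<noteq> 0" "d \<noteq> 0"
    and ex: "\<And>t :: nat \<Rightarrow> real. \<exists>!w. \<forall>i<7. \<theta> i w = t i"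
  shows "bij_betw (to8 (frame7 p q r a x y d \<theta>)) UNIV R7"
proof -
  let ?E = "frame7 p q r a x y d \<theta>"
  have E0: "?E 0 w = 0" for w by (simp add: frame7_def frame_coeffs_def)
  have eq: "to8 ?E w = z \<longleftrightarrow> (\<forall>i<7. \<theta> i w = frame_solution p q r a x y d (\<lambda>i. kc i z) i)" if "z \<in> R7" for z w
    unfolding vec8_eq_iff to8_nth E0 frame7_solve[OF nz, of x y \<theta> w "\<lambda>i. kc i z", symmetric]
    using that by (simp add: R7_def kc_def)
  have "to8 ?E w \<in> R7" for w by (simp add: R7_def to8_nth E0)
  moreover have "\<exists>!w. to8 ?E w = z" if "z \<in> R7" for z using ex[of "frame_solution p q r a x y d (\<lambda>i. kc i
      z)"] eq[OF that] by simp
  ultimately show ?thesis unfolding bij_betw_def inj_on_def by (auto simp: image_iff set_eq_iff) metis+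
qed

definition frame8 ::
  "real \<Rightarrow> real \<Rightarrow> real \<Rightarrow> real \<Rightarrow> real \<Rightarrow> real \<Rightarrow> real \<Rightarrow> real \<Rightarrow> (nat \<Rightarrow> 'v \<Rightarrow> real) \<Rightarrow> nat \<Rightarrow> 'v \<Rightarrow> real" where
  "frame8 k p q r a x y d \<theta> i = (if i = 0 then (\<lambda>w. k * \<theta> 7 w) else frame7 p q r a x y d \<theta> i)"

lemma bij_frame8:
  assumes nz: "k \<noteq> 0" "p \<noteq> 0" "q \<noteq> 0" "r \<noteq> 0" "a \<noteq> 0" "d \<noteq> 0"
    and ex: "\<And>t :: nat \<Rightarrow> real. \<exists>!w. \<forall>i<8. \<theta> i w = t i"
  shows "bij (to8 (frame8 k p q r a x y d \<theta>))"
proof -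
  let ?E = "frame8 k p q r a x y d \<theta>"
  have eq: "to8 ?E w = z \<longleftrightarrow> (\<forall>i<8. \<theta> i w = (if i = 7 then z $ 0 / k else frame_solution p q r a x y d (\<lambda>i.
      kc i z) i))" for z w
  proof -
    have "to8 ?E w = z \<longleftrightarrow> k * \<theta> 7 w = z $ 0 \<and> (\<forall>i<7. \<theta> i w = frame_solution p q r a x y d (\<lambda>i. kc i z) i)"
      unfolding vec8_eq_iff to8_nth frame7_solve[OF nz(2-), of x y \<theta> w "\<lambda>i. kc i z", symmetric]
      by (simp add: frame8_def kc_def)
    also have "k * \<theta> 7 w = z $ 0 \<longleftrightarrow> \<theta> 7 w = z $ 0 / k" using nz(1) by (auto simp: field_simps)
    finally show ?thesis unfolding all_less_7 all_less_8 by (simp only:) (simp, blast)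
  qed
  have "\<exists>!w. to8 ?E w = z" for z
    using ex[of "\<lambda>i. if i = 7 then z $ 0 / k else frame_solution p q r a x y d (\<lambda>i. kc i z) i"] eq by simp
  then show ?thesis unfolding bij_iff by blast
qed

lemma ev_kc_to8:
  assumes "list_all (\<lambda>(c, is). list_all (\<lambda>i. i < 8) is) cs"
  shows "ev kc cs (\<lambda>i. to8 E (v i)) = ev E cs v"
proof -
  have "ev kc cs (\<lambda>i. to8 E (v i)) = ev (\<lambda>i w. kc i (to8 E w)) cs v" by (rule ev_compose[symmetric])
  also have "\<dots> = ev E cs v"
  proof (rule ev_cong)
    fix c "is" i assume "(c, is) \<in> set cs" "i \<in> set is"
    then have "i < 8" using assms by (auto simp: list_all_iff)
    then show "(\<lambda>w. kc i (to8 E w)) = E i" by (simp add: kc_to8)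
  qed
  finally show ?thesis .
qed

lemma phiT_scale: "ev \<theta> (phiT (e * P) (e * Q) (e * R) (e * T) (e * h) (e * k) (e * l)) v = e * ev \<theta> (phiT
    P Q R T h k l) v"
  unfolding ev_nf by (simp add: phiT_def algebra_simps)

lemma psiT_scale: "ev \<theta> (psiT (e * P) (e * Q) (e * R) (e * T) (e * h) (e * k) (e * l)) v = e * ev \<theta> (psiT
    P Q R T h k l) v"
  unfolding ev_nf by (simp add: psiT_def algebra_simps)

text \<open>\<open>co\<close> matches the frame with \<open>\<phi>\<close>, and \<open>star\<close>
  matches its dual 4-form with the prescribed coefficients. The number
  \<open>\<sigma> = s^(1/3)\<close> is for the 8-dimensional frame: scaling the 7-dimensional one by
  \<open>\<sigma>\<close> multiplies \<open>\<phi>\<close> by \<open>s\<close> and the 4-form by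
  \<open>s^(4/3)\<close>, and using \<open>\<eta> / s\<close> undoes the first factor.\<close>

locale adapted_frame =
  fixes p q r a x y d \<sigma> s c P Q R T u :: real
  assumes pos: "p > 0" "q > 0" "r > 0" "a > 0" "d > 0" "\<sigma> > 0"
    and sigma: "\<sigma> ^ 3 = s" "\<sigma> ^ 4 = s powr (4 / 3)"
    and co: "- (p * a\<^sup>2) = P" "- (p * (x\<^sup>2 + y\<^sup>2 + d\<^sup>2)) = Q" "- (p * a * x) = R" "p * a * y = T"
      "p * q * r = 1" "r * a * d = s + c" "q * a * d = u * (s + c)"
    and star: "s powr (4 / 3) * (q * r) = (s * (s + c))\<^sup>2 * p" "s powr (4 / 3) * (a\<^sup>2 * d\<^sup>2) = s * (s + c) * u"
      "s powr (4 / 3) * (p * q * a * d) = s * u" "s powr (4 / 3) * (p * r * a * d) = s"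

text \<open>The conditions force \<open>p\<close>. From \<open>p q r = 1\<close>,
  \<open>r a d = s + c\<close>, \<open>q a d = u (s + c)\<close> and
  \<open>p^2 a^2 d^2 = P Q - R^2 - T^2\<close> one gets
  \<open>p^3 = (P Q - R^2 - T^2) / (u (s + c)^2)\<close>, which the equation for \<open>u\<close>
  turns into \<open>1 / (s (s + c)^3)\<close>. For this value the conditions \<open>star\<close>
  hold.\<close>

lemma adapted_frame_exists:
  assumes s: "0 < s" and c: "0 \<le> c" and P: "P < 0" and D: "0 < P * Q - R\<^sup>2 - T\<^sup>2"
    and u: "u = s * (s + c) * (P * Q - R\<^sup>2 - T\<^sup>2)"
  shows "\<exists>p q r a x y d \<sigma>. adapted_frame p q r a x y d \<sigma> s c P Q R T u"
proof -
  define D where "D = P * Q - R\<^sup>2 - T\<^sup>2"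
  define \<sigma> where "\<sigma> = s powr (1 / 3)"
  define p where "p = 1 / (\<sigma> * (s + c))"
  define a where "a = sqrt (- P / p)"
  define d where "d = sqrt (- D / (P * p))"
  define r where "r = (s + c) / (a * d)"
  define q where "q = u * (s + c) / (a * d)"
  have \<sigma>: "\<sigma> > 0" "\<sigma> ^ 3 = s" "\<sigma> ^ 4 = s powr (4 / 3)"
    using s by (simp_all add: \<sigma>_def powr_powr flip: powr_realpow)
  have sc: "s + c > 0" using s c by simp
  have p: "p > 0" using \<sigma> sc by (simp add: p_def)
  have D0: "D > 0" using D by (simp add: D_def)
  have "- P / p > 0" "- D / (P * p) > 0" using P p D0 by (simp_all add: field_simps mult_neg_pos)
  then have a: "a > 0" "a\<^sup>2 = - P / p" and d: "d > 0" "d\<^sup>2 = - D / (P * p)" by (simp_all add: a_def d_def)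
  have ad2: "a\<^sup>2 * d\<^sup>2 = D / p\<^sup>2" unfolding a d using P p by (simp add: field_simps power2_eq_square)
  have u0: "u > 0" using u s sc D by simp
  have pos: "q > 0" "r > 0" using u0 sc a d by (simp_all add: q_def r_def)
  have uD: "u = \<sigma> ^ 3 * (s + c) * D" using u \<sigma> by (simp add: D_def)
  have ps: "p * \<sigma> * (s + c) = 1" using \<sigma> sc by (simp add: p_def)
  have qr: "q * r * p = 1"
  proof -
    have "q * r * (a\<^sup>2 * d\<^sup>2) = u * (s + c)\<^sup>2" using a(1) d(1) by (simp add: q_def r_def power2_eq_square)
    then have *: "q * r * (D / p\<^sup>2) = \<sigma> ^ 3 * (s + c) * D * (s + c)\<^sup>2" unfolding ad2 uD .
    have "q * r = q * r * (D / p\<^sup>2) * p\<^sup>2 / D" using D0 p by simp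
    also have "\<dots> = p\<^sup>2 * (\<sigma> ^ 3 * (s + c) ^ 3)" unfolding * using D0 by (simp add: power2_eq_square
        power3_eq_cube)
    finally have "q * r = p\<^sup>2 * (\<sigma> ^ 3 * (s + c) ^ 3)" .
    then have "q * r * p = (p * \<sigma> * (s + c)) ^ 3" by (simp add: power2_eq_square power3_eq_cube mult_ac)
    then show ?thesis using ps by simp
  qed
  define x y where "x = - R / (p * a)" and "y = T / (p * a)"
  have adapted: "adapted_frame p q r a x y d \<sigma> s c P Q R T u"
  proof
    show "- (p * a\<^sup>2) = P" using a p by simp
    have "x\<^sup>2 + y\<^sup>2 = (R\<^sup>2 + T\<^sup>2) / (p\<^sup>2 * a\<^sup>2)" by (simp add: x_def y_def power_divide power_mult_distrib
        add_divide_distrib)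
    also have "\<dots> = - (R\<^sup>2 + T\<^sup>2) / (P * p)" unfolding a(2) using p P by (simp add: field_simps power2_eq_square)
    finally have "x\<^sup>2 + y\<^sup>2 + d\<^sup>2 = - (R\<^sup>2 + T\<^sup>2 + D) / (P * p)" unfolding d(2) by (simp add:
        add_divide_distrib diff_divide_distrib)
    also have "\<dots> = - Q / p" using P p by (simp add: D_def field_simps)
    finally show "- (p * (x\<^sup>2 + y\<^sup>2 + d\<^sup>2)) = Q" using p by simp
    show "- (p * a * x) = R" "p * a * y = T" "r * a * d = s + c" "q * a * d = u * (s + c)"
      using p a d by (simp_all add: x_def y_def r_def q_def)
    show "p * q * r = 1" using qr by (simp add: mult_ac)
    have k: "\<sigma> ^ 4 * (q * r) = (\<sigma> ^ 3 * (s + c))\<^sup>2 * p"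
    proof -
      have "q * r = q * r * p * (\<sigma> * (s + c))" using ps by (metis mult.assoc mult.right_neutral)
      then have "q * r = \<sigma> * (s + c)" using qr by simp
      moreover have "(\<sigma> ^ 3 * (s + c))\<^sup>2 * p = \<sigma> ^ 4 * (\<sigma> * (s + c)) * (p * \<sigma> * (s + c))"
        by (simp add: power2_eq_square power3_eq_cube power4_eq_xxxx mult_ac)
      ultimately show ?thesis using ps by simp
    qed
    then show "s powr (4 / 3) * (q * r) = (s * (s + c))\<^sup>2 * p" using \<sigma> by simp
    have "p\<^sup>2 * (\<sigma> ^ 4 * (a\<^sup>2 * d\<^sup>2)) = p\<^sup>2 * (\<sigma> ^ 3 * (s + c) * u)"
    proof -
      have "p\<^sup>2 * (\<sigma> ^ 4 * (a\<^sup>2 * d\<^sup>2)) = \<sigma> ^ 4 * D" unfolding ad2 using p by simp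
      also have "\<dots> = \<sigma> ^ 4 * D * (p * \<sigma> * (s + c))\<^sup>2" using ps by simp
      also have "\<dots> = p\<^sup>2 * (\<sigma> ^ 3 * (s + c) * u)"
        unfolding uD by (simp add: power2_eq_square power3_eq_cube power4_eq_xxxx mult_ac)
      finally show ?thesis .
    qed
    then show "s powr (4 / 3) * (a\<^sup>2 * d\<^sup>2) = s * (s + c) * u" using \<sigma> p by simp
    have w: "p * \<sigma> ^ 4 * (s + c) = s"
    proof -
      have "p * \<sigma> ^ 4 * (s + c) = \<sigma> ^ 3 * (p * \<sigma> * (s + c))" by (simp add: power3_eq_cube power4_eq_xxxx
          mult_ac)
      then show ?thesis using ps \<sigma> by simp
    qed
    have h: "\<sigma> ^ 4 * (p * q * a * d) = (p * \<sigma> ^ 4 * (s + c)) * u" "\<sigma> ^ 4 * (p * r * a * d) = p * \<sigma> ^ 4 *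
        (s + c)"
      using a d by (simp_all add: q_def r_def)
    show "s powr (4 / 3) * (p * q * a * d) = s * u" "s powr (4 / 3) * (p * r * a * d) = s"
      unfolding \<sigma>(3)[symmetric] h w by simp_all
  qed (use p pos a d \<sigma> in auto)
  then show ?thesis by blast
qed

context adapted_frame
begin

abbreviation "phi_list \<equiv> phiT P Q R T 1 (s + c) (u * (s + c))"
abbreviation "psi_list \<equiv> psiT ((s * (s + c))\<^sup>2 * P) ((s * (s + c))\<^sup>2 * Q) ((s * (s + c))\<^sup>2 * R) ((s * (s +
    c))\<^sup>2 * T)
  (s * (s + c) * u) (s * u) s"

lemma frame7_phi: "ev (frame7 p q r a x y d \<theta>) phi_terms v = ev \<theta> phi_list v"
  unfolding frame_phi co ..

lemma frame7_psi: "s powr (4 / 3) * ev (frame7 p q r a x y d \<theta>) psi_terms v = ev \<theta> psi_list v"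
proof -
  have *: "s powr (4 / 3) * (- (q * r * a\<^sup>2)) = (s * (s + c))\<^sup>2 * P"
    "s powr (4 / 3) * (- (q * r * (x\<^sup>2 + y\<^sup>2 + d\<^sup>2))) = (s * (s + c))\<^sup>2 * Q"
    "s powr (4 / 3) * (- (q * r * a * x)) = (s * (s + c))\<^sup>2 * R"
    "s powr (4 / 3) * (q * r * a * y) = (s * (s + c))\<^sup>2 * T"
    unfolding co(1-4)[symmetric] using star(1) by (simp_all flip: mult.assoc)
  show ?thesis unfolding frame_psi psiT_scale[symmetric] * star(2-4) ..
qed

text \<open>The words with leading 0 carry the factor \<open>(1 / s) \<sigma>^3 = 1\<close>, the
  others \<open>\<sigma>^4 = s^(4/3)\<close>.\<close>

lemma frame8_Phi:
  "ev (frame8 (1 / s) (\<sigma> * p) (\<sigma> * q) (\<sigma> * r) (\<sigma> * a) (\<sigma> * x) (\<sigma> * y) (\<sigma> * d) \<theta>)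
    (map (\<lambda>(c, is). (c, 0 # is)) phi_terms @ psi_terms) v
    = ev \<theta> (map (\<lambda>(c, is). (c, 7 # is)) phi_list @ psi_list) v"
proof -
  let ?F = "frame7 (\<sigma> * p) (\<sigma> * q) (\<sigma> * r) (\<sigma> * a) (\<sigma> * x) (\<sigma> * y) (\<sigma> * d) \<theta>"
  let ?E = "frame8 (1 / s) (\<sigma> * p) (\<sigma> * q) (\<sigma> * r) (\<sigma> * a) (\<sigma> * x) (\<sigma> * y) (\<sigma> * d) \<theta>"
  have s0: "s > 0" using pos(6) sigma(1) by (metis zero_less_power)
  have sc: "frame7 (\<sigma> * p) (\<sigma> * q) (\<sigma> * r) (\<sigma> * a) (\<sigma> * x) (\<sigma> * y) (\<sigma> * d) \<theta> i w = \<sigma> * frame7 p q r a x y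
      d \<theta> i w" for i w
    by (simp add: frame7_def frame_coeffs_def algebra_simps)
  have E: "ev ?E cs w = ev ?F cs w" if "list_all (\<lambda>(c, is). list_all (\<lambda>i. i \<noteq> 0) is) cs" for cs w
  proof (rule ev_cong)
    fix c "is" i assume "(c, is) \<in> set cs" "i \<in> set is"
    then have "i \<noteq> 0" using that by (auto simp: list_all_iff)
    then show "?E i = ?F i" by (simp add: frame8_def)
  qed
  have phi: "ev ?F phi_terms w = s * ev \<theta> phi_list w" for w
  proof -
    have *: "- (\<sigma> * p * (\<sigma> * a)\<^sup>2) = \<sigma> ^ 3 * (- (p * a\<^sup>2))"
      "- (\<sigma> * p * ((\<sigma> * x)\<^sup>2 + (\<sigma> * y)\<^sup>2 + (\<sigma> * d)\<^sup>2)) = \<sigma> ^ 3 * (- (p * (x\<^sup>2 + y\<^sup>2 + d\<^sup>2)))"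
      "- (\<sigma> * p * (\<sigma> * a) * (\<sigma> * x)) = \<sigma> ^ 3 * (- (p * a * x))"
      "\<sigma> * p * (\<sigma> * a) * (\<sigma> * y) = \<sigma> ^ 3 * (p * a * y)" "\<sigma> * p * (\<sigma> * q) * (\<sigma> * r) = \<sigma> ^ 3 * (p * q * r)"
      "\<sigma> * r * (\<sigma> * a) * (\<sigma> * d) = \<sigma> ^ 3 * (r * a * d)" "\<sigma> * q * (\<sigma> * a) * (\<sigma> * d) = \<sigma> ^ 3 * (q * a * d)"
      by (simp_all add: power_mult_distrib power2_eq_square power3_eq_cube algebra_simps)
    show ?thesis unfolding frame_phi * phiT_scale co sigma ..
  qed
  have psi: "ev ?F psi_terms w = ev \<theta> psi_list w" for w
  proof -
    have *: "- (\<sigma> * q * (\<sigma> * r) * (\<sigma> * a)\<^sup>2) = \<sigma> ^ 4 * (- (q * r * a\<^sup>2))"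
      "- (\<sigma> * q * (\<sigma> * r) * ((\<sigma> * x)\<^sup>2 + (\<sigma> * y)\<^sup>2 + (\<sigma> * d)\<^sup>2)) = \<sigma> ^ 4 * (- (q * r * (x\<^sup>2 + y\<^sup>2 + d\<^sup>2)))"
      "- (\<sigma> * q * (\<sigma> * r) * (\<sigma> * a) * (\<sigma> * x)) = \<sigma> ^ 4 * (- (q * r * a * x))"
      "\<sigma> * q * (\<sigma> * r) * (\<sigma> * a) * (\<sigma> * y) = \<sigma> ^ 4 * (q * r * a * y)"
      "(\<sigma> * a)\<^sup>2 * (\<sigma> * d)\<^sup>2 = \<sigma> ^ 4 * (a\<^sup>2 * d\<^sup>2)"
      "\<sigma> * p * (\<sigma> * q) * (\<sigma> * a) * (\<sigma> * d) = \<sigma> ^ 4 * (p * q * a * d)"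
      "\<sigma> * p * (\<sigma> * r) * (\<sigma> * a) * (\<sigma> * d) = \<sigma> ^ 4 * (p * r * a * d)"
      by (simp_all add: power_mult_distrib power2_eq_square power4_eq_xxxx algebra_simps)
    show ?thesis unfolding frame7_psi[symmetric] unfolding frame_psi * psiT_scale sigma ..
  qed
  have "ev ?E (map (\<lambda>(c, is). (c, 0 # is)) phi_terms) v = wone 3 (?E 0) (ev ?E phi_terms) v"
    by (rule wone_ev[symmetric]) (auto simp: phi_terms_def)
  also have "\<dots> = wone 3 (\<lambda>w. 1 / s * \<theta> 7 w + 0) (\<lambda>w. s * ev \<theta> phi_list w) v"
  proof -
    have "ev ?E phi_terms w = s * ev \<theta> phi_list w" for w
      using E[of phi_terms w] phi by (simp add: phi_terms_def del: ev_Cons)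
    moreover have "?E 0 = (\<lambda>w. 1 / s * \<theta> 7 w + 0)" by (simp add: frame8_def)
    ultimately show ?thesis by (auto intro: wone_cong)
  qed
  also have "\<dots> = wone 3 (\<theta> 7) (ev \<theta> phi_list) v"
    unfolding wone_lincomb wone_cmult using s0 by (simp add: wone_def)
  also have "\<dots> = ev \<theta> (map (\<lambda>(c, is). (c, 7 # is)) phi_list) v"
    by (rule wone_ev) (auto simp: phiT_def)
  finally show ?thesis using E[of psi_terms v] psi by (simp add: psi_terms_def del: ev_Cons)
qed

lemma g2_frame7:
  assumes lin: "\<And>i. linear (\<theta> i)" and ex: "\<And>t :: nat \<Rightarrow> real. \<exists>!w. \<forall>i<7. \<theta> i w = t i"
    and \<phi>: "\<phi> = ev \<theta> phi_list"
  shows "g2_frame \<phi> (to8 (frame7 p q r a x y d \<theta>))"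
    and "s powr (4 / 3) * g2_star \<phi> 3 \<phi> v = ev \<theta> psi_list v"
proof -
  let ?E = "frame7 p q r a x y d \<theta>"
  show g2: "g2_frame \<phi> (to8 ?E)"
    unfolding g2_frame_def
  proof (intro conjI)
    show "linear (to8 ?E)" by (intro linear_to8 linear_frame7 lin)
    show "bij_betw (to8 ?E) UNIV R7" by (rule bij_frame7) (use pos ex in auto)
    have "ev kc phi_terms (\<lambda>i. to8 ?E (v i)) = ev \<theta> phi_list v" for v
      unfolding frame7_phi[symmetric] by (rule ev_kc_to8) (simp add: phi_terms_def)
    then show "\<phi> = pullback (to8 ?E) phi0" by (simp add: \<phi> pullback_def phi0_wl)
  qed
  have "ev kc psi_terms (\<lambda>i. to8 ?E (v i)) = ev ?E psi_terms v"
    by (rule ev_kc_to8) (simp add: psi_terms_def)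
  then show "s powr (4 / 3) * g2_star \<phi> 3 \<phi> v = ev \<theta> psi_list v"
    unfolding g2_star_frame[OF g2] pullback_def frame7_psi[symmetric] by simp
qed

lemma spin7_frame8:
  assumes lin: "\<And>i. linear (\<theta> i)" and ex: "\<And>t :: nat \<Rightarrow> real. \<exists>!w. \<forall>i<8. \<theta> i w = t i"
  shows "\<exists>L. linear L \<and> bij L \<and> ev \<theta> (map (\<lambda>(c, is). (c, 7 # is)) phi_list @ psi_list) = pullback L Phi0"
proof (intro exI conjI)
  let ?E = "frame8 (1 / s) (\<sigma> * p) (\<sigma> * q) (\<sigma> * r) (\<sigma> * a) (\<sigma> * x) (\<sigma> * y) (\<sigma> * d) \<theta>"
  have s0: "s > 0" using pos(6) sigma(1) by (metis zero_less_power)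
  have "linear (?E i)" for i
    using linear_frame7[OF lin] linear_compose_scale_right[OF lin[of 7], of "1 / s"] by (simp add: frame8_def)
  then show "linear (to8 ?E)" by (rule linear_to8)
  show "bij (to8 ?E)" by (rule bij_frame8) (use pos ex s0 in auto)
  show "ev \<theta> (map (\<lambda>(c, is). (c, 7 # is)) phi_list @ psi_list) = pullback (to8 ?E) Phi0"
  proof
    fix v
    have "Phi0 (\<lambda>i. to8 ?E (v i)) = ev ?E (map (\<lambda>(c, is). (c, 0 # is)) phi_terms @ psi_terms) v"
      unfolding Phi0_wl by (rule ev_kc_to8) (simp add: phi_terms_def psi_terms_def)
    then show "ev \<theta> (map (\<lambda>(c, is). (c, 7 # is)) phi_list @ psi_list) v = pullback (to8 ?E) Phi0 v"
      unfolding frame8_Phi by (simp add: pullback_def)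
  qed
qed

end

subsection \<open>The torsion free structure\<close>

text \<open>The coefficients of \<open>phiT\<close> as functions on the base, since they are going
  to be differentiated.\<close>

definition phiF :: "real \<Rightarrow> (base \<Rightarrow> real) \<Rightarrow> ((base \<Rightarrow> real) \<times> nat list) list" where
  "phiF c F = [(\<lambda>b. - coP F b, [5, 0, 1]), (\<lambda>b. - coQ F b, [5, 2, 3]), (coT F, [5, 0, 2]), (coT F, [5, 1, 3]),
    (\<lambda>b. - coR F b, [5, 0, 3]), (coR F, [5, 1, 2]), (\<lambda>b. 1, [5, 4, 6]), (\<lambda>b. snd b + c, [0, 2, 6]),
    (\<lambda>b. - (snd b + c), [1, 3, 6]), (\<lambda>b. uu F b * (snd b + c), [0, 3, 4]), (\<lambda>b. uu F b * (snd b + c), [1,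
        2, 4])]"

text \<open>The coefficients of \<open>s^(4/3)\<close> times the dual 4-form. They are polynomial in
  \<open>s\<close>, \<open>u\<close> and the second derivatives of \<open>F\<close>: the fractional
  powers cancel by the conditions \<open>star\<close>.\<close>

definition psiF :: "real \<Rightarrow> (base \<Rightarrow> real) \<Rightarrow> ((base \<Rightarrow> real) \<times> nat list) list" where
  "psiF c F = [(\<lambda>b. snd b * (snd b + c) * uu F b, [0, 1, 2, 3]),
    (\<lambda>b. - ((snd b * (snd b + c))\<^sup>2 * coP F b), [0, 1, 4, 6]), (\<lambda>b. - ((snd b * (snd b + c))\<^sup>2 * coQ F b),
        [2, 3, 4, 6]),
    (\<lambda>b. (snd b * (snd b + c))\<^sup>2 * coT F b, [0, 2, 4, 6]), (\<lambda>b. (snd b * (snd b + c))\<^sup>2 * coT F b, [1, 3,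
        4, 6]),
    (\<lambda>b. - ((snd b * (snd b + c))\<^sup>2 * coR F b), [0, 3, 4, 6]), (\<lambda>b. (snd b * (snd b + c))\<^sup>2 * coR F b, [1,
        2, 4, 6]),
    (\<lambda>b. snd b * uu F b, [5, 4, 0, 2]), (\<lambda>b. - (snd b * uu F b), [5, 4, 1, 3]),
    (\<lambda>b. - snd b, [5, 6, 0, 3]), (\<lambda>b. - snd b, [5, 6, 1, 2])]"

definition PhiF :: "real \<Rightarrow> (base \<Rightarrow> real) \<Rightarrow> ((base \<Rightarrow> real) \<times> nat list) list" where
  "PhiF c F = map (\<lambda>(f, is). (f, 7 # is)) (phiF c F) @ psiF c F"

abbreviation at_pt :: "'a \<Rightarrow> (('a \<Rightarrow> real) \<times> nat list) list \<Rightarrow> (real \<times> nat list) list" where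
  "at_pt b L \<equiv> map (\<lambda>(f, is). (f b, is)) L"

lemma at_pt_phiF: "at_pt b (phiF c F) =
    phiT (coP F b) (coQ F b) (coR F b) (coT F b) 1 (snd b + c) (uu F b * (snd b + c))"
  by (simp add: phiF_def phiT_def)

lemma at_pt_PhiF: "at_pt b (PhiF c F) =
    map (\<lambda>(c, is). (c, 7 # is)) (phiT (coP F b) (coQ F b) (coR F b) (coT F b) 1 (snd b + c) (uu F b * (snd
        b + c))) @
    psiT ((snd b * (snd b + c))\<^sup>2 * coP F b) ((snd b * (snd b + c))\<^sup>2 * coQ F b) ((snd b * (snd b + c))\<^sup>2
        * coR F b)
      ((snd b * (snd b + c))\<^sup>2 * coT F b) (snd b * (snd b + c) * uu F b) (snd b * uu F b) (snd b)"
  by (simp add: PhiF_def phiF_def psiF_def phiT_def psiT_def)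

lemma ev_bco_co7:
  assumes "list_all (\<lambda>(c, is). list_all (\<lambda>i. i < 5) is) cs"
  shows "ev bco cs (\<lambda>i. fst (v i)) = ev (\<lambda>i. co7 X A i x) cs v"
proof -
  have "ev bco cs (\<lambda>i. fst (v i)) = ev (\<lambda>i p. bco i (fst p)) cs v" by (rule ev_compose[symmetric])
  also have "\<dots> = ev (\<lambda>i. co7 X A i x) cs v"
  proof (rule ev_cong)
    fix c "is" i assume "(c, is) \<in> set cs" "i \<in> set is"
    then have "i < 5" using assms by (auto simp: list_all_iff)
    then show "(\<lambda>p. bco i (fst p)) = co7 X A i x" by (auto simp: co7_def)
  qed
  finally show ?thesis .
qed

lemma ev_co7_co8:
  assumes "list_all (\<lambda>(c, is). list_all (\<lambda>i. i < 7) is) cs"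
  shows "ev (\<lambda>i. co7 X A i (snd x)) cs (\<lambda>i. snd (v i)) = ev (\<lambda>i. co8 X Y A i x) cs v"
proof -
  have "ev (\<lambda>i. co7 X A i (snd x)) cs (\<lambda>i. snd (v i)) = ev (\<lambda>i p. co7 X A i (snd x) (snd p)) cs v" by
      (rule ev_compose[symmetric])
  also have "\<dots> = ev (\<lambda>i. co8 X Y A i x) cs v"
  proof (rule ev_cong)
    fix c "is" i assume "(c, is) \<in> set cs" "i \<in> set is"
    then have "i < 7" using assms by (auto simp: list_all_iff)
    then show "(\<lambda>p. co7 X A i (snd x) (snd p)) = co8 X Y A i x" by (auto simp: co8_def)
  qed
  finally show ?thesis .
qed

text \<open>The first five values determine the base component of the vector, after which the
  potentials only shift the two fibre components.\<close>

lemma co7_unique: "\<exists>!w. \<forall>i<7. co7 X A i x w = t i"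
proof -
  define b :: base where "b = ((Complex (t 0) (t 1), Complex (t 2) (t 3)), t 4)"
  have "(\<forall>i<7. co7 X A i x w = t i) \<longleftrightarrow> w = (b, t 5 - X (fst x) (\<lambda>_. b), t 6 - A (fst x) (\<lambda>_. b))" for w
  proof -
    obtain b' k l where w: "w = (b', k, l)" by (cases w)
    have "b' = b \<longleftrightarrow> bco 0 b' = t 0 \<and> bco 1 b' = t 1 \<and> bco 2 b' = t 2 \<and> bco 3 b' = t 3 \<and> bco 4 b' = t 4"
      by (cases b') (auto simp: b_def complex_eq_iff)
    then show ?thesis unfolding all_less_7 w by (auto simp: co7_def)
  qed
  then show ?thesis by simp
qed

lemma co8_unique: "\<exists>!w. \<forall>i<8. co8 X Y A i x w = t i"
proof -
  obtain w7 where w7: "\<And>w. (\<forall>i<7. co7 X A i (snd x) w = t i) \<longleftrightarrow> w = w7"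
    using co7_unique[of X A "snd x" t] by blast
  have "(\<forall>i<8. co8 X Y A i x w = t i) \<longleftrightarrow> w = (t 7 - Y (fst (snd x)) (\<lambda>_. fst w7), w7)" for w
  proof -
    have "(\<forall>i<8. co8 X Y A i x w = t i) \<longleftrightarrow>
        (\<forall>i<7. co7 X A i (snd x) (snd w) = t i) \<and> fst w + Y (fst (snd x)) (\<lambda>_. fst (snd w)) = t 7"
      unfolding all_less_7 all_less_8 by (simp add: co8_def)
    then show ?thesis unfolding w7 by (cases w) auto
  qed
  then show ?thesis by simp
qed

lemma phi_form_ev:
  assumes B: "open B" "smooth_on F B" and sm: "smooth_form 1 B X" "smooth_form 1 B A" and x: "x \<in> B \<times> UNIV"
  shows "phi_form c F (conn_xi X) (conn_alpha A) x = ev (\<lambda>i. co7 X A i x) (at_pt (fst x) (phiF c F))"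
proof
  fix v
  let ?\<theta> = "\<lambda>i. co7 X A i x" and ?b = "fst x"
  have b: "?b \<in> B" using x by auto
  have xi: "conn_xi X x = ev ?\<theta> [(1, [5])]" and al: "conn_alpha A x = ev ?\<theta> [(1, [6])]"
    using conn_forms(1)[OF sm(1) x] conn_forms(2)[OF sm(2) x] by (auto simp: wl_1 co7_def fun_eq_iff simp
        del: wl.simps)
  have pf: "pull_form fst \<beta> x = ev ?\<theta> cs"
    if "\<And>v. \<beta> ?b v = ev bco cs v" "list_all (\<lambda>(c, is). list_all (\<lambda>i. i < 5) is) cs" for \<beta> :: bform and cs
    using ev_bco_co7[OF that(2)] that(1) by (simp add: pull_form_def pullback_def fun_eq_iff)
  have ds: "pull_form fst ds_base x = ev ?\<theta> [(1, [4])]" by (rule pf, rule ds_base_ev) simp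
  have w1: "pull_form fst (omega1t F) x = ev ?\<theta> (om1 (coP F ?b) (coQ F ?b) (coR F ?b) (coT F ?b))"
    by (rule pf, rule omega1t_ev[OF B b]) (simp add: om1_def)
  have w2: "pull_form fst omega2_base x = ev ?\<theta> [(1, [0, 2]), (-1, [1, 3])]" by (rule pf, rule
      omega2_base_ev) simp
  have w3: "pull_form fst omega3_base x = ev ?\<theta> [(1, [0, 3]), (1, [1, 2])]" by (rule pf, rule
      omega3_base_ev) simp
  have da: "wedge 1 1 (ev ?\<theta> [(1, [4])]) (ev ?\<theta> [(1, [6])]) y = ev ?\<theta> [(1, [4, 6])] y" for y
    by (subst wedge_ev_all) simp_all
  have "(\<lambda>y. ev ?\<theta> (om1 (coP F ?b) (coQ F ?b) (coR F ?b) (coT F ?b)) y + ev ?\<theta> [(1, [4, 6])] y)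
      = ev ?\<theta> (om1 (coP F ?b) (coQ F ?b) (coR F ?b) (coT F ?b) @ [(1, [4, 6])])"
    by (rule ext) (rule ev_append[symmetric])
  then show "phi_form c F (conn_xi X) (conn_alpha A) x v = ev ?\<theta> (at_pt ?b (phiF c F)) v"
    unfolding phi_form_def Let_def xi al ds w1 w2 w3 da s_deriv2_eq[OF B b] uu_def[symmetric]
    by (simp add: wedge_ev_all om1_def at_pt_phiF phiT_def algebra_simps del: wl.simps)
qed

lemma ext_d_cong_open:
  assumes "open S" "x \<in> S" "\<And>y. y \<in> S \<Longrightarrow> \<beta> y = \<gamma> y"
  shows "ext_d k \<beta> x = ext_d k \<gamma> x"
  unfolding ext_d_dird[abs_def] fun_eq_iff
  by (intro allI sum.cong refl arg_cong2[where f="(*)"] dird_cong[OF assms(1,2)]) (simp add: assms(3))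

text \<open>The structure equations: \<open>d\<xi> = - \<omega>_2\<close>, the curvature of
  \<open>\<alpha>\<close>, \<open>d\<eta> = - \<omega>_3\<close>, and closed coordinate
  differentials.\<close>

definition st8 :: "(base \<Rightarrow> real) \<Rightarrow> base \<Rightarrow> nat \<Rightarrow> (real \<times> nat \<times> nat) list" where
  "st8 F b i = (if i = 5 then xi_terms else if i = 6 then curv_terms F b else if i = 7 then eta_terms else [])"

text \<open>Coefficients and potentials are pulled back from the base, so their derivatives are base
  derivatives, and the curvatures are all that \<open>d\<close> of the coframe contributes.\<close>

lemma ext_d_co8:
  assumes B: "open B" "smooth_on F B" and pc: "prescribed_curvatures B F X Y A" and x: "x \<in> UNIV \<times> B \<times> UNIV"
    and L: "\<And>f is. (f, is) \<in> set L \<Longrightarrow> length is = n \<and> smooth_on f B"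
  defines "b \<equiv> fst (snd x)"
  shows "ext_d n (\<lambda>y. ev (\<lambda>i. co8 X Y A i y) (at_pt (fst (snd y)) L)) x v =
    ev (\<lambda>i. co8 X Y A i x) (concat (map (\<lambda>(f, is). map (\<lambda>k. (dird (eb k) f b, k # is)) [0, 1, 2, 3, 4] @
      map (\<lambda>(c, js). (f b * c, js)) (dE (st8 F b) is)) L)) v"
proof -
  let ?S = "UNIV \<times> B \<times> UNIV :: tot8 set" and ?\<pi> = "\<lambda>y::tot8. fst (snd y)"
  have sm: "smooth_form 1 B X" "smooth_form 1 B Y" "smooth_form 1 B A"
    and curv: "\<And>b p q. b \<in> B \<Longrightarrow> curl X b p q = two bco xi_terms p q" "\<And>b p q. b \<in> B \<Longrightarrow> curl Y b p q = two
        bco eta_terms p q"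
      "\<And>b p q. b \<in> B \<Longrightarrow> curl A b p q = two bco (curv_terms F b) p q"
    using pc unfolding prescribed_curvatures_iff[OF B] by blast+
  have S: "open ?S" by (rule open_base8[OF B(1)])
  have b: "b \<in> B" using x by (auto simp: b_def)
  note \<theta>s = smooth_on_co8[OF B(1) sm]
  have df: "f differentiable (at b)" if "(f, is) \<in> set L" for f "is" using L[OF that] b
      smooth_on_differentiable by blast
  have pull: "dird p (\<lambda>y. f (?\<pi> y)) x = dird (?\<pi> p) f b" "(\<lambda>y. f (?\<pi> y)) differentiable (at x)"
    if "f differentiable (at b)" for f :: "base \<Rightarrow> real" and p
    using dird_compose_linear[OF bounded_linear_fst_snd, where f=f and x=x] that by (simp_all add: b_def)
  have two8: "two bco cs (?\<pi> p) (?\<pi> q) = (\<Sum>(c, k, l)\<leftarrow>cs. c * (co8 X Y A k x p * co8 X Y A l x q - co8 X Y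
      A k x q * co8 X Y A l x p))"
    if "list_all (\<lambda>(c, k, l). k < 5 \<and> l < 5) cs" for cs p q
    unfolding two_def using that by (induction cs) (auto simp: co8_def co7_def)
  have dconn: "dird p (\<lambda>y. k q + Z (?\<pi> y) (\<lambda>_. ?\<pi> q)) x - dird q (\<lambda>y. k p + Z (?\<pi> y) (\<lambda>_. ?\<pi> p)) x = curl
      Z b (?\<pi> p) (?\<pi> q)"
    if Z: "smooth_form 1 B Z" for Z :: bform and k :: "tot8 \<Rightarrow> real" and p q
  proof -
    have d: "(\<lambda>b. Z b (\<lambda>_. e)) differentiable (at b)" for e using smooth_on_differentiable[OF
        one_form_smooth[OF Z] b] .
    show ?thesis using pull[OF d] by (simp add: dird_add curl_def)
  qed
  have st: "dird p (\<lambda>y. co8 X Y A i y q) x - dird q (\<lambda>y. co8 X Y A i y p) x =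
      (\<Sum>(c, k, l)\<leftarrow>st8 F b i. c * (co8 X Y A k x p * co8 X Y A l x q - co8 X Y A k x q * co8 X Y A l x p))"
          for i p q
  proof -
    consider "i = 5" | "i = 6" | "i = 7" | "i \<noteq> 5" "i \<noteq> 6" "i \<noteq> 7" by blast
    then show ?thesis
    proof cases
      case 1
      have "list_all (\<lambda>(c, k, l). k < 5 \<and> l < 5) xi_terms" by (simp add: xi_terms_def)
      from two8[OF this] show ?thesis
        using dconn[OF sm(1), of p "\<lambda>q. fst (snd (snd q))" q] curv(1)[OF b] by (simp add: 1 co8_def
            co7_def st8_def)
    next
      case 2
      have "list_all (\<lambda>(c, k, l). k < 5 \<and> l < 5) (curv_terms F b)" by (simp add: curv_terms_def)
      from two8[OF this] show ?thesis
        using dconn[OF sm(3), of p "\<lambda>q. snd (snd (snd q))" q] curv(3)[OF b] by (simp add: 2 co8_def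
            co7_def st8_def)
    next
      case 3
      have "list_all (\<lambda>(c, k, l). k < 5 \<and> l < 5) eta_terms" by (simp add: eta_terms_def)
      from two8[OF this] show ?thesis
        using dconn[OF sm(2), of p fst q] curv(2)[OF b] by (simp add: 3 co8_def st8_def)
    next
      case 4
      then show ?thesis by (simp add: co8_def co7_def st8_def)
    qed
  qed
  let ?L = "map (\<lambda>(f, is). (\<lambda>y. f (?\<pi> y), is)) L"
  have "ext_d n (\<lambda>y. ev (\<lambda>i. co8 X Y A i y) (map (\<lambda>(f, is). (f y, is)) ?L)) x v =
    ev (\<lambda>i. co8 X Y A i x) (concat (map (\<lambda>(f, is). map (\<lambda>k. (dird (0, eb k, 0) f x, k # is)) [0, 1, 2, 3, 4] @
      map (\<lambda>(c, js). (f x * c, js)) (dE (st8 F b) is)) ?L)) v"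
  proof (rule ext_d_ev[where bas="\<lambda>k. (0, eb k, 0)"])
    show "(\<lambda>y. co8 X Y A i y p) differentiable (at x)" for i p
      using smooth_on_differentiable[OF \<theta>s x] .
    show "dird p (\<lambda>y. co8 X Y A i y q) x - dird q (\<lambda>y. co8 X Y A i y p) x =
      (\<Sum>(c, k, l)\<leftarrow>st8 F b i. c * (co8 X Y A k x p * co8 X Y A l x q - co8 X Y A k x q * co8 X Y A l x p))"
          for i p q
      by (rule st)
    fix g "is" assume "(g, is) \<in> set ?L"
    then obtain f where f: "(f, is) \<in> set L" and g: "g = (\<lambda>y. f (?\<pi> y))" by auto
    have "dird p g x = (\<Sum>k\<leftarrow>[0, 1, 2, 3, 4]. dird (0, eb k, 0) g x * co8 X Y A k x p)" for p
      unfolding g pull[OF df[OF f]] dird_base[OF df[OF f], of "?\<pi> p"] by (simp add: co8_def co7_def del: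
          eb_simps bco_simps)
    then show "length is = n \<and> g differentiable (at x) \<and> (\<forall>p. dird p g x = (\<Sum>k\<leftarrow>[0, 1, 2, 3, 4]. dird (0,
        eb k, 0) g x * co8 X Y A k x p))"
      using L[OF f] pull(2)[OF df[OF f]] g by blast
  qed
  moreover have "map (\<lambda>(f, is). map (\<lambda>k. (dird (0, eb k, 0) f x, k # is)) [0, 1, 2, 3, 4] @
      map (\<lambda>(c, js). (f x * c, js)) (dE (st8 F b) is)) ?L =
    map (\<lambda>(f, is). map (\<lambda>k. (dird (eb k) f b, k # is)) [0, 1, 2, 3, 4] @
      map (\<lambda>(c, js). (f b * c, js)) (dE (st8 F b) is)) L"
    unfolding map_map
  proof (rule map_cong[OF refl])
    fix z assume z: "z \<in> set L"
    obtain f "is" where fi: "z = (f, is)" by (cases z)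
    have "(f, is) \<in> set L" using z fi by simp
    from pull(1)[OF df[OF this], of "(0, eb k, 0)" for k] show
      "((\<lambda>(f, is). map (\<lambda>k. (dird (0, eb k, 0) f x, k # is)) [0, 1, 2, 3, 4] @
        map (\<lambda>(c, js). (f x * c, js)) (dE (st8 F b) is)) \<circ> (\<lambda>(f, is). (\<lambda>y. f (?\<pi> y), is))) z =
      (case z of (f, is) \<Rightarrow> map (\<lambda>k. (dird (eb k) f b, k # is)) [0, 1, 2, 3, 4] @
        map (\<lambda>(c, js). (f b * c, js)) (dE (st8 F b) is))"
      by (simp add: fi b_def del: eb_simps)
  qed
  moreover have "(\<lambda>y. ev (\<lambda>i. co8 X Y A i y) (map (\<lambda>(f, is). (f y, is)) ?L)) = (\<lambda>y. ev (\<lambda>i. co8 X Y A i y)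
      (at_pt (?\<pi> y) L))"
    by (simp add: o_def case_prod_unfold)
  ultimately show ?thesis by (simp only:)
qed

section \<open>Closedness of the 4-form\<close>

text \<open>The four components of \<open>d \<omega>_1 = 0\<close> in the surface directions; each
  is a relation between third derivatives of \<open>F\<close>, whose order is immaterial.\<close>

lemma omega1_closed:
  assumes B: "open B" "smooth_on F B" "b \<in> B"
  shows "dird (eb 0) (coR F) b = dird (eb 2) (coP F) b + dird (eb 1) (coT F) b"
    and "dird (eb 0) (coT F) b = dird (eb 3) (coP F) b - dird (eb 1) (coR F) b"
    and "dird (eb 0) (coQ F) b = dird (eb 3) (coT F) b + dird (eb 2) (coR F) b"
    and "dird (eb 1) (coQ F) b = dird (eb 3) (coR F) b - dird (eb 2) (coT F) b"
proof -
  let ?T = "\<lambda>i j k. dird (eb i) (dird (eb j) (dird (eb k) F)) b"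
  have d: "dird p (dird q F) differentiable (at b)" for p q
    using smooth_on_differentiable[OF smooth_on_dird[OF B(1) smooth_on_dird[OF B(1,2)]] B(3)] .
  have c1: "?T i j k = ?T j i k" for i j k by (rule dird_commute[OF B(1) smooth_on_dird[OF B(1,2)] B(3)])
  have c2: "?T i j k = ?T i k j" for i j k
    by (rule dird_cong[OF B(1,3)]) (rule dird_commute[OF B(1,2)])
  have co: "dird p (coP F) b = dird p (dird (eb 0) (dird (eb 0) F)) b + dird p (dird (eb 1) (dird (eb 1) F)) b"
    "dird p (coQ F) b = dird p (dird (eb 2) (dird (eb 2) F)) b + dird p (dird (eb 3) (dird (eb 3) F)) b"
    "dird p (coR F) b = dird p (dird (eb 0) (dird (eb 2) F)) b + dird p (dird (eb 1) (dird (eb 3) F)) b"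
    "dird p (coT F) b = dird p (dird (eb 0) (dird (eb 3) F)) b - dird p (dird (eb 1) (dird (eb 2) F)) b" for p
    unfolding co_defs[abs_def] using d by (simp_all add: dird_add dird_diff)
  have s: "?T 2 0 0 = ?T 0 0 2" "?T 2 1 1 = ?T 1 1 2" "?T 1 0 3 = ?T 0 1 3" "?T 3 0 0 = ?T 0 0 3" "?T 3 1
      1 = ?T 1 1 3"
    "?T 1 0 2 = ?T 0 1 2" "?T 3 0 3 = ?T 0 3 3" "?T 3 1 2 = ?T 1 2 3" "?T 2 0 2 = ?T 0 2 2" "?T 2 1 3 = ?T
        1 2 3"
    "?T 3 0 2 = ?T 0 2 3" "?T 3 1 3 = ?T 1 3 3" "?T 2 0 3 = ?T 0 2 3" "?T 2 1 2 = ?T 1 2 2"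
    by (metis c1 c2)+
  show "dird (eb 0) (coR F) b = dird (eb 2) (coP F) b + dird (eb 1) (coT F) b"
    "dird (eb 0) (coT F) b = dird (eb 3) (coP F) b - dird (eb 1) (coR F) b"
    "dird (eb 0) (coQ F) b = dird (eb 3) (coT F) b + dird (eb 2) (coR F) b"
    "dird (eb 1) (coQ F) b = dird (eb 3) (coR F) b - dird (eb 2) (coT F) b"
    unfolding co s by simp_all
qed

text \<open>The \<open>s\<close>-derivative of the equation, multiplied by \<open>s (s + c)\<close>
  so that \<open>u\<close> replaces \<open>s (s + c) Delta\<close> in the first term. In this shape
  it is one coefficient of \<open>d\<Phi>\<close>.\<close>

lemma pde_s_derivative:
  assumes B: "open B" "smooth_on F B" "b \<in> B" and pde: "\<And>b. b \<in> B \<Longrightarrow> pde 1 c F b"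
  shows "snd b * (snd b + c) * dird (eb 4) (uu F) b = (2 * snd b + c) * uu F b + (snd b * (snd b + c))\<^sup>2 *
    (dird (eb 4) (coP F) b * coQ F b + coP F b * dird (eb 4) (coQ F) b
      - 2 * coR F b * dird (eb 4) (coR F) b - 2 * coT F b * dird (eb 4) (coT F) b)"
proof -
  have u: "uu F y = snd y * (snd y + c) * (coP F y * coQ F y - coR F y * coR F y - coT F y * coT F y)" if
      "y \<in> B" for y
    using pde[OF that] by (simp add: pde_def uu_def Delta_def power2_eq_square)
  have d: "coP F differentiable (at b)" "coQ F differentiable (at b)" "coR F differentiable (at b)" "coT F
      differentiable (at b)"
    using smooth_on_co[OF B(1,2)] smooth_on_differentiable B(3) by blast+
  have ds: "snd differentiable (at b)" by (rule bounded_linear_imp_differentiable[OF bounded_linear_snd])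
  have dds: "dird p snd b = snd p" for p :: base by (rule dird_bounded_linear[OF bounded_linear_snd])
  have "dird (eb 4) (uu F) b = dird (eb 4) (\<lambda>y. snd y * (snd y + c) * (coP F y * coQ F y - coR F y * coR F
      y - coT F y * coT F y)) b"
    by (rule dird_cong[OF B(1,3) u])
  also have "\<dots> = (2 * snd b + c) * (coP F b * coQ F b - coR F b * coR F b - coT F b * coT F b) + snd b *
      (snd b + c) *
    (dird (eb 4) (coP F) b * coQ F b + coP F b * dird (eb 4) (coQ F) b
      - 2 * coR F b * dird (eb 4) (coR F) b - 2 * coT F b * dird (eb 4) (coT F) b)"
    using d ds by (simp add: dird_mult dird_add dird_diff dds)
  finally have D: "dird (eb 4) (uu F) b = \<dots>" .
  show ?thesis unfolding D u[OF B(3)] by algebra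
qed

lemma nf_concat: "nf W (concat ls) = (\<Sum>l\<leftarrow>ls. nf W l)"
  by (induction ls) auto

text \<open>All coefficients of the 5-form cancel by the structure equations and
  \<open>omega1_closed\<close>, except that of the product of the five base differentials; that one
  is \<open>E\<close>, the content of \<open>pde_s_derivative\<close>.\<close>

lemma PhiF_closed:
  assumes B: "open B" "smooth_on F B" and pc: "prescribed_curvatures B F X Y A" and x: "x \<in> UNIV \<times> B \<times> UNIV"
    and pde: "\<And>b. b \<in> B \<Longrightarrow> pde 1 c F b"
    and sm: "\<And>f is. (f, is) \<in> set (PhiF c F) \<Longrightarrow> smooth_on f B"
  shows "ext_d 4 (\<lambda>y. ev (\<lambda>i. co8 X Y A i y) (at_pt (fst (snd y)) (PhiF c F))) x v = 0"
proof -
  define b where "b = fst (snd x)"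
  have b: "b \<in> B" using x by (auto simp: b_def)
  have d: "coP F differentiable (at b)" "coQ F differentiable (at b)" "coR F differentiable (at b)" "coT F
      differentiable (at b)"
    using smooth_on_co[OF B] smooth_on_differentiable b by blast+
  have du: "uu F differentiable (at b)"
    unfolding uu_def using smooth_on_differentiable[OF smooth_on_dird[OF B(1) smooth_on_dird[OF B]] b] .
  have ds: "snd differentiable (at b)" by (rule bounded_linear_imp_differentiable[OF bounded_linear_snd])
  have dds: "dird p snd b = snd p" for p :: base by (rule dird_bounded_linear[OF bounded_linear_snd])
  have se: "snd (eb 0) = 0" "snd (eb (Suc 0)) = 0" "snd (eb 2) = 0" "snd (eb 3) = 0" "snd (eb 4) = 1" by
      simp_all
  have len: "length is = 4" if "(f, is) \<in> set (PhiF c F)" for f "is"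
    using that by (auto simp: PhiF_def phiF_def psiF_def)
  note cl = omega1_closed[OF B b, unfolded One_nat_def]
  define E where "E = snd b * (snd b + c) * dird (eb 4) (uu F) b - ((2 * snd b + c) * uu F b + (snd b *
      (snd b + c))\<^sup>2 *
    (dird (eb 4) (coP F) b * coQ F b + coP F b * dird (eb 4) (coQ F) b
      - 2 * coR F b * dird (eb 4) (coR F) b - 2 * coT F b * dird (eb 4) (coT F) b))"
  have E: "E = 0" using pde_s_derivative[OF B b pde] unfolding E_def by simp
  have "nf W (concat (map (\<lambda>(f, is). map (\<lambda>k. (dird (eb k) f b, k # is)) [0, 1, 2, 3, 4] @
      map (\<lambda>(c, js). (f b * c, js)) (dE (st8 F b) is)) (PhiF c F))) =
    E * W [0, 1, 2, 3, 4]" for W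
    unfolding nf_concat PhiF_def phiF_def psiF_def E_def power2_eq_square
    using d du ds
    by (simp add: dird_mult dird_add dird_diff dird_minus dds se st8_def xi_terms_def eta_terms_def
        curv_terms_def del: eb_simps)
      (simp add: cl algebra_simps del: eb_simps)
  then have "nf W (concat (map (\<lambda>(f, is). map (\<lambda>k. (dird (eb k) f b, k # is)) [0, 1, 2, 3, 4] @
      map (\<lambda>(c, js). (f b * c, js)) (dE (st8 F b) is)) (PhiF c F))) = 0" for W
    unfolding E by simp
  note 0 = this
  show ?thesis
    by (subst ext_d_co8[OF B pc x]) (use len sm 0 in \<open>auto simp only: ev_nf b_def\<close>)
qed

lemma smooth_on_PhiF:
  assumes B: "open B" "smooth_on F B" and "(f, is) \<in> set (PhiF c F)"
  shows "smooth_on f B"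
proof -
  have "smooth_on (uu F) B" unfolding uu_def using B smooth_on_dird by blast
  moreover have "smooth_on (snd :: base \<Rightarrow> real) B" by (rule smooth_on_linear[OF bounded_linear_snd])
  ultimately show ?thesis
    using assms(3) smooth_on_co[OF B]
    by (auto simp: PhiF_def phiF_def psiF_def intro!: smooth_on_mult smooth_on_add smooth_on_minus
        smooth_on_diff smooth_on_power B(1))
qed

lemma smooth_form_cong:
  assumes "open S" "smooth_form k S \<gamma>" "\<And>x. x \<in> S \<Longrightarrow> \<beta> x = \<gamma> x"
  shows "smooth_form k S \<beta>"
  using assms smooth_on_cong[OF assms(1), of "\<lambda>x. \<gamma> x v" "\<lambda>x. \<beta> x v" for v] unfolding smooth_form_def by simp

text \<open>At each point the equation and the signs of \<open>coP F\<close> and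
  \<open>Delta F\<close> supply an adapted frame. It evaluates the Hodge star in
  \<open>\<Phi>\<close> and shows both forms to be pointwise standard; the exterior derivative is
  then taken on the coefficient lists.\<close>

lemma yields_torsion_free_spin7I:
  assumes B: "open B" "smooth_on F B" and c: "0 \<le> c" and s: "\<And>b. b \<in> B \<Longrightarrow> 0 < snd b"
    and pde: "\<And>b. b \<in> B \<Longrightarrow> pde 1 c F b" and P: "\<And>b. b \<in> B \<Longrightarrow> coP F b < 0" and D: "\<And>b. b \<in> B \<Longrightarrow> 0 < Delta F b"
  shows "yields_torsion_free_spin7 c B F"
  unfolding yields_torsion_free_spin7_def
proof (intro conjI allI impI ex_prescribed_curvatures[OF B])
  fix X Y A assume pc: "prescribed_curvatures B F X Y A"
  have sm: "smooth_form 1 B X" "smooth_form 1 B Y" "smooth_form 1 B A"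
    using pc unfolding prescribed_curvatures_def by blast+
  define \<phi> where "\<phi> = phi_form c F (conn_xi X) (conn_alpha A)"
  define \<Phi> where "\<Phi> = Phi_form (conn_eta Y) \<phi>"
  let ?c7 = "\<lambda>x i. co7 X A i x" and ?c8 = "\<lambda>x i. co8 X Y A i x"
  let ?S7 = "B \<times> UNIV :: tot7 set" and ?S8 = "UNIV \<times> B \<times> UNIV :: tot8 set"
  have fr: "\<exists>p q r a x y d \<sigma>. adapted_frame p q r a x y d \<sigma> (snd b) c (coP F b) (coQ F b) (coR F b) (coT F
      b) (uu F b)"
    if "b \<in> B" for b
    using adapted_frame_exists[OF s[OF that] c P[OF that], of "coQ F b" "coR F b" "coT F b" "uu F b"] D[OF
        that] pde[OF that]
    by (simp add: Delta_def uu_def pde_def)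
  have phi: "\<phi> x = ev (?c7 x) (at_pt (fst x) (phiF c F))" if "x \<in> ?S7" for x
    unfolding \<phi>_def by (rule phi_form_ev[OF B sm(1,3) that])
  have lin7: "linear (?c7 x i)" if "x \<in> ?S7" for x i by (rule linear_co7[OF sm(1,3) that])
  have lin8: "linear (?c8 x i)" if "x \<in> ?S8" for x i by (rule linear_co8[OF sm that])
  have smF: "smooth_on f B" if "(f, is) \<in> set (PhiF c F)" for f "is" by (rule smooth_on_PhiF[OF B that])
  have Phi: "\<Phi> x = ev (?c8 x) (at_pt (fst (snd x)) (PhiF c F))" if x: "x \<in> ?S8" for x
  proof
    fix v
    let ?b = "fst (snd x)"
    have b: "?b \<in> B" and x7: "snd x \<in> ?S7" using x by auto
    from fr[OF b] obtain p q r a x' y d \<sigma>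
      where "adapted_frame p q r a x' y d \<sigma> (snd ?b) c (coP F ?b) (coQ F ?b) (coR F ?b) (coT F ?b) (uu F
          ?b)" by blast
    then interpret adapted_frame p q r a x' y d \<sigma> "snd ?b" c "coP F ?b" "coQ F ?b" "coR F ?b" "coT F ?b"
        "uu F ?b" .
    have eta: "conn_eta Y x = ev (?c8 x) [(1, [7])]"
      using conn_forms(3)[OF sm(2) x] by (auto simp: wl_1 co8_def fun_eq_iff simp del: wl.simps)
    have "pull_form snd \<phi> x w = ev (?c8 x) phi_list w" for w
      using ev_co7_co8[of phi_list X A x w Y] phi[OF x7]
      by (simp add: pull_form_def pullback_def at_pt_phiF) (simp add: phiT_def)
    moreover have "snd ?b powr (4 / 3) * pull_form snd (\<lambda>y. g2_star (\<phi> y) 3 (\<phi> y)) x v = ev (?c8 x) psi_list v"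
    proof -
      have "snd ?b powr (4 / 3) * g2_star (\<phi> (snd x)) 3 (\<phi> (snd x)) (\<lambda>i. snd (v i)) = ev (?c7 (snd x))
          psi_list (\<lambda>i. snd (v i))"
        by (rule g2_frame7(2)) (use lin7[OF x7] co7_unique phi[OF x7] in \<open>auto simp: at_pt_phiF\<close>)
      also have "\<dots> = ev (?c8 x) psi_list v" by (rule ev_co7_co8) (simp add: psiT_def)
      finally show ?thesis by (simp add: pull_form_def pullback_def)
    qed
    moreover have "wedge 1 3 (ev (?c8 x) [(1, [7])]) (ev (?c8 x) phi_list) v = ev (?c8 x) (map (\<lambda>(c, is).
        (c, 7 # is)) phi_list) v"
      by (subst wedge_ev_all) (simp_all add: phiT_def)
    ultimately show "\<Phi> x v = ev (?c8 x) (at_pt ?b (PhiF c F)) v"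
      unfolding \<Phi>_def Phi_form_def Let_def eta at_pt_PhiF ev_append by (metis (no_types, lifting) ext)
  qed
  have g2: "g2_structure ?S7 \<phi>"
    unfolding g2_structure_def
  proof (intro conjI ballI)
    have "smooth_form 3 ?S7 (\<lambda>x. ev (?c7 x) (map (\<lambda>(f, is). (f x, is)) (map (\<lambda>(f, is). (\<lambda>x. f (fst x),
        is)) (phiF c F))))"
    proof (rule smooth_form_ev[OF open_base7[OF B(1)] smooth_on_co7[OF B(1) sm(1,3)] lin7])
      fix g "is" assume "(g, is) \<in> set (map (\<lambda>(f, is). (\<lambda>x::tot7. f (fst x), is)) (phiF c F))"
      then obtain f where f: "(f, is) \<in> set (phiF c F)" "g = (\<lambda>x. f (fst x))" by auto
      have "smooth_on f B" by (rule smF[of f "7 # is"]) (use f in \<open>force simp: PhiF_def\<close>)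
      then have "smooth_on g ?S7"
        unfolding f(2) by (intro smooth_on_compose_linear[OF B(1) open_base7[OF B(1)] bounded_linear_fst]) auto
      then show "smooth_on g ?S7 \<and> length is = 3" using f(1) by (auto simp: phiF_def)
    qed
    then have "smooth_form 3 ?S7 (\<lambda>x. ev (?c7 x) (at_pt (fst x) (phiF c F)))" by (simp add: o_def
        case_prod_unfold)
    then show "smooth_form 3 ?S7 \<phi>"
      by (rule smooth_form_cong[OF open_base7[OF B(1)] _ phi])
    fix x assume x: "x \<in> ?S7"
    let ?b = "fst x"
    have b: "?b \<in> B" using x by auto
    from fr[OF b] obtain p q r a x' y d \<sigma>
      where "adapted_frame p q r a x' y d \<sigma> (snd ?b) c (coP F ?b) (coQ F ?b) (coR F ?b) (coT F ?b) (uu F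
          ?b)" by blast
    then interpret adapted_frame p q r a x' y d \<sigma> "snd ?b" c "coP F ?b" "coQ F ?b" "coR F ?b" "coT F ?b"
        "uu F ?b" .
    have "g2_frame (\<phi> x) (to8 (frame7 p q r a x' y d (?c7 x)))"
      by (rule g2_frame7(1)) (use lin7[OF x] co7_unique phi[OF x] in \<open>auto simp: at_pt_phiF\<close>)
    then show "\<exists>L. g2_frame (\<phi> x) L" by blast
  qed
  have sm8: "smooth_form 4 ?S8 \<Phi>"
  proof -
    have "smooth_form 4 ?S8 (\<lambda>x. ev (?c8 x) (map (\<lambda>(f, is). (f x, is)) (map (\<lambda>(f, is). (\<lambda>x. f (fst (snd
        x)), is)) (PhiF c F))))"
    proof (rule smooth_form_ev[OF open_base8[OF B(1)] smooth_on_co8[OF B(1) sm] lin8])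
      fix g "is" assume "(g, is) \<in> set (map (\<lambda>(f, is). (\<lambda>x::tot8. f (fst (snd x)), is)) (PhiF c F))"
      then obtain f where f: "(f, is) \<in> set (PhiF c F)" "g = (\<lambda>x. f (fst (snd x)))" by auto
      have "smooth_on g ?S8"
        unfolding f(2) by (intro smooth_on_compose_linear[OF B(1) open_base8[OF B(1)]
            bounded_linear_fst_snd _ smF[OF f(1)]]) auto
      then show "smooth_on g ?S8 \<and> length is = 4" using f(1) by (auto simp: PhiF_def phiF_def psiF_def)
    qed
    then have "smooth_form 4 ?S8 (\<lambda>x. ev (?c8 x) (at_pt (fst (snd x)) (PhiF c F)))" by (simp add: o_def
        case_prod_unfold)
    then show ?thesis by (rule smooth_form_cong[OF open_base8[OF B(1)] _ Phi])
  qed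
  have "torsion_free_spin7_structure ?S8 \<Phi>"
    unfolding torsion_free_spin7_structure_def spin7_structure_def
  proof (intro conjI ballI sm8)
    fix x assume x: "x \<in> ?S8"
    let ?b = "fst (snd x)"
    have b: "?b \<in> B" using x by auto
    from fr[OF b] obtain p q r a x' y d \<sigma>
      where "adapted_frame p q r a x' y d \<sigma> (snd ?b) c (coP F ?b) (coQ F ?b) (coR F ?b) (coT F ?b) (uu F
          ?b)" by blast
    then interpret adapted_frame p q r a x' y d \<sigma> "snd ?b" c "coP F ?b" "coQ F ?b" "coR F ?b" "coT F ?b"
        "uu F ?b" .
    show "\<exists>L. linear L \<and> bij L \<and> \<Phi> x = pullback L Phi0"
      unfolding Phi[OF x] at_pt_PhiF by (rule spin7_frame8) (use lin8[OF x] co8_unique in auto)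
    show "ext_d 4 \<Phi> x = (\<lambda>v. 0)"
    proof
      have "ext_d 4 \<Phi> x = ext_d 4 (\<lambda>y. ev (?c8 y) (at_pt (fst (snd y)) (PhiF c F))) x"
        by (rule ext_d_cong_open[OF open_base8[OF B(1)] x]) (rule Phi)
      then show "ext_d 4 \<Phi> x v = 0" for v using PhiF_closed[OF B pc x pde smF] by simp
    qed
  qed
  moreover have "torus_invariant B \<Phi>"
    unfolding torus_invariant_def
  proof (intro ballI allI)
    fix b t p q assume "b \<in> B"
    then have "(t, b, p, q) \<in> ?S8" "(0, b, 0, 0) \<in> ?S8" by auto
    \<comment> \<open>The coframe, and hence \<open>\<Phi>\<close>, depends on the base point
      only.\<close>
    moreover have "?c8 (t, b, p, q) = ?c8 (0, b, 0, 0)" by (simp add: co8_def co7_def fun_eq_iff)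
    ultimately show "\<Phi> (t, b, p, q) = \<Phi> (0, b, 0, 0)" using Phi by simp
  qed
  ultimately show "let \<phi> = phi_form c F (conn_xi X) (conn_alpha A); \<Phi> = Phi_form (conn_eta Y) \<phi>
    in g2_structure (B \<times> UNIV) \<phi> \<and> torus_invariant B \<Phi> \<and> torsion_free_spin7_structure (UNIV \<times> B \<times> UNIV) \<Phi>"
    using g2 unfolding Let_def \<phi>_def[symmetric] \<Phi>_def[symmetric] by blast
qed

subsection \<open>Existence and uniqueness\<close>

text \<open>Two test vectors suffice: \<open>(1, 0)\<close> gives \<open>- P > 0\<close>, and
  \<open>(- R + i T, P)\<close>, which completes the square in the first coordinate, gives
  \<open>- P (P Q - R^2 - T^2) > 0\<close>.\<close>

lemma kaehler_potential_positive:
  assumes V: "open V" "smooth_on f V" "z \<in> V" and k: "kaehler_potential V f"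
  shows "opP f z < 0" and "0 < opP f z * opQ f z - opR f z ^ 2 - opT f z ^ 2"
proof -
  have pos: "0 < - opP f z * (a\<^sup>2 + b\<^sup>2) - opQ f z * (d\<^sup>2 + e\<^sup>2) - 2 * opT f z * (a * e - b * d) - 2 * opR
      f z * (a * d + b * e)"
    if "(a, b, d, e) \<noteq> (0, 0, 0, 0)" for a b d e :: real
  proof -
    have "(Complex a b, Complex d e) \<noteq> 0" using that by (auto simp: complex_eq_iff zero_prod_def)
    then have "0 < dd_c f z (case_nat (Complex a b, Complex d e) (\<lambda>_. J1 (Complex a b, Complex d e)))"
      using k V(3) unfolding kaehler_potential_def kaehler_form_def by blast
    then show ?thesis
      unfolding dd_c_ev[OF V] by (simp add: wl_2 J1_def power2_eq_square algebra_simps del: wl.simps)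
  qed
  show P: "opP f z < 0" using pos[of 1 0 0 0] by simp
  have "0 < - opP f z * (opP f z * opQ f z - opR f z ^ 2 - opT f z ^ 2)"
    using pos[of "- opR f z" "opT f z" "opP f z" 0] P by (simp add: power2_eq_square algebra_simps)
  then show "0 < opP f z * opQ f z - opR f z ^ 2 - opT f z ^ 2" using P by (metis mult_neg_pos
      neg_0_less_iff_less zero_less_mult_pos)
qed

text \<open>The initial data have geometric majorants near \<open>p\<close>, which start the
  recursion. The Kaehler condition on \<open>F0\<close> gives \<open>coP F < 0\<close> and
  \<open>Delta F > 0\<close> at \<open>(p, 0)\<close>, and continuity extends both signs to a
  product neighbourhood inside the domain of the series.\<close>

lemma local_solution:
  fixes F0 F1 :: "surf \<Rightarrow> real"
  assumes M: "open M" and c: "c \<ge> 0" and F0: "real_analytic_on F0 M" "kaehler_potential M F0"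
    and F1: "real_analytic_on F1 M" and p: "p \<in> M"
  shows "\<exists>U \<epsilon> F. open U \<and> p \<in> U \<and> U \<subseteq> M \<and> 0 < \<epsilon> \<and> real_analytic_on F (U \<times> {-\<epsilon><..<\<epsilon>}) \<and>
    (\<forall>z\<in>U. F (z, 0) = F0 z \<and> s_deriv F (z, 0) = F1 z) \<and>
    (\<forall>b\<in>U \<times> {-\<epsilon><..<\<epsilon>}. pde \<kappa> c F b \<and> coP F b < 0 \<and> 0 < Delta F b)"
proof -
  obtain \<rho>0 K0 \<tau>0 where m0: "0 < \<rho>0" "0 < \<tau>0" "0 \<le> K0" "maj (ball p \<rho>0) F0 (geo K0 \<tau>0)"
    using real_analytic_imp_maj[OF F0(1) p] by blast
  obtain \<rho>1 K1 \<tau>1 where m1: "0 < \<rho>1" "0 < \<tau>1" "0 \<le> K1" "maj (ball p \<rho>1) F1 (geo K1 \<tau>1)"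
    using real_analytic_imp_maj[OF F1 p] by blast
  obtain \<rho>2 where \<rho>2: "0 < \<rho>2" "ball p \<rho>2 \<subseteq> M" using M p open_contains_ball by blast
  define \<rho> where "\<rho> = min \<rho>2 (min \<rho>0 \<rho>1)"
  define V where "V = ball p \<rho>"
  \<comment> \<open>A common ratio for both data; the 16 in \<open>A\<close> meets the bound
    \<open>A / 16\<close> demanded of \<open>F1\<close>.\<close>
  define R where "R = 1 / min \<tau>0 \<tau>1"
  define A where "A = max K0 (16 * K1)"
  have \<rho>: "0 < \<rho>" using m0 m1 \<rho>2 by (simp add: \<rho>_def)
  have V: "open V" "p \<in> V" "V \<subseteq> M" "V \<subseteq> ball p \<rho>0" "V \<subseteq> ball p \<rho>1"
    using \<rho> \<rho>2 unfolding V_def by (auto simp: \<rho>_def)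
  have R: "0 < R" and A: "0 \<le> A" using m0 m1 by (auto simp: R_def A_def)
  have le: "fps_nth (geo K \<tau>) m \<le> fps_nth (fps_const B * gfps R) m" if "0 \<le> K" "K \<le> B" "\<tau> = \<tau>0 \<or> \<tau> = \<tau>1"
      for K B \<tau> m
  proof -
    have "1 / \<tau> \<le> R" "0 < \<tau>" using that(3) m0 m1 by (auto simp: R_def intro!: divide_left_mono)
    then have "(1 / \<tau>) ^ m \<le> R ^ m" by (intro power_mono) auto
    then have "K * (1 / \<tau>) ^ m \<le> B * R ^ m" using that R \<open>0 < \<tau>\<close> by (intro mult_mono) auto
    then show ?thesis by (simp add: power_divide)
  qed
  have maj0: "maj V F0 (fps_const A * gfps R)"
    by (rule maj_mono[OF maj_subset[OF m0(4) V(4)] le]) (use m0 in \<open>auto simp: A_def\<close>)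
  have maj1: "maj V F1 (fps_const (A / 16) * gfps R)"
    by (rule maj_mono[OF maj_subset[OF m1(4) V(5)] le]) (use m1 in \<open>auto simp: A_def\<close>)
  obtain \<delta> F K where \<delta>: "0 < \<delta>" and mF: "maj (V \<times> {-\<delta><..<\<delta>}) F (geo K \<delta>)"
    and i0: "\<And>z. z \<in> V \<Longrightarrow> F (z, 0) = F0 z" and i1: "\<And>z. z \<in> V \<Longrightarrow> dird (0, 1) F (z, 0) = F1 z"
    and eq: "\<And>b. b \<in> V \<times> {-\<delta><..<\<delta>} \<Longrightarrow> pde \<kappa> c F b"
    using ck_solution[OF V(1) R A c maj0 maj1, of \<kappa>] by blast
  let ?W = "V \<times> {-\<delta><..<\<delta>}"
  have W: "open ?W" "(p, 0) \<in> ?W" using V \<delta> by (auto simp: open_Times)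
  have F: "smooth_on F ?W" by (rule maj_smooth[OF mF])
  have sm: "smooth_on (coP F) ?W" "smooth_on (Delta F) ?W"
    using smooth_on_co[OF W(1) F] W(1)
    by (auto simp: Delta_def[abs_def] intro!: smooth_on_diff smooth_on_mult smooth_on_power)
  have "(coP F \<longlongrightarrow> coP F (p, 0)) (at (p, 0))" "(Delta F \<longlongrightarrow> Delta F (p, 0)) (at (p, 0))"
    using smooth_on_differentiable[OF sm(1) W(2)] smooth_on_differentiable[OF sm(2) W(2)]
      differentiable_imp_continuous_within continuous_within by blast+
  moreover have "coP F (p, 0) < 0" "0 < Delta F (p, 0)"
  proof -
    have F0s: "smooth_on F0 M" by (rule real_analytic_imp_smooth[OF F0(1)])
    have e: "opP F0 p = coP F (p, 0)" "opQ F0 p = coQ F (p, 0)" "opR F0 p = coR F (p, 0)" "opT F0 p = coT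
        F (p, 0)"
    proof -
      have "dird a (dird b F0) p = dird a (dird b (\<lambda>w. F (w, 0))) p" for a b
      proof (rule dird_cong[OF V(1,2)])
        show "dird b F0 y = dird b (\<lambda>w. F (w, 0)) y" if "y \<in> V" for y
          by (rule dird_cong[OF V(1) that]) (simp add: i0)
      qed
      then show "opP F0 p = coP F (p, 0)" "opQ F0 p = coQ F (p, 0)" "opR F0 p = coR F (p, 0)" "opT F0 p =
          coT F (p, 0)"
        unfolding op_slice[OF W(1) F W(2), symmetric] op_defs by simp_all
    qed
    show "coP F (p, 0) < 0" "0 < Delta F (p, 0)"
      using kaehler_potential_positive[OF M F0s p F0(2)] unfolding Delta_def e by simp_all
  qed
  ultimately have "\<forall>\<^sub>F b in at (p, 0). coP F b < 0" "\<forall>\<^sub>F b in at (p, 0). 0 < Delta F b"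
    using order_tendstoD by blast+
  moreover have "coP F (p, 0) < 0 \<and> 0 < Delta F (p, 0)" by (intro conjI; fact)
  ultimately have "\<forall>\<^sub>F b in nhds (p, 0). coP F b < 0 \<and> 0 < Delta F b"
    unfolding eventually_nhds_conv_at by (auto intro: eventually_conj)
  then obtain N where N: "open N" "(p, 0) \<in> N" "\<And>b. b \<in> N \<Longrightarrow> coP F b < 0 \<and> 0 < Delta F b"
    unfolding eventually_nhds by blast
  obtain U I where UI: "open U" "open I" "p \<in> U" "0 \<in> I" "U \<times> I \<subseteq> N \<inter> ?W"
    using open_prod_elim[of "N \<inter> ?W" "(p, 0)"] N W by (metis IntI open_Int mem_Sigma_iff)
  obtain \<epsilon> where \<epsilon>: "0 < \<epsilon>" "ball 0 \<epsilon> \<subseteq> I" using UI open_contains_ball by blast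
  have I: "{-\<epsilon><..<\<epsilon>} \<subseteq> I" using \<epsilon>(2) by (auto simp: dist_real_def subset_iff)
  have sub: "U \<times> {-\<epsilon><..<\<epsilon>} \<subseteq> N" "U \<times> {-\<epsilon><..<\<epsilon>} \<subseteq> ?W" using UI(5) I by blast+
  have UV: "U \<subseteq> V" using subsetD[OF sub(2), of "(z, 0)" for z] \<epsilon>(1) by (intro subsetI) simp
  have "real_analytic_on F ?W" by (rule maj_imp_real_analytic[OF W(1) mF \<delta>])
  then have "real_analytic_on F (U \<times> {-\<epsilon><..<\<epsilon>})" using sub(2) unfolding real_analytic_on_def by blast
  moreover have "s_deriv F (z, 0) = F1 z" if "z \<in> U" for z
  proof -
    have "(z, 0) \<in> ?W" using that UV \<delta> by auto
    then show ?thesis using s_deriv_eq(1)[OF smooth_on_differentiable[OF F]] i1 that UV by auto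
  qed
  moreover have "pde \<kappa> c F b \<and> coP F b < 0 \<and> 0 < Delta F b" if "b \<in> U \<times> {-\<epsilon><..<\<epsilon>}" for b
    using that sub eq N(3) by blast
  moreover have "F (z, 0) = F0 z" if "z \<in> U" for z using that UV i0 by blast
  moreover have "U \<subseteq> M" using UV V(3) by blast
  ultimately show ?thesis using UI(1,3) \<epsilon>(1) by blast
qed

text \<open>Stated for any condition \<open>E\<close> equivalent to \<open>pde \<kappa> c\<close>,
  so that it serves both normalisations.\<close>

lemma analytic_solution_unique:
  assumes E: "\<And>W F b. open W \<Longrightarrow> smooth_on F W \<Longrightarrow> b \<in> W \<Longrightarrow> E F b \<longleftrightarrow> pde \<kappa> c F b"
    and U: "open U" and ab: "a < 0" "0 < b"
    and F: "analytic_solution E F0 F1 U {a<..<b} F" and G: "analytic_solution E F0 F1 U {a<..<b} G"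
    and x: "x \<in> U \<times> {a<..<b}"
  shows "F x = G x"
proof -
  let ?W = "U \<times> {a<..<b}"
  have W: "open ?W" using U by (simp add: open_Times)
  have sub: "U \<times> {0} \<subseteq> ?W" using ab by auto
  have *: "real_analytic_on H ?W" "smooth_on H ?W" "\<And>z. z \<in> U \<Longrightarrow> H (z, 0) = F0 z"
    "\<And>z. z \<in> U \<Longrightarrow> dird (0, 1) H (z, 0) = F1 z" "\<And>b. b \<in> ?W \<Longrightarrow> pde \<kappa> c H b"
    if H: "analytic_solution E F0 F1 U {a<..<b} H" for H
  proof -
    show an: "real_analytic_on H ?W" using H by (simp add: analytic_solution_def)
    show sm: "smooth_on H ?W" by (rule real_analytic_imp_smooth[OF an])
    show "H (z, 0) = F0 z" if "z \<in> U" for z using H that by (simp add: analytic_solution_def)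
    show "dird (0, 1) H (z, 0) = F1 z" if "z \<in> U" for z
    proof -
      have "(z, 0) \<in> ?W" using that ab by simp
      then have "s_deriv H (z, 0) = dird (0, 1) H (z, 0)" using s_deriv_eq(1) smooth_on_differentiable[OF
          sm] by blast
      then show ?thesis using H that by (simp add: analytic_solution_def)
    qed
    show "pde \<kappa> c H b" if "b \<in> ?W" for b
      using H that E[OF W sm that] unfolding analytic_solution_def by blast
  qed
  have "flat m U (\<lambda>x. F x - G x)" for m
    by (rule pde_unique_flat[OF U W sub *(2)[OF F] *(2)[OF G] *(5)[OF F] *(5)[OF G]])
      (simp_all add: *(3,4)[OF F] *(3,4)[OF G])
  then show ?thesis by (rule analytic_diff_unique[OF U ab *(1)[OF F] *(1)[OF G] _ x])
qed

theorem corollary4p6: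
  fixes M :: "surf set" and c :: real and F0 F1 :: "surf \<Rightarrow> real"
  assumes "open M"
    and "c \<ge> 0"
    and "real_analytic_on F0 M"
    and "kaehler_potential M F0"
    and "real_analytic_on F1 M"
  shows
    "(\<forall>p\<in>M. \<exists>U \<epsilon> F. open U \<and> p \<in> U \<and> U \<subseteq> M \<and> 0 < \<epsilon> \<and>
        analytic_solution (ma_equation c) F0 F1 U {-\<epsilon><..<\<epsilon>} F \<and>
        (\<forall>b \<in> U \<times> {-\<epsilon><..<\<epsilon>}. volume_condition c (\<lambda>b. F b / 4) b) \<and>
        yields_torsion_free_spin7 c (U \<times> {0<..<\<epsilon>}) (\<lambda>b. F b / 4)) \<and>
     (\<forall>p\<in>M. \<exists>U \<epsilon> F. open U \<and> p \<in> U \<and> U \<subseteq> M \<and> 0 < \<epsilon> \<and>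
        analytic_solution (volume_condition c) F0 F1 U {-\<epsilon><..<\<epsilon>} F \<and>
        yields_torsion_free_spin7 c (U \<times> {0<..<\<epsilon>}) F) \<and>
     (\<forall>E \<in> {ma_equation c, volume_condition c}. \<forall>U a b F G.
        open U \<and> U \<subseteq> M \<and> a < 0 \<and> 0 < b \<and>
        analytic_solution E F0 F1 U {a<..<b} F \<and> analytic_solution E F0 F1 U {a<..<b} G \<longrightarrow>
        (\<forall>x \<in> U \<times> {a<..<b}. F x = G x))"
proof (intro conjI ballI)
  fix p assume p: "p \<in> M"
  obtain U \<epsilon> F where U: "open U" "p \<in> U" "U \<subseteq> M" "0 < \<epsilon>" and an: "real_analytic_on F (U \<times> {-\<epsilon><..<\<epsilon>})"
    and i: "\<forall>z\<in>U. F (z, 0) = F0 z \<and> s_deriv F (z, 0) = F1 z"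
    and eq: "\<And>b. b \<in> U \<times> {-\<epsilon><..<\<epsilon>} \<Longrightarrow> pde (1 / 4) c F b \<and> coP F b < 0 \<and> 0 < Delta F b"
    using local_solution[OF assms p, of "1 / 4"] by blast
  let ?W = "U \<times> {-\<epsilon><..<\<epsilon>}" and ?B = "U \<times> {0<..<\<epsilon>}" and ?G = "\<lambda>b. F b / 4"
  have W: "open ?W" and B: "open ?B" and BW: "?B \<subseteq> ?W" using U by (auto simp: open_Times)
  have F: "smooth_on F ?W" by (rule real_analytic_imp_smooth[OF an])
  have G4: "?G = (\<lambda>b. 1 / 4 * F b)" by (simp add: fun_eq_iff)
  have G: "smooth_on ?G ?W" unfolding G4 by (intro smooth_on_mult smooth_on_const W F)
  \<comment> \<open>A quarter of a solution for \<open>\<kappa> = 1 / 4\<close> satisfies the volume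
    condition, so the construction is applied to the quartered potential.\<close>
  have pdeG: "pde 1 c ?G b" if "b \<in> ?W" for b using pde_scale[OF W F that] eq[OF that] by blast
  have "analytic_solution (ma_equation c) F0 F1 U {-\<epsilon><..<\<epsilon>} F"
    unfolding analytic_solution_def using an i eq ma_equation_iff[OF W F] by blast
  moreover have "\<forall>b \<in> ?W. volume_condition c ?G b" using volume_condition_iff[OF W G] pdeG by blast
  moreover have "yields_torsion_free_spin7 c ?B ?G"
  proof (rule yields_torsion_free_spin7I[OF B smooth_on_subset[OF G BW] assms(2)])
    fix b assume b: "b \<in> ?B"
    then have bW: "b \<in> ?W" using BW by blast
    show "0 < snd b" using b by auto
    show "pde 1 c ?G b" by (rule pdeG[OF bW])
    \<comment> \<open>The factor 1/4 keeps both signs: \<open>coP\<close> scales linearly and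
      \<open>Delta\<close> quadratically.\<close>
    show "coP ?G b < 0" unfolding G4 co_scale[OF W F bW] using eq[OF bW] by simp
    show "0 < Delta ?G b" unfolding G4 Delta_def co_scale[OF W F bW] using eq[OF bW]
      by (simp add: Delta_def power2_eq_square algebra_simps)
  qed
  ultimately show "\<exists>U \<epsilon> F. open U \<and> p \<in> U \<and> U \<subseteq> M \<and> 0 < \<epsilon> \<and>
      analytic_solution (ma_equation c) F0 F1 U {-\<epsilon><..<\<epsilon>} F \<and>
      (\<forall>b \<in> U \<times> {-\<epsilon><..<\<epsilon>}. volume_condition c (\<lambda>b. F b / 4) b) \<and>
      yields_torsion_free_spin7 c (U \<times> {0<..<\<epsilon>}) (\<lambda>b. F b / 4)"
    using U by blast
next
  fix p assume p: "p \<in> M"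
  obtain U \<epsilon> F where U: "open U" "p \<in> U" "U \<subseteq> M" "0 < \<epsilon>" and an: "real_analytic_on F (U \<times> {-\<epsilon><..<\<epsilon>})"
    and i: "\<forall>z\<in>U. F (z, 0) = F0 z \<and> s_deriv F (z, 0) = F1 z"
    and eq: "\<And>b. b \<in> U \<times> {-\<epsilon><..<\<epsilon>} \<Longrightarrow> pde 1 c F b \<and> coP F b < 0 \<and> 0 < Delta F b"
    using local_solution[OF assms p, of 1] by blast
  let ?W = "U \<times> {-\<epsilon><..<\<epsilon>}" and ?B = "U \<times> {0<..<\<epsilon>}"
  have W: "open ?W" and B: "open ?B" and BW: "?B \<subseteq> ?W" using U by (auto simp: open_Times)
  have F: "smooth_on F ?W" by (rule real_analytic_imp_smooth[OF an])
  have "analytic_solution (volume_condition c) F0 F1 U {-\<epsilon><..<\<epsilon>} F"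
    unfolding analytic_solution_def using an i eq volume_condition_iff[OF W F] by blast
  moreover have "yields_torsion_free_spin7 c ?B F"
    by (rule yields_torsion_free_spin7I[OF B smooth_on_subset[OF F BW] assms(2)]) (use eq BW in auto)
  ultimately show "\<exists>U \<epsilon> F. open U \<and> p \<in> U \<and> U \<subseteq> M \<and> 0 < \<epsilon> \<and>
      analytic_solution (volume_condition c) F0 F1 U {-\<epsilon><..<\<epsilon>} F \<and>
      yields_torsion_free_spin7 c (U \<times> {0<..<\<epsilon>}) F"
    using U by blast
next
  fix E assume "E \<in> {ma_equation c, volume_condition c}"
  then obtain \<kappa> where E: "\<And>W F b. open W \<Longrightarrow> smooth_on F W \<Longrightarrow> b \<in> W \<Longrightarrow> E F b \<longleftrightarrow> pde \<kappa> c F b"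
    using ma_equation_iff volume_condition_iff by blast
  show "\<forall>U a b F G.
      open U \<and> U \<subseteq> M \<and> a < 0 \<and> 0 < b \<and>
      analytic_solution E F0 F1 U {a<..<b} F \<and> analytic_solution E F0 F1 U {a<..<b} G \<longrightarrow>
      (\<forall>x \<in> U \<times> {a<..<b}. F x = G x)"
  proof (intro allI impI ballI, elim conjE)
    fix U a b F G x
    assume "open U" "a < 0" "0 < b" "analytic_solution E F0 F1 U {a<..<b} F" "analytic_solution E F0 F1 U
        {a<..<b} G"
      "x \<in> U \<times> {a<..<b}"
    with E show "F x = G x" by (rule analytic_solution_unique)
  qed
qed

end
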